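(* Let $\Omega\subset\mathbb{R}^3$ be a bounded regular domain, let $a>0$ and suppose $\gamma\in(2,4)$. For $\lambda>0$ consider the problem $$-\left(a+\lambda\int_\Omega |\nabla u|^2\right)\Delta u=|u|^{\gamma-2}u\ \text{ in }\Omega,\qquad u=0\ \text{ on }\partial\Omega, \qquad (P_\lambda)$$ and the functional $\Phi_\lambda:H_0^1(\Omega)\to\mathbb{R}$, $$\Phi_\lambda(u)=\frac a2\int_\Omega|\nabla u|^2+\frac\lambda4\left(\int_\Omega|\nabla u|^2\right)^2-\frac1\gamma\int_\Omega|u|^\gamma.$$ Then there exist parameters $0<\lambda_0^*<\lambda^*$ and $\varepsilon>0$ such that: 1) For each $\lambda\in(0,\lambda^*]$ problem $(P_\lambda)$ has a positive solution $u_\lambda$ which is a global minimizer for $\Phi_\lambda$ when $\lambda\in(0,\lambda_0^*]$, while $u_\lambda$ is a local minimizer for $\Phi_\lambda$ when $\lambda\in(\lambda_0^*,\lambda^* )$. Moreover $\Phi_\lambda''(u_\lambda)(u_\lambda,u_\lambda)>0$ for $\lambda\in(0,\lambda^* )$ and $\Phi_{\lambda^*}''(u_{\lambda^*})(u_{\lambda^*},u_{\lambda^*})=0$. 2) For each $\lambda\in(0,\lambda_0^*+\varepsilon)$ problem $(P_\lambda)$ has a positive solution $w_\lambda$ which is a mountain pass critical point for $\Phi_\lambda$. 3) If $\lambda\in(0,\lambda_0^* )$ then $\Phi_\lambda(u_\lambda)<0$, while $\Phi_{\lambda_0^*}(u_{\lambda_0^*})=0$, and if $\lambda\in(\lambda_0^*,\lambda^*]$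 then $\Phi_\lambda(u_\lambda)>0$. 4) $\Phi_\lambda(w_\lambda)>0$ and $\Phi_\lambda(w_\lambda)>\Phi_\lambda(u_\lambda)$ for each $\lambda\in(0,\lambda_0^*+\varepsilon)$. 5) If $\lambda>\lambda^*$ then the only solution $u\in H_0^1(\Omega)$ to problem $(P_\lambda)$ is the zero function $u=0$.
   Context: A solution of $(P_\lambda)$ is by definition a critical point of the functional $\Phi_\lambda$ on $H_0^1(\Omega)$. The space $H_0^1(\Omega)$ carries the norm $\|u\|=(\int_\Omega|\nabla u|^2)^{1/2}$; local minimizers are with respect to this norm. Here a mountain pass critical point for $\Phi_\lambda$ is a critical point $w$ of $\Phi_\lambda$ with $\Phi_\lambda(w)=c_\lambda$, where $$c_\lambda=\inf_{\varphi\in\Gamma_\lambda}\max_{t\in[0,1]}\Phi_\lambda(\varphi(t)),\qquad \Gamma_\lambda=\{\varphi\in C([0,1],H_0^1(\Omega)):\varphi(0)=0,\ \varphi(1)=\bar u_\lambda\},$$ with $\bar u_\lambda=u_{\lambda_0^*}$ if $\lambda\in(0,\lambda_0^*]$ and $\bar u_\lambda=u_\lambda$ if $\lambda\in(\lambda_0^*,\lambda^* )$ ($u_\lambda$ being the solutions from item 1). *)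

theory Defs
  imports "HOL-Analysis.Analysis"
begin

section \<open>Domains and test functions\<close>

text \<open>Functions of class \<open>C\<^sup>k\<close> on an open set; \<^const>\<open>gderiv\<close> is the Frechet derivative written
  as a gradient.\<close>

primrec Ck_on :: "nat \<Rightarrow> 'a::euclidean_space set \<Rightarrow> ('a \<Rightarrow> real) \<Rightarrow> bool" where
  "Ck_on 0 S f \<longleftrightarrow> continuous_on S f"
| "Ck_on (Suc k) S f \<longleftrightarrow>
     (\<exists>g. (\<forall>x\<in>S. GDERIV f x :> g x) \<and> (\<forall>b\<in>Basis. Ck_on k S (\<lambda>x. g x \<bullet> b)))"

text \<open>A bounded domain with \<open>C\<^sup>1\<close> boundary, the latter expressed by local defining functions: near
  each boundary point the domain lies on one side of a regular level set.  This is the weakest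
  usual meaning of ``regular''; domains with boundary of class \<open>C\<^sup>k\<close> (\<open>1 \<le> k \<le> \<infinity>\<close>) satisfy it.\<close>

definition bounded_regular_domain :: "'a::euclidean_space set \<Rightarrow> bool" where
  "bounded_regular_domain \<Omega> \<longleftrightarrow>
     open \<Omega> \<and> connected \<Omega> \<and> \<Omega> \<noteq> {} \<and> bounded \<Omega> \<and>
     (\<forall>p\<in>frontier \<Omega>. \<exists>U \<rho>. open U \<and> p \<in> U \<and> Ck_on 1 U \<rho> \<and>
        (\<forall>x\<in>U. \<not> GDERIV \<rho> x :> 0) \<and>
        \<Omega> \<inter> U = {x\<in>U. \<rho> x < 0} \<and> frontier \<Omega> \<inter> U = {x\<in>U. \<rho> x = 0})"

definition test_functions :: "'a::euclidean_space set \<Rightarrow> ('a \<Rightarrow> real) set" where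
  "test_functions \<Omega> =
     {\<phi>. (\<forall>k. Ck_on k UNIV \<phi>) \<and> compact (closure {x. \<phi> x \<noteq> 0}) \<and> closure {x. \<phi> x \<noteq> 0} \<subseteq> \<Omega>}"


section \<open>The space \<open>H\<^sub>0\<^sup>1(\<Omega>)\<close>\<close>

text \<open>Elements of Sobolev spaces are represented by functions on the whole space; only their values
  on \<open>\<Omega>\<close> matter, and these only up to a null set.  Equality in \<open>H\<^sub>0\<^sup>1(\<Omega>)\<close> is therefore equality
  almost everywhere in \<open>\<Omega>\<close>, and the norms below are seminorms on representatives.\<close>

definition square_integrable ::
  "'a::euclidean_space set \<Rightarrow> ('a \<Rightarrow> 'b::euclidean_space) \<Rightarrow> bool" where
  "square_integrable \<Omega> f \<longleftrightarrow>
     f \<in> borel_measurable (lebesgue_on \<Omega>) \<and> integrable (lebesgue_on \<Omega>) (\<lambda>x. (norm (f x))\<^sup>2)"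

definition locally_integrable ::
  "'a::euclidean_space set \<Rightarrow> ('a \<Rightarrow> 'b::euclidean_space) \<Rightarrow> bool" where
  "locally_integrable \<Omega> f \<longleftrightarrow> (\<forall>K. compact K \<and> K \<subseteq> \<Omega> \<longrightarrow> integrable (lebesgue_on K) f)"

definition has_weak_gradient ::
  "'a::euclidean_space set \<Rightarrow> ('a \<Rightarrow> real) \<Rightarrow> ('a \<Rightarrow> 'a) \<Rightarrow> bool" where
  "has_weak_gradient \<Omega> u G \<longleftrightarrow>
     locally_integrable \<Omega> u \<and> locally_integrable \<Omega> G \<and>
     (\<forall>\<phi>\<in>test_functions \<Omega>. \<forall>D. (\<forall>x. GDERIV \<phi> x :> D x) \<longrightarrow>
        (LINT x|lebesgue_on \<Omega>. u x *\<^sub>R D x) = - (LINT x|lebesgue_on \<Omega>. \<phi> x *\<^sub>R G x))"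

text \<open>Determined up to a null subset of an open \<open>\<Omega>\<close>.\<close>

definition weak_gradient :: "'a::euclidean_space set \<Rightarrow> ('a \<Rightarrow> real) \<Rightarrow> 'a \<Rightarrow> 'a" where
  "weak_gradient \<Omega> u = (SOME G. has_weak_gradient \<Omega> u G)"

definition H1 :: "'a::euclidean_space set \<Rightarrow> ('a \<Rightarrow> real) set" where
  "H1 \<Omega> = {u. square_integrable \<Omega> u \<and> (\<exists>G. square_integrable \<Omega> G \<and> has_weak_gradient \<Omega> u G)}"

definition dirichlet :: "'a::euclidean_space set \<Rightarrow> ('a \<Rightarrow> real) \<Rightarrow> real" where
  "dirichlet \<Omega> u = (LINT x|lebesgue_on \<Omega>. (norm (weak_gradient \<Omega> u x))\<^sup>2)"

definition H1_norm :: "'a::euclidean_space set \<Rightarrow> ('a \<Rightarrow> real) \<Rightarrow> real" where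
  "H1_norm \<Omega> u = sqrt ((LINT x|lebesgue_on \<Omega>. (u x)\<^sup>2) + dirichlet \<Omega> u)"

text \<open>The closure of the test functions in \<open>H\<^sup>1(\<Omega>)\<close>.\<close>

definition H01 :: "'a::euclidean_space set \<Rightarrow> ('a \<Rightarrow> real) set" where
  "H01 \<Omega> = {u \<in> H1 \<Omega>. \<forall>e>0. \<exists>\<phi>\<in>test_functions \<Omega>. H1_norm \<Omega> (\<lambda>x. u x - \<phi> x) < e}"

definition H01_norm :: "'a::euclidean_space set \<Rightarrow> ('a \<Rightarrow> real) \<Rightarrow> real" where
  "H01_norm \<Omega> u = sqrt (dirichlet \<Omega> u)"


section \<open>Differential calculus on \<open>H\<^sub>0\<^sup>1(\<Omega>)\<close>\<close>

text \<open>Frechet derivatives with respect to \<^const>\<open>H01_norm\<close>.  The library's \<^const>\<open>has_derivative\<close>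
  needs a type of class \<^class>\<open>real_normed_vector\<close>, which the space of representatives is not.\<close>

definition H01_linear :: "'a::euclidean_space set \<Rightarrow> (('a \<Rightarrow> real) \<Rightarrow> real) \<Rightarrow> bool" where
  "H01_linear \<Omega> L \<longleftrightarrow>
     (\<forall>u\<in>H01 \<Omega>. \<forall>v\<in>H01 \<Omega>. L (\<lambda>x. u x + v x) = L u + L v) \<and>
     (\<forall>c. \<forall>u\<in>H01 \<Omega>. L (\<lambda>x. c * u x) = c * L u)"

definition H01_bounded_linear :: "'a::euclidean_space set \<Rightarrow> (('a \<Rightarrow> real) \<Rightarrow> real) \<Rightarrow> bool" where
  "H01_bounded_linear \<Omega> L \<longleftrightarrow>
     H01_linear \<Omega> L \<and> (\<exists>K. \<forall>u\<in>H01 \<Omega>. \<bar>L u\<bar> \<le> K * H01_norm \<Omega> u)"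

definition H01_bounded_bilinear ::
  "'a::euclidean_space set \<Rightarrow> (('a \<Rightarrow> real) \<Rightarrow> ('a \<Rightarrow> real) \<Rightarrow> real) \<Rightarrow> bool" where
  "H01_bounded_bilinear \<Omega> B \<longleftrightarrow>
     (\<forall>u\<in>H01 \<Omega>. H01_linear \<Omega> (\<lambda>v. B u v)) \<and> (\<forall>v\<in>H01 \<Omega>. H01_linear \<Omega> (\<lambda>u. B u v)) \<and>
     (\<exists>K. \<forall>u\<in>H01 \<Omega>. \<forall>v\<in>H01 \<Omega>. \<bar>B u v\<bar> \<le> K * H01_norm \<Omega> u * H01_norm \<Omega> v)"

definition has_H01_derivative ::
  "'a::euclidean_space set \<Rightarrow> (('a \<Rightarrow> real) \<Rightarrow> real) \<Rightarrow> (('a \<Rightarrow> real) \<Rightarrow> real) \<Rightarrow> ('a \<Rightarrow> real) \<Rightarrow> bool"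
  where
  "has_H01_derivative \<Omega> F L u \<longleftrightarrow>
     H01_bounded_linear \<Omega> L \<and>
     (\<forall>e>0. \<exists>d>0. \<forall>h\<in>H01 \<Omega>. H01_norm \<Omega> h < d \<longrightarrow>
        \<bar>F (\<lambda>x. u x + h x) - F u - L h\<bar> \<le> e * H01_norm \<Omega> h)"

text \<open>\<open>B\<close> is the derivative at \<open>u\<close> of \<open>v \<mapsto> F'(v)\<close>, the latter taken in the dual norm.\<close>

definition has_H01_second_derivative ::
  "'a::euclidean_space set \<Rightarrow> (('a \<Rightarrow> real) \<Rightarrow> real) \<Rightarrow>
     (('a \<Rightarrow> real) \<Rightarrow> ('a \<Rightarrow> real) \<Rightarrow> real) \<Rightarrow> ('a \<Rightarrow> real) \<Rightarrow> bool" where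
  "has_H01_second_derivative \<Omega> F B u \<longleftrightarrow>
     H01_bounded_bilinear \<Omega> B \<and>
     (\<exists>D. (\<forall>v\<in>H01 \<Omega>. has_H01_derivative \<Omega> F (D v) v) \<and>
        (\<forall>e>0. \<exists>d>0. \<forall>h\<in>H01 \<Omega>. H01_norm \<Omega> h < d \<longrightarrow>
           (\<forall>k\<in>H01 \<Omega>. \<bar>D (\<lambda>x. u x + h x) k - D u k - B h k\<bar>
                        \<le> e * H01_norm \<Omega> h * H01_norm \<Omega> k)))"

definition critical_point ::
  "'a::euclidean_space set \<Rightarrow> (('a \<Rightarrow> real) \<Rightarrow> real) \<Rightarrow> ('a \<Rightarrow> real) \<Rightarrow> bool" where
  "critical_point \<Omega> F u \<longleftrightarrow> u \<in> H01 \<Omega> \<and> has_H01_derivative \<Omega> F (\<lambda>h. 0) u"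

definition global_minimizer ::
  "'a::euclidean_space set \<Rightarrow> (('a \<Rightarrow> real) \<Rightarrow> real) \<Rightarrow> ('a \<Rightarrow> real) \<Rightarrow> bool" where
  "global_minimizer \<Omega> F u \<longleftrightarrow> u \<in> H01 \<Omega> \<and> (\<forall>v\<in>H01 \<Omega>. F u \<le> F v)"

definition local_minimizer ::
  "'a::euclidean_space set \<Rightarrow> (('a \<Rightarrow> real) \<Rightarrow> real) \<Rightarrow> ('a \<Rightarrow> real) \<Rightarrow> bool" where
  "local_minimizer \<Omega> F u \<longleftrightarrow>
     u \<in> H01 \<Omega> \<and> (\<exists>r>0. \<forall>v\<in>H01 \<Omega>. H01_norm \<Omega> (\<lambda>x. v x - u x) < r \<longrightarrow> F u \<le> F v)"

text \<open>Continuous paths in \<open>H\<^sub>0\<^sup>1(\<Omega>)\<close> from \<open>0\<close> to \<open>v\<close>.\<close>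

definition H01_paths ::
  "'a::euclidean_space set \<Rightarrow> ('a \<Rightarrow> real) \<Rightarrow> (real \<Rightarrow> 'a \<Rightarrow> real) set" where
  "H01_paths \<Omega> v =
     {\<phi>. (\<forall>t\<in>{0..1}. \<phi> t \<in> H01 \<Omega>) \<and>
         (\<forall>t\<in>{0..1}. ((\<lambda>s. H01_norm \<Omega> (\<lambda>x. \<phi> s x - \<phi> t x)) \<longlongrightarrow> 0) (at t within {0..1})) \<and>
         (AE x in lebesgue_on \<Omega>. \<phi> 0 x = 0) \<and> (AE x in lebesgue_on \<Omega>. \<phi> 1 x = v x)}"

text \<open>For continuous \<open>F\<close> the supremum is a maximum.\<close>

definition mountain_pass_level ::
  "'a::euclidean_space set \<Rightarrow> (('a \<Rightarrow> real) \<Rightarrow> real) \<Rightarrow> ('a \<Rightarrow> real) \<Rightarrow> real" where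
  "mountain_pass_level \<Omega> F v = (INF \<phi>\<in>H01_paths \<Omega> v. SUP t\<in>{0..1}. F (\<phi> t))"

definition mountain_pass_critical_point ::
  "'a::euclidean_space set \<Rightarrow> (('a \<Rightarrow> real) \<Rightarrow> real) \<Rightarrow> ('a \<Rightarrow> real) \<Rightarrow> ('a \<Rightarrow> real) \<Rightarrow> bool" where
  "mountain_pass_critical_point \<Omega> F v w \<longleftrightarrow>
     critical_point \<Omega> F w \<and> F w = mountain_pass_level \<Omega> F v"


section \<open>The Kirchhoff problem\<close>

definition kirchhoff_functional ::
  "'a::euclidean_space set \<Rightarrow> real \<Rightarrow> real \<Rightarrow> real \<Rightarrow> ('a \<Rightarrow> real) \<Rightarrow> real" where
  "kirchhoff_functional \<Omega> a \<gamma> l u =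
     a / 2 * dirichlet \<Omega> u + l / 4 * (dirichlet \<Omega> u)\<^sup>2
       - 1 / \<gamma> * (LINT x|lebesgue_on \<Omega>. \<bar>u x\<bar> powr \<gamma>)"

text \<open>Solutions of \<open>-(a + l \<integral>|\<nabla>u|\<^sup>2) \<Delta>u = |u|\<^bsup>\<gamma>-2\<^esup> u\<close> in \<open>\<Omega>\<close>, \<open>u = 0\<close> on the boundary, are by definition the
  critical points of the functional.\<close>

definition kirchhoff_solution ::
  "'a::euclidean_space set \<Rightarrow> real \<Rightarrow> real \<Rightarrow> real \<Rightarrow> ('a \<Rightarrow> real) \<Rightarrow> bool" where
  "kirchhoff_solution \<Omega> a \<gamma> l u \<longleftrightarrow> critical_point \<Omega> (kirchhoff_functional \<Omega> a \<gamma> l) u"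

definition positive_kirchhoff_solution ::
  "'a::euclidean_space set \<Rightarrow> real \<Rightarrow> real \<Rightarrow> real \<Rightarrow> ('a \<Rightarrow> real) \<Rightarrow> bool" where
  "positive_kirchhoff_solution \<Omega> a \<gamma> l u \<longleftrightarrow>
     kirchhoff_solution \<Omega> a \<gamma> l u \<and> (AE x in lebesgue_on \<Omega>. u x > 0)"

end

theory Submission
  imports Defs "HOL-Complex_Analysis.Great_Picard" "HOL-Library.Diagonal_Subsequence"
begin

text \<open>Let \<open>D u = \<integral>|\<nabla>u|\<^sup>2\<close> and let \<open>S\<close> be the best constant in \<open>\<integral>|u|\<^sup>\<gamma> \<le> S (D u)\<^bsup>\<gamma>/2\<^esup>\<close>.  It is attained at a
  positive \<open>v\<close> with \<open>D v = 1\<close>, and both branches of solutions are multiples of \<open>v\<close>: since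
  \<open>\<Phi>\<^sub>\<lambda>(u) \<ge> a/2 t\<^sup>2 + \<lambda>/4 t\<^sup>4 - S/\<gamma> t\<^sup>\<gamma>\<close> for \<open>t = \<parallel>u\<parallel>\<close>, with equality on the ray \<open>u = t v\<close>, all assertions on
  minimizers, mountain pass levels and signs reduce to this function of one variable.  Its critical
  points are the solutions of \<open>\<lambda> = (S t\<^bsup>\<gamma>-2\<^esup> - a)/t\<^sup>2\<close>, whose right-hand side increases to \<open>\<lambda>\<^sup>*\<close> and then
  decreases to \<open>0\<close>.

  The Sobolev and Rellich theorems come from one estimate, \<open>\<parallel>u(\<cdot> + h) - u\<parallel>\<^sub>2 \<le> |h| \<parallel>\<nabla>u\<parallel>\<^sub>2\<close>, applied to the
  averages of \<open>u\<close> over cubes of dyadic size.  A maximizing sequence converges strongly by the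
  parallelogram law.  Positivity follows from the monotonicity of the averages of superharmonic
  functions.\<close>

subsection \<open>Smooth functions and test functions\<close>

text \<open>Beyond 2, the only Lebesgue exponent that enters is 4: it dominates every \<gamma> < 4,
  lies below the critical exponent 6 of dimension three, and, being an even integer, allows
  Minkowski and Hoelder to be replaced by convexity of the fourth power and repeated Cauchy-Schwarz.
  Halving the side r of a cube changes the average by order r^(-1/2) in the supremum and by order r
  in L2; interpolation gives order r^(1/4) in L4, a convergent geometric series over dyadic scales.
  Averages of one fixed scale are equicontinuous, whence compactness.

  No Palais-Smale condition is required. A path from 0 to a point \<tau> v beyond the first critical
  radius must cross the sphere of that radius, and the segment along v realizes the resulting lower
  bound, so the mountain pass level is attained on the ray itself. This works for every parameter
  below \<open>lstar\<close>, which is why \<epsilon> can be \<open>lstar - lzero\<close>.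

  The extremal v is known only modulo null sets and without regularity. The maximum principle
  therefore argues at Lebesgue points and propagates balls on which v vanishes almost
  everywhere.\<close>

lemma GDERIV_unique:
  assumes "GDERIV f x :> D" "GDERIV f x :> E"
  shows "D = E"
proof -
  have "(\<lambda>h. inner h D) = (\<lambda>h. inner h E)"
    using assms unfolding gderiv_def by (rule has_derivative_unique)
  then show ?thesis by (metis inner_commute vector_eq_rdot)
qed

definition grad :: "('a::euclidean_space \<Rightarrow> real) \<Rightarrow> 'a \<Rightarrow> 'a" where
  "grad f x = (THE D. GDERIV f x :> D)"

lemma grad_eq: "GDERIV f x :> D \<Longrightarrow> grad f x = D"
  unfolding grad_def using GDERIV_unique by blast

abbreviation Ck :: "nat \<Rightarrow> ('a::euclidean_space \<Rightarrow> real) \<Rightarrow> bool" where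
  "Ck k f \<equiv> Ck_on k UNIV f"

lemma Ck_SucI:
  assumes "\<And>x. GDERIV f x :> g x" "\<And>b. b \<in> Basis \<Longrightarrow> Ck k (\<lambda>x. g x \<bullet> b)"
  shows "Ck (Suc k) f"
  using assms by auto

lemma Ck_SucD:
  assumes "Ck (Suc k) f"
  shows "GDERIV f x :> grad f x" "b \<in> Basis \<Longrightarrow> Ck k (\<lambda>x. grad f x \<bullet> b)"
proof -
  obtain g where g: "\<forall>x. GDERIV f x :> g x" "\<forall>b\<in>Basis. Ck k (\<lambda>x. g x \<bullet> b)"
    using assms by auto
  then have "grad f = g" by (auto simp: grad_eq)
  then show "GDERIV f x :> grad f x" "b \<in> Basis \<Longrightarrow> Ck k (\<lambda>x. grad f x \<bullet> b)"
    using g by auto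
qed

lemma GDERIV_continuous:
  assumes "\<And>x. GDERIV f x :> g x"
  shows "continuous_on UNIV f"
  using assms unfolding gderiv_def
  by (meson continuous_at_imp_continuous_on has_derivative_continuous)

lemma Ck_pred: "Ck (Suc k) f \<Longrightarrow> Ck k f"
proof (induction k arbitrary: f)
  case 0
  then show ?case using GDERIV_continuous[of f] by auto
next
  case (Suc k)
  show ?case
    by (rule Ck_SucI[of f "grad f"]) (use Ck_SucD[OF Suc.prems] Suc.IH in auto)
qed

lemma Ck_const: "Ck k (\<lambda>x. c)"
proof (induction k arbitrary: c)
  case (Suc k)
  show ?case by (rule Ck_SucI[of _ "\<lambda>_. 0"]) (use Suc in \<open>auto intro: GDERIV_const\<close>)
qed auto

lemma Ck_add: "Ck k f \<Longrightarrow> Ck k g \<Longrightarrow> Ck k (\<lambda>x. f x + g x)"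
proof (induction k arbitrary: f g)
  case 0
  then show ?case by (auto intro: continuous_intros)
next
  case (Suc k)
  show ?case
    by (rule Ck_SucI[of _ "\<lambda>x. grad f x + grad g x"])
      (use Ck_SucD[OF Suc.prems(1)] Ck_SucD[OF Suc.prems(2)] Suc.IH in
        \<open>auto intro: GDERIV_add simp: inner_add_left\<close>)
qed

lemma Ck_mult: "Ck k f \<Longrightarrow> Ck k g \<Longrightarrow> Ck k (\<lambda>x. f x * g x)"
proof (induction k arbitrary: f g)
  case 0
  then show ?case by (auto intro: continuous_intros)
next
  case (Suc k)
  note 1 = Ck_SucD[OF Suc.prems(1)] and 2 = Ck_SucD[OF Suc.prems(2)]
  show ?case
  proof (rule Ck_SucI)
    show "GDERIV (\<lambda>x. f x * g x) x :> f x *\<^sub>R grad g x + g x *\<^sub>R grad f x" for x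
      by (rule GDERIV_mult[OF 1(1) 2(1)])
    fix b :: 'a assume b: "b \<in> Basis"
    have "Ck k (\<lambda>x. f x * (grad g x \<bullet> b) + g x * (grad f x \<bullet> b))"
      by (intro Ck_add Suc.IH Ck_pred[OF Suc.prems(1)] Ck_pred[OF Suc.prems(2)] 1(2) 2(2) b)
    then show "Ck k (\<lambda>x. (f x *\<^sub>R grad g x + g x *\<^sub>R grad f x) \<bullet> b)"
      by (simp add: inner_add_left)
  qed
qed

lemma Ck_prod: "finite A \<Longrightarrow> (\<And>i. i \<in> A \<Longrightarrow> Ck k (f i)) \<Longrightarrow> Ck k (\<lambda>x. \<Prod>i\<in>A. f i x)"
  by (induction A rule: finite_induct) (auto intro: Ck_const Ck_mult)

lemma Ck_cmult: "Ck k f \<Longrightarrow> Ck k (\<lambda>x. c * f x)"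
  by (intro Ck_mult Ck_const)

lemma Ck_diff: "Ck k f \<Longrightarrow> Ck k g \<Longrightarrow> Ck k (\<lambda>x. f x - g x)"
  using Ck_add[of k f "\<lambda>x. (-1) * g x"] Ck_cmult[of k g "-1"] by simp

lemma GDERIV_inner_right: "GDERIV (\<lambda>x. x \<bullet> v) x :> v"
  unfolding gderiv_def by (auto intro!: derivative_eq_intros)

lemma Ck_inner: "Ck k (\<lambda>x. x \<bullet> v)"
proof (cases k)
  case (Suc m)
  then show ?thesis
    by (simp only: Suc) (rule Ck_SucI[OF GDERIV_inner_right Ck_const])
qed (auto intro: continuous_intros)

lemma GDERIV_norm_sq: "GDERIV (\<lambda>x. (x - c) \<bullet> (x - c)) x :> 2 *\<^sub>R (x - c)"
  unfolding gderiv_def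
  by (auto intro!: derivative_eq_intros simp: inner_commute algebra_simps inner_simps)

lemma Ck_norm_sq: "Ck k (\<lambda>x. (x - c) \<bullet> (x - c))"
proof (cases k)
  case (Suc m)
  show ?thesis
  proof (simp only: Suc, rule Ck_SucI[OF GDERIV_norm_sq])
    fix b :: 'a assume "b \<in> Basis"
    have "Ck m (\<lambda>x. 2 * (x \<bullet> b - c \<bullet> b))"
      by (intro Ck_cmult Ck_diff Ck_inner Ck_const)
    then show "Ck m (\<lambda>x. (2 *\<^sub>R (x - c)) \<bullet> b)" by (simp add: inner_diff_left)
  qed
qed (auto intro!: continuous_intros)

text \<open>The derivatives of \<open>t \<mapsto> exp (- 1 / t)\<close>, extended by \<open>0\<close>, are combinations of these functions.\<close>

definition bump :: "nat \<Rightarrow> real \<Rightarrow> real" where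
  "bump n t = (if t > 0 then exp (- 1 / t) / t ^ n else 0)"

lemma bump_nonneg: "bump n t \<ge> 0" by (simp add: bump_def)

lemma bump_pos: "t > 0 \<Longrightarrow> bump n t > 0" by (simp add: bump_def)

lemma bump_zero: "t \<le> 0 \<Longrightarrow> bump n t = 0" by (simp add: bump_def)

text \<open>A single term, of index \<open>n + m\<close>, of the exponential series at
  \<open>1/t\<close> already bounds it from below. The case \<open>m = 0\<close> bounds
  \<open>bump n\<close>; the case \<open>m = 2\<close> makes its difference quotient at 0
  vanish.\<close>

lemma bump_le: "bump n t \<le> fact (n + m) * \<bar>t\<bar> ^ m"
proof (cases "t > 0")
  case True
  have "(1/t) ^ (n + m) / fact (n + m) \<le> exp (1/t)"
  proof -
    have "(\<Sum>k\<in>{n + m}. (1/t) ^ k /\<^sub>R fact k) \<le> (\<Sum>k. (1/t) ^ k /\<^sub>R fact k)"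
      using True by (intro sum_le_suminf summable_exp_generic) auto
    then show ?thesis by (simp add: exp_def field_simps)
  qed
  then have "exp (- 1 / t) \<le> fact (n + m) * t ^ (n + m)"
    using True by (simp add: exp_minus field_simps power_divide)
  then show ?thesis using True by (simp add: bump_def field_simps power_add)
qed (simp add: bump_def)

lemma bump_DERIV: "(bump n has_real_derivative (bump (n + 2) t - real n * bump (n + 1) t)) (at t)"
proof -
  consider "t > 0" | "t < 0" | "t = 0" by linarith
  then show ?thesis
  proof cases
    case 1
    have "((\<lambda>t. exp (- 1 / t) / t ^ n) has_real_derivative
         (bump (n + 2) t - real n * bump (n + 1) t)) (at t)"
      using 1 by (auto intro!: derivative_eq_intros simp: bump_def field_simps power2_eq_square)
        (cases n; simp add: field_simps power2_eq_square)+
    then show ?thesis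
      by (rule has_field_derivative_transform_within_open[where S="{0<..}"])
        (use 1 in \<open>auto simp: bump_def\<close>)
  next
    case 2
    have "((\<lambda>t. 0) has_real_derivative (bump (n + 2) t - real n * bump (n + 1) t)) (at t)"
      using 2 by (simp add: bump_def)
    then show ?thesis
      by (rule has_field_derivative_transform_within_open[where S="{..<0}"])
        (use 2 in \<open>auto simp: bump_def\<close>)
  next
    case 3
    have "((\<lambda>h. (bump n h) / h) \<longlongrightarrow> 0) (at 0)"
    proof (rule Lim_null_comparison)
      show "\<forall>\<^sub>F h in at 0. norm (bump n h / h) \<le> fact (n + 2) * \<bar>h\<bar>"
      proof (rule eventuallyI)
        fix h :: real
        have "norm (bump n h / h) \<le> fact (n + 2) * \<bar>h\<bar> ^ 2 / \<bar>h\<bar>"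
          unfolding real_norm_def abs_divide
          by (rule divide_right_mono) (use bump_le[of n h 2] bump_nonneg[of n h] in auto)
        then show "norm (bump n h / h) \<le> fact (n + 2) * \<bar>h\<bar>"
          by (simp add: power2_eq_square del: abs_mult_self_eq fact_Suc split: if_splits)
      qed
      show "((\<lambda>h. fact (n + 2) * \<bar>h\<bar>) \<longlongrightarrow> 0) (at (0::real))"
        by (auto intro!: tendsto_eq_intros)
    qed
    then show ?thesis by (simp add: 3 DERIV_def bump_zero)
  qed
qed

text \<open>Differentiation raises the index \<open>n\<close>, so the induction on the order treats
  all indices at once.\<close>

lemma Ck_bump: "(\<And>k. Ck k p) \<Longrightarrow> Ck k (\<lambda>x. bump n (p x))"
proof (induction k arbitrary: n)
  case 0
  have "continuous_on UNIV p" using 0[of 0] by simp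
  moreover have "continuous_on UNIV (bump n)"
    by (meson DERIV_continuous bump_DERIV continuous_at_imp_continuous_on)
  ultimately show ?case
    using continuous_on_compose2[of UNIV "bump n" UNIV p] by auto
next
  case (Suc k)
  show ?case
  proof (rule Ck_SucI)
    show "GDERIV (\<lambda>x. bump n (p x)) x :>
        (bump (n + 2) (p x) - real n * bump (n + 1) (p x)) *\<^sub>R grad p x" for x
      by (rule GDERIV_DERIV_compose[OF Ck_SucD(1)[OF Suc.prems] bump_DERIV])
    fix b :: 'a assume b: "b \<in> Basis"
    have "Ck k (\<lambda>x. (bump (n + 2) (p x) - real n * bump (n + 1) (p x)) * (grad p x \<bullet> b))"
      by (intro Ck_mult Ck_diff Ck_cmult Suc.IH Suc.prems Ck_SucD(2)[OF Suc.prems b])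
    then show "Ck k (\<lambda>x. ((bump (n + 2) (p x) - real n * bump (n + 1) (p x)) *\<^sub>R grad p x) \<bullet> b)"
      by simp
  qed
qed

lemma Ck_powr:
  assumes p: "\<And>k. Ck k p" "\<And>x. p x > 0"
  shows "Ck k (\<lambda>x. p x powr r)"
proof (induction k arbitrary: r)
  case 0
  have "continuous_on UNIV p" using p(1)[of 0] by simp
  moreover have "\<forall>x\<in>UNIV. p x \<noteq> 0" using p(2) by (simp add: less_imp_neq[symmetric])
  ultimately show ?case by (simp add: continuous_on_powr)
next
  case (Suc k)
  show ?case
  proof (rule Ck_SucI)
    show "GDERIV (\<lambda>x. p x powr r) x :> (r * p x powr (r - 1)) *\<^sub>R grad p x" for x
      by (rule GDERIV_DERIV_compose[OF Ck_SucD(1)[OF p(1)] has_real_derivative_powr]) (rule p)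
    fix b :: 'a assume b: "b \<in> Basis"
    have "Ck k (\<lambda>x. (r * p x powr (r - 1)) * (grad p x \<bullet> b))"
      by (intro Ck_mult Ck_cmult Suc.IH p Ck_const Ck_SucD(2)[OF p(1) b])
    then show "Ck k (\<lambda>x. ((r * p x powr (r - 1)) *\<^sub>R grad p x) \<bullet> b)"
      by simp
  qed
qed

section \<open>Test functions: closure under algebra, differentiation and regularization\<close>

lemma test_functions_iff:
  "\<phi> \<in> test_functions \<Omega> \<longleftrightarrow>
     (\<forall>k. Ck k \<phi>) \<and> compact (closure {x. \<phi> x \<noteq> 0}) \<and> closure {x. \<phi> x \<noteq> 0} \<subseteq> \<Omega>"
  by (simp add: test_functions_def)

lemma test_functionsI:
  assumes "\<And>k. Ck k \<phi>" "compact K" "K \<subseteq> \<Omega>" "\<And>x. \<phi> x \<noteq> 0 \<Longrightarrow> x \<in> K"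
  shows "\<phi> \<in> test_functions \<Omega>"
proof -
  have "closure {x. \<phi> x \<noteq> 0} \<subseteq> K"
    using assms by (intro closure_minimal) (auto intro: compact_imp_closed)
  moreover have "compact (closure {x. \<phi> x \<noteq> 0})"
    using calculation assms(2) by (meson bounded_subset closed_closure compact_eq_bounded_closed)
  ultimately show ?thesis using assms by (auto simp: test_functions_iff)
qed

lemma test_functionsE:
  assumes "\<phi> \<in> test_functions \<Omega>"
  obtains K where "compact K" "K \<subseteq> \<Omega>" "\<And>x. x \<notin> K \<Longrightarrow> \<phi> x = 0" "\<And>x. x \<notin> K \<Longrightarrow> grad \<phi> x = 0"
proof
  define K where "K = closure {x. \<phi> x \<noteq> 0}"
  show K: "compact K" "K \<subseteq> \<Omega>" using assms by (auto simp: test_functions_iff K_def)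
  show z: "\<phi> x = 0" if "x \<notin> K" for x
    using that closure_subset[of "{x. \<phi> x \<noteq> 0}"] unfolding K_def by blast
  show "grad \<phi> x = 0" if "x \<notin> K" for x
  proof (rule grad_eq)
    have "((\<lambda>x. 0) has_derivative (\<lambda>h. h \<bullet> 0)) (at x)" by simp
    then show "GDERIV \<phi> x :> 0" unfolding gderiv_def
      by (rule has_derivative_transform_within_open[of _ _ _ _ "- K"])
        (use that z K(1) in \<open>auto intro: compact_imp_closed\<close>)
  qed
qed

lemma test_support:
  assumes "\<phi> \<in> test_functions \<Omega>"
  shows "\<exists>K. compact K \<and> K \<subseteq> \<Omega> \<and> (\<forall>x. x \<notin> K \<longrightarrow> \<phi> x = 0) \<and> (\<forall>x. x \<notin> K \<longrightarrow> grad \<phi> x = 0)"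
  by (rule test_functionsE[OF assms]) blast

lemma test_GDERIV: "\<phi> \<in> test_functions \<Omega> \<Longrightarrow> GDERIV \<phi> x :> grad \<phi> x"
  unfolding test_functions_iff using Ck_SucD(1) by blast

lemma test_Ck: "\<phi> \<in> test_functions \<Omega> \<Longrightarrow> Ck k \<phi>"
  unfolding test_functions_iff by blast

lemma test_continuous: "\<phi> \<in> test_functions \<Omega> \<Longrightarrow> continuous_on UNIV \<phi>"
  using test_Ck[of \<phi> \<Omega> 0] by simp

lemma test_grad_continuous: "\<phi> \<in> test_functions \<Omega> \<Longrightarrow> continuous_on UNIV (grad \<phi>)"
  using Ck_SucD(2)[OF test_Ck[of \<phi> \<Omega> 1, simplified One_nat_def]]
  by (subst continuous_on_componentwise) auto

lemma test_grad_component: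
  assumes "\<phi> \<in> test_functions \<Omega>" "b \<in> Basis"
  shows "(\<lambda>x. grad \<phi> x \<bullet> b) \<in> test_functions \<Omega>"
proof -
  obtain K where K: "compact K" "K \<subseteq> \<Omega>" "\<forall>x. x \<notin> K \<longrightarrow> grad \<phi> x = 0"
    using test_support[OF assms(1)] by blast
  show ?thesis
    by (rule test_functionsI[OF _ K(1,2)])
      (use K(3) Ck_SucD(2)[OF test_Ck[OF assms(1)] assms(2)] in auto)
qed

lemma test_add:
  assumes "\<phi> \<in> test_functions \<Omega>" "\<psi> \<in> test_functions \<Omega>"
  shows "(\<lambda>x. \<phi> x + \<psi> x) \<in> test_functions \<Omega>"
proof -
  obtain K L where K: "compact K" "K \<subseteq> \<Omega>" "\<forall>x. x \<notin> K \<longrightarrow> \<phi> x = 0"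
    "compact L" "L \<subseteq> \<Omega>" "\<forall>x. x \<notin> L \<longrightarrow> \<psi> x = 0"
    using test_support[OF assms(1)] test_support[OF assms(2)] by blast
  show ?thesis
    by (rule test_functionsI[of _ "K \<union> L"]) (use K assms in \<open>auto intro: Ck_add test_Ck\<close>)
qed

lemma test_mult:
  assumes "\<phi> \<in> test_functions \<Omega>" "\<And>k. Ck k \<psi>"
  shows "(\<lambda>x. \<phi> x * \<psi> x) \<in> test_functions \<Omega>"
proof -
  obtain K where K: "compact K" "K \<subseteq> \<Omega>" "\<forall>x. x \<notin> K \<longrightarrow> \<phi> x = 0"
    using test_support[OF assms(1)] by blast
  show ?thesis
    by (rule test_functionsI[of _ "K"]) (use K assms in \<open>auto intro: Ck_mult test_Ck\<close>)
qed

lemma test_cmult: "\<phi> \<in> test_functions \<Omega> \<Longrightarrow> (\<lambda>x. c * \<phi> x) \<in> test_functions \<Omega>"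
  using test_mult[of \<phi> \<Omega> "\<lambda>_. c"] by (simp add: Ck_const mult.commute)

lemma test_diff:
  "\<phi> \<in> test_functions \<Omega> \<Longrightarrow> \<psi> \<in> test_functions \<Omega> \<Longrightarrow> (\<lambda>x. \<phi> x - \<psi> x) \<in> test_functions \<Omega>"
  using test_add[of \<phi> \<Omega> "\<lambda>x. (-1) * \<psi> x"] test_cmult[of \<psi> \<Omega> "-1"] by simp

lemma test_zero: "(\<lambda>x. 0) \<in> test_functions \<Omega>"
  by (rule test_functionsI[of _ "{}"]) (auto intro: Ck_const)

text \<open>A smooth replacement for the absolute value, under which test functions remain test
  functions. Subtracting \<open>d\<close> makes it vanish at 0 and so preserves compact supports;
  its slope is at most 1 in modulus, so the Dirichlet integral does not grow. It makes maximizing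
  sequences nonnegative.\<close>

definition soft_abs :: "real \<Rightarrow> real \<Rightarrow> real" where
  "soft_abs d t = sqrt (t\<^sup>2 + d\<^sup>2) - d"

lemma soft_abs_nonneg: "0 \<le> d \<Longrightarrow> soft_abs d t \<ge> 0"
  by (simp add: soft_abs_def real_le_rsqrt)

lemma soft_abs_bounds:
  assumes "0 \<le> d" shows "\<bar>t\<bar> - d \<le> soft_abs d t" "soft_abs d t \<le> \<bar>t\<bar>"
proof -
  show "\<bar>t\<bar> - d \<le> soft_abs d t" by (simp add: soft_abs_def real_le_rsqrt)
  have "sqrt (t\<^sup>2 + d\<^sup>2) \<le> \<bar>t\<bar> + d"
    by (rule real_le_lsqrt) (use assms in \<open>auto simp: power2_eq_square algebra_simps\<close>)
  then show "soft_abs d t \<le> \<bar>t\<bar>" by (simp add: soft_abs_def)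
qed

lemma test_soft_abs:
  assumes "\<phi> \<in> test_functions \<Omega>" "d > 0"
  shows "(\<lambda>x. soft_abs d (\<phi> x)) \<in> test_functions \<Omega>"
    and "norm (grad (\<lambda>x. soft_abs d (\<phi> x)) x) \<le> norm (grad \<phi> x)"
proof -
  have pos: "t\<^sup>2 + d\<^sup>2 > 0" for t using assms(2) by (simp add: add_nonneg_pos)
  have eq: "soft_abs d (\<phi> x) = (\<phi> x * \<phi> x + d * d) powr (1/2) - d" for x
    using pos[of "\<phi> x"] by (simp add: soft_abs_def powr_half_sqrt power2_eq_square)
  obtain K where K: "compact K" "K \<subseteq> \<Omega>" "\<forall>x. x \<notin> K \<longrightarrow> \<phi> x = 0"
    using test_support[OF assms(1)] by blast
  show "(\<lambda>x. soft_abs d (\<phi> x)) \<in> test_functions \<Omega>"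
  proof (rule test_functionsI[OF _ K(1,2)])
    show "Ck k (\<lambda>x. soft_abs d (\<phi> x))" for k
      unfolding eq using pos
      by (intro Ck_diff Ck_powr Ck_add Ck_mult Ck_const test_Ck[OF assms(1)])
        (simp add: power2_eq_square)
    show "soft_abs d (\<phi> x) \<noteq> 0 \<Longrightarrow> x \<in> K" for x
      using K(3) assms(2) by (auto simp: soft_abs_def)
  qed
  have D: "(soft_abs d has_real_derivative (t / sqrt (t\<^sup>2 + d\<^sup>2))) (at t)" for t
    unfolding soft_abs_def using pos[of t]
    by (auto intro!: derivative_eq_intros simp: field_simps)
  have "grad (\<lambda>x. soft_abs d (\<phi> x)) x = (\<phi> x / sqrt ((\<phi> x)\<^sup>2 + d\<^sup>2)) *\<^sub>R grad \<phi> x"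
    by (rule grad_eq[OF GDERIV_DERIV_compose[OF test_GDERIV[OF assms(1)] D]])
  moreover have "\<bar>t / sqrt (t\<^sup>2 + d\<^sup>2)\<bar> \<le> 1" for t
    using pos[of t] by (simp add: abs_divide divide_le_eq real_le_rsqrt)
  ultimately show "norm (grad (\<lambda>x. soft_abs d (\<phi> x)) x) \<le> norm (grad \<phi> x)"
    using mult_left_le_one_le[of "norm (grad \<phi> x)" "\<bar>\<phi> x / sqrt ((\<phi> x)\<^sup>2 + d\<^sup>2)\<bar>"] by simp
qed

text \<open>As \<open>c\<close> grows these products tend to the indicator of the open box, which
  lets integrals over boxes be reached by test functions.\<close>

lemma box_bump_test:
  fixes l u :: "'a::euclidean_space"
  assumes "cbox l u \<subseteq> \<Omega>" "c > 0"
  shows "(\<lambda>x. \<Prod>b\<in>Basis. bump 0 (c * (x \<bullet> b - l \<bullet> b)) * bump 0 (c * (u \<bullet> b - x \<bullet> b)))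
    \<in> test_functions \<Omega>"
proof (rule test_functionsI[OF _ compact_cbox assms(1)])
  show "Ck k (\<lambda>x. \<Prod>b\<in>Basis. bump 0 (c * (x \<bullet> b - l \<bullet> b)) * bump 0 (c * (u \<bullet> b - x \<bullet> b)))" for k
    by (intro Ck_prod Ck_mult Ck_bump Ck_diff Ck_cmult Ck_inner Ck_const) auto
  fix x assume "(\<Prod>b\<in>Basis. bump 0 (c * (x \<bullet> b - l \<bullet> b)) * bump 0 (c * (u \<bullet> b - x \<bullet> b))) \<noteq> 0"
  then have "bump 0 (c * (x \<bullet> b - l \<bullet> b)) \<noteq> 0" "bump 0 (c * (u \<bullet> b - x \<bullet> b)) \<noteq> 0"
    if "b \<in> Basis" for b using that by auto
  then have "c * (x \<bullet> b - l \<bullet> b) > 0" "c * (u \<bullet> b - x \<bullet> b) > 0" if "b \<in> Basis" for b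
    using that bump_zero by (meson not_le)+
  then show "x \<in> cbox l u" using \<open>c > 0\<close> by (auto simp: mem_box zero_less_mult_iff less_imp_le)
qed

subsection \<open>Translation estimates\<close>

lemma integrable_compact_support:
  fixes f :: "'a::euclidean_space \<Rightarrow> 'b::euclidean_space"
  assumes "continuous_on UNIV f" "compact K" "\<And>x. x \<notin> K \<Longrightarrow> f x = 0"
  shows "integrable lborel f"
proof -
  have "integrable lborel (\<lambda>x. indicator K x *\<^sub>R f x)"
    using assms(1) by (intro borel_integrable_compact assms(2)) (rule continuous_on_subset, auto)
  moreover have "(\<lambda>x. indicator K x *\<^sub>R f x) = f"
    using assms(3) by (auto simp: indicator_def fun_eq_iff)
  ultimately show ?thesis by simp
qed

lemma nn_integral_translate:
  fixes f :: "'a::euclidean_space \<Rightarrow> ennreal"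
  assumes [measurable]: "f \<in> borel_measurable borel"
  shows "(\<integral>\<^sup>+x. f (x + h) \<partial>lborel) = (\<integral>\<^sup>+x. f x \<partial>lborel)"
proof -
  have "(\<integral>\<^sup>+x. f x \<partial>lborel) = (\<integral>\<^sup>+x. f x \<partial>distr lborel borel ((+) h))"
    by (simp add: lborel_distr_plus)
  also have "\<dots> = (\<integral>\<^sup>+x. f (h + x) \<partial>lborel)"
    by (subst nn_integral_distr) auto
  finally show ?thesis by (simp add: add.commute)
qed

lemma integral_translate:
  fixes f :: "'a::euclidean_space \<Rightarrow> 'b::euclidean_space"
  assumes [measurable]: "f \<in> borel_measurable borel"
  shows "(\<integral>x. f (x + h) \<partial>lborel) = (\<integral>x. f x \<partial>lborel)"
proof -
  have "(\<integral>x. f x \<partial>lborel) = (\<integral>x. f x \<partial>distr lborel borel ((+) h))"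
    by (simp add: lborel_distr_plus)
  also have "\<dots> = (\<integral>x. f (h + x) \<partial>lborel)"
    by (subst integral_distr) auto
  finally show ?thesis by (simp add: add.commute)
qed

lemma nn_integral_affine:
  fixes f :: "'a::euclidean_space \<Rightarrow> ennreal"
  assumes [measurable]: "f \<in> borel_measurable borel" and c: "c > 0"
  shows "(\<integral>\<^sup>+z. f (x + c *\<^sub>R z) \<partial>lborel) = ennreal (1 / c ^ DIM('a)) * (\<integral>\<^sup>+y. f y \<partial>lborel)"
proof -
  have "(\<integral>\<^sup>+y. f y \<partial>lborel) = (\<integral>\<^sup>+y. f y \<partial>density (distr lborel borel (\<lambda>z. x + c *\<^sub>R z)) (\<lambda>_. \<bar>c\<bar> ^ DIM('a)))"
    using c by (subst lborel_affine[of c x]) auto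
  also have "\<dots> = ennreal (c ^ DIM('a)) * (\<integral>\<^sup>+z. f (x + c *\<^sub>R z) \<partial>lborel)"
    using c by (simp add: nn_integral_density nn_integral_distr nn_integral_cmult ennreal_power)
  finally have "ennreal (1 / c ^ DIM('a)) * (\<integral>\<^sup>+y. f y \<partial>lborel) =
     ennreal (1 / c ^ DIM('a)) * ennreal (c ^ DIM('a)) * (\<integral>\<^sup>+z. f (x + c *\<^sub>R z) \<partial>lborel)"
    by (simp add: mult.assoc)
  also have "ennreal (1 / c ^ DIM('a)) * ennreal (c ^ DIM('a)) = 1"
    using c by (simp add: ennreal_mult'[symmetric])
  finally show ?thesis by simp
qed

text \<open>Jensen's inequality for the square, from Cauchy-Schwarz against the indicator of
  \<open>S\<close>; the second factor is absorbed because \<open>S\<close> has measure at most 1. It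
  is used on the unit interval and on the unit cube.\<close>

lemma average_square_le:
  fixes f :: "'a \<Rightarrow> real"
  assumes S: "S \<in> sets M" "emeasure M S \<le> 1" and f: "integrable M (\<lambda>x. indicator S x * f x)"
  shows "ennreal ((\<integral>x. indicator S x * f x \<partial>M)\<^sup>2) \<le> (\<integral>\<^sup>+x. ennreal ((f x)\<^sup>2) * indicator S x \<partial>M)"
proof -
  let ?g = "\<lambda>x. ennreal \<bar>indicator S x * f x\<bar>"
  have [measurable]: "(\<lambda>x. indicator S x * f x) \<in> borel_measurable M" using f by simp
  note S(1)[measurable]
  have "ennreal ((\<integral>x. indicator S x * f x \<partial>M)\<^sup>2) = (ennreal \<bar>\<integral>x. indicator S x * f x \<partial>M\<bar>)\<^sup>2"
    by (simp add: ennreal_power)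
  also have "\<dots> \<le> (\<integral>\<^sup>+x. ?g x \<partial>M)\<^sup>2"
    using integral_norm_bound_ennreal[OF f] by (intro power_mono) auto
  also have "(\<integral>\<^sup>+x. ?g x \<partial>M) = (\<integral>\<^sup>+x. ?g x * indicator S x \<partial>M)"
    by (intro nn_integral_cong) (auto simp: indicator_def)
  also have "(\<integral>\<^sup>+x. ?g x * indicator S x \<partial>M)\<^sup>2 \<le> (\<integral>\<^sup>+x. (?g x)\<^sup>2 \<partial>M) * (\<integral>\<^sup>+x. (indicator S x)\<^sup>2 \<partial>M)"
    by (rule Cauchy_Schwarz_nn_integral) measurable
  also have "(\<integral>\<^sup>+x. (indicator S x)\<^sup>2 \<partial>M) = emeasure M S"
  proof -
    have "(\<integral>\<^sup>+x. (indicator S x)\<^sup>2 \<partial>M) = (\<integral>\<^sup>+x. indicator S x \<partial>M)"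
      by (intro nn_integral_cong) (auto simp: indicator_def)
    then show ?thesis using S(1) by simp
  qed
  also have "(\<integral>\<^sup>+x. (?g x)\<^sup>2 \<partial>M) * emeasure M S \<le> (\<integral>\<^sup>+x. (?g x)\<^sup>2 \<partial>M) * 1"
    by (rule mult_left_mono[OF S(2)]) simp
  also have "\<dots> = (\<integral>\<^sup>+x. ennreal ((f x)\<^sup>2) * indicator S x \<partial>M)"
    by (simp, intro nn_integral_cong) (auto simp: indicator_def ennreal_power)
  finally show ?thesis .
qed

text \<open>The fundamental theorem of calculus on the segment from \<open>y\<close> to
  \<open>y + k\<close>, followed by Jensen on the unit interval and Cauchy-Schwarz in the
  integrand.\<close>

lemma square_increment_le:
  fixes f :: "'a::euclidean_space \<Rightarrow> real"
  assumes D: "\<And>x. GDERIV f x :> g x" and g: "continuous_on UNIV g"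
  shows "ennreal ((f (y + k) - f y)\<^sup>2) \<le>
    ennreal ((norm k)\<^sup>2) * (\<integral>\<^sup>+t. ennreal ((norm (g (y + t *\<^sub>R k)))\<^sup>2) * indicator {0..1::real} t \<partial>lborel)"
proof -
  define \<phi> where "\<phi> t = k \<bullet> g (y + t *\<^sub>R k)" for t
  have cont: "continuous_on A (\<lambda>t. g (y + t *\<^sub>R k))" for A
    by (rule continuous_on_compose2[OF g]) (auto intro!: continuous_intros)
  have c\<phi>: "continuous_on {0..1} \<phi>" unfolding \<phi>_def by (intro continuous_intros cont)
  have [measurable]: "(\<lambda>t. g (y + t *\<^sub>R k)) \<in> borel_measurable borel"
    by (rule borel_measurable_continuous_onI[OF cont])
  have vd: "((\<lambda>t. f (y + t *\<^sub>R k)) has_vector_derivative \<phi> t) (at t within {0..1})" for t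
  proof -
    have "(f has_derivative (\<lambda>h. h \<bullet> g (y + t *\<^sub>R k))) (at (y + t *\<^sub>R k))"
      using D unfolding gderiv_def by blast
    moreover have "((\<lambda>t. y + t *\<^sub>R k) has_derivative (\<lambda>s. s *\<^sub>R k)) (at t)"
      by (auto intro!: derivative_eq_intros)
    ultimately have "((\<lambda>t. f (y + t *\<^sub>R k)) has_derivative (\<lambda>s. (s *\<^sub>R k) \<bullet> g (y + t *\<^sub>R k))) (at t)"
      by (rule has_derivative_compose[rotated])
    then show ?thesis unfolding has_vector_derivative_def \<phi>_def
      by (auto intro: has_derivative_at_withinI)
  qed
  have "(\<integral>t. indicator {0..1} t *\<^sub>R \<phi> t \<partial>lborel) = f (y + 1 *\<^sub>R k) - f (y + 0 *\<^sub>R k)"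
    by (rule integral_FTC_Icc[OF _ vd c\<phi>]) auto
  then have eq: "f (y + k) - f y = (\<integral>t. indicator {0..1} t * \<phi> t \<partial>lborel)" by simp
  have "integrable lborel (\<lambda>t. indicator {0..1} t * \<phi> t)"
    using borel_integrable_compact[OF _ c\<phi>] by simp
  then have "ennreal ((f (y + k) - f y)\<^sup>2) \<le> (\<integral>\<^sup>+t. ennreal ((\<phi> t)\<^sup>2) * indicator {0..1} t \<partial>lborel)"
    unfolding eq by (intro average_square_le) auto
  also have "\<dots> \<le> (\<integral>\<^sup>+t. ennreal ((norm k)\<^sup>2) *
      (ennreal ((norm (g (y + t *\<^sub>R k)))\<^sup>2) * indicator {0..1} t) \<partial>lborel)"
  proof (rule nn_integral_mono)
    fix t
    have "(\<phi> t)\<^sup>2 \<le> (norm k)\<^sup>2 * (norm (g (y + t *\<^sub>R k)))\<^sup>2"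
      unfolding \<phi>_def using Cauchy_Schwarz_ineq2[of k "g (y + t *\<^sub>R k)"]
      by (metis abs_ge_zero power2_abs power_mono power_mult_distrib)
    then have "ennreal ((\<phi> t)\<^sup>2) \<le> ennreal ((norm k)\<^sup>2) * ennreal ((norm (g (y + t *\<^sub>R k)))\<^sup>2)"
      by (simp add: ennreal_mult'[symmetric])
    then show "ennreal ((\<phi> t)\<^sup>2) * indicator {0..1} t \<le> ennreal ((norm k)\<^sup>2) *
      (ennreal ((norm (g (y + t *\<^sub>R k)))\<^sup>2) * indicator {0..1} t)"
      by (auto simp: indicator_def)
  qed
  also have "\<dots> = ennreal ((norm k)\<^sup>2) *
      (\<integral>\<^sup>+t. ennreal ((norm (g (y + t *\<^sub>R k)))\<^sup>2) * indicator {0..1} t \<partial>lborel)"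
    by (intro nn_integral_cmult) measurable
  finally show ?thesis .
qed

text \<open>Extended nonnegative values let Tonelli and monotonicity be applied before any
  integrability is known.\<close>

abbreviation energy :: "('a::euclidean_space \<Rightarrow> 'b::real_normed_vector) \<Rightarrow> ennreal" where
  "energy f \<equiv> \<integral>\<^sup>+x. ennreal ((norm (f x))\<^sup>2) \<partial>lborel"

text \<open>After integrating the increment bound over \<open>x\<close> and exchanging the
  integrals, the inner integral is \<open>energy g\<close> for every fixed \<open>t\<close> by
  translation invariance.\<close>

lemma translation_estimate:
  fixes f :: "'a::euclidean_space \<Rightarrow> real"
  assumes D: "\<And>x. GDERIV f x :> g x" and g: "continuous_on UNIV g"
  shows "(\<integral>\<^sup>+x. ennreal ((f (x + k) - f x)\<^sup>2) \<partial>lborel) \<le> ennreal ((norm k)\<^sup>2) * energy g"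
proof -
  have [measurable]: "g \<in> borel_measurable borel"
    by (rule borel_measurable_continuous_onI[OF g])
  have "(\<integral>\<^sup>+x. ennreal ((f (x + k) - f x)\<^sup>2) \<partial>lborel) \<le>
    (\<integral>\<^sup>+x. ennreal ((norm k)\<^sup>2) *
      (\<integral>\<^sup>+t. ennreal ((norm (g (x + t *\<^sub>R k)))\<^sup>2) * indicator {0..1::real} t \<partial>lborel) \<partial>lborel)"
    by (intro nn_integral_mono square_increment_le[OF D g])
  also have "\<dots> = ennreal ((norm k)\<^sup>2) * (\<integral>\<^sup>+x.
      (\<integral>\<^sup>+t. ennreal ((norm (g (x + t *\<^sub>R k)))\<^sup>2) * indicator {0..1::real} t \<partial>lborel) \<partial>lborel)"
    by (intro nn_integral_cmult) measurable
  also have "(\<integral>\<^sup>+x. (\<integral>\<^sup>+t. ennreal ((norm (g (x + t *\<^sub>R k)))\<^sup>2) * indicator {0..1::real} t \<partial>lborel) \<partial>lborel)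
    = (\<integral>\<^sup>+t. (\<integral>\<^sup>+x. ennreal ((norm (g (x + t *\<^sub>R k)))\<^sup>2) * indicator {0..1::real} t \<partial>lborel) \<partial>lborel)"
    by (rule lborel_pair.Fubini') measurable
  also have "\<dots> = (\<integral>\<^sup>+t. energy g * indicator {0..1::real} t \<partial>lborel)"
    using nn_integral_translate[of "\<lambda>x. ennreal ((norm (g x))\<^sup>2)"]
    by (intro nn_integral_cong) (simp add: nn_integral_multc)
  also have "\<dots> = energy g" by (simp add: nn_integral_cmult_indicator)
  finally show ?thesis .
qed

text \<open>A translation by \<open>2 R\<close> moves the support off itself, so the squared L2 norm
  of the difference is the sum of two copies of the energy. The translation estimate bounds this sum
  with the constant \<open>(2 R)^2\<close>.\<close>

lemma poincare_smooth:
  fixes f :: "'a::euclidean_space \<Rightarrow> real"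
  assumes D: "\<And>x. GDERIV f x :> g x" and g: "continuous_on UNIV g"
    and R: "\<And>x. f x \<noteq> 0 \<Longrightarrow> norm x < R" "R > 0"
  shows "energy f \<le> ennreal (4 * R\<^sup>2) * energy g"
proof -
  obtain b :: 'a where b: "b \<in> Basis" using nonempty_Basis by blast
  define k where "k = (2 * R) *\<^sub>R b"
  have nk: "norm k = 2 * R" using b R by (simp add: k_def)
  have cf: "continuous_on UNIV f" using D by (rule GDERIV_continuous)
  have [measurable]: "f \<in> borel_measurable borel"
    by (rule borel_measurable_continuous_onI[OF cf])
  have disj: "f x = 0 \<or> f (x + k) = 0" for x
  proof (rule ccontr)
    assume "\<not> (f x = 0 \<or> f (x + k) = 0)"
    then have "norm x < R" "norm (x + k) < R" using R by auto
    moreover have "norm k \<le> norm (x + k) + norm x"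
      using norm_triangle_ineq4[of "x + k" x] by simp
    ultimately show False using nk by simp
  qed
  have "energy f \<le> energy f + (\<integral>\<^sup>+x. ennreal ((norm (f (x + k)))\<^sup>2) \<partial>lborel)" by simp
  also have "\<dots> = (\<integral>\<^sup>+x. ennreal ((norm (f x))\<^sup>2) + ennreal ((norm (f (x + k)))\<^sup>2) \<partial>lborel)"
    by (rule nn_integral_add[symmetric]) measurable
  also have "\<dots> = (\<integral>\<^sup>+x. ennreal ((f (x + k) - f x)\<^sup>2) \<partial>lborel)"
  proof (rule nn_integral_cong)
    show "ennreal ((norm (f x))\<^sup>2) + ennreal ((norm (f (x + k)))\<^sup>2) = ennreal ((f (x + k) - f x)\<^sup>2)" for x
      using disj[of x] by auto
  qed
  also have "\<dots> \<le> ennreal ((norm k)\<^sup>2) * energy g" by (rule translation_estimate[OF D g])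
  finally show ?thesis by (simp add: nk power_mult_distrib)
qed

section \<open>Averages over the cube with corner \<open>x\<close> and side \<open>r\<close>\<close>

definition box_average :: "real \<Rightarrow> ('a::euclidean_space \<Rightarrow> real) \<Rightarrow> 'a \<Rightarrow> real" where
  "box_average r u x = (\<integral>z. indicator (cbox 0 One) z * u (x + r *\<^sub>R z) \<partial>lborel)"

lemma emeasure_unit_cube: "emeasure lborel (cbox 0 One :: 'a::euclidean_space set) = 1"
  by (simp add: emeasure_lborel_cbox_eq)

lemma box_average_integrable:
  fixes u :: "'a::euclidean_space \<Rightarrow> real"
  assumes "continuous_on UNIV u"
  shows "integrable lborel (\<lambda>z. indicator (cbox 0 One) z * u (x + r *\<^sub>R z))"
proof -
  have "continuous_on (cbox 0 One) (\<lambda>z. u (x + r *\<^sub>R z))"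
    by (rule continuous_on_compose2[OF assms]) (auto intro!: continuous_intros)
  from borel_integrable_compact[OF compact_cbox this] show ?thesis by simp
qed

text \<open>Both cubes are parametrized by the same \<open>z\<close>, so a difference of averages is
  an average of differences. Changes of scale and of position are thereby reduced to increments of
  \<open>u\<close>.\<close>

lemma box_average_diff_square_le:
  fixes u :: "'a::euclidean_space \<Rightarrow> real"
  assumes u: "continuous_on UNIV u"
  shows "ennreal ((box_average r u x - box_average s u y)\<^sup>2)
    \<le> (\<integral>\<^sup>+z. ennreal ((u (x + r *\<^sub>R z) - u (y + s *\<^sub>R z))\<^sup>2) * indicator (cbox 0 One) z \<partial>lborel)"
proof -
  note i = box_average_integrable[OF u]
  have "box_average r u x - box_average s u y =
     (\<integral>z. indicator (cbox 0 One) z * (u (x + r *\<^sub>R z) - u (y + s *\<^sub>R z)) \<partial>lborel)"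
    unfolding box_average_def
    by (subst Bochner_Integration.integral_diff[symmetric]) (simp_all only: i right_diff_distrib)
  also have "ennreal (\<dots>\<^sup>2) \<le> (\<integral>\<^sup>+z. ennreal ((u (x + r *\<^sub>R z) - u (y + s *\<^sub>R z))\<^sup>2) *
      indicator (cbox 0 One) z \<partial>lborel)"
    using Bochner_Integration.integrable_diff[OF i i, of x r y s]
    by (intro average_square_le) (auto simp: emeasure_unit_cube algebra_simps)
  finally show ?thesis .
qed

lemma box_average_square_le:
  fixes u :: "'a::euclidean_space \<Rightarrow> real"
  assumes u: "continuous_on UNIV u"
  shows "ennreal ((box_average r u x)\<^sup>2)
    \<le> (\<integral>\<^sup>+z. ennreal ((u (x + r *\<^sub>R z))\<^sup>2) * indicator (cbox 0 One) z \<partial>lborel)"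
  unfolding box_average_def
  by (intro average_square_le box_average_integrable u) (auto simp: emeasure_unit_cube)

lemma nn_integral_cube_le:
  fixes f :: "'a::euclidean_space \<Rightarrow> ennreal"
  assumes [measurable]: "f \<in> borel_measurable borel" and c: "c > 0"
  shows "(\<integral>\<^sup>+z. f (x + c *\<^sub>R z) * indicator (cbox 0 One) z \<partial>lborel)
     \<le> ennreal (1 / c ^ DIM('a)) * (\<integral>\<^sup>+y. f y \<partial>lborel)"
proof -
  have "(\<integral>\<^sup>+z. f (x + c *\<^sub>R z) * indicator (cbox 0 One) z \<partial>lborel) \<le> (\<integral>\<^sup>+z. f (x + c *\<^sub>R z) \<partial>lborel)"
    by (intro nn_integral_mono) (auto simp: indicator_def)
  also have "\<dots> = ennreal (1 / c ^ DIM('a)) * (\<integral>\<^sup>+y. f y \<partial>lborel)"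
    by (rule nn_integral_affine[OF assms])
  finally show ?thesis .
qed

lemma box_average_bound:
  fixes u :: "'a::euclidean_space \<Rightarrow> real"
  assumes u: "continuous_on UNIV u" and r: "r > 0"
  shows "ennreal ((box_average r u x)\<^sup>2) \<le> ennreal (1 / r ^ DIM('a)) * energy u"
proof -
  have [measurable]: "u \<in> borel_measurable borel"
    by (rule borel_measurable_continuous_onI[OF u])
  show ?thesis
    using order_trans[OF box_average_square_le[OF u] nn_integral_cube_le[of "\<lambda>y. ennreal ((u y)\<^sup>2)" r x]] r
    by simp
qed

text \<open>The translation estimate for the shift \<open>x - y\<close>, after rescaling the cube.
  With \<open>r\<close> fixed, this is the equicontinuity that Arzela-Ascoli needs.\<close>

lemma box_average_Lipschitz:
  fixes u :: "'a::euclidean_space \<Rightarrow> real"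
  assumes D: "\<And>x. GDERIV u x :> g x" and g: "continuous_on UNIV g" and r: "r > 0"
  shows "ennreal ((box_average r u x - box_average r u y)\<^sup>2) \<le>
    ennreal (1 / r ^ DIM('a)) * (ennreal ((norm (x - y))\<^sup>2) * energy g)"
proof -
  have u: "continuous_on UNIV u" using D by (rule GDERIV_continuous)
  have [measurable]: "u \<in> borel_measurable borel"
    by (rule borel_measurable_continuous_onI[OF u])
  have "ennreal ((box_average r u x - box_average r u y)\<^sup>2)
    \<le> (\<integral>\<^sup>+z. ennreal ((u (y + r *\<^sub>R z + (x - y)) - u (y + r *\<^sub>R z))\<^sup>2) * indicator (cbox 0 One) z \<partial>lborel)"
    using box_average_diff_square_le[OF u, of r x r y] by (simp add: algebra_simps)
  also have "\<dots> \<le> ennreal (1 / r ^ DIM('a)) * (\<integral>\<^sup>+y'. ennreal ((u (y' + (x - y)) - u y')\<^sup>2) \<partial>lborel)"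
    by (rule nn_integral_cube_le) (use r in auto)
  also have "\<dots> \<le> ennreal (1 / r ^ DIM('a)) * (ennreal ((norm (x - y))\<^sup>2) * energy g)"
    by (intro mult_left_mono translation_estimate D g) auto
  finally show ?thesis .
qed

lemma norm_unit_cube_le:
  fixes z :: "'a::euclidean_space"
  assumes "z \<in> cbox 0 One"
  shows "(norm z)\<^sup>2 \<le> DIM('a)"
proof -
  have "(norm z)\<^sup>2 = (\<Sum>b\<in>Basis. (z \<bullet> b)\<^sup>2)"
    by (simp only: power2_norm_eq_inner euclidean_inner[of z z] power2_eq_square[symmetric])
  also have "\<dots> \<le> (\<Sum>b\<in>(Basis::'a set). 1)"
    using assms by (intro sum_mono) (auto simp: mem_box power_le_one)
  finally show ?thesis by simp
qed

text \<open>The point moves along the segment from \<open>x + (r/2) z\<close> to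
  \<open>x + r z\<close>, of squared length at most \<open>3 r^2 / 4\<close>. For fixed
  \<open>t\<close> it is \<open>x + (r (1 + t) / 2) z\<close>, and since this scale is at least
  \<open>r/2\<close> the change of variables costs at most \<open>8 / r^3\<close>. The product of
  the two constants is \<open>6 / r\<close>.\<close>

lemma box_average_half_sup:
  fixes u :: "'a::euclidean_space \<Rightarrow> real"
  assumes D: "\<And>x. GDERIV u x :> g x" and g: "continuous_on UNIV g" and r: "r > 0"
    and d3: "DIM('a) = 3"
  shows "ennreal ((box_average r u x - box_average (r/2) u x)\<^sup>2) \<le> ennreal (6 / r) * energy g"
proof -
  have u: "continuous_on UNIV u" using D by (rule GDERIV_continuous)
  have [measurable]: "g \<in> borel_measurable borel" "u \<in> borel_measurable borel"
    by (rule borel_measurable_continuous_onI, rule g u)+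
  let ?Q = "cbox 0 One :: 'a set"
  let ?c = "ennreal (3 * r\<^sup>2 / 4)"
  let ?p = "\<lambda>t z. x + (r * (1 + t) / 2) *\<^sub>R z"
  have "ennreal ((box_average r u x - box_average (r/2) u x)\<^sup>2) \<le>
     (\<integral>\<^sup>+z. ennreal ((u (x + r *\<^sub>R z) - u (x + (r/2) *\<^sub>R z))\<^sup>2) * indicator ?Q z \<partial>lborel)"
    by (rule box_average_diff_square_le[OF u])
  also have "\<dots> \<le> (\<integral>\<^sup>+z. ?c * ((\<integral>\<^sup>+t. ennreal ((norm (g (?p t z)))\<^sup>2) *
      indicator {0..1::real} t * indicator ?Q z \<partial>lborel)) \<partial>lborel)"
  proof (rule nn_integral_mono)
    fix z
    have eq: "x + (r/2) *\<^sub>R z + t *\<^sub>R (r/2) *\<^sub>R z = ?p t z" for t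
      by (simp add: algebra_simps add_divide_distrib)
    have eq1: "x + (r/2) *\<^sub>R z + (r/2) *\<^sub>R z = x + r *\<^sub>R z"
      by (metis (no_types) add.assoc field_sum_of_halves scaleR_add_left)
    have *: "ennreal ((u (x + r *\<^sub>R z) - u (x + (r/2) *\<^sub>R z))\<^sup>2) \<le> ennreal ((norm ((r/2) *\<^sub>R z))\<^sup>2) *
       (\<integral>\<^sup>+t. ennreal ((norm (g (?p t z)))\<^sup>2) * indicator {0..1::real} t \<partial>lborel)"
      using square_increment_le[OF D g, of "x + (r/2) *\<^sub>R z" "(r/2) *\<^sub>R z"] unfolding eq eq1 .
    show "ennreal ((u (x + r *\<^sub>R z) - u (x + (r/2) *\<^sub>R z))\<^sup>2) * indicator ?Q z \<le>
      ?c * (\<integral>\<^sup>+t. ennreal ((norm (g (?p t z)))\<^sup>2) * indicator {0..1::real} t * indicator ?Q z \<partial>lborel)"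
    proof (cases "z \<in> ?Q")
      case True
      have "(norm ((r/2) *\<^sub>R z))\<^sup>2 = (r\<^sup>2/4) * (norm z)\<^sup>2"
        by (simp add: power_mult_distrib power_divide)
      also have "\<dots> \<le> (r\<^sup>2/4) * 3"
        using norm_unit_cube_le[OF True] d3 by (intro mult_left_mono) auto
      finally have "ennreal ((norm ((r/2) *\<^sub>R z))\<^sup>2) \<le> ?c"
        by (intro ennreal_leI) simp
      with * have "ennreal ((u (x + r *\<^sub>R z) - u (x + (r/2) *\<^sub>R z))\<^sup>2) \<le> ?c *
       (\<integral>\<^sup>+t. ennreal ((norm (g (?p t z)))\<^sup>2) * indicator {0..1::real} t \<partial>lborel)"
        by (meson mult_right_mono order_trans zero_le)
      with True show ?thesis by simp
    qed simp
  qed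
  also have "\<dots> = ?c * (\<integral>\<^sup>+z. (\<integral>\<^sup>+t. ennreal ((norm (g (?p t z)))\<^sup>2) *
      indicator {0..1::real} t * indicator ?Q z \<partial>lborel) \<partial>lborel)"
    by (intro nn_integral_cmult) measurable
  also have "(\<integral>\<^sup>+z. (\<integral>\<^sup>+t. ennreal ((norm (g (?p t z)))\<^sup>2) *
      indicator {0..1::real} t * indicator ?Q z \<partial>lborel) \<partial>lborel) =
     (\<integral>\<^sup>+t. (\<integral>\<^sup>+z. ennreal ((norm (g (?p t z)))\<^sup>2) *
      indicator {0..1::real} t * indicator ?Q z \<partial>lborel) \<partial>lborel)"
    by (rule lborel_pair.Fubini') measurable
  also have "\<dots> \<le> (\<integral>\<^sup>+t. ennreal (8 / r ^ 3) * energy g * indicator {0..1::real} t \<partial>lborel)"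
  proof (rule nn_integral_mono)
    fix t :: real
    show "(\<integral>\<^sup>+z. ennreal ((norm (g (?p t z)))\<^sup>2) * indicator {0..1::real} t * indicator ?Q z \<partial>lborel)
      \<le> ennreal (8 / r ^ 3) * energy g * indicator {0..1::real} t"
    proof (cases "t \<in> {0..1}")
      case True
      have pos: "r * (1 + t) / 2 > 0" using r True by auto
      have "(\<integral>\<^sup>+z. ennreal ((norm (g (?p t z)))\<^sup>2) * indicator ?Q z \<partial>lborel) \<le>
        ennreal (1 / (r * (1 + t) / 2) ^ DIM('a)) * energy g"
        by (rule nn_integral_cube_le[OF _ pos]) measurable
      also have "\<dots> \<le> ennreal (8 / r ^ 3) * energy g"
      proof (intro mult_right_mono ennreal_leI)
        have "(r / 2) ^ 3 \<le> (r * (1 + t) / 2) ^ 3"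
          using r True by (intro power_mono) (auto simp: field_simps)
        then have "1 / (r * (1 + t) / 2) ^ 3 \<le> 1 / (r / 2) ^ 3"
          using r by (intro divide_left_mono) (use pos r in auto)
        then show "1 / (r * (1 + t) / 2) ^ DIM('a) \<le> 8 / r ^ 3"
          unfolding d3 by (simp add: power_divide)
      qed auto
      finally show ?thesis using True by simp
    qed simp
  qed
  also have "\<dots> = ennreal (8 / r ^ 3) * energy g"
    by (simp add: nn_integral_cmult_indicator)
  finally have "ennreal ((box_average r u x - box_average (r/2) u x)\<^sup>2) \<le>
      ?c * ennreal (8 / r ^ 3) * energy g"
    by (simp add: mult_left_mono mult.assoc)
  also have "?c * ennreal (8 / r ^ 3) = ennreal (6 / r)"
    using r by (subst ennreal_mult'[symmetric]) (auto simp: field_simps power2_eq_square power3_eq_cube)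
  finally show ?thesis .
qed

lemma box_average_measurable [measurable]:
  assumes "continuous_on UNIV u"
  shows "box_average r u \<in> borel_measurable borel"
proof -
  have [measurable]: "u \<in> borel_measurable borel"
    by (rule borel_measurable_continuous_onI[OF assms])
  show ?thesis unfolding box_average_def by measurable
qed

text \<open>Integrating over \<open>x\<close> first turns the inner integral into the translation
  estimate for the shift \<open>(r/2) z\<close>, whose squared length is at most
  \<open>3 r^2 / 4\<close>.\<close>

lemma box_average_half_L2:
  fixes u :: "'a::euclidean_space \<Rightarrow> real"
  assumes D: "\<And>x. GDERIV u x :> g x" and g: "continuous_on UNIV g" and r: "r > 0"
    and d3: "DIM('a) = 3"
  shows "(\<integral>\<^sup>+x. ennreal ((box_average r u x - box_average (r/2) u x)\<^sup>2) \<partial>lborel)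
    \<le> ennreal (3 * r\<^sup>2 / 4) * energy g"
proof -
  have u: "continuous_on UNIV u" using D by (rule GDERIV_continuous)
  have [measurable]: "g \<in> borel_measurable borel" "u \<in> borel_measurable borel"
    by (rule borel_measurable_continuous_onI, rule g u)+
  let ?Q = "cbox 0 One :: 'a set"
  have "(\<integral>\<^sup>+x. ennreal ((box_average r u x - box_average (r/2) u x)\<^sup>2) \<partial>lborel) \<le>
     (\<integral>\<^sup>+x. (\<integral>\<^sup>+z. ennreal ((u (x + r *\<^sub>R z) - u (x + (r/2) *\<^sub>R z))\<^sup>2) * indicator ?Q z \<partial>lborel) \<partial>lborel)"
    by (intro nn_integral_mono box_average_diff_square_le[OF u])
  also have "\<dots> = (\<integral>\<^sup>+z. (\<integral>\<^sup>+x. ennreal ((u (x + r *\<^sub>R z) - u (x + (r/2) *\<^sub>R z))\<^sup>2) * indicator ?Q z \<partial>lborel) \<partial>lborel)"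
    by (rule lborel_pair.Fubini') measurable
  also have "\<dots> \<le> (\<integral>\<^sup>+z. ennreal (3 * r\<^sup>2 / 4) * energy g * indicator ?Q z \<partial>lborel)"
  proof (rule nn_integral_mono)
    fix z
    show "(\<integral>\<^sup>+x. ennreal ((u (x + r *\<^sub>R z) - u (x + (r/2) *\<^sub>R z))\<^sup>2) * indicator ?Q z \<partial>lborel)
      \<le> ennreal (3 * r\<^sup>2 / 4) * energy g * indicator ?Q z"
    proof (cases "z \<in> ?Q")
      case True
      have eq: "x + r *\<^sub>R z = x + (r/2) *\<^sub>R z + (r/2) *\<^sub>R z" for x
        by (metis (no_types) add.assoc field_sum_of_halves scaleR_add_left)
      have "(\<integral>\<^sup>+x. ennreal ((u (x + r *\<^sub>R z) - u (x + (r/2) *\<^sub>R z))\<^sup>2) \<partial>lborel) =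
         (\<integral>\<^sup>+x. ennreal ((u (x + (r/2) *\<^sub>R z) - u x)\<^sup>2) \<partial>lborel)"
        unfolding eq
        by (rule nn_integral_translate[of "\<lambda>x. ennreal ((u (x + (r/2) *\<^sub>R z) - u x)\<^sup>2)"]) measurable
      also have "\<dots> \<le> ennreal ((norm ((r/2) *\<^sub>R z))\<^sup>2) * energy g"
        by (rule translation_estimate[OF D g])
      also have "\<dots> \<le> ennreal (3 * r\<^sup>2 / 4) * energy g"
      proof (intro mult_right_mono ennreal_leI)
        have "(norm ((r/2) *\<^sub>R z))\<^sup>2 = (r\<^sup>2/4) * (norm z)\<^sup>2"
          by (simp add: power_mult_distrib power_divide)
        also have "\<dots> \<le> (r\<^sup>2/4) * 3"
          using norm_unit_cube_le[OF True] d3 by (intro mult_left_mono) auto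
        finally show "(norm ((r/2) *\<^sub>R z))\<^sup>2 \<le> 3 * r\<^sup>2 / 4" by simp
      qed simp
      finally show ?thesis using True by simp
    qed simp
  qed
  also have "\<dots> = ennreal (3 * r\<^sup>2 / 4) * energy g"
    by (simp add: nn_integral_cmult_indicator emeasure_unit_cube)
  finally show ?thesis .
qed

subsection \<open>The embedding into \<open>L\<^sup>4\<close> and its compactness\<close>

text \<open>Convexity at the points \<open>x/A\<close> and \<open>y/B\<close> with weights
  proportional to \<open>A\<close> and \<open>B\<close>. These weights are the ones for which
  integration yields Minkowski's inequality when \<open>A\<close> and \<open>B\<close> bound the two
  L4 norms.\<close>

lemma fourth_power_convex:
  fixes x y A B :: real
  assumes "A > 0" "B > 0"
  shows "(x + y) ^ 4 \<le> (A + B) ^ 3 * (x ^ 4 / A ^ 3 + y ^ 4 / B ^ 3)"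
proof -
  have c: "convex_on UNIV (\<lambda>x::real. x ^ 4)" by (rule convex_power_even) auto
  have "((A / (A + B)) *\<^sub>R (x / A) + (B / (A + B)) *\<^sub>R (y / B)) ^ 4 \<le>
    A / (A + B) * (x / A) ^ 4 + B / (A + B) * (y / B) ^ 4"
    using convex_onD[OF c, of "B / (A + B)" "x / A" "y / B"] assms
    by (simp add: field_simps)
  moreover have "(A / (A + B)) *\<^sub>R (x / A) + (B / (A + B)) *\<^sub>R (y / B) = (x + y) / (A + B)"
    using assms by (simp add: add_divide_distrib)
  ultimately have "((x + y) / (A + B)) ^ 4 \<le> A / (A + B) * (x / A) ^ 4 + B / (A + B) * (y / B) ^ 4"
    by simp
  then have "(A + B) ^ 4 * ((x + y) / (A + B)) ^ 4 \<le>
      (A + B) ^ 4 * (A / (A + B) * (x / A) ^ 4 + B / (A + B) * (y / B) ^ 4)"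
    using assms by (intro mult_left_mono) auto
  moreover have "(A + B) ^ 4 * ((x + y) / (A + B)) ^ 4 = (x + y) ^ 4"
    using assms by (simp add: power_divide)
  moreover have "A * (x / A) ^ 4 = x ^ 4 / A ^ 3" "B * (y / B) ^ 4 = y ^ 4 / B ^ 3"
    using assms by (simp_all add: power_divide power4_eq_xxxx power3_eq_cube)
  then have "(A + B) ^ 4 * (A / (A + B) * (x / A) ^ 4 + B / (A + B) * (y / B) ^ 4)
     = (A + B) ^ 4 / (A + B) * (x ^ 4 / A ^ 3 + y ^ 4 / B ^ 3)"
    by (metis (no_types, opaque_lifting) add_divide_distrib times_divide_eq_left times_divide_eq_right)
  moreover have "(A + B) ^ 4 / (A + B) = (A + B) ^ 3"
    using assms by (simp add: power4_eq_xxxx power3_eq_cube)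
  ultimately show ?thesis by simp
qed

lemma Minkowski_fourth_power:
  fixes f g :: "'a \<Rightarrow> real"
  assumes [measurable]: "f \<in> borel_measurable M" "g \<in> borel_measurable M"
    and A: "A > 0" and B: "B > 0"
    and f: "(\<integral>\<^sup>+x. ennreal ((f x) ^ 4) \<partial>M) \<le> ennreal (A ^ 4)"
    and g: "(\<integral>\<^sup>+x. ennreal ((g x) ^ 4) \<partial>M) \<le> ennreal (B ^ 4)"
  shows "(\<integral>\<^sup>+x. ennreal ((f x + g x) ^ 4) \<partial>M) \<le> ennreal ((A + B) ^ 4)"
proof -
  let ?a = "(A + B) ^ 3 / A ^ 3" and ?b = "(A + B) ^ 3 / B ^ 3"
  have nn: "?a \<ge> 0" "?b \<ge> 0" using A B by auto
  have "(\<integral>\<^sup>+x. ennreal ((f x + g x) ^ 4) \<partial>M) \<le>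
    (\<integral>\<^sup>+x. ennreal ?a * ennreal ((f x) ^ 4) + ennreal ?b * ennreal ((g x) ^ 4) \<partial>M)"
  proof (rule nn_integral_mono)
    fix x
    have "(f x + g x) ^ 4 \<le> ?a * (f x) ^ 4 + ?b * (g x) ^ 4"
      using fourth_power_convex[OF A B, of "f x" "g x"] by (simp add: algebra_simps)
    then show "ennreal ((f x + g x) ^ 4) \<le> ennreal ?a * ennreal ((f x) ^ 4) + ennreal ?b * ennreal ((g x) ^ 4)"
      unfolding ennreal_mult'[OF nn(1), symmetric] ennreal_mult'[OF nn(2), symmetric]
      by (subst ennreal_plus[symmetric]) (use A B in \<open>auto intro!: ennreal_leI simp del: ennreal_plus\<close>)
  qed
  also have "\<dots> = ennreal ?a * (\<integral>\<^sup>+x. ennreal ((f x) ^ 4) \<partial>M) + ennreal ?b * (\<integral>\<^sup>+x. ennreal ((g x) ^ 4) \<partial>M)"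
    by (simp add: nn_integral_add nn_integral_cmult)
  also have "\<dots> \<le> ennreal ?a * ennreal (A ^ 4) + ennreal ?b * ennreal (B ^ 4)"
    by (intro add_mono mult_left_mono f g) auto
  also have "\<dots> = ennreal (?a * A ^ 4 + ?b * B ^ 4)"
    using nn A B by (simp add: ennreal_mult'[symmetric] ennreal_plus[symmetric] del: ennreal_plus)
  also have "?a * A ^ 4 + ?b * B ^ 4 = (A + B) ^ 4"
    using A B by (simp add: power4_eq_xxxx power3_eq_cube field_simps)
  finally show ?thesis .
qed

section \<open>Telescoping over dyadic scales in L4\<close>

abbreviation dyadic_average :: "nat \<Rightarrow> ('a::euclidean_space \<Rightarrow> real) \<Rightarrow> 'a \<Rightarrow> real" where
  "dyadic_average k \<equiv> box_average ((1/2) ^ k)"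

text \<open>The ratio by which the L4 norms of successive dyadic increments decay: the fourth power
  of such a norm is of the order of the scale, which is halved each time.\<close>

definition \<theta> :: real where "\<theta> = root 4 (1/2)"

lemma \<theta>: "0 < \<theta>" "\<theta> < 1" "\<theta> ^ 4 = 1/2"
  by (simp_all add: \<theta>_def)

text \<open>Reading a point value as the average of scale 0 lets
  \<open>box_average_diff_square_le\<close> compare \<open>u\<close> with its own averages.\<close>

lemma box_average_zero: "box_average 0 u x = u x"
  by (simp add: box_average_def measure_def emeasure_unit_cube)

lemma dyadic_average_tendsto:
  fixes u :: "'a::euclidean_space \<Rightarrow> real"
  assumes u: "continuous_on UNIV u"
  shows "(\<lambda>k. dyadic_average k u x) \<longlonglongrightarrow> u x"
proof (rule LIMSEQ_I)
  fix e :: real assume e: "e > 0"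
  have "isCont u x" using u by (simp add: continuous_on_eq_continuous_at)
  then obtain d where d: "d > 0" "\<And>y. norm (y - x) < d \<Longrightarrow> \<bar>u y - u x\<bar> < e/2"
    using e unfolding continuous_at_eps_delta
    by (metis dist_norm half_gt_zero real_norm_def)
  let ?n = "sqrt DIM('a) + 1"
  have "(\<lambda>k. (1/2) ^ k * ?n) \<longlonglongrightarrow> 0 * ?n"
    by (intro tendsto_intros) auto
  then obtain N where N: "\<And>k. k \<ge> N \<Longrightarrow> (1/2) ^ k * ?n < d"
    using order_tendstoD(2)[of "\<lambda>k. (1/2) ^ k * ?n" "0" sequentially d] d(1)
    by (auto simp: eventually_sequentially)
  show "\<exists>N. \<forall>n\<ge>N. norm (dyadic_average n u x - u x) < e"
  proof (intro exI[of _ N] allI impI)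
    fix k assume k: "k \<ge> N"
    have "ennreal ((dyadic_average k u x - box_average 0 u x)\<^sup>2) \<le>
       (\<integral>\<^sup>+z. ennreal ((u (x + (1/2) ^ k *\<^sub>R z) - u (x + 0 *\<^sub>R z))\<^sup>2) * indicator (cbox 0 One) z \<partial>lborel)"
      by (rule box_average_diff_square_le[OF u])
    also have "\<dots> \<le> (\<integral>\<^sup>+z. ennreal ((e/2)\<^sup>2) * indicator (cbox 0 One) (z::'a) \<partial>lborel)"
    proof (rule nn_integral_mono)
      fix z :: 'a
      show "ennreal ((u (x + (1/2) ^ k *\<^sub>R z) - u (x + 0 *\<^sub>R z))\<^sup>2) * indicator (cbox 0 One) z \<le>
        ennreal ((e/2)\<^sup>2) * indicator (cbox 0 One) z"
      proof (cases "z \<in> cbox 0 One")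
        case True
        have "norm z \<le> sqrt DIM('a)"
          using norm_unit_cube_le[OF True] by (simp add: real_le_rsqrt)
        then have "(1/2) ^ k * norm z \<le> (1/2) ^ k * ?n" by (intro mult_left_mono) auto
        then have "(1/2) ^ k * norm z < d" using N[OF k] by (rule le_less_trans)
        then have "norm (x + (1/2) ^ k *\<^sub>R z - x) < d" by simp
        then have "\<bar>u (x + (1/2) ^ k *\<^sub>R z) - u x\<bar> \<le> e/2" using d(2) less_imp_le by blast
        then have "(u (x + (1/2) ^ k *\<^sub>R z) - u x)\<^sup>2 \<le> (e/2)\<^sup>2"
          by (metis abs_ge_zero power2_abs power_mono)
        then show ?thesis using True by (simp add: ennreal_leI)
      qed simp
    qed
    also have "\<dots> = ennreal ((e/2)\<^sup>2)"
      by (simp add: nn_integral_cmult_indicator emeasure_unit_cube)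
    finally have "(dyadic_average k u x - u x)\<^sup>2 \<le> (e/2)\<^sup>2"
      by (simp add: box_average_zero)
    then have "\<bar>dyadic_average k u x - u x\<bar> \<le> e/2"
      using e by (metis abs_le_square_iff abs_of_pos half_gt_zero)
    then show "norm (dyadic_average k u x - u x) < e" using e by simp
  qed
qed

text \<open>One factor \<open>w^2\<close> of \<open>w^4\<close> is bounded by its supremum
  \<open>6 d^2 / r\<close>, the other is integrated to at most \<open>3 r^2 d^2 / 4\<close>. The
  product is \<open>9/2 * r * d^4\<close>, and rounding \<open>9/2\<close> up to 16 leaves the
  fourth power of \<open>2 \<theta>^k d\<close>.\<close>

lemma dyadic_average_step:
  fixes u :: "'a::euclidean_space \<Rightarrow> real"
  assumes D: "\<And>x. GDERIV u x :> g x" and g: "continuous_on UNIV g"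
    and d3: "DIM('a) = 3" and d: "d > 0" "energy g \<le> ennreal (d\<^sup>2)"
  shows "(\<integral>\<^sup>+x. ennreal ((dyadic_average k u x - dyadic_average (Suc k) u x) ^ 4) \<partial>lborel)
    \<le> ennreal ((2 * \<theta> ^ k * d) ^ 4)"
proof -
  have u: "continuous_on UNIV u" using D by (rule GDERIV_continuous)
  note [measurable] = box_average_measurable[OF u]
  define r where "r = (1/2 :: real) ^ k"
  have r: "r > 0" by (simp add: r_def)
  have cc: "ennreal (6 / r) * ennreal (d\<^sup>2) = ennreal (6 / r * d\<^sup>2)"
    using r by (intro ennreal_mult[symmetric]) auto
  let ?w = "\<lambda>x. box_average r u x - box_average (r/2) u x"
  have "(\<integral>\<^sup>+x. ennreal ((?w x) ^ 4) \<partial>lborel) \<le> (\<integral>\<^sup>+x. ennreal (6 / r * d\<^sup>2) * ennreal ((?w x)\<^sup>2) \<partial>lborel)"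
  proof (rule nn_integral_mono)
    fix x
    have "ennreal ((?w x)\<^sup>2) \<le> ennreal (6 / r) * ennreal (d\<^sup>2)"
      by (rule order_trans[OF box_average_half_sup[OF D g r d3]]) (intro mult_left_mono d, simp)
    then have "ennreal ((?w x)\<^sup>2) * ennreal ((?w x)\<^sup>2) \<le> ennreal (6 / r * d\<^sup>2) * ennreal ((?w x)\<^sup>2)"
      unfolding cc by (intro mult_right_mono) auto
    then show "ennreal ((?w x) ^ 4) \<le> ennreal (6 / r * d\<^sup>2) * ennreal ((?w x)\<^sup>2)"
      by (simp add: ennreal_mult'[symmetric] flip: power_add)
  qed
  also have "\<dots> = ennreal (6 / r * d\<^sup>2) * (\<integral>\<^sup>+x. ennreal ((?w x)\<^sup>2) \<partial>lborel)"
    by (intro nn_integral_cmult) measurable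
  also have "\<dots> \<le> ennreal (6 / r * d\<^sup>2) * (ennreal (3 * r\<^sup>2 / 4) * ennreal (d\<^sup>2))"
    by (intro mult_left_mono order_trans[OF box_average_half_L2[OF D g r d3]] d) auto
  also have "\<dots> = ennreal (6 / r * d\<^sup>2 * (3 * r\<^sup>2 / 4 * d\<^sup>2))"
    using r by (simp add: ennreal_mult'[symmetric])
  also have "\<dots> \<le> ennreal ((2 * \<theta> ^ k * d) ^ 4)"
  proof (rule ennreal_leI)
    have "(\<theta> ^ k) ^ 4 = r"
      by (metis \<theta>(3) power_commutes power_mult mult.commute r_def)
    then have "(2 * \<theta> ^ k * d) ^ 4 = 16 * r * d ^ 4" by (simp add: power_mult_distrib)
    moreover have "6 / r * d\<^sup>2 * (3 * r\<^sup>2 / 4 * d\<^sup>2) = 9 / 2 * r * d ^ 4"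
      using r by (simp add: power2_eq_square power4_eq_xxxx)
    moreover have "9 / 2 * r * d ^ 4 \<le> 16 * r * d ^ 4"
      using r by (intro mult_right_mono) auto
    ultimately show "6 / r * d\<^sup>2 * (3 * r\<^sup>2 / 4 * d\<^sup>2) \<le> (2 * \<theta> ^ k * d) ^ 4"
      by (simp only:)
  qed
  finally show ?thesis by (simp add: r_def)
qed

text \<open>The induction keeps \<open>k\<close> arbitrary, because after the first step there
  remains a tail starting at \<open>Suc k\<close>; the geometric sum reproduces the same bound.
  Fatou's lemma then replaces the last average by \<open>u\<close>.\<close>

lemma dyadic_average_tail:
  fixes u :: "'a::euclidean_space \<Rightarrow> real"
  assumes D: "\<And>x. GDERIV u x :> g x" and g: "continuous_on UNIV g"
    and d3: "DIM('a) = 3" and d: "d > 0" "energy g \<le> ennreal (d\<^sup>2)"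
  shows "(\<integral>\<^sup>+x. ennreal ((dyadic_average k u x - u x) ^ 4) \<partial>lborel)
    \<le> ennreal ((2 * \<theta> ^ k * d / (1 - \<theta>)) ^ 4)"
proof -
  have u: "continuous_on UNIV u" using D by (rule GDERIV_continuous)
  note [measurable] = box_average_measurable[OF u]
  have *: "(\<integral>\<^sup>+x. ennreal ((dyadic_average k u x - dyadic_average (k + m) u x) ^ 4) \<partial>lborel)
    \<le> ennreal ((2 * \<theta> ^ k * d / (1 - \<theta>)) ^ 4)" for m
  proof (induction m arbitrary: k)
    case (Suc m)
    let ?f = "\<lambda>x. dyadic_average k u x - dyadic_average (Suc k) u x"
    let ?g = "\<lambda>x. dyadic_average (Suc k) u x - dyadic_average (Suc k + m) u x"
    have "(\<integral>\<^sup>+x. ennreal ((?f x + ?g x) ^ 4) \<partial>lborel) \<le>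
        ennreal ((2 * \<theta> ^ k * d + 2 * \<theta> ^ Suc k * d / (1 - \<theta>)) ^ 4)"
      by (rule Minkowski_fourth_power)
        (use \<theta> d Suc.IH[of "Suc k"] dyadic_average_step[OF D g d3 d] in auto)
    also have "2 * \<theta> ^ k * d + 2 * \<theta> ^ Suc k * d / (1 - \<theta>) = 2 * \<theta> ^ k * d / (1 - \<theta>)"
      using \<theta>(2) by (simp add: field_simps)
    finally show ?case by simp
  qed simp
  have "(\<integral>\<^sup>+x. ennreal ((dyadic_average k u x - u x) ^ 4) \<partial>lborel) =
    (\<integral>\<^sup>+x. liminf (\<lambda>m. ennreal ((dyadic_average k u x - dyadic_average (m + k) u x) ^ 4)) \<partial>lborel)"
  proof (rule nn_integral_cong)
    fix x
    have "(\<lambda>m. ennreal ((dyadic_average k u x - dyadic_average (m + k) u x) ^ 4))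
      \<longlonglongrightarrow> ennreal ((dyadic_average k u x - u x) ^ 4)"
      by (intro tendsto_intros LIMSEQ_ignore_initial_segment[OF dyadic_average_tendsto[OF u]])
    then show "ennreal ((dyadic_average k u x - u x) ^ 4) =
      liminf (\<lambda>m. ennreal ((dyadic_average k u x - dyadic_average (m + k) u x) ^ 4))"
      by (intro lim_imp_Liminf[symmetric]) auto
  qed
  also have "\<dots> \<le> liminf (\<lambda>m. \<integral>\<^sup>+x. ennreal ((dyadic_average k u x - dyadic_average (m + k) u x) ^ 4) \<partial>lborel)"
    by (rule nn_integral_liminf) measurable
  also have "\<dots> \<le> liminf (\<lambda>m. ennreal ((2 * \<theta> ^ k * d / (1 - \<theta>)) ^ 4))"
    by (rule Liminf_mono) (use * in \<open>simp add: add.commute\<close>)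
  also have "\<dots> = ennreal ((2 * \<theta> ^ k * d / (1 - \<theta>)) ^ 4)"
    by (simp add: Liminf_const)
  finally show ?thesis .
qed

text \<open>The function is split into its average of scale 1 and the dyadic tail. The first is
  bounded both in the supremum and in L2 by the Poincare inequality, contributing
  \<open>2 R\<close>; the second contributes the geometric sum. A strict upper bound
  \<open>d\<close> replaces the norm itself because Minkowski is applied with positive
  bounds.\<close>

lemma Sobolev_L4_smooth:
  assumes "R > 0" "DIM('a::euclidean_space) = 3"
  obtains C where "C > 0"
    "\<And>(u :: 'a \<Rightarrow> real) g d. (\<And>x. GDERIV u x :> g x) \<Longrightarrow> continuous_on UNIV g \<Longrightarrow>
       (\<And>x. u x \<noteq> 0 \<Longrightarrow> norm x < R) \<Longrightarrow> d > 0 \<Longrightarrow> energy g \<le> ennreal (d\<^sup>2) \<Longrightarrow>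
       (\<integral>\<^sup>+x. ennreal ((u x) ^ 4) \<partial>lborel) \<le> ennreal (C * d ^ 4)"
proof
  let ?A = "2 * R" and ?B = "2 / (1 - \<theta>)"
  have B: "?B > 0" using \<theta> by simp
  show "(?A + ?B) ^ 4 > 0" using assms(1) B by (intro zero_less_power add_pos_pos) auto
  fix u :: "'a \<Rightarrow> real" and g d
  assume D: "\<And>x. GDERIV u x :> g x" and g: "continuous_on UNIV g"
    and R: "\<And>x. u x \<noteq> 0 \<Longrightarrow> norm x < R" and d: "d > 0" "energy g \<le> ennreal (d\<^sup>2)"
  have u: "continuous_on UNIV u" using D by (rule GDERIV_continuous)
  note [measurable] = box_average_measurable[OF u] borel_measurable_continuous_onI[OF u]
  have eu: "energy u \<le> ennreal (4 * R\<^sup>2 * d\<^sup>2)"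
  proof -
    have "energy u \<le> ennreal (4 * R\<^sup>2) * ennreal (d\<^sup>2)"
      by (rule order_trans[OF poincare_smooth[OF D g R assms(1)]]) (auto intro!: mult_left_mono d)
    then show ?thesis by (simp add: ennreal_mult')
  qed
  let ?v = "dyadic_average 0 u"
  have sup: "ennreal ((?v x)\<^sup>2) \<le> ennreal (4 * R\<^sup>2 * d\<^sup>2)" for x
    using order_trans[OF box_average_bound[OF u zero_less_one, of x] mult_left_mono[OF eu]] by simp
  have "(\<integral>\<^sup>+x. ennreal ((?v x)\<^sup>2) \<partial>lborel) \<le>
    (\<integral>\<^sup>+x. (\<integral>\<^sup>+z. ennreal ((u (x + z))\<^sup>2) * indicator (cbox 0 One) z \<partial>lborel) \<partial>lborel)"
    using box_average_square_le[OF u, of 1] by (intro nn_integral_mono) simp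
  also have "\<dots> = (\<integral>\<^sup>+z. (\<integral>\<^sup>+x. ennreal ((u (x + z))\<^sup>2) * indicator (cbox 0 One) z \<partial>lborel) \<partial>lborel)"
    by (rule lborel_pair.Fubini') measurable
  also have "\<dots> = (\<integral>\<^sup>+z. energy u * indicator (cbox 0 One) (z::'a) \<partial>lborel)"
    using nn_integral_translate[of "\<lambda>x. ennreal ((u x)\<^sup>2)"]
    by (intro nn_integral_cong) (simp add: nn_integral_multc)
  also have "\<dots> = energy u" by (simp add: nn_integral_cmult_indicator emeasure_unit_cube)
  finally have L2: "(\<integral>\<^sup>+x. ennreal ((?v x)\<^sup>2) \<partial>lborel) \<le> ennreal (4 * R\<^sup>2 * d\<^sup>2)"
    using eu by (rule order_trans)
  have "(\<integral>\<^sup>+x. ennreal ((?v x) ^ 4) \<partial>lborel) \<le>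
      (\<integral>\<^sup>+x. ennreal (4 * R\<^sup>2 * d\<^sup>2) * ennreal ((?v x)\<^sup>2) \<partial>lborel)"
  proof (rule nn_integral_mono)
    fix x
    have "ennreal ((?v x)\<^sup>2) * ennreal ((?v x)\<^sup>2) \<le> ennreal (4 * R\<^sup>2 * d\<^sup>2) * ennreal ((?v x)\<^sup>2)"
      by (intro mult_right_mono sup) auto
    then show "ennreal ((?v x) ^ 4) \<le> ennreal (4 * R\<^sup>2 * d\<^sup>2) * ennreal ((?v x)\<^sup>2)"
      by (simp add: ennreal_mult'[symmetric] flip: power_add)
  qed
  also have "\<dots> = ennreal (4 * R\<^sup>2 * d\<^sup>2) * (\<integral>\<^sup>+x. ennreal ((?v x)\<^sup>2) \<partial>lborel)"
    by (intro nn_integral_cmult) measurable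
  also have "\<dots> \<le> ennreal (4 * R\<^sup>2 * d\<^sup>2) * ennreal (4 * R\<^sup>2 * d\<^sup>2)"
    by (intro mult_left_mono L2) auto
  also have "\<dots> = ennreal ((?A * d) ^ 4)"
    using assms(1) by (subst ennreal_mult'[symmetric])
      (auto simp: power4_eq_xxxx power2_eq_square algebra_simps zero_le_mult_iff)
  finally have v4: "(\<integral>\<^sup>+x. ennreal ((- ?v x) ^ 4) \<partial>lborel) \<le> ennreal ((?A * d) ^ 4)" by simp
  have t4: "(\<integral>\<^sup>+x. ennreal ((?v x - u x) ^ 4) \<partial>lborel) \<le> ennreal ((?B * d) ^ 4)"
    using dyadic_average_tail[OF D g assms(2) d, of 0] by simp
  have "(\<integral>\<^sup>+x. ennreal ((- ?v x + (?v x - u x)) ^ 4) \<partial>lborel) \<le> ennreal ((?A * d + ?B * d) ^ 4)"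
    by (rule Minkowski_fourth_power[OF _ _ _ _ v4 t4]) (use assms(1) d B in auto)
  also have "(?A * d + ?B * d) ^ 4 = (?A + ?B) ^ 4 * d ^ 4"
    unfolding distrib_right[symmetric] power_mult_distrib ..
  finally show "(\<integral>\<^sup>+x. ennreal ((u x) ^ 4) \<partial>lborel) \<le> ennreal ((?A + ?B) ^ 4 * d ^ 4)" by simp
qed

text \<open>At each dyadic scale the averages are uniformly bounded and equicontinuous on a ball, so
  Arzela-Ascoli applies; a diagonal subsequence is uniformly Cauchy at all scales. The tails are
  small in L4 uniformly along the sequence, so it suffices to fix one fine scale.\<close>

lemma Rellich_L4_smooth:
  fixes u :: "nat \<Rightarrow> 'a::euclidean_space \<Rightarrow> real"
  assumes D: "\<And>n x. GDERIV (u n) x :> g n x" and g: "\<And>n. continuous_on UNIV (g n)"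
    and R: "\<And>n x. u n x \<noteq> 0 \<Longrightarrow> norm x < R" "R > 0"
    and d: "d > 0" "\<And>n. energy (g n) \<le> ennreal (d\<^sup>2)" and d3: "DIM('a) = 3"
  shows "\<exists>s :: nat \<Rightarrow> nat. strict_mono s \<and>
    (\<forall>e>0. \<exists>N. \<forall>m\<ge>N. \<forall>n\<ge>N. (\<integral>\<^sup>+x. ennreal ((u (s m) x - u (s n) x) ^ 4) \<partial>lborel) \<le> ennreal e)"
proof -
  have u: "continuous_on UNIV (u n)" for n using D by (rule GDERIV_continuous)
  note [measurable] = box_average_measurable[OF u] borel_measurable_continuous_onI[OF u]
  define S where "S = cball (0::'a) R"
  define F where "F k n = dyadic_average k (u n)" for k n
  have [measurable]: "F k n \<in> borel_measurable borel" for k n unfolding F_def by measurable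
  define P where "P k s \<longleftrightarrow> (\<forall>e>0. \<exists>N. \<forall>m\<ge>N. \<forall>n\<ge>N. \<forall>x\<in>S. \<bar>F k (s m) x - F k (s n) x\<bar> < e)"
    for k and s :: "nat \<Rightarrow> nat"
  have eu: "energy (u n) \<le> ennreal (4 * R\<^sup>2 * d\<^sup>2)" for n
  proof -
    have "energy (u n) \<le> ennreal (4 * R\<^sup>2) * ennreal (d\<^sup>2)"
      by (rule order_trans[OF poincare_smooth[OF D g R(1)[of n] R(2)]]) (auto intro!: mult_left_mono d)
    then show ?thesis by (simp add: ennreal_mult')
  qed
  have sub: "\<exists>r. strict_mono r \<and> P k (s \<circ> r)" for k and s :: "nat \<Rightarrow> nat"
  proof -
    define c where "c = sqrt (1 / ((1/2) ^ k) ^ DIM('a))"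
    have c: "c > 0" "c\<^sup>2 = 1 / ((1/2) ^ k) ^ DIM('a)" by (simp_all add: c_def)
    have bd: "norm (F k (s n) x) \<le> c * (2 * R * d)" for n x
    proof -
      have "ennreal ((F k (s n) x)\<^sup>2) \<le> ennreal (c\<^sup>2) * ennreal (4 * R\<^sup>2 * d\<^sup>2)"
        unfolding F_def c(2)
        by (rule order_trans[OF box_average_bound[OF u] mult_left_mono[OF eu]]) auto
      then have "(F k (s n) x)\<^sup>2 \<le> (c * (2 * R * d))\<^sup>2"
        by (simp add: ennreal_mult'[symmetric] power_mult_distrib)
      then show ?thesis using c R d by (simp add: abs_le_square_iff[symmetric])
    qed
    have lip: "norm (F k (s n) x - F k (s n) y) \<le> c * d * norm (x - y)" for n x y
    proof -
      have "ennreal ((F k (s n) x - F k (s n) y)\<^sup>2) \<le>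
          ennreal (c\<^sup>2) * (ennreal ((norm (x - y))\<^sup>2) * ennreal (d\<^sup>2))"
        unfolding F_def c(2)
        by (rule order_trans[OF box_average_Lipschitz[OF D g]]) (auto intro!: mult_left_mono d)
      then have "(F k (s n) x - F k (s n) y)\<^sup>2 \<le> (c * d * norm (x - y))\<^sup>2"
        by (simp add: ennreal_mult'[symmetric] power_mult_distrib mult_ac)
      then show ?thesis using c d by (simp add: abs_le_square_iff[symmetric] abs_mult)
    qed
    obtain h r where r: "strict_mono (r :: nat \<Rightarrow> nat)"
      "\<And>e. 0 < e \<Longrightarrow> \<exists>N. \<forall>n x. n \<ge> N \<and> x \<in> S \<longrightarrow> norm (F k (s (r n)) x - h x) < e"
    proof (rule Arzela_Ascoli[of S "\<lambda>n. F k (s n)" "c * (2 * R * d)"])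
      show "compact S" by (simp add: S_def)
      show "norm (F k (s n) x) \<le> c * (2 * R * d)" for n x by (rule bd)
      fix x e assume "x \<in> S" "(0::real) < e"
      have "c * d > 0" using c d by simp
      show "\<exists>\<delta>>0. \<forall>n y. y \<in> S \<and> norm (x - y) < \<delta> \<longrightarrow> norm (F k (s n) x - F k (s n) y) < e"
      proof (intro exI[of _ "e / (c * d)"] conjI allI impI)
        show "e / (c * d) > 0" using \<open>c * d > 0\<close> \<open>e > 0\<close> by simp
        fix n y assume "y \<in> S \<and> norm (x - y) < e / (c * d)"
        then have "c * d * norm (x - y) < e"
          using \<open>c * d > 0\<close> by (simp add: pos_less_divide_eq mult.commute)
        then show "norm (F k (s n) x - F k (s n) y) < e" using lip[of n x y] by simp
      qed
    qed blast
    have "P k (s \<circ> r)" unfolding P_def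
    proof (intro allI impI)
      fix e :: real assume "e > 0"
      then obtain N where N: "\<And>n x. n \<ge> N \<Longrightarrow> x \<in> S \<Longrightarrow> norm (F k (s (r n)) x - h x) < e/2"
        using r(2)[of "e/2"] by auto
      show "\<exists>N. \<forall>m\<ge>N. \<forall>n\<ge>N. \<forall>x\<in>S. \<bar>F k ((s \<circ> r) m) x - F k ((s \<circ> r) n) x\<bar> < e"
      proof (intro exI[of _ N] allI impI ballI)
        fix m n x assume "m \<ge> N" "n \<ge> N" "x \<in> S"
        then show "\<bar>F k ((s \<circ> r) m) x - F k ((s \<circ> r) n) x\<bar> < e"
          using N[of m x] N[of n x] unfolding real_norm_def o_def by linarith
      qed
    qed
    with r(1) show ?thesis by blast
  qed
  interpret subseqs P by standard (rule sub)
  have stable: "P k (s \<circ> r)" if "strict_mono r" "P k s" for k s and r :: "nat \<Rightarrow> nat"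
    unfolding P_def
  proof (intro allI impI)
    fix e :: real assume "e > 0"
    then obtain N where N: "\<forall>m\<ge>N. \<forall>n\<ge>N. \<forall>x\<in>S. \<bar>F k (s m) x - F k (s n) x\<bar> < e"
      using \<open>P k s\<close> unfolding P_def by blast
    have "r m \<ge> N" if "m \<ge> N" for m
      using seq_suble[OF \<open>strict_mono r\<close>, of m] that by linarith
    then show "\<exists>N. \<forall>m\<ge>N. \<forall>n\<ge>N. \<forall>x\<in>S. \<bar>F k ((s \<circ> r) m) x - F k ((s \<circ> r) n) x\<bar> < e"
      using N by (intro exI[of _ N]) auto
  qed
  define s where "s = diagseq"
  have s: "strict_mono s" unfolding s_def by (rule subseq_diagseq)
  have Ps: "P k s" for k
    unfolding P_def
  proof (intro allI impI)
    fix e :: real assume "e > 0"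
    \<comment> \<open>The diagonal sequence refines the \<open>k\<close>-th chosen subsequence only
      after its first \<open>Suc k\<close> terms, hence the shift, which is undone below by
      enlarging \<open>N\<close>.\<close>
    moreover have "P k (diagseq \<circ> (+) (Suc k))" by (rule diagseq_holds) (rule stable)
    ultimately obtain N where
      N: "\<forall>m\<ge>N. \<forall>n\<ge>N. \<forall>x\<in>S. \<bar>F k (s (Suc k + m)) x - F k (s (Suc k + n)) x\<bar> < e"
      unfolding P_def s_def o_def by blast
    show "\<exists>N. \<forall>m\<ge>N. \<forall>n\<ge>N. \<forall>x\<in>S. \<bar>F k (s m) x - F k (s n) x\<bar> < e"
    proof (intro exI[of _ "N + Suc k"] allI impI ballI)
      fix m n x assume "N + Suc k \<le> m" "N + Suc k \<le> n" "x \<in> S"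
      then show "\<bar>F k (s m) x - F k (s n) x\<bar> < e"
        using N[rule_format, of "m - Suc k" "n - Suc k" x] by simp
    qed
  qed
  have "\<exists>N. \<forall>m\<ge>N. \<forall>n\<ge>N. (\<integral>\<^sup>+x. ennreal ((u (s m) x - u (s n) x) ^ 4) \<partial>lborel) \<le> ennreal e"
    if e: "e > 0" for e
  proof -
    \<comment> \<open>The difference is a sum of three terms, each of L4 norm at most
      \<open>\<eta>\<close>.\<close>
    define \<eta> where "\<eta> = root 4 e / 3"
    have \<eta>: "\<eta> > 0" "(\<eta> + \<eta> + \<eta>) ^ 4 = e" using e by (simp_all add: \<eta>_def)
    define \<mu> where "\<mu> = measure lborel S"
    have \<mu>: "\<mu> \<ge> 0" "emeasure lborel S = ennreal \<mu>"
      using emeasure_bounded_finite[of S]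
      by (auto simp: \<mu>_def S_def intro!: emeasure_eq_ennreal_measure)
    have "(\<lambda>k. 2 * \<theta> ^ k * d / (1 - \<theta>)) \<longlonglongrightarrow> 2 * 0 * d / (1 - \<theta>)"
      using \<theta> by (intro tendsto_intros LIMSEQ_power_zero) auto
    then obtain k where k: "2 * \<theta> ^ k * d / (1 - \<theta>) < \<eta>"
      using order_tendstoD(2)[of "\<lambda>k. 2 * \<theta> ^ k * d / (1 - \<theta>)" 0 sequentially \<eta>] \<eta>(1)
      by (auto simp: eventually_sequentially)
    have kpos: "2 * \<theta> ^ k * d / (1 - \<theta>) > 0" using \<theta> d by simp
    have tail: "(\<integral>\<^sup>+x. ennreal ((indicator S x * (F k n x - u n x)) ^ 4) \<partial>lborel) \<le> ennreal (\<eta> ^ 4)" for n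
    proof -
      have "(\<integral>\<^sup>+x. ennreal ((indicator S x * (F k n x - u n x)) ^ 4) \<partial>lborel) \<le>
         (\<integral>\<^sup>+x. ennreal ((F k n x - u n x) ^ 4) \<partial>lborel)"
        by (intro nn_integral_mono) (auto simp: indicator_def)
      also have "\<dots> \<le> ennreal ((2 * \<theta> ^ k * d / (1 - \<theta>)) ^ 4)"
        unfolding F_def by (rule dyadic_average_tail[OF D g d3 d])
      also have "\<dots> \<le> ennreal (\<eta> ^ 4)"
        using k kpos by (intro ennreal_leI power_mono) auto
      finally show ?thesis .
    qed
    \<comment> \<open>A uniform bound \<open>\<eta> / (1 + \<mu>)\<close> on a set of measure
      \<open>\<mu>\<close> gives L4 norm at most \<open>\<eta>\<close>, since
      \<open>\<mu> \<le> (1 + \<mu>)^4\<close>; the summand 1 also covers a vanishing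
      measure.\<close>
    have "\<eta> / (1 + \<mu>) > 0" using \<eta> \<mu> by simp
    then obtain N where N: "\<forall>m\<ge>N. \<forall>n\<ge>N. \<forall>x\<in>S. \<bar>F k (s m) x - F k (s n) x\<bar> < \<eta> / (1 + \<mu>)"
      using Ps[of k] unfolding P_def by blast
    show ?thesis
    proof (intro exI[of _ N] allI impI)
      fix m n assume mn: "m \<ge> N" "n \<ge> N"
      \<comment> \<open>The functions vanish outside \<open>S\<close> but their averages may not, so
        the decomposition is cut off by the indicator of \<open>S\<close>.\<close>
      let ?f = "\<lambda>x. indicator S x * (F k (s n) x - u (s n) x)"
      let ?g = "\<lambda>x. indicator S x * (F k (s m) x - F k (s n) x)"
      let ?h = "\<lambda>x. - (indicator S x * (F k (s m) x - u (s m) x))"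
      have [measurable]: "S \<in> sets borel" by (simp add: S_def)
      have "(\<integral>\<^sup>+x. ennreal ((?g x) ^ 4) \<partial>lborel) \<le>
          (\<integral>\<^sup>+x. ennreal ((\<eta> / (1 + \<mu>)) ^ 4) * indicator S x \<partial>lborel)"
      proof (rule nn_integral_mono)
        fix x
        show "ennreal ((?g x) ^ 4) \<le> ennreal ((\<eta> / (1 + \<mu>)) ^ 4) * indicator S x"
        proof (cases "x \<in> S")
          case True
          then have "\<bar>F k (s m) x - F k (s n) x\<bar> \<le> \<eta> / (1 + \<mu>)"
            using N mn less_imp_le by blast
          then have "\<bar>F k (s m) x - F k (s n) x\<bar> ^ 4 \<le> (\<eta> / (1 + \<mu>)) ^ 4"
            by (intro power_mono) auto
          then show ?thesis using True by (simp add: ennreal_leI)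
        qed simp
      qed
      also have "\<dots> = ennreal ((\<eta> / (1 + \<mu>)) ^ 4) * ennreal \<mu>"
        by (simp add: nn_integral_cmult_indicator \<mu>(2))
      also have "\<dots> = ennreal (\<eta> ^ 4 * (\<mu> / (1 + \<mu>) ^ 4))"
        using \<mu>(1) \<eta>(1) by (simp add: ennreal_mult'[symmetric] power_divide)
      also have "\<dots> \<le> ennreal (\<eta> ^ 4 * 1)"
      proof (intro ennreal_leI mult_left_mono)
        have "\<mu> \<le> (1 + \<mu>) ^ 1" by simp
        also have "\<dots> \<le> (1 + \<mu>) ^ 4" by (rule power_increasing) (use \<mu> in auto)
        finally show "\<mu> / (1 + \<mu>) ^ 4 \<le> 1" using \<mu>(1) by (simp add: divide_le_eq_1)
      qed simp
      finally have g4: "(\<integral>\<^sup>+x. ennreal ((?g x) ^ 4) \<partial>lborel) \<le> ennreal (\<eta> ^ 4)" by simp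
      have fg4: "(\<integral>\<^sup>+x. ennreal ((?f x + ?g x) ^ 4) \<partial>lborel) \<le> ennreal ((\<eta> + \<eta>) ^ 4)"
        by (rule Minkowski_fourth_power[OF _ _ \<eta>(1) \<eta>(1) tail g4]) measurable
      have h4: "(\<integral>\<^sup>+x. ennreal ((?h x) ^ 4) \<partial>lborel) \<le> ennreal (\<eta> ^ 4)"
        using tail[of "s m"] by simp
      have "(\<integral>\<^sup>+x. ennreal ((?f x + ?g x + ?h x) ^ 4) \<partial>lborel) \<le> ennreal ((\<eta> + \<eta> + \<eta>) ^ 4)"
        by (rule Minkowski_fourth_power[OF _ _ _ _ fg4 h4]) (use \<eta>(1) in \<open>measurable, auto\<close>)
      also have "(\<lambda>x. ?f x + ?g x + ?h x) = (\<lambda>x. u (s m) x - u (s n) x)"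
      proof
        fix x
        have "u j x = 0" if "x \<notin> S" for j
        proof (rule ccontr)
          assume "u j x \<noteq> 0"
          then have "norm x < R" by (rule R)
          with that show False by (simp add: S_def)
        qed
        then show "?f x + ?g x + ?h x = u (s m) x - u (s n) x"
          by (cases "x \<in> S") (auto simp: algebra_simps)
      qed
      finally show "(\<integral>\<^sup>+x. ennreal ((u (s m) x - u (s n) x) ^ 4) \<partial>lborel) \<le> ennreal e"
        unfolding \<eta>(2) .
    qed
  qed
  then show ?thesis using s by (intro exI[of _ s] conjI allI impI)
qed

subsection \<open>Square integrable functions\<close>

lemma square_integrable_inner:
  fixes f g :: "'a \<Rightarrow> 'b::euclidean_space"
  assumes [measurable]: "f \<in> borel_measurable M" "g \<in> borel_measurable M"
    and "integrable M (\<lambda>x. (norm (f x))\<^sup>2)" "integrable M (\<lambda>x. (norm (g x))\<^sup>2)"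
  shows "integrable M (\<lambda>x. f x \<bullet> g x)"
proof (rule Bochner_Integration.integrable_bound)
  show "integrable M (\<lambda>x. (norm (f x))\<^sup>2 + (norm (g x))\<^sup>2)" using assms by simp
  show "AE x in M. norm (f x \<bullet> g x) \<le> norm ((norm (f x))\<^sup>2 + (norm (g x))\<^sup>2)"
  proof (rule AE_I2)
    fix x
    have "\<bar>f x \<bullet> g x\<bar> \<le> norm (f x) * norm (g x)" by (rule Cauchy_Schwarz_ineq2)
    also have "\<dots> \<le> (norm (f x))\<^sup>2 + (norm (g x))\<^sup>2"
    proof -
      have "2 * (norm (f x) * norm (g x)) \<le> (norm (f x))\<^sup>2 + (norm (g x))\<^sup>2"
        using sum_squares_bound[of "norm (f x)" "norm (g x)"] by (simp add: mult.assoc)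
      moreover have "0 \<le> norm (f x) * norm (g x)" by simp
      ultimately show ?thesis by linarith
    qed
    finally show "norm (f x \<bullet> g x) \<le> norm ((norm (f x))\<^sup>2 + (norm (g x))\<^sup>2)" by simp
  qed
qed measurable

lemma square_integrable_add:
  fixes f g :: "'a \<Rightarrow> 'b::euclidean_space"
  assumes [measurable]: "f \<in> borel_measurable M" "g \<in> borel_measurable M"
    and "integrable M (\<lambda>x. (norm (f x))\<^sup>2)" "integrable M (\<lambda>x. (norm (g x))\<^sup>2)"
  shows "integrable M (\<lambda>x. (norm (f x + g x))\<^sup>2)"
proof -
  have "(\<lambda>x. (norm (f x + g x))\<^sup>2) = (\<lambda>x. (norm (f x))\<^sup>2 + 2 * (f x \<bullet> g x) + (norm (g x))\<^sup>2)"
    by (auto simp: power2_norm_eq_inner algebra_simps inner_commute)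
  then show ?thesis using square_integrable_inner[OF assms] assms by simp
qed

lemma Cauchy_Schwarz_integral:
  fixes f g :: "'a \<Rightarrow> 'b::euclidean_space"
  assumes m: "f \<in> borel_measurable M" "g \<in> borel_measurable M"
    and i: "integrable M (\<lambda>x. (norm (f x))\<^sup>2)" "integrable M (\<lambda>x. (norm (g x))\<^sup>2)"
  shows "\<bar>\<integral>x. f x \<bullet> g x \<partial>M\<bar> \<le> sqrt (\<integral>x. (norm (f x))\<^sup>2 \<partial>M) * sqrt (\<integral>x. (norm (g x))\<^sup>2 \<partial>M)"
proof -
  define A where "A = (\<integral>x. (norm (f x))\<^sup>2 \<partial>M)"
  define B where "B = (\<integral>x. (norm (g x))\<^sup>2 \<partial>M)"
  define C where "C = (\<integral>x. f x \<bullet> g x \<partial>M)"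
  have AB: "A \<ge> 0" "B \<ge> 0" by (simp_all add: A_def B_def)
  have q: "0 \<le> A * s\<^sup>2 + 2 * s * t * C + t\<^sup>2 * B" for s t
  proof -
    have "0 \<le> (\<integral>x. (norm (s *\<^sub>R f x + t *\<^sub>R g x))\<^sup>2 \<partial>M)" by simp
    also have "(\<lambda>x. (norm (s *\<^sub>R f x + t *\<^sub>R g x))\<^sup>2) =
       (\<lambda>x. s\<^sup>2 * (norm (f x))\<^sup>2 + (2 * s * t) * (f x \<bullet> g x) + t\<^sup>2 * (norm (g x))\<^sup>2)"
      by (auto simp: power2_norm_eq_inner inner_add_left inner_add_right inner_commute
          power2_eq_square[of s] power2_eq_square[of t] algebra_simps)
    also have "(\<integral>x. \<dots> x \<partial>M) = s\<^sup>2 * A + 2 * s * t * C + t\<^sup>2 * B"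
      unfolding A_def B_def C_def using i square_integrable_inner[OF m i] by simp
    finally show ?thesis by (simp add: mult.commute)
  qed
  have "C\<^sup>2 \<le> A * B"
  proof (cases "A = 0")
    case True
    \<comment> \<open>For \<open>A = 0\<close> the quadratic form at \<open>s = - (B + 1)\<close>,
      \<open>t = C\<close> equals \<open>- C^2 (B + 2)\<close>, and its nonnegativity forces
      \<open>C = 0\<close>.\<close>
    have "0 \<le> 2 * (- (B + 1)) * C * C + C\<^sup>2 * B"
      using q[of "- (B + 1)" "C"] True by (simp add: power2_eq_square mult_ac)
    then have "0 \<le> - (C\<^sup>2 * (B + 2))" by (simp add: power2_eq_square algebra_simps)
    then have "C\<^sup>2 * (B + 2) \<le> 0" by linarith
    then have "C\<^sup>2 \<le> 0" using AB by (simp add: mult_le_0_iff)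
    then show ?thesis using True by simp
  next
    case False
    have "0 \<le> A * C\<^sup>2 + 2 * (- C) * A * C + A\<^sup>2 * B"
      using q[of "- C" A] by (simp add: power2_eq_square mult_ac)
    then have "0 \<le> A * (A * B - C\<^sup>2)" by (simp add: power2_eq_square algebra_simps)
    then show ?thesis using False AB by (simp add: zero_le_mult_iff)
  qed
  then have "\<bar>C\<bar> \<le> sqrt (A * B)" by (simp add: real_le_rsqrt)
  then show ?thesis by (simp add: A_def B_def C_def real_sqrt_mult)
qed

text \<open>The bound \<open>a \<le> 2\<^sup>-\<^sup>k + 2\<^sup>k a\<^sup>2\<close> makes the increments of a fast Cauchy subsequence summable
  almost everywhere.\<close>

lemma L2_complete:
  fixes f :: "nat \<Rightarrow> 'a \<Rightarrow> 'b::euclidean_space"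
  assumes m[measurable]: "\<And>n. f n \<in> borel_measurable M"
    and i: "\<And>n. integrable M (\<lambda>x. (norm (f n x))\<^sup>2)"
    and C: "\<And>e. e > 0 \<Longrightarrow> \<exists>N. \<forall>m\<ge>N. \<forall>n\<ge>N. (\<integral>\<^sup>+x. ennreal ((norm (f m x - f n x))\<^sup>2) \<partial>M) \<le> ennreal e"
  obtains g where "g \<in> borel_measurable M" "integrable M (\<lambda>x. (norm (g x))\<^sup>2)"
    "(\<lambda>n. \<integral>x. (norm (f n x - g x))\<^sup>2 \<partial>M) \<longlonglongrightarrow> 0"
    "\<exists>s::nat\<Rightarrow>nat. strict_mono s \<and> (AE x in M. (\<lambda>n. f (s n) x) \<longlonglongrightarrow> g x)"
proof -
  \<comment> \<open>The precision \<open>(1/4)^k\<close> leaves the summable bound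
    \<open>(1/2)^k\<close> after multiplication with the weight \<open>2^k\<close>.\<close>
  define N where "N k = (SOME N. \<forall>m\<ge>N. \<forall>n\<ge>N. (\<integral>\<^sup>+x. ennreal ((norm (f m x - f n x))\<^sup>2) \<partial>M) \<le> ennreal ((1/4)^k))" for k :: nat
  have N: "(\<integral>\<^sup>+x. ennreal ((norm (f m x - f n x))\<^sup>2) \<partial>M) \<le> ennreal ((1/4)^k)" if "m \<ge> N k" "n \<ge> N k" for m n k
    using someI_ex[OF C[of "(1/4)^k"]] that unfolding N_def by simp
  \<comment> \<open>The maximum makes the indices strictly increasing while keeping each beyond the
    Cauchy threshold of its level.\<close>
  define s where "s = rec_nat (N 0) (\<lambda>k p. max (Suc p) (N (Suc k)))"
  have s_Suc: "s (Suc k) = max (Suc (s k)) (N (Suc k))" for k by (simp add: s_def)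
  have sm: "strict_mono s" by (rule strict_monoI_Suc) (simp add: s_Suc)
  have sN: "s k \<ge> N k" for k by (cases k) (simp_all add: s_Suc, simp add: s_def)
  let ?a = "\<lambda>k x. norm (f (s (Suc k)) x - f (s k) x)"
  have "(\<integral>\<^sup>+x. (\<Sum>k. ennreal (2^k * (?a k x)\<^sup>2)) \<partial>M) = (\<Sum>k. \<integral>\<^sup>+x. ennreal (2^k * (?a k x)\<^sup>2) \<partial>M)"
    by (rule nn_integral_suminf) measurable
  also have "\<dots> \<le> (\<Sum>k. ennreal ((1/2)^k))"
  proof (rule suminf_le)
    fix k
    have "(\<integral>\<^sup>+x. ennreal (2^k * (?a k x)\<^sup>2) \<partial>M) = ennreal (2^k) * (\<integral>\<^sup>+x. ennreal ((?a k x)\<^sup>2) \<partial>M)"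
      by (simp add: ennreal_mult' nn_integral_cmult)
    also have "\<dots> \<le> ennreal (2^k) * ennreal ((1/4)^k)"
      by (intro mult_left_mono N) (use sN[of k] strict_monoD[OF sm, of k "Suc k"] in auto)
    also have "\<dots> = ennreal ((1/2)^k)"
      by (simp add: ennreal_mult'[symmetric] power_divide flip: power_mult_distrib)
        (metis (no_types, lifting) nonzero_divide_mult_cancel_left num_double numeral_times_numeral power_mult_distrib zero_neq_numeral power_eq_0_iff)
    finally show "(\<integral>\<^sup>+x. ennreal (2^k * (?a k x)\<^sup>2) \<partial>M) \<le> ennreal ((1/2)^k)" .
  qed auto
  also have "\<dots> = ennreal (\<Sum>k. (1/2)^k)"
    by (intro suminf_ennreal2 summable_geometric) auto
  also have "\<dots> < \<infinity>" by simp
  finally have "AE x in M. (\<Sum>k. ennreal (2^k * (?a k x)\<^sup>2)) \<noteq> \<infinity>"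
    by (intro nn_integral_PInf_AE) (auto simp: less_top)
  then have conv: "AE x in M. convergent (\<lambda>k. f (s k) x)"
  proof eventually_elim
    case (elim x)
    have "summable (\<lambda>k. 2^k * (?a k x)\<^sup>2)"
      using elim by (intro summable_suminf_not_top) (auto simp: top_unique)
    then have sm: "summable (\<lambda>k. (1/2)^k + 2^k * (?a k x)\<^sup>2)"
      by (intro summable_add summable_geometric) auto
    have "?a k x \<le> (1/2)^k + 2^k * (?a k x)\<^sup>2" for k
    proof -
      have "2 * ?a k x \<le> (1/2)^k + 2^k * (?a k x)\<^sup>2"
        using zero_le_power2[of "2^k * ?a k x - 1"]
        by (simp add: field_simps power2_eq_square power_divide)
      then show ?thesis using norm_ge_zero[of "f (s (Suc k)) x - f (s k) x"] by linarith
    qed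
    then have "summable (\<lambda>k. f (s (Suc k)) x - f (s k) x)"
      by (intro summable_comparison_test'[OF sm]) simp
    then have "convergent (\<lambda>n. \<Sum>k<n. f (s (Suc k)) x - f (s k) x)"
      by (simp add: summable_iff_convergent)
    then have "convergent (\<lambda>n. f (s n) x - f (s 0) x)"
      by (simp add: sum_lessThan_telescope[of "\<lambda>k. f (s k) x"])
    then have "convergent (\<lambda>n. f (s n) x - f (s 0) x + f (s 0) x)"
      by (rule convergent_add) (rule convergent_const)
    then show ?case by simp
  qed
  define g where "g x = lim (\<lambda>k. f (s k) x)" for x
  have gm[measurable]: "g \<in> borel_measurable M" unfolding g_def by measurable
  have lim: "AE x in M. (\<lambda>n. f (s n) x) \<longlonglongrightarrow> g x"
    using conv by eventually_elim (simp add: g_def convergent_LIMSEQ_iff)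
  have bound: "\<exists>N. \<forall>n\<ge>N. (\<integral>\<^sup>+x. ennreal ((norm (f n x - g x))\<^sup>2) \<partial>M) \<le> ennreal e" if "e > 0" for e
  proof -
    obtain N where N: "\<forall>m\<ge>N. \<forall>n\<ge>N. (\<integral>\<^sup>+x. ennreal ((norm (f m x - f n x))\<^sup>2) \<partial>M) \<le> ennreal e"
      using C[OF \<open>e > 0\<close>] by blast
    show ?thesis
    proof (intro exI[of _ N] allI impI)
      fix n assume n: "n \<ge> N"
      have "(\<integral>\<^sup>+x. ennreal ((norm (f n x - g x))\<^sup>2) \<partial>M) =
        (\<integral>\<^sup>+x. liminf (\<lambda>k. ennreal ((norm (f n x - f (s k) x))\<^sup>2)) \<partial>M)"
      proof (rule nn_integral_cong_AE, use lim in eventually_elim)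
        case (elim x)
        have "(\<lambda>k. ennreal ((norm (f n x - f (s k) x))\<^sup>2)) \<longlonglongrightarrow> ennreal ((norm (f n x - g x))\<^sup>2)"
          by (intro tendsto_intros elim)
        then show ?case by (intro lim_imp_Liminf[symmetric]) auto
      qed
      also have "\<dots> \<le> liminf (\<lambda>k. \<integral>\<^sup>+x. ennreal ((norm (f n x - f (s k) x))\<^sup>2) \<partial>M)"
        by (rule nn_integral_liminf) measurable
      also have "\<dots> \<le> liminf (\<lambda>k::nat. ennreal e)"
      proof (rule Liminf_mono, unfold eventually_sequentially, intro exI[of _ N] allI impI)
        fix k assume "k \<ge> N"
        then have "s k \<ge> N" using seq_suble[OF sm, of k] by linarith
        then show "(\<integral>\<^sup>+x. ennreal ((norm (f n x - f (s k) x))\<^sup>2) \<partial>M) \<le> ennreal e"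
          using N n by blast
      qed
      finally show "(\<integral>\<^sup>+x. ennreal ((norm (f n x - g x))\<^sup>2) \<partial>M) \<le> ennreal e"
        by (simp add: Liminf_const)
    qed
  qed
  have fg: "\<exists>N. \<forall>n\<ge>N. integrable M (\<lambda>x. (norm (f n x - g x))\<^sup>2) \<and> (\<integral>x. (norm (f n x - g x))\<^sup>2 \<partial>M) \<le> e"
    if "e > 0" for e
  proof -
    obtain N where N: "\<forall>n\<ge>N. (\<integral>\<^sup>+x. ennreal ((norm (f n x - g x))\<^sup>2) \<partial>M) \<le> ennreal e"
      using bound[OF \<open>e > 0\<close>] by blast
    show ?thesis
    proof (intro exI[of _ N] allI impI)
      fix n assume n: "n \<ge> N"
      have int: "integrable M (\<lambda>x. (norm (f n x - g x))\<^sup>2)"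
        using N n by (intro integrableI_bounded) (auto intro: le_less_trans)
      moreover have "ennreal (\<integral>x. (norm (f n x - g x))\<^sup>2 \<partial>M) \<le> ennreal e"
        using N n by (subst nn_integral_eq_integral[symmetric, OF int]) auto
      ultimately show "integrable M (\<lambda>x. (norm (f n x - g x))\<^sup>2) \<and> (\<integral>x. (norm (f n x - g x))\<^sup>2 \<partial>M) \<le> e"
        using \<open>e > 0\<close> by (simp add: ennreal_le_iff)
    qed
  qed
  obtain n where "integrable M (\<lambda>x. (norm (f n x - g x))\<^sup>2)" using fg[of 1] by auto
  then have "integrable M (\<lambda>x. (norm (f n x + (g x - f n x)))\<^sup>2)"
    by (intro square_integrable_add) (auto simp: i norm_minus_commute)
  then have gi: "integrable M (\<lambda>x. (norm (g x))\<^sup>2)" by simp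
  have "(\<lambda>n. \<integral>x. (norm (f n x - g x))\<^sup>2 \<partial>M) \<longlonglongrightarrow> 0"
  proof (rule LIMSEQ_I)
    fix e :: real assume "e > 0"
    then obtain N where "\<forall>n\<ge>N. (\<integral>x. (norm (f n x - g x))\<^sup>2 \<partial>M) \<le> e/2"
      using fg[of "e/2"] by auto
    then show "\<exists>no. \<forall>n\<ge>no. norm ((\<integral>x. (norm (f n x - g x))\<^sup>2 \<partial>M) - 0) < e"
      using \<open>e > 0\<close> by (intro exI[of _ N]) fastforce
  qed
  then show ?thesis using that gm gi lim sm by blast
qed

subsection \<open>Integration by parts\<close>

text \<open>Difference quotients have integral zero by translation invariance and converge to the
  partial derivative. A Lipschitz bound dominates them, and since the steps have length at most 1
  they all vanish outside the ball of radius \<open>R + 1\<close>.\<close>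

lemma integral_grad_zero:
  fixes f :: "'a::euclidean_space \<Rightarrow> real"
  assumes D: "\<And>x. GDERIV f x :> g x" and g: "continuous_on UNIV g"
    and K: "compact K" "\<And>x. x \<notin> K \<Longrightarrow> f x = 0" "\<And>x. x \<notin> K \<Longrightarrow> g x = 0"
  shows "(\<integral>x. g x \<partial>lborel) = 0"
proof -
  have f: "continuous_on UNIV f" using D by (rule GDERIV_continuous)
  have [measurable]: "f \<in> borel_measurable borel" "g \<in> borel_measurable borel"
    by (rule borel_measurable_continuous_onI, rule f g)+
  have fi: "integrable lborel f" by (rule integrable_compact_support[OF f K(1,2)])
  have gi: "integrable lborel g" by (rule integrable_compact_support[OF g K(1,3)])
  obtain R where R: "R > 0" "\<And>x. x \<in> K \<Longrightarrow> norm x \<le> R"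
    using compact_imp_bounded[OF K(1)] unfolding bounded_pos by blast
  have "bounded (g ` K)"
    using K(1) g by (intro compact_imp_bounded compact_continuous_image) (auto intro: continuous_on_subset)
  then obtain B where B: "B > 0" "\<And>x. x \<in> K \<Longrightarrow> norm (g x) \<le> B" unfolding bounded_pos by blast
  have B': "norm (g x) \<le> B" for x using B K(3)[of x] by (cases "x \<in> K") auto
  have lip: "\<bar>f (x + h) - f x\<bar> \<le> B * norm h" for x h
  proof -
    have "norm (f (x + h) - f x) \<le> B * norm (x + h - x)"
    proof (rule differentiable_bound[of UNIV f "\<lambda>y h. h \<bullet> g y"])
      show "(f has_derivative (\<lambda>h. h \<bullet> g y)) (at y within UNIV)" for y
        using D unfolding gderiv_def by blast
      show "onorm (\<lambda>h. h \<bullet> g y) \<le> B" for y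
      proof (rule onorm_bound)
        show "norm (h \<bullet> g y) \<le> B * norm h" for h
        proof -
          have "\<bar>h \<bullet> g y\<bar> \<le> norm h * norm (g y)" by (rule Cauchy_Schwarz_ineq2)
          also have "\<dots> \<le> norm h * B" by (intro mult_left_mono B') auto
          finally show ?thesis by (simp add: mult.commute)
        qed
      qed (use B in auto)
    qed auto
    then show ?thesis by simp
  qed
  have comp: "(\<integral>x. g x \<bullet> b \<partial>lborel) = 0" if b: "b \<in> Basis" for b
  proof -
    define q where "q n x = (f (x + (1 / real (Suc n)) *\<^sub>R b) - f x) / (1 / real (Suc n))" for n x
    have q0: "(\<integral>x. q n x \<partial>lborel) = 0" for n
    proof -
      have "integrable lborel (\<lambda>x. f (x + (1 / real (Suc n)) *\<^sub>R b))"
      proof (rule integrable_compact_support)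
        show "continuous_on UNIV (\<lambda>x. f (x + (1 / real (Suc n)) *\<^sub>R b))"
          by (rule continuous_on_compose2[OF f]) (auto intro!: continuous_intros)
        show "compact ((\<lambda>x. x - (1 / real (Suc n)) *\<^sub>R b) ` K)"
          by (intro compact_continuous_image K continuous_intros)
        fix x assume "x \<notin> (\<lambda>x. x - (1 / real (Suc n)) *\<^sub>R b) ` K"
        then have "x + (1 / real (Suc n)) *\<^sub>R b \<notin> K" by (metis add_diff_cancel image_eqI)
        then show "f (x + (1 / real (Suc n)) *\<^sub>R b) = 0" by (rule K)
      qed
      then show ?thesis unfolding q_def using fi by (simp add: integral_translate)
    qed
    have "(\<lambda>n. \<integral>x. q n x \<partial>lborel) \<longlonglongrightarrow> (\<integral>x. g x \<bullet> b \<partial>lborel)"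
    proof (rule integral_dominated_convergence[where w = "\<lambda>x. indicator (cball 0 (R + 1)) x * B"])
      show "integrable lborel (\<lambda>x. indicator (cball 0 (R + 1)) x * B :: real)"
        using borel_integrable_compact[of "cball 0 (R + 1)" "\<lambda>_. B"] by simp
      show "AE x in lborel. (\<lambda>n. q n x) \<longlonglongrightarrow> g x \<bullet> b"
      proof (rule AE_I2)
        fix x
        have "(f has_derivative (\<lambda>h. h \<bullet> g x)) (at (x + 0 *\<^sub>R b))"
          using D unfolding gderiv_def by simp
        moreover have "((\<lambda>t. x + t *\<^sub>R b) has_derivative (\<lambda>s. s *\<^sub>R b)) (at 0)"
          by (auto intro!: derivative_eq_intros)
        ultimately have "((\<lambda>t. f (x + t *\<^sub>R b)) has_derivative (\<lambda>s. (s *\<^sub>R b) \<bullet> g x)) (at 0)"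
          by (rule has_derivative_compose[rotated])
        then have "((\<lambda>t. f (x + t *\<^sub>R b)) has_real_derivative (g x \<bullet> b)) (at 0)"
        proof -
          have "(\<lambda>s. (s *\<^sub>R b) \<bullet> g x) = (*) (g x \<bullet> b)" by (auto simp: inner_commute)
          then show ?thesis
            using \<open>((\<lambda>t. f (x + t *\<^sub>R b)) has_derivative (\<lambda>s. (s *\<^sub>R b) \<bullet> g x)) (at 0)\<close>
            unfolding has_field_derivative_def by simp
        qed
        then have "((\<lambda>h. (f (x + h *\<^sub>R b) - f x) / h) \<longlongrightarrow> g x \<bullet> b) (at 0)"
          by (simp add: DERIV_def)
        moreover have "filterlim (\<lambda>n. 1 / real (Suc n)) (at 0) sequentially"
          unfolding filterlim_at using LIMSEQ_inverse_real_of_nat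
          by (auto simp: inverse_eq_divide eventually_sequentially)
        ultimately show "(\<lambda>n. q n x) \<longlonglongrightarrow> g x \<bullet> b" unfolding q_def
          by (rule filterlim_compose)
      qed
      fix n
      show "AE x in lborel. norm (q n x) \<le> indicator (cball 0 (R + 1)) x * B"
      proof (rule AE_I2)
        fix x
        let ?h = "(1 / real (Suc n)) *\<^sub>R b"
        have nh: "norm ?h = 1 / real (Suc n)" using b by simp
        show "norm (q n x) \<le> indicator (cball 0 (R + 1)) x * B"
        proof (cases "x \<in> cball 0 (R + 1)")
          case True
          have "norm (q n x) = \<bar>f (x + ?h) - f x\<bar> / (1 / real (Suc n))"
            unfolding q_def real_norm_def abs_divide by simp
          also have "\<dots> \<le> (B * norm ?h) / (1 / real (Suc n))"
            by (intro divide_right_mono lip) simp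
          also have "\<dots> = B" using nh by simp
          finally show ?thesis using True by simp
        next
          case False
          then have nx: "norm x > R + 1" by simp
          have "norm ?h \<le> 1" using nh by simp
          moreover have "norm x \<le> norm (x + ?h) + norm ?h"
            using norm_triangle_ineq4[of "x + ?h" ?h] by (simp only: add_diff_cancel)
          ultimately have "norm (x + ?h) > R" using nx by linarith
          then have "x \<notin> K" "x + ?h \<notin> K" using R nx by fastforce+
          then show ?thesis using K(2) False by (simp add: q_def)
        qed
      qed
    qed (auto simp: q_def)
    then show ?thesis using q0 by (simp add: LIMSEQ_const_iff)
  qed
  show ?thesis
  proof (rule euclidean_eqI)
    fix b :: 'a assume b: "b \<in> Basis"
    have "(\<integral>x. g x \<partial>lborel) \<bullet> b = (\<integral>x. g x \<bullet> b \<partial>lborel)"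
      using gi by simp
    then show "(\<integral>x. g x \<partial>lborel) \<bullet> b = 0 \<bullet> b" using comp[OF b] by simp
  qed
qed

subsection \<open>Weak gradients\<close>

lemma Lebesgue_points:
  fixes f :: "'a::euclidean_space \<Rightarrow> 'b::euclidean_space"
  assumes f: "integrable lebesgue f"
  shows "AE x in lebesgue. \<forall>e>0. \<exists>d>0. \<forall>h. 0 < h \<and> h < d \<longrightarrow>
    norm ((LINT y|lebesgue_on (cbox x (x + h *\<^sub>R One)). f y) /\<^sub>R h ^ DIM('a) - f x) < e"
proof -
  have i: "integrable (lebesgue_on (cbox a b)) f" for a b
    using f integrable_mult_indicator[of "cbox a b" lebesgue f] by (simp add: integrable_restrict_space)
  have "f integrable_on cbox a b" for a b by (rule integrable_on_lebesgue_on[OF i]) simp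
  then obtain N where N: "negligible N"
    "\<And>x e. \<lbrakk>x \<notin> N; 0 < e\<rbrakk> \<Longrightarrow> \<exists>d>0. \<forall>h. 0 < h \<and> h < d \<longrightarrow>
      norm(integral (cbox x (x + h *\<^sub>R One)) f /\<^sub>R h ^ DIM('a) - f x) < e"
    using integrable_ccontinuous_explicit by metis
  have "AE x in lebesgue. x \<notin> N"
    using N(1) by (simp add: negligible_iff_null_sets AE_not_in)
  then show ?thesis
    by eventually_elim (use N(2) in \<open>simp add: lebesgue_integral_eq_integral[OF i]\<close>)
qed

text \<open>An open set is a countable union of closed boxes, and each of these differs from its
  interior by a null set.\<close>

lemma AE_open_from_boxes:
  fixes \<Omega> :: "'a::euclidean_space set"
  assumes "open \<Omega>" "\<And>l u. cbox l u \<subseteq> \<Omega> \<Longrightarrow> AE x in lebesgue. x \<in> box l u \<longrightarrow> P x"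
  shows "AE x in lebesgue_on \<Omega>. P x"
proof -
  obtain \<D> where D: "countable \<D>" "\<D> \<subseteq> Pow \<Omega>" "\<And>X. X \<in> \<D> \<Longrightarrow> \<exists>a b. X = cbox a b" "\<Union>\<D> = \<Omega>"
    using open_countable_Union_open_cbox[OF assms(1)] by metis
  have "\<forall>X\<in>\<D>. AE x in lebesgue. x \<in> X \<longrightarrow> P x"
  proof
    fix X assume X: "X \<in> \<D>"
    then obtain l u where lu: "X = cbox l u" using D(3) by blast
    have "AE x in lebesgue. x \<notin> cbox l u - box l u"
      by (rule AE_not_in) (simp add: negligible_iff_null_sets[symmetric] negligible_frontier_interval)
    moreover have "AE x in lebesgue. x \<in> box l u \<longrightarrow> P x" using assms(2) X D(2) lu by blast
    ultimately show "AE x in lebesgue. x \<in> X \<longrightarrow> P x" by eventually_elim (use lu in auto)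
  qed
  then have "AE x in lebesgue. \<forall>X\<in>\<D>. x \<in> X \<longrightarrow> P x"
    by (rule AE_ball_countable[OF D(1), THEN iffD2])
  then have "AE x in lebesgue. x \<in> \<Omega> \<longrightarrow> P x"
    by eventually_elim (use D(4) in blast)
  then show ?thesis using assms(1) by (simp add: AE_restrict_space_iff)
qed

lemma locally_integrable_mult:
  fixes f :: "'a::euclidean_space \<Rightarrow> 'b::euclidean_space" and g :: "'a \<Rightarrow> 'c::euclidean_space"
  assumes \<Omega>: "open \<Omega>" and f: "locally_integrable \<Omega> f" and K: "compact K" "K \<subseteq> \<Omega>"
    and g: "g \<in> borel_measurable (lebesgue_on K)" "\<And>x. x \<in> K \<Longrightarrow> norm (g x) \<le> B * norm (f x)"
      "\<And>x. x \<notin> K \<Longrightarrow> g x = 0"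
  shows "integrable (lebesgue_on \<Omega>) g" "(LINT x|lebesgue_on \<Omega>. g x) = (LINT x|lebesgue_on K. g x)"
proof -
  have "K \<in> sets lborel" using compact_imp_closed[OF K(1)] by simp
  then have sK: "K \<in> sets lebesgue" using sets_completionI_sets by blast
  have fK: "integrable (lebesgue_on K) f"
    using f K by (auto simp: locally_integrable_def)
  have gK: "integrable (lebesgue_on K) g"
  proof (rule Bochner_Integration.integrable_bound)
    show "integrable (lebesgue_on K) (\<lambda>x. B * norm (f x))" using fK by simp
    show "AE x in lebesgue_on K. norm (g x) \<le> norm (B * norm (f x))"
      by (rule AE_I2) (use g(2) in force)
  qed (rule g(1))
  have eq: "(\<lambda>x. indicator \<Omega> x *\<^sub>R g x) = (\<lambda>x. indicator K x *\<^sub>R g x)"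
    using g(3) K(2) by (auto simp: indicator_def fun_eq_iff)
  show "integrable (lebesgue_on \<Omega>) g" "(LINT x|lebesgue_on \<Omega>. g x) = (LINT x|lebesgue_on K. g x)"
    using gK \<Omega> sK by (auto simp: integrable_restrict_space integral_restrict_space eq)
qed

lemma continuous_on_bounded_compact:
  fixes f :: "'a::euclidean_space \<Rightarrow> 'b::euclidean_space"
  assumes "continuous_on UNIV f" "compact K"
  obtains B where "B > 0" "\<And>x. x \<in> K \<Longrightarrow> norm (f x) \<le> B"
proof -
  have "bounded (f ` K)"
    using assms by (intro compact_imp_bounded compact_continuous_image) (auto intro: continuous_on_subset)
  then show ?thesis using that unfolding bounded_pos by blast
qed

lemma test_scale_integrable:
  fixes f :: "'a::euclidean_space \<Rightarrow> 'b::euclidean_space"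
  assumes "open \<Omega>" "locally_integrable \<Omega> f" "\<phi> \<in> test_functions \<Omega>"
  shows "integrable (lebesgue_on \<Omega>) (\<lambda>x. \<phi> x *\<^sub>R f x)"
proof -
  obtain K where K: "compact K" "K \<subseteq> \<Omega>" "\<forall>x. x \<notin> K \<longrightarrow> \<phi> x = 0"
    using test_support[OF assms(3)] by blast
  have c: "continuous_on UNIV \<phi>" by (rule test_continuous[OF assms(3)])
  obtain B where B: "B > 0" "\<And>x. x \<in> K \<Longrightarrow> norm (\<phi> x) \<le> B"
    using continuous_on_bounded_compact[OF c K(1)] by blast
  have "K \<in> sets lborel" using compact_imp_closed[OF K(1)] by simp
  then have sK: "K \<in> sets lebesgue" using sets_completionI_sets by blast
  have [measurable]: "\<phi> \<in> borel_measurable (lebesgue_on K)"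
    by (rule continuous_imp_measurable_on_sets_lebesgue[OF continuous_on_subset[OF c] sK]) simp
  have "integrable (lebesgue_on K) f"
    using assms(2) K(1,2) by (simp add: locally_integrable_def)
  then have [measurable]: "f \<in> borel_measurable (lebesgue_on K)" by simp
  show ?thesis
    by (rule locally_integrable_mult(1)[OF assms(1,2) K(1,2), of _ B])
      (use B(2) K(3) in \<open>auto intro!: mult_right_mono\<close>)
qed

lemma grad_scale_integrable:
  fixes f :: "'a::euclidean_space \<Rightarrow> real"
  assumes "open \<Omega>" "locally_integrable \<Omega> f" "\<phi> \<in> test_functions \<Omega>"
  shows "integrable (lebesgue_on \<Omega>) (\<lambda>x. f x *\<^sub>R grad \<phi> x)"
proof -
  obtain K where K: "compact K" "K \<subseteq> \<Omega>" "\<forall>x. x \<notin> K \<longrightarrow> grad \<phi> x = 0"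
    using test_support[OF assms(3)] by blast
  have c: "continuous_on UNIV (grad \<phi>)" by (rule test_grad_continuous[OF assms(3)])
  obtain B where B: "B > 0" "\<And>x. x \<in> K \<Longrightarrow> norm (grad \<phi> x) \<le> B"
    using continuous_on_bounded_compact[OF c K(1)] by blast
  have "K \<in> sets lborel" using compact_imp_closed[OF K(1)] by simp
  then have sK: "K \<in> sets lebesgue" using sets_completionI_sets by blast
  have [measurable]: "grad \<phi> \<in> borel_measurable (lebesgue_on K)"
    by (rule continuous_imp_measurable_on_sets_lebesgue[OF continuous_on_subset[OF c] sK]) simp
  have "integrable (lebesgue_on K) f"
    using assms(2) K(1,2) by (simp add: locally_integrable_def)
  then have [measurable]: "f \<in> borel_measurable (lebesgue_on K)" by simp
  show ?thesis
  proof (rule locally_integrable_mult(1)[OF assms(1,2) K(1,2), of _ B])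
    show "norm (f x *\<^sub>R grad \<phi> x) \<le> B * norm (f x)" if "x \<in> K" for x
      using mult_right_mono[OF B(2)[OF that] norm_ge_zero[of "f x"]] by (simp add: mult.commute)
  qed (use K(3) in auto)
qed

lemma box_approximation:
  fixes l u x :: "'a::euclidean_space"
  shows "(\<lambda>n. \<Prod>b\<in>Basis. bump 0 (real (Suc n) * (x \<bullet> b - l \<bullet> b)) * bump 0 (real (Suc n) * (u \<bullet> b - x \<bullet> b)))
    \<longlonglongrightarrow> indicator (box l u) x"
proof (cases "x \<in> box l u")
  case True
  have *: "(\<lambda>n. bump 0 (real (Suc n) * c)) \<longlonglongrightarrow> 1" if c: "c > 0" for c
  proof -
    have "(\<lambda>n. exp (- (inverse (real (Suc n)) * (1 / c)))) \<longlonglongrightarrow> exp (- (0 * (1 / c)))"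
      by (intro tendsto_intros LIMSEQ_inverse_real_of_nat)
    then show ?thesis using c by (simp add: bump_def divide_simps del: of_nat_Suc)
  qed
  have "(\<lambda>n. \<Prod>b\<in>Basis. bump 0 (real (Suc n) * (x \<bullet> b - l \<bullet> b)) * bump 0 (real (Suc n) * (u \<bullet> b - x \<bullet> b)))
    \<longlonglongrightarrow> (\<Prod>b\<in>(Basis::'a set). 1 * 1)"
    using True by (intro tendsto_prod tendsto_mult *) (auto simp: mem_box)
  then show ?thesis using True by simp
next
  case False
  then obtain b where b: "b \<in> Basis" "x \<bullet> b \<le> l \<bullet> b \<or> u \<bullet> b \<le> x \<bullet> b" by (auto simp: mem_box not_less)
  have eq0: "(\<Prod>b\<in>Basis. bump 0 (real (Suc n) * (x \<bullet> b - l \<bullet> b)) * bump 0 (real (Suc n) * (u \<bullet> b - x \<bullet> b))) = 0" for n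
  proof (rule prod_zero)
    have "bump 0 (real (Suc n) * (x \<bullet> b - l \<bullet> b)) = 0 \<or> bump 0 (real (Suc n) * (u \<bullet> b - x \<bullet> b)) = 0"
      using b(2) by (auto intro!: bump_zero simp: mult_le_0_iff)
    then show "\<exists>b\<in>Basis. bump 0 (real (Suc n) * (x \<bullet> b - l \<bullet> b)) * bump 0 (real (Suc n) * (u \<bullet> b - x \<bullet> b)) = 0"
      using b(1) by auto
  qed simp
  show ?thesis unfolding eq0 using False by simp
qed

lemma bump_0_le_1: "bump 0 t \<le> 1" by (simp add: bump_def)

text \<open>Bump products converging to the indicator of a box show that \<open>G\<close> has
  integral zero over every closed box in \<Omega>. At a Lebesgue point the means over shrinking
  cubes converge to the value of \<open>G\<close>, which is therefore zero.\<close>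

lemma fundamental_lemma:
  fixes G :: "'a::euclidean_space \<Rightarrow> 'b::euclidean_space"
  assumes \<Omega>: "open \<Omega>" and G: "locally_integrable \<Omega> G"
    and 0: "\<And>\<phi>. \<phi> \<in> test_functions \<Omega> \<Longrightarrow> (LINT x|lebesgue_on \<Omega>. \<phi> x *\<^sub>R G x) = 0"
  shows "AE x in lebesgue_on \<Omega>. G x = 0"
proof (rule AE_open_from_boxes[OF \<Omega>])
  have box0: "(LINT x|lebesgue_on (cbox l u). G x) = 0" if lu: "cbox l u \<subseteq> \<Omega>" for l u
  proof -
    define \<phi> where "\<phi> n x = (\<Prod>b\<in>Basis. bump 0 (real (Suc n) * (x \<bullet> b - l \<bullet> b)) * bump 0 (real (Suc n) * (u \<bullet> b - x \<bullet> b)))"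
      for n :: nat and x :: 'a
    have t: "\<phi> n \<in> test_functions \<Omega>" for n unfolding \<phi>_def by (rule box_bump_test[OF lu]) simp
    have GK: "integrable (lebesgue_on (cbox l u)) G"
      using G lu by (auto simp: locally_integrable_def)
    have b01: "0 \<le> \<phi> n x" "\<phi> n x \<le> 1" for n x
      unfolding \<phi>_def by (auto intro!: prod_nonneg prod_le_1 mult_nonneg_nonneg mult_le_one bump_nonneg bump_0_le_1)
    have z: "\<phi> n x = 0" if x: "x \<notin> cbox l u" for n x
    proof -
      obtain b where b: "b \<in> Basis" "x \<bullet> b \<le> l \<bullet> b \<or> u \<bullet> b \<le> x \<bullet> b"
        using x by (auto simp: mem_box not_le intro: less_imp_le)
      then have "bump 0 (real (Suc n) * (x \<bullet> b - l \<bullet> b)) * bump 0 (real (Suc n) * (u \<bullet> b - x \<bullet> b)) = 0"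
        by (auto intro!: bump_zero simp: mult_le_0_iff)
      then show ?thesis unfolding \<phi>_def using b(1) by (intro prod_zero) auto
    qed
    have [measurable]: "\<phi> n \<in> borel_measurable (lebesgue_on (cbox l u))" for n
      by (rule continuous_imp_measurable_on_sets_lebesgue[OF continuous_on_subset[OF test_continuous[OF t]]]) auto
    have [measurable]: "G \<in> borel_measurable (lebesgue_on (cbox l u))" using GK by simp
    have *: "(LINT x|lebesgue_on (cbox l u). \<phi> n x *\<^sub>R G x) = 0" for n
    proof -
      have "(LINT x|lebesgue_on \<Omega>. \<phi> n x *\<^sub>R G x) = (LINT x|lebesgue_on (cbox l u). \<phi> n x *\<^sub>R G x)"
        by (rule locally_integrable_mult(2)[OF \<Omega> G compact_cbox lu, of _ 1])
          (use b01 z in \<open>auto simp: mult_left_le_one_le\<close>)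
      then show ?thesis using 0[OF t] by simp
    qed
    have "(\<lambda>n. LINT x|lebesgue_on (cbox l u). \<phi> n x *\<^sub>R G x) \<longlonglongrightarrow>
        (LINT x|lebesgue_on (cbox l u). indicator (box l u) x *\<^sub>R G x)"
    proof (rule integral_dominated_convergence[where w = "\<lambda>x. norm (G x)"])
      show "AE x in lebesgue_on (cbox l u). (\<lambda>n. \<phi> n x *\<^sub>R G x) \<longlonglongrightarrow> indicator (box l u) x *\<^sub>R G x"
        unfolding \<phi>_def by (intro AE_I2 tendsto_scaleR box_approximation tendsto_const)
      show "AE x in lebesgue_on (cbox l u). norm (\<phi> n x *\<^sub>R G x) \<le> norm (G x)" for n
        by (rule AE_I2) (use b01[of n] in \<open>simp add: mult_left_le_one_le del: of_nat_Suc\<close>)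
      have "box l u \<in> sets (lebesgue_on (cbox l u))"
        by (auto simp: sets_restrict_space_iff box_subset_cbox)
      then show "(\<lambda>x. indicator (box l u) x *\<^sub>R G x) \<in> borel_measurable (lebesgue_on (cbox l u))"
        by measurable
    qed (use GK in \<open>auto simp del: of_nat_Suc\<close>)
    then have "(LINT x|lebesgue_on (cbox l u). indicator (box l u) x *\<^sub>R G x) = 0"
      using * by (simp add: LIMSEQ_const_iff del: of_nat_Suc)
    moreover have "(LINT x|lebesgue_on (cbox l u). indicator (box l u) x *\<^sub>R G x) =
        (LINT x|lebesgue_on (cbox l u). G x)"
    proof (rule integral_cong_AE)
      have "AE x in lebesgue. x \<notin> cbox l u - box l u"
        by (rule AE_not_in) (simp add: negligible_iff_null_sets[symmetric] negligible_frontier_interval)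
      then show "AE x in lebesgue_on (cbox l u). indicator (box l u) x *\<^sub>R G x = G x"
        by (subst AE_restrict_space_iff) (auto elim!: eventually_mono)
      have "box l u \<in> sets (lebesgue_on (cbox l u))"
        by (auto simp: sets_restrict_space_iff box_subset_cbox)
      then show "(\<lambda>x. indicator (box l u) x *\<^sub>R G x) \<in> borel_measurable (lebesgue_on (cbox l u))"
        by measurable
    qed measurable
    ultimately show ?thesis by simp
  qed
  fix l u :: 'a assume lu: "cbox l u \<subseteq> \<Omega>"
  define f where "f = (\<lambda>x. indicator (cbox l u) x *\<^sub>R G x)"
  have "integrable (lebesgue_on (cbox l u)) G"
    using G lu by (auto simp: locally_integrable_def)
  then have "integrable lebesgue f"
    unfolding f_def by (subst (asm) integrable_restrict_space) auto
  from Lebesgue_points[OF this]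
  show "AE x in lebesgue. x \<in> box l u \<longrightarrow> G x = 0"
  proof eventually_elim
    case (elim x)
    show ?case
    proof (intro impI, rule ccontr)
      assume x: "x \<in> box l u" and nz: "G x \<noteq> 0"
      have fx: "f x = G x" using x box_subset_cbox[of l u] by (auto simp: f_def)
      then obtain d where d: "d > 0" "\<forall>h. 0 < h \<and> h < d \<longrightarrow>
        norm ((LINT y|lebesgue_on (cbox x (x + h *\<^sub>R One)). f y) /\<^sub>R h ^ DIM('a) - f x) < norm (G x)"
        using elim nz by (metis zero_less_norm_iff)
      obtain e where e: "e > 0" "cball x e \<subseteq> box l u"
        using x open_box open_contains_cball by blast
      \<comment> \<open>The bound \<open>e / DIM('a)\<close> keeps the cube inside the ball of
        radius \<open>e\<close>, as the norm is at most the sum of the moduli of the coordinates;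
        \<open>d/2\<close> provides the strict inequality \<open>h < d\<close>.\<close>
      define h where "h = min (d/2) (e / DIM('a))"
      have h: "0 < h" "h < d" "h * DIM('a) \<le> e"
        using d(1) e(1) by (auto simp: h_def min_def field_simps)
      have sub: "cbox x (x + h *\<^sub>R One) \<subseteq> box l u"
      proof
        fix y assume y: "y \<in> cbox x (x + h *\<^sub>R One)"
        have "norm (y - x) \<le> (\<Sum>b\<in>Basis. \<bar>(y - x) \<bullet> b\<bar>)" by (rule norm_le_l1)
        also have "\<dots> \<le> (\<Sum>b\<in>(Basis::'a set). h)"
          using y by (intro sum_mono) (auto simp: mem_box inner_simps abs_if algebra_simps)
        finally show "y \<in> box l u" using h e(2) by (auto simp: dist_norm norm_minus_commute mult.commute)
      qed
      have "(LINT y|lebesgue_on (cbox x (x + h *\<^sub>R One)). f y) =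
          (LINT y|lebesgue_on (cbox x (x + h *\<^sub>R One)). G y)"
        using sub box_subset_cbox[of l u]
        by (intro Bochner_Integration.integral_cong) (auto simp: f_def indicator_def)
      also have "\<dots> = 0" using sub box_subset_cbox[of l u] lu by (intro box0) blast
      finally show False using d(2) h fx by auto
    qed
  qed
qed

section \<open>Weak gradients on a bounded open set\<close>

locale bounded_open =
  fixes \<Omega> :: "'a::euclidean_space set"
  assumes open_domain: "open \<Omega>" and bounded_domain: "bounded \<Omega>"
begin

abbreviation "M \<equiv> lebesgue_on \<Omega>"

sublocale M: finite_measure M
  by (rule finite_measure_lebesgue_on[OF lmeasurable_open[OF bounded_domain open_domain]])

lemma domain_sets [simp, measurable]: "\<Omega> \<in> sets lebesgue"
  using open_domain by simp

lemma M_continuous [measurable]: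
  fixes f :: "'a \<Rightarrow> 'b::euclidean_space"
  assumes "continuous_on UNIV f" shows "f \<in> borel_measurable M"
  by (rule continuous_imp_measurable_on_sets_lebesgue[OF continuous_on_subset[OF assms]]) auto

lemma M_integral_lborel:
  fixes f :: "'a \<Rightarrow> 'b::euclidean_space"
  assumes "f \<in> borel_measurable borel" "\<And>x. x \<notin> \<Omega> \<Longrightarrow> f x = 0"
  shows "(LINT x|M. f x) = (LINT x|lborel. f x)" "integrable M f \<longleftrightarrow> integrable lborel f"
proof -
  have eq: "(\<lambda>x. indicator \<Omega> x *\<^sub>R f x) = f"
    using assms(2) by (auto simp: indicator_def fun_eq_iff)
  show "(LINT x|M. f x) = (LINT x|lborel. f x)" "integrable M f \<longleftrightarrow> integrable lborel f"
    using assms(1) by (auto simp: integral_restrict_space integrable_restrict_space eq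
        integral_completion integrable_completion)
qed

lemma M_nn_integral_lborel:
  fixes f :: "'a \<Rightarrow> ennreal"
  assumes "f \<in> borel_measurable borel" "\<And>x. x \<notin> \<Omega> \<Longrightarrow> f x = 0"
  shows "(\<integral>\<^sup>+x. f x \<partial>M) = (\<integral>\<^sup>+x. f x \<partial>lborel)"
proof -
  have eq: "(\<lambda>x. f x * indicator \<Omega> x) = f"
    using assms(2) by (auto simp: indicator_def fun_eq_iff)
  show ?thesis using assms(1) by (simp add: nn_integral_restrict_space nn_integral_completion eq)
qed

text \<open>Rests on the completeness of Lebesgue measure, applied to the extensions by
  zero.\<close>

lemma M_AE_measurable:
  fixes f g :: "'a \<Rightarrow> 'b::euclidean_space"
  assumes "f \<in> borel_measurable M" "AE x in M. f x = g x"
  shows "g \<in> borel_measurable M"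
proof -
  have "(\<lambda>x. indicator \<Omega> x *\<^sub>R f x) \<in> borel_measurable lebesgue"
    using assms(1) by (simp add: borel_measurable_restrict_space_iff)
  moreover have "AE x in lebesgue. indicator \<Omega> x *\<^sub>R f x = indicator \<Omega> x *\<^sub>R g x"
    using assms(2) by (simp add: AE_restrict_space_iff) (auto elim!: eventually_mono simp: indicator_def)
  ultimately have "(\<lambda>x. indicator \<Omega> x *\<^sub>R g x) \<in> borel_measurable lebesgue"
    by (rule borel_measurable_AE)
  then show ?thesis by (simp add: borel_measurable_restrict_space_iff)
qed

abbreviation sqi :: "('a \<Rightarrow> 'b::euclidean_space) \<Rightarrow> bool" where "sqi \<equiv> square_integrable \<Omega>"

lemma sqiD: "sqi f \<Longrightarrow> f \<in> borel_measurable M" "sqi f \<Longrightarrow> integrable M (\<lambda>x. (norm (f x))\<^sup>2)"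
  by (auto simp: square_integrable_def)

lemma sqi_inner: "sqi f \<Longrightarrow> sqi g \<Longrightarrow> integrable M (\<lambda>x. f x \<bullet> g x)"
  by (simp add: square_integrable_def square_integrable_inner)

lemma sqi_add: "sqi f \<Longrightarrow> sqi g \<Longrightarrow> sqi (\<lambda>x. f x + g x)"
  by (auto simp: square_integrable_def intro: square_integrable_add borel_measurable_add)

lemma sqi_scale:
  assumes "sqi f" shows "sqi (\<lambda>x. c *\<^sub>R f x)"
proof -
  have "(\<lambda>x. (norm (c *\<^sub>R f x))\<^sup>2) = (\<lambda>x. c\<^sup>2 * (norm (f x))\<^sup>2)"
    by (simp add: power_mult_distrib)
  then show ?thesis using sqiD[OF assms] unfolding square_integrable_def by simp
qed

lemma sqi_cmult: "sqi f \<Longrightarrow> sqi (\<lambda>x. c * f x)" for f :: "'a \<Rightarrow> real"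
  using sqi_scale[of f c] by simp

lemma sqi_diff: "sqi f \<Longrightarrow> sqi g \<Longrightarrow> sqi (\<lambda>x. f x - g x)"
  using sqi_add[of f "\<lambda>x. (-1) *\<^sub>R g x"] sqi_scale[of g "-1"] by simp

lemma sqi_integrable:
  assumes "sqi f" shows "integrable M f"
proof (rule Bochner_Integration.integrable_bound)
  show "integrable M (\<lambda>x. 1 + (norm (f x))\<^sup>2)" using sqiD[OF assms] by simp
  show "AE x in M. norm (f x) \<le> norm (1 + (norm (f x))\<^sup>2)"
  proof (rule AE_I2)
    fix x
    have "2 * norm (f x) * 1 \<le> (norm (f x))\<^sup>2 + 1\<^sup>2" by (rule sum_squares_bound)
    then have "norm (f x) \<le> 1 + (norm (f x))\<^sup>2"
      using norm_ge_zero[of "f x"] by (simp only: mult_1_right one_power2)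
    then show "norm (f x) \<le> norm (1 + (norm (f x))\<^sup>2)" by simp
  qed
qed (rule sqiD[OF assms])

lemma integrable_locally:
  fixes f :: "'a \<Rightarrow> 'b::euclidean_space"
  assumes "integrable M f" shows "locally_integrable \<Omega> f"
  unfolding locally_integrable_def
proof (intro allI impI)
  fix K assume K: "compact K \<and> K \<subseteq> \<Omega>"
  then have "K \<in> sets lborel" using compact_imp_closed[of K] by simp
  then have sK: "K \<in> sets lebesgue" using sets_completionI_sets by blast
  have "integrable lebesgue (\<lambda>x. indicator \<Omega> x *\<^sub>R f x)"
    using assms by (simp add: integrable_restrict_space)
  then have "integrable lebesgue (\<lambda>x. indicator K x *\<^sub>R indicator \<Omega> x *\<^sub>R f x)"
    by (rule integrable_mult_indicator[OF sK])
  also have "(\<lambda>x. indicator K x *\<^sub>R indicator \<Omega> x *\<^sub>R f x) = (\<lambda>x. indicator K x *\<^sub>R f x)"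
    using K by (auto simp: indicator_def fun_eq_iff)
  finally show "integrable (lebesgue_on K) f" using sK by (simp add: integrable_restrict_space)
qed

text \<open>The gradient of a test function is unique, so the quantifier over all derivative
  functions \<open>D\<close> collapses to \<open>grad\<close>.\<close>

lemma has_weak_gradient_iff:
  "has_weak_gradient \<Omega> u G \<longleftrightarrow> locally_integrable \<Omega> u \<and> locally_integrable \<Omega> G \<and>
     (\<forall>\<phi>\<in>test_functions \<Omega>. (LINT x|M. u x *\<^sub>R grad \<phi> x) = - (LINT x|M. \<phi> x *\<^sub>R G x))"
proof -
  have "(\<forall>D. (\<forall>x. GDERIV \<phi> x :> D x) \<longrightarrow>
        (LINT x|M. u x *\<^sub>R D x) = - (LINT x|M. \<phi> x *\<^sub>R G x)) \<longleftrightarrow>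
      (LINT x|M. u x *\<^sub>R grad \<phi> x) = - (LINT x|M. \<phi> x *\<^sub>R G x)" if "\<phi> \<in> test_functions \<Omega>" for \<phi>
  proof -
    have "D = grad \<phi>" if "\<forall>x. GDERIV \<phi> x :> D x" for D
      using that grad_eq by (metis ext)
    then show ?thesis using test_GDERIV[OF \<open>\<phi> \<in> test_functions \<Omega>\<close>] by blast
  qed
  then show ?thesis unfolding has_weak_gradient_def by auto
qed

lemma locally_integrable_diff:
  "locally_integrable \<Omega> f \<Longrightarrow> locally_integrable \<Omega> g \<Longrightarrow> locally_integrable \<Omega> (\<lambda>x. f x - g x)"
  by (simp add: locally_integrable_def)

text \<open>The fundamental lemma for \<open>G - H\<close>. Allowing \<open>u\<close> and
  \<open>v\<close> to agree only almost everywhere makes the weak gradient a property of the class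
  of a function, not of its representative.\<close>

lemma weak_gradient_unique:
  assumes "has_weak_gradient \<Omega> u G" "has_weak_gradient \<Omega> v H" "AE x in M. u x = v x"
  shows "AE x in M. G x = H x"
proof -
  note a = assms[unfolded has_weak_gradient_iff]
  have "AE x in M. G x - H x = 0"
  proof (rule fundamental_lemma[OF open_domain])
    show "locally_integrable \<Omega> (\<lambda>x. G x - H x)" using a by (intro locally_integrable_diff) auto
    fix \<phi> assume t: "\<phi> \<in> test_functions \<Omega>"
    have "(LINT x|M. u x *\<^sub>R grad \<phi> x) = (LINT x|M. v x *\<^sub>R grad \<phi> x)"
    proof (rule integral_cong_AE)
      show "AE x in M. u x *\<^sub>R grad \<phi> x = v x *\<^sub>R grad \<phi> x"
        using assms(3) by eventually_elim simp
    qed (rule borel_measurable_integrable, rule grad_scale_integrable[OF open_domain _ t], use a in simp)+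
    then have "(LINT x|M. \<phi> x *\<^sub>R G x) = (LINT x|M. \<phi> x *\<^sub>R H x)" using a t by simp
    then show "(LINT x|M. \<phi> x *\<^sub>R (G x - H x)) = 0"
      using a t by (simp add: scaleR_diff_right test_scale_integrable[OF open_domain])
  qed
  then show ?thesis by eventually_elim simp
qed

text \<open>Linear combinations and limits are carried out for this relation: a combination of
  gradients is again a gradient, whereas the chosen \<open>weak_gradient\<close> commutes with such
  operations only up to null sets.\<close>

definition wg :: "('a \<Rightarrow> real) \<Rightarrow> ('a \<Rightarrow> 'a) \<Rightarrow> bool" where
  "wg u G \<longleftrightarrow> sqi u \<and> sqi G \<and> has_weak_gradient \<Omega> u G"

lemma wg_iff: "wg u G \<longleftrightarrow> sqi u \<and> sqi G \<and>
     (\<forall>\<phi>\<in>test_functions \<Omega>. (LINT x|M. u x *\<^sub>R grad \<phi> x) = - (LINT x|M. \<phi> x *\<^sub>R G x))"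
  unfolding wg_def has_weak_gradient_iff by (auto intro: integrable_locally sqi_integrable)

lemma H1_iff: "u \<in> H1 \<Omega> \<longleftrightarrow> (\<exists>G. wg u G)"
  by (auto simp: H1_def wg_def)

lemma wg_unique: "wg u G \<Longrightarrow> wg v H \<Longrightarrow> AE x in M. u x = v x \<Longrightarrow> AE x in M. G x = H x"
  unfolding wg_def using weak_gradient_unique by blast

lemma sqi_cong_AE:
  fixes f :: "'a \<Rightarrow> 'b::euclidean_space"
  assumes "sqi f" "AE x in M. f x = g x"
  shows "sqi g"
proof -
  have [measurable]: "f \<in> borel_measurable M" "g \<in> borel_measurable M"
    using assms sqiD M_AE_measurable by blast+
  have "integrable M (\<lambda>x. (norm (f x))\<^sup>2) \<longleftrightarrow> integrable M (\<lambda>x. (norm (g x))\<^sup>2)"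
    by (rule integrable_cong_AE) (use assms(2) in \<open>auto elim!: eventually_mono\<close>)
  then show ?thesis using assms by (simp add: square_integrable_def)
qed

text \<open>The chosen gradient is by construction only locally integrable; it inherits square
  integrability from \<open>G\<close>, with which it agrees almost everywhere.\<close>

lemma wg_weak_gradient:
  assumes "wg u G" shows "wg u (weak_gradient \<Omega> u)" "AE x in M. weak_gradient \<Omega> u x = G x"
proof -
  have h: "has_weak_gradient \<Omega> u (weak_gradient \<Omega> u)"
    using assms someI_ex[of "has_weak_gradient \<Omega> u"] unfolding wg_def weak_gradient_def by blast
  show ae: "AE x in M. weak_gradient \<Omega> u x = G x"
    by (rule weak_gradient_unique[OF h, of u]) (use assms in \<open>auto simp: wg_def\<close>)
  have "sqi (weak_gradient \<Omega> u)"
    by (rule sqi_cong_AE[of G]) (use assms ae in \<open>auto simp: wg_def elim!: eventually_mono\<close>)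
  then show "wg u (weak_gradient \<Omega> u)" using assms h by (simp add: wg_def)
qed

lemma wg_H1: "u \<in> H1 \<Omega> \<Longrightarrow> wg u (weak_gradient \<Omega> u)"
  using H1_iff wg_weak_gradient by blast

lemma dirichlet_wg:
  assumes "wg u G" shows "dirichlet \<Omega> u = (LINT x|M. (norm (G x))\<^sup>2)"
  unfolding dirichlet_def
proof (rule integral_cong_AE)
  have [measurable]: "G \<in> borel_measurable M" "weak_gradient \<Omega> u \<in> borel_measurable M"
    using assms wg_weak_gradient[OF assms] sqiD unfolding wg_def by blast+
  show "(\<lambda>x. (norm (weak_gradient \<Omega> u x))\<^sup>2) \<in> borel_measurable M" "(\<lambda>x. (norm (G x))\<^sup>2) \<in> borel_measurable M"
    by measurable
  show "AE x in M. (norm (weak_gradient \<Omega> u x))\<^sup>2 = (norm (G x))\<^sup>2"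
    using wg_weak_gradient(2)[OF assms] by eventually_elim simp
qed

lemma wg_add:
  assumes "wg u G" "wg v H" shows "wg (\<lambda>x. u x + v x) (\<lambda>x. G x + H x)"
proof -
  have l: "locally_integrable \<Omega> u" "locally_integrable \<Omega> v" "locally_integrable \<Omega> G" "locally_integrable \<Omega> H"
    using assms by (auto simp: wg_def has_weak_gradient_def)
  show ?thesis
    using assms unfolding wg_iff
    by (auto simp: sqi_add scaleR_add_left scaleR_add_right grad_scale_integrable[OF open_domain]
        test_scale_integrable[OF open_domain] l)
qed

lemma wg_cmult:
  assumes "wg u G" shows "wg (\<lambda>x. c * u x) (\<lambda>x. c *\<^sub>R G x)"
proof -
  have e: "(LINT x|M. (c * u x) *\<^sub>R grad \<phi> x) = c *\<^sub>R (LINT x|M. u x *\<^sub>R grad \<phi> x)"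
     "(LINT x|M. \<phi> x *\<^sub>R c *\<^sub>R G x) = c *\<^sub>R (LINT x|M. \<phi> x *\<^sub>R G x)" for \<phi>
    by (simp_all flip: scaleR_scaleR integral_scaleR_right) (simp add: mult.commute)
  show ?thesis
    using assms unfolding wg_iff by (auto simp: sqi_scale sqi_cmult e simp del: scaleR_scaleR)
qed

lemma wg_diff: "wg u G \<Longrightarrow> wg v H \<Longrightarrow> wg (\<lambda>x. u x - v x) (\<lambda>x. G x - H x)"
  using wg_add[of u G "\<lambda>x. (-1) * v x" "\<lambda>x. (-1) *\<^sub>R H x"] wg_cmult[of v H "-1"] by simp

lemma test_sqi:
  assumes "\<phi> \<in> test_functions \<Omega>" shows "sqi \<phi>" "sqi (grad \<phi>)"
proof -
  obtain K where K: "compact K" "K \<subseteq> \<Omega>" "\<forall>x. x \<notin> K \<longrightarrow> \<phi> x = 0" "\<forall>x. x \<notin> K \<longrightarrow> grad \<phi> x = 0"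
    using test_support[OF assms] by blast
  have c: "continuous_on UNIV \<phi>" "continuous_on UNIV (grad \<phi>)"
    using assms test_continuous test_grad_continuous by blast+
  have *: "sqi f" if f: "continuous_on UNIV f" "\<forall>x. x \<notin> K \<longrightarrow> f x = 0" for f :: "'a \<Rightarrow> 'b::euclidean_space"
  proof -
    have "continuous_on UNIV (\<lambda>x. (norm (f x))\<^sup>2)" using f(1) by (intro continuous_intros)
    moreover from this have "integrable lborel (\<lambda>x. (norm (f x))\<^sup>2)"
      by (rule integrable_compact_support[OF _ K(1)]) (use f in auto)
    ultimately have "integrable M (\<lambda>x. (norm (f x))\<^sup>2)"
      using f(2) K(2) by (subst M_integral_lborel(2)) (auto intro: borel_measurable_continuous_onI)
    then show ?thesis using f(1) by (simp add: square_integrable_def M_continuous)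
  qed
  show "sqi \<phi>" "sqi (grad \<phi>)" using * c K by blast+
qed

lemma wg_test:
  assumes \<phi>: "\<phi> \<in> test_functions \<Omega>" shows "wg \<phi> (grad \<phi>)"
  unfolding wg_iff
proof (intro conjI ballI test_sqi[OF \<phi>])
  fix \<psi> assume \<psi>: "\<psi> \<in> test_functions \<Omega>"
  obtain K where K: "compact K" "K \<subseteq> \<Omega>" "\<forall>x. x \<notin> K \<longrightarrow> \<phi> x = 0" "\<forall>x. x \<notin> K \<longrightarrow> grad \<phi> x = 0"
    using test_support[OF \<phi>] by blast
  have l: "locally_integrable \<Omega> \<phi>" "locally_integrable \<Omega> (grad \<phi>)"
    by (intro integrable_locally sqi_integrable test_sqi[OF \<phi>])+
  have c: "continuous_on UNIV (\<lambda>x. \<phi> x *\<^sub>R grad \<psi> x + \<psi> x *\<^sub>R grad \<phi> x)"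
    using \<phi> \<psi> by (intro continuous_intros test_continuous test_grad_continuous)
  have "(LINT x|M. \<phi> x *\<^sub>R grad \<psi> x) + (LINT x|M. \<psi> x *\<^sub>R grad \<phi> x) =
     (LINT x|M. \<phi> x *\<^sub>R grad \<psi> x + \<psi> x *\<^sub>R grad \<phi> x)"
    using \<psi> l by (simp add: grad_scale_integrable[OF open_domain] test_scale_integrable[OF open_domain])
  also have "\<dots> = (LINT x|lborel. \<phi> x *\<^sub>R grad \<psi> x + \<psi> x *\<^sub>R grad \<phi> x)"
  proof (rule M_integral_lborel)
    fix x assume "x \<notin> \<Omega>"
    then have "x \<notin> K" using K(2) by blast
    then show "\<phi> x *\<^sub>R grad \<psi> x + \<psi> x *\<^sub>R grad \<phi> x = 0" using K(3,4) by simp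
  qed (rule borel_measurable_continuous_onI[OF c])
  also have "\<dots> = 0"
    by (rule integral_grad_zero[of "\<lambda>x. \<phi> x * \<psi> x", OF GDERIV_mult[OF test_GDERIV[OF \<phi>] test_GDERIV[OF \<psi>]] c K(1)])
      (use K in auto)
  finally show "(LINT x|M. \<phi> x *\<^sub>R grad \<psi> x) = - (LINT x|M. \<psi> x *\<^sub>R grad \<phi> x)"
    by (simp add: eq_neg_iff_add_eq_0)
qed

end

subsection \<open>The Hilbert space structure\<close>

context bounded_open begin

lemma H01_H1: "u \<in> H01 \<Omega> \<Longrightarrow> u \<in> H1 \<Omega>" by (simp add: H01_def)

lemma wg_sqi: "wg u G \<Longrightarrow> sqi u" "wg u G \<Longrightarrow> sqi G" by (auto simp: wg_def)

definition ip :: "('a \<Rightarrow> real) \<Rightarrow> ('a \<Rightarrow> real) \<Rightarrow> real" where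
  "ip u v = (LINT x|M. weak_gradient \<Omega> u x \<bullet> weak_gradient \<Omega> v x)"

lemma ip_wg:
  assumes "wg u G" "wg v H" shows "ip u v = (LINT x|M. G x \<bullet> H x)"
  unfolding ip_def
proof (rule integral_cong_AE)
  have [measurable]: "G \<in> borel_measurable M" "weak_gradient \<Omega> u \<in> borel_measurable M"
      "H \<in> borel_measurable M" "weak_gradient \<Omega> v \<in> borel_measurable M"
    using assms wg_weak_gradient(1) wg_sqi(2) sqiD(1) by blast+
  show "(\<lambda>x. weak_gradient \<Omega> u x \<bullet> weak_gradient \<Omega> v x) \<in> borel_measurable M"
    "(\<lambda>x. G x \<bullet> H x) \<in> borel_measurable M" by measurable
  show "AE x in M. weak_gradient \<Omega> u x \<bullet> weak_gradient \<Omega> v x = G x \<bullet> H x"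
    using wg_weak_gradient(2)[OF assms(1)] wg_weak_gradient(2)[OF assms(2)] by eventually_elim simp
qed

lemma dirichlet_ip: "dirichlet \<Omega> u = ip u u"
  by (simp add: dirichlet_def ip_def power2_norm_eq_inner)

lemma ip_commute: "ip u v = ip v u" by (simp add: ip_def inner_commute)

lemma dirichlet_nonneg: "dirichlet \<Omega> u \<ge> 0" by (simp add: dirichlet_def)

lemma H01_norm_sq: "(H01_norm \<Omega> u)\<^sup>2 = dirichlet \<Omega> u"
  by (simp add: H01_norm_def dirichlet_nonneg)

lemma H01_norm_nonneg: "H01_norm \<Omega> u \<ge> 0" by (simp add: H01_norm_def dirichlet_nonneg)

lemma ip_add_H1: "u \<in> H1 \<Omega> \<Longrightarrow> v \<in> H1 \<Omega> \<Longrightarrow> w \<in> H1 \<Omega> \<Longrightarrow> ip (\<lambda>x. u x + v x) w = ip u w + ip v w"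
  using ip_wg[OF wg_add wg_H1, OF wg_H1 wg_H1, of u v w]
  by (simp add: inner_add_left sqi_inner wg_sqi(2)[OF wg_H1] ip_def)

lemma ip_cmult_H1: "u \<in> H1 \<Omega> \<Longrightarrow> w \<in> H1 \<Omega> \<Longrightarrow> ip (\<lambda>x. c * u x) w = c * ip u w"
  using ip_wg[OF wg_cmult wg_H1, OF wg_H1, of u w c] by (simp add: ip_def)

lemma H1_add: "u \<in> H1 \<Omega> \<Longrightarrow> v \<in> H1 \<Omega> \<Longrightarrow> (\<lambda>x. u x + v x) \<in> H1 \<Omega>"
  unfolding H1_iff using wg_add by blast

lemma H1_cmult: "u \<in> H1 \<Omega> \<Longrightarrow> (\<lambda>x. c * u x) \<in> H1 \<Omega>"
  unfolding H1_iff using wg_cmult by blast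

lemma H1_diff: "u \<in> H1 \<Omega> \<Longrightarrow> v \<in> H1 \<Omega> \<Longrightarrow> (\<lambda>x. u x - v x) \<in> H1 \<Omega>"
  unfolding H1_iff using wg_diff by blast

lemma ip_Cauchy_Schwarz:
  assumes "u \<in> H1 \<Omega>" "v \<in> H1 \<Omega>"
  shows "\<bar>ip u v\<bar> \<le> H01_norm \<Omega> u * H01_norm \<Omega> v"
  unfolding ip_def H01_norm_def dirichlet_def
  by (rule Cauchy_Schwarz_integral) (use assms wg_H1 wg_sqi(2) sqiD in blast)+

lemma dirichlet_add:
  assumes "u \<in> H1 \<Omega>" "v \<in> H1 \<Omega>"
  shows "dirichlet \<Omega> (\<lambda>x. u x + v x) = dirichlet \<Omega> u + 2 * ip u v + dirichlet \<Omega> v"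
proof -
  have "ip (\<lambda>x. u x + v x) (\<lambda>x. u x + v x) = ip u (\<lambda>x. u x + v x) + ip v (\<lambda>x. u x + v x)"
    by (intro ip_add_H1 assms H1_add)
  also have "ip u (\<lambda>x. u x + v x) = ip u u + ip v u"
    unfolding ip_commute[of u "\<lambda>x. u x + v x"] by (intro ip_add_H1 assms)
  also have "ip v (\<lambda>x. u x + v x) = ip u v + ip v v"
    unfolding ip_commute[of v "\<lambda>x. u x + v x"] by (intro ip_add_H1 assms)
  finally show ?thesis by (simp add: dirichlet_ip ip_commute)
qed

lemma dirichlet_cmult: "u \<in> H1 \<Omega> \<Longrightarrow> dirichlet \<Omega> (\<lambda>x. c * u x) = c\<^sup>2 * dirichlet \<Omega> u"
  using dirichlet_wg[OF wg_cmult[OF wg_H1], of u c]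
  by (simp add: dirichlet_def power_mult_distrib)

lemma H01_norm_cmult: "u \<in> H1 \<Omega> \<Longrightarrow> H01_norm \<Omega> (\<lambda>x. c * u x) = \<bar>c\<bar> * H01_norm \<Omega> u"
  by (simp add: H01_norm_def dirichlet_cmult real_sqrt_mult)

lemma H01_norm_triangle:
  assumes "u \<in> H1 \<Omega>" "v \<in> H1 \<Omega>"
  shows "H01_norm \<Omega> (\<lambda>x. u x + v x) \<le> H01_norm \<Omega> u + H01_norm \<Omega> v"
proof (rule power2_le_imp_le)
  have "(H01_norm \<Omega> (\<lambda>x. u x + v x))\<^sup>2 = dirichlet \<Omega> u + 2 * ip u v + dirichlet \<Omega> v"
    by (simp add: H01_norm_sq dirichlet_add assms)
  also have "\<dots> \<le> dirichlet \<Omega> u + 2 * (H01_norm \<Omega> u * H01_norm \<Omega> v) + dirichlet \<Omega> v"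
    using ip_Cauchy_Schwarz[OF assms] by linarith
  also have "\<dots> = (H01_norm \<Omega> u + H01_norm \<Omega> v)\<^sup>2"
    by (simp add: power2_sum H01_norm_sq)
  finally show "(H01_norm \<Omega> (\<lambda>x. u x + v x))\<^sup>2 \<le> (H01_norm \<Omega> u + H01_norm \<Omega> v)\<^sup>2" .
qed (simp add: H01_norm_nonneg)

lemma H01_norm_diff_triangle:
  assumes "u \<in> H1 \<Omega>" "v \<in> H1 \<Omega>"
  shows "\<bar>H01_norm \<Omega> u - H01_norm \<Omega> v\<bar> \<le> H01_norm \<Omega> (\<lambda>x. u x - v x)"
proof -
  note d = H1_diff[OF assms]
  have "H01_norm \<Omega> u \<le> H01_norm \<Omega> (\<lambda>x. u x - v x) + H01_norm \<Omega> v"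
    using H01_norm_triangle[OF d assms(2)] by simp
  moreover have "H01_norm \<Omega> v \<le> H01_norm \<Omega> (\<lambda>x. - 1 * (u x - v x)) + H01_norm \<Omega> u"
    using H01_norm_triangle[OF H1_cmult[OF d, of "-1"] assms(1)] by simp
  moreover have "H01_norm \<Omega> (\<lambda>x. - 1 * (u x - v x)) = H01_norm \<Omega> (\<lambda>x. u x - v x)"
    by (subst H01_norm_cmult[OF d]) simp
  ultimately show ?thesis by linarith
qed

lemma dirichlet_cong:
  assumes "u \<in> H1 \<Omega>" "v \<in> H1 \<Omega>" "AE x in M. u x = v x"
  shows "dirichlet \<Omega> u = dirichlet \<Omega> v"
proof -
  note w = wg_H1[OF assms(1)] wg_H1[OF assms(2)]
  have [measurable]: "weak_gradient \<Omega> u \<in> borel_measurable M" "weak_gradient \<Omega> v \<in> borel_measurable M"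
    using w wg_sqi(2) sqiD(1) by blast+
  have "AE x in M. weak_gradient \<Omega> u x = weak_gradient \<Omega> v x"
    by (rule wg_unique[OF w assms(3)])
  then show ?thesis unfolding dirichlet_def
    by (intro integral_cong_AE) (auto elim!: eventually_mono)
qed

lemma L2_add_le:
  fixes f g :: "'a \<Rightarrow> 'b::euclidean_space"
  assumes "sqi f" "sqi g"
  shows "(LINT x|M. (norm (f x + g x))\<^sup>2) \<le> 2 * (LINT x|M. (norm (f x))\<^sup>2) + 2 * (LINT x|M. (norm (g x))\<^sup>2)"
proof -
  have "(LINT x|M. (norm (f x + g x))\<^sup>2) \<le> (LINT x|M. 2 * (norm (f x))\<^sup>2 + 2 * (norm (g x))\<^sup>2)"
  proof (rule integral_mono)
    show "integrable M (\<lambda>x. (norm (f x + g x))\<^sup>2)" using sqiD(2)[OF sqi_add[OF assms]] .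
    show "integrable M (\<lambda>x. 2 * (norm (f x))\<^sup>2 + 2 * (norm (g x))\<^sup>2)"
      using sqiD(2)[OF assms(1)] sqiD(2)[OF assms(2)] by simp
    fix x
    have "(norm (f x + g x))\<^sup>2 \<le> (norm (f x) + norm (g x))\<^sup>2"
      by (intro power_mono norm_triangle_ineq norm_ge_zero)
    also have "\<dots> \<le> 2 * (norm (f x))\<^sup>2 + 2 * (norm (g x))\<^sup>2"
      using sum_squares_bound[of "norm (f x)" "norm (g x)"] by (simp add: power2_sum)
    finally show "(norm (f x + g x))\<^sup>2 \<le> 2 * (norm (f x))\<^sup>2 + 2 * (norm (g x))\<^sup>2" .
  qed
  also have "\<dots> = 2 * (LINT x|M. (norm (f x))\<^sup>2) + 2 * (LINT x|M. (norm (g x))\<^sup>2)"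
    using sqiD(2)[OF assms(1)] sqiD(2)[OF assms(2)] by simp
  finally show ?thesis .
qed

definition approximates :: "(nat \<Rightarrow> 'a \<Rightarrow> real) \<Rightarrow> ('a \<Rightarrow> real) \<Rightarrow> bool" where
  "approximates \<phi> u \<longleftrightarrow> (\<forall>n. \<phi> n \<in> test_functions \<Omega>) \<and> (\<lambda>n. LINT x|M. (u x - \<phi> n x)\<^sup>2) \<longlonglongrightarrow> 0 \<and>
     (\<lambda>n. dirichlet \<Omega> (\<lambda>x. u x - \<phi> n x)) \<longlonglongrightarrow> 0"

lemma H1_norm_sq: "(H1_norm \<Omega> u)\<^sup>2 = (LINT x|M. (u x)\<^sup>2) + dirichlet \<Omega> u"
  by (simp add: H1_norm_def dirichlet_nonneg)

lemma H01_approximates: "u \<in> H01 \<Omega> \<longleftrightarrow> u \<in> H1 \<Omega> \<and> (\<exists>\<phi>. approximates \<phi> u)"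
proof
  assume u: "u \<in> H01 \<Omega>"
  then have "\<forall>n. \<exists>\<phi>\<in>test_functions \<Omega>. H1_norm \<Omega> (\<lambda>x. u x - \<phi> x) < 1 / real (Suc n)"
    unfolding H01_def by simp
  then obtain \<phi> where \<phi>: "\<And>n. \<phi> n \<in> test_functions \<Omega>" "\<And>n. H1_norm \<Omega> (\<lambda>x. u x - \<phi> n x) < 1 / real (Suc n)"
    by metis
  have "(\<lambda>n. H1_norm \<Omega> (\<lambda>x. u x - \<phi> n x)) \<longlonglongrightarrow> 0"
  proof (rule tendsto_sandwich[OF _ _ tendsto_const])
    show "\<forall>\<^sub>F n in sequentially. 0 \<le> H1_norm \<Omega> (\<lambda>x. u x - \<phi> n x)"
      by (simp add: H1_norm_def dirichlet_nonneg)
    show "\<forall>\<^sub>F n in sequentially. H1_norm \<Omega> (\<lambda>x. u x - \<phi> n x) \<le> inverse (real (Suc n))"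
      using \<phi>(2) by (simp add: inverse_eq_divide less_imp_le)
  qed (rule LIMSEQ_inverse_real_of_nat)
  then have *: "(\<lambda>n. (H1_norm \<Omega> (\<lambda>x. u x - \<phi> n x))\<^sup>2) \<longlonglongrightarrow> 0"
    using tendsto_power[of _ 0 sequentially 2] by fastforce
  have "approximates \<phi> u" unfolding approximates_def
  proof (intro conjI allI \<phi>)
    show "(\<lambda>n. LINT x|M. (u x - \<phi> n x)\<^sup>2) \<longlonglongrightarrow> 0"
      by (rule tendsto_sandwich[OF _ _ tendsto_const *]) (simp_all add: H1_norm_sq dirichlet_nonneg)
    show "(\<lambda>n. dirichlet \<Omega> (\<lambda>x. u x - \<phi> n x)) \<longlonglongrightarrow> 0"
      by (rule tendsto_sandwich[OF _ _ tendsto_const *]) (simp_all add: H1_norm_sq dirichlet_nonneg)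
  qed
  then show "u \<in> H1 \<Omega> \<and> (\<exists>\<phi>. approximates \<phi> u)" using u by (auto simp: H01_def)
next
  assume "u \<in> H1 \<Omega> \<and> (\<exists>\<phi>. approximates \<phi> u)"
  then obtain \<phi> where u: "u \<in> H1 \<Omega>" and \<phi>: "\<And>n. \<phi> n \<in> test_functions \<Omega>"
    "(\<lambda>n. LINT x|M. (u x - \<phi> n x)\<^sup>2) \<longlonglongrightarrow> 0" "(\<lambda>n. dirichlet \<Omega> (\<lambda>x. u x - \<phi> n x)) \<longlonglongrightarrow> 0"
    unfolding approximates_def by blast
  have "(\<lambda>n. H1_norm \<Omega> (\<lambda>x. u x - \<phi> n x)) \<longlonglongrightarrow> sqrt (0 + 0)"
    unfolding H1_norm_def by (intro tendsto_intros \<phi>)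
  then have l: "(\<lambda>n. H1_norm \<Omega> (\<lambda>x. u x - \<phi> n x)) \<longlonglongrightarrow> 0" by simp
  have "\<exists>\<phi>\<in>test_functions \<Omega>. H1_norm \<Omega> (\<lambda>x. u x - \<phi> x) < e" if "e > 0" for e
    using order_tendstoD(2)[OF l that] \<phi>(1) by (auto simp: eventually_sequentially)
  with u show "u \<in> H01 \<Omega>" by (auto simp: H01_def)
qed

lemma test_H1: "\<phi> \<in> test_functions \<Omega> \<Longrightarrow> \<phi> \<in> H1 \<Omega>"
  unfolding H1_iff using wg_test by blast

lemma test_H01: "\<phi> \<in> test_functions \<Omega> \<Longrightarrow> \<phi> \<in> H01 \<Omega>"
  unfolding H01_approximates
  using dirichlet_cmult[OF test_H1[OF test_zero], of 0]
  by (intro conjI test_H1 exI[of _ "\<lambda>_. \<phi>"]) (auto simp: approximates_def)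

lemma dirichlet_add_le:
  assumes "u \<in> H1 \<Omega>" "v \<in> H1 \<Omega>"
  shows "dirichlet \<Omega> (\<lambda>x. u x + v x) \<le> 2 * dirichlet \<Omega> u + 2 * dirichlet \<Omega> v"
  using dirichlet_wg[OF wg_add[OF wg_H1 wg_H1], OF assms]
    L2_add_le[OF wg_sqi(2)[OF wg_H1] wg_sqi(2)[OF wg_H1], OF assms]
  by (simp add: dirichlet_def)

lemma H1_sqi: "u \<in> H1 \<Omega> \<Longrightarrow> sqi u" by (simp add: H1_def)

lemma approximates_add:
  assumes u: "u \<in> H1 \<Omega>" "approximates \<phi> u" and v: "v \<in> H1 \<Omega>" "approximates \<psi> v"
  shows "approximates (\<lambda>n x. \<phi> n x + \<psi> n x) (\<lambda>x. u x + v x)"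
proof -
  note a = u(2)[unfolded approximates_def] v(2)[unfolded approximates_def]
  have eq: "u x + v x - (\<phi> n x + \<psi> n x) = (u x - \<phi> n x) + (v x - \<psi> n x)" for n x by simp
  have h: "(\<lambda>x. u x - \<phi> n x) \<in> H1 \<Omega>" "(\<lambda>x. v x - \<psi> n x) \<in> H1 \<Omega>" for n
    by (intro H1_diff u v test_H1, use a in blast)+
  show ?thesis unfolding approximates_def eq
  proof (intro conjI allI)
    show "(\<lambda>x. \<phi> n x + \<psi> n x) \<in> test_functions \<Omega>" for n using a by (auto intro: test_add)
    have "(\<lambda>n. 2 * (LINT x|M. (u x - \<phi> n x)\<^sup>2) + 2 * (LINT x|M. (v x - \<psi> n x)\<^sup>2)) \<longlonglongrightarrow> 2 * 0 + 2 * 0"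
      using a by (intro tendsto_intros) auto
    then have "(\<lambda>n. 2 * (LINT x|M. (u x - \<phi> n x)\<^sup>2) + 2 * (LINT x|M. (v x - \<psi> n x)\<^sup>2)) \<longlonglongrightarrow> 0" by simp
    then show "(\<lambda>n. LINT x|M. (u x - \<phi> n x + (v x - \<psi> n x))\<^sup>2) \<longlonglongrightarrow> 0"
      by (rule tendsto_sandwich[OF _ _ tendsto_const, rotated 2])
        (use L2_add_le[OF H1_sqi[OF h(1)] H1_sqi[OF h(2)]] in simp_all)
    have "(\<lambda>n. 2 * dirichlet \<Omega> (\<lambda>x. u x - \<phi> n x) + 2 * dirichlet \<Omega> (\<lambda>x. v x - \<psi> n x)) \<longlonglongrightarrow> 2 * 0 + 2 * 0"
      using a by (intro tendsto_intros) auto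
    then have "(\<lambda>n. 2 * dirichlet \<Omega> (\<lambda>x. u x - \<phi> n x) + 2 * dirichlet \<Omega> (\<lambda>x. v x - \<psi> n x)) \<longlonglongrightarrow> 0" by simp
    then show "(\<lambda>n. dirichlet \<Omega> (\<lambda>x. u x - \<phi> n x + (v x - \<psi> n x))) \<longlonglongrightarrow> 0"
      by (rule tendsto_sandwich[OF _ _ tendsto_const, rotated 2])
        (use dirichlet_add_le[OF h(1) h(2)] in \<open>simp_all add: dirichlet_nonneg\<close>)
  qed
qed

lemma H01_add: "u \<in> H01 \<Omega> \<Longrightarrow> v \<in> H01 \<Omega> \<Longrightarrow> (\<lambda>x. u x + v x) \<in> H01 \<Omega>"
  unfolding H01_approximates using approximates_add H1_add by blast

lemma H01_cmult:
  assumes "u \<in> H01 \<Omega>" shows "(\<lambda>x. c * u x) \<in> H01 \<Omega>"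
proof -
  obtain \<phi> where u: "u \<in> H1 \<Omega>" and a: "approximates \<phi> u"
    using assms unfolding H01_approximates by blast
  note a = a[unfolded approximates_def]
  have eq: "c * u x - c * \<phi> n x = c * (u x - \<phi> n x)" for n x by (simp add: algebra_simps)
  have h: "(\<lambda>x. u x - \<phi> n x) \<in> H1 \<Omega>" for n
    by (intro H1_diff u test_H1) (use a in blast)
  have "(\<lambda>n. c\<^sup>2 * (LINT x|M. (u x - \<phi> n x)\<^sup>2)) \<longlonglongrightarrow> c\<^sup>2 * 0"
      "(\<lambda>n. c\<^sup>2 * dirichlet \<Omega> (\<lambda>x. u x - \<phi> n x)) \<longlonglongrightarrow> c\<^sup>2 * 0"
    by (rule tendsto_mult_left, use a in blast)+
  then have "approximates (\<lambda>n x. c * \<phi> n x) (\<lambda>x. c * u x)"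
    using a unfolding approximates_def eq by (auto simp: dirichlet_cmult[OF h] power_mult_distrib intro: test_cmult)
  then show ?thesis using u unfolding H01_approximates by (blast intro: H1_cmult)
qed

lemma H01_diff: "u \<in> H01 \<Omega> \<Longrightarrow> v \<in> H01 \<Omega> \<Longrightarrow> (\<lambda>x. u x - v x) \<in> H01 \<Omega>"
  using H01_add[of u "\<lambda>x. -1 * v x"] H01_cmult[of v "-1"] by simp

lemma H01_zero: "(\<lambda>x. 0) \<in> H01 \<Omega>" by (rule test_H01[OF test_zero])

lemma dirichlet_test:
  assumes "\<phi> \<in> test_functions \<Omega>"
  shows "energy (grad \<phi>) = ennreal (dirichlet \<Omega> \<phi>)" "energy \<phi> = ennreal (LINT x|M. (\<phi> x)\<^sup>2)"
proof -
  obtain K where K: "compact K" "K \<subseteq> \<Omega>" "\<forall>x. x \<notin> K \<longrightarrow> \<phi> x = 0" "\<forall>x. x \<notin> K \<longrightarrow> grad \<phi> x = 0"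
    using test_support[OF assms] by blast
  have z: "\<phi> x = 0" "grad \<phi> x = 0" if "x \<notin> \<Omega>" for x using K that by blast+
  have [measurable]: "\<phi> \<in> borel_measurable borel" "grad \<phi> \<in> borel_measurable borel"
    by (intro borel_measurable_continuous_onI test_continuous[OF assms] test_grad_continuous[OF assms])+
  have "energy (grad \<phi>) = (\<integral>\<^sup>+x. ennreal ((norm (grad \<phi> x))\<^sup>2) \<partial>M)"
    by (rule M_nn_integral_lborel[symmetric]) (use z in auto)
  also have "\<dots> = ennreal (LINT x|M. (norm (grad \<phi> x))\<^sup>2)"
    by (rule nn_integral_eq_integral) (use sqiD(2)[OF test_sqi(2)[OF assms]] in auto)
  finally show "energy (grad \<phi>) = ennreal (dirichlet \<Omega> \<phi>)"
    by (simp add: dirichlet_wg[OF wg_test[OF assms]])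
  have "energy \<phi> = (\<integral>\<^sup>+x. ennreal ((norm (\<phi> x))\<^sup>2) \<partial>M)"
    by (rule M_nn_integral_lborel[symmetric]) (use z in auto)
  also have "\<dots> = ennreal (LINT x|M. (norm (\<phi> x))\<^sup>2)"
    by (rule nn_integral_eq_integral) (use sqiD(2)[OF test_sqi(1)[OF assms]] in auto)
  finally show "energy \<phi> = ennreal (LINT x|M. (\<phi> x)\<^sup>2)" by simp
qed

lemma domain_radius: obtains R where "R > 0" "\<And>x. x \<in> \<Omega> \<Longrightarrow> norm x < R"
proof -
  obtain B where "B > 0" "\<And>x. x \<in> \<Omega> \<Longrightarrow> norm x \<le> B" using bounded_domain unfolding bounded_pos by blast
  then show ?thesis using that[of "B + 1"] by force
qed

lemma test_support_domain: "\<phi> \<in> test_functions \<Omega> \<Longrightarrow> \<phi> x \<noteq> 0 \<Longrightarrow> x \<in> \<Omega>"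
  using test_support[of \<phi> \<Omega>] by blast

lemma L2_convergence:
  fixes f :: "'a \<Rightarrow> 'b::euclidean_space"
  assumes f: "sqi f" "\<And>n. sqi (g n)" and l: "(\<lambda>n. LINT x|M. (norm (f x - g n x))\<^sup>2) \<longlonglongrightarrow> 0"
  shows "(\<lambda>n. LINT x|M. (norm (g n x))\<^sup>2) \<longlonglongrightarrow> (LINT x|M. (norm (f x))\<^sup>2)"
proof -
  let ?A = "LINT x|M. (norm (f x))\<^sup>2"
  let ?e = "\<lambda>n. LINT x|M. (norm (f x - g n x))\<^sup>2"
  have d: "sqi (\<lambda>x. f x - g n x)" for n by (intro sqi_diff f)
  have eq: "(LINT x|M. (norm (g n x))\<^sup>2) = ?A - 2 * (LINT x|M. f x \<bullet> (f x - g n x)) + ?e n" for n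
  proof -
    have "(\<lambda>x. (norm (g n x))\<^sup>2) = (\<lambda>x. (norm (f x))\<^sup>2 - 2 * (f x \<bullet> (f x - g n x)) + (norm (f x - g n x))\<^sup>2)"
      by (auto simp: power2_norm_eq_inner inner_diff_left inner_diff_right inner_commute algebra_simps)
    then show ?thesis using sqiD(2)[OF f(1)] sqiD(2)[OF d] sqi_inner[OF f(1) d] by simp
  qed
  have "(\<lambda>n. LINT x|M. f x \<bullet> (f x - g n x)) \<longlonglongrightarrow> 0"
  proof (rule Lim_null_comparison)
    show "\<forall>\<^sub>F n in sequentially. norm (LINT x|M. f x \<bullet> (f x - g n x)) \<le> sqrt ?A * sqrt (?e n)"
      using Cauchy_Schwarz_integral[OF sqiD(1)[OF f(1)] sqiD(1)[OF d] sqiD(2)[OF f(1)] sqiD(2)[OF d]]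
      by (intro always_eventually) auto
    have "(\<lambda>n. sqrt ?A * sqrt (?e n)) \<longlonglongrightarrow> sqrt ?A * sqrt 0" by (intro tendsto_intros l)
    then show "(\<lambda>n. sqrt ?A * sqrt (?e n)) \<longlonglongrightarrow> 0" by simp
  qed
  then have "(\<lambda>n. ?A - 2 * (LINT x|M. f x \<bullet> (f x - g n x)) + ?e n) \<longlonglongrightarrow> ?A - 2 * 0 + 0"
    by (intro tendsto_intros l)
  then show ?thesis unfolding eq by simp
qed

lemma approximates_convergence:
  assumes "u \<in> H1 \<Omega>" "approximates \<phi> u"
  shows "(\<lambda>n. LINT x|M. (\<phi> n x)\<^sup>2) \<longlonglongrightarrow> (LINT x|M. (u x)\<^sup>2)"
    "(\<lambda>n. dirichlet \<Omega> (\<phi> n)) \<longlonglongrightarrow> dirichlet \<Omega> u"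
proof -
  note a = assms(2)[unfolded approximates_def]
  have h: "\<phi> n \<in> H1 \<Omega>" for n using a test_H1 by blast
  show "(\<lambda>n. LINT x|M. (\<phi> n x)\<^sup>2) \<longlonglongrightarrow> (LINT x|M. (u x)\<^sup>2)"
    using L2_convergence[OF H1_sqi[OF assms(1)] H1_sqi[OF h]] a by simp
  have "(\<lambda>n. LINT x|M. (norm (weak_gradient \<Omega> u x - weak_gradient \<Omega> (\<phi> n) x))\<^sup>2) \<longlonglongrightarrow> 0"
    using a dirichlet_wg[OF wg_diff[OF wg_H1 wg_H1], OF assms(1) h] by simp
  from L2_convergence[OF wg_sqi(2)[OF wg_H1] wg_sqi(2)[OF wg_H1] this, OF assms(1) h]
  show "(\<lambda>n. dirichlet \<Omega> (\<phi> n)) \<longlonglongrightarrow> dirichlet \<Omega> u" by (simp add: dirichlet_def)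
qed

lemma Poincare: "\<exists>C>0. \<forall>u\<in>H01 \<Omega>. (LINT x|M. (u x)\<^sup>2) \<le> C * dirichlet \<Omega> u"
proof -
  obtain R where R: "R > 0" "\<And>x. x \<in> \<Omega> \<Longrightarrow> norm x < R" using domain_radius by blast
  have t: "(LINT x|M. (\<phi> x)\<^sup>2) \<le> 4 * R\<^sup>2 * dirichlet \<Omega> \<phi>" if \<phi>: "\<phi> \<in> test_functions \<Omega>" for \<phi>
  proof -
    have "energy \<phi> \<le> ennreal (4 * R\<^sup>2) * energy (grad \<phi>)"
      by (rule poincare_smooth[OF test_GDERIV[OF \<phi>] test_grad_continuous[OF \<phi>] _ R(1)])
        (use R(2) test_support_domain[OF \<phi>] in blast)
    then show ?thesis unfolding dirichlet_test[OF \<phi>]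
      by (simp add: ennreal_mult'[symmetric] ennreal_le_iff dirichlet_nonneg)
  qed
  have "(LINT x|M. (u x)\<^sup>2) \<le> 4 * R\<^sup>2 * dirichlet \<Omega> u" if u: "u \<in> H01 \<Omega>" for u
  proof -
    obtain \<phi> where h: "u \<in> H1 \<Omega>" "approximates \<phi> u" using u unfolding H01_approximates by blast
    show ?thesis
    proof (rule LIMSEQ_le)
      show "(\<lambda>n. LINT x|M. (\<phi> n x)\<^sup>2) \<longlonglongrightarrow> (LINT x|M. (u x)\<^sup>2)"
        by (rule approximates_convergence[OF h])
      show "(\<lambda>n. 4 * R\<^sup>2 * dirichlet \<Omega> (\<phi> n)) \<longlonglongrightarrow> 4 * R\<^sup>2 * dirichlet \<Omega> u"
        by (intro tendsto_intros approximates_convergence[OF h])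
    qed (use h t in \<open>auto simp: approximates_def\<close>)
  qed
  then show ?thesis using R(1) by (intro exI[of _ "4 * R\<^sup>2"]) auto
qed

text \<open>Both sides of the defining identity are pairings with a fixed test function or its
  gradient, hence continuous under L2 convergence.\<close>

lemma wg_limit:
  assumes w: "\<And>n. wg (u n) (G n)" and s: "sqi v" "sqi H"
    and l: "(\<lambda>n. LINT x|M. (norm (u n x - v x))\<^sup>2) \<longlonglongrightarrow> 0" "(\<lambda>n. LINT x|M. (norm (G n x - H x))\<^sup>2) \<longlonglongrightarrow> 0"
  shows "wg v H"
  unfolding wg_iff
proof (intro conjI s ballI)
  fix \<phi> assume \<phi>: "\<phi> \<in> test_functions \<Omega>"
  have lim: "(\<lambda>n. LINT x|M. a x *\<^sub>R g n x) \<longlonglongrightarrow> (LINT x|M. a x *\<^sub>R g' x)"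
    if "sqi a" "\<And>n. sqi (g n)" "sqi g'" "(\<lambda>n. LINT x|M. (norm (g n x - g' x))\<^sup>2) \<longlonglongrightarrow> 0"
    for a :: "'a \<Rightarrow> real" and g :: "nat \<Rightarrow> 'a \<Rightarrow> 'a" and g'
  proof -
    have sc: "integrable M (\<lambda>x. a x *\<^sub>R f x)" if "sqi f" for f :: "'a \<Rightarrow> 'a"
    proof (rule Bochner_Integration.integrable_bound)
      have [measurable]: "a \<in> borel_measurable M" "f \<in> borel_measurable M"
        using \<open>sqi a\<close> that sqiD by blast+
      show "(\<lambda>x. a x *\<^sub>R f x) \<in> borel_measurable M" by measurable
      show "integrable M (\<lambda>x. \<bar>a x\<bar> \<bullet> norm (f x))"
        using \<open>sqi a\<close> that by (intro sqi_inner) (auto simp: square_integrable_def)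
    qed (auto intro!: AE_I2)
    have d: "sqi (\<lambda>x. g n x - g' x)" for n by (intro sqi_diff that)
    have "(\<lambda>n. LINT x|M. a x *\<^sub>R (g n x - g' x)) \<longlonglongrightarrow> 0"
    proof (rule Lim_null_comparison)
      show "\<forall>\<^sub>F n in sequentially. norm (LINT x|M. a x *\<^sub>R (g n x - g' x)) \<le>
        sqrt (LINT x|M. (norm (a x))\<^sup>2) * sqrt (LINT x|M. (norm (g n x - g' x))\<^sup>2)"
      proof (intro always_eventually allI)
        fix n
        have "norm (LINT x|M. a x *\<^sub>R (g n x - g' x)) \<le> (LINT x|M. norm (a x *\<^sub>R (g n x - g' x)))"
          by (rule integral_norm_bound)
        also have "\<dots> = (LINT x|M. \<bar>a x\<bar> \<bullet> norm (g n x - g' x))" by simp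
        also have "\<dots> \<le> \<bar>LINT x|M. \<bar>a x\<bar> \<bullet> norm (g n x - g' x)\<bar>" by (rule abs_ge_self)
        also have "\<dots> \<le> sqrt (LINT x|M. (norm \<bar>a x\<bar>)\<^sup>2) * sqrt (LINT x|M. (norm (norm (g n x - g' x)))\<^sup>2)"
          by (rule Cauchy_Schwarz_integral) (use sqiD[OF \<open>sqi a\<close>] sqiD[OF d] in auto)
        finally show "norm (LINT x|M. a x *\<^sub>R (g n x - g' x)) \<le>
          sqrt (LINT x|M. (norm (a x))\<^sup>2) * sqrt (LINT x|M. (norm (g n x - g' x))\<^sup>2)" by simp
      qed
      have "(\<lambda>n. sqrt (LINT x|M. (norm (a x))\<^sup>2) * sqrt (LINT x|M. (norm (g n x - g' x))\<^sup>2)) \<longlonglongrightarrow>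
         sqrt (LINT x|M. (norm (a x))\<^sup>2) * sqrt 0"
        by (intro tendsto_intros that)
      then show "(\<lambda>n. sqrt (LINT x|M. (norm (a x))\<^sup>2) * sqrt (LINT x|M. (norm (g n x - g' x))\<^sup>2)) \<longlonglongrightarrow> 0"
        by simp
    qed
    then have "(\<lambda>n. (LINT x|M. a x *\<^sub>R g n x) - (LINT x|M. a x *\<^sub>R g' x)) \<longlonglongrightarrow> 0"
      using that by (simp add: scaleR_diff_right sc)
    then show ?thesis by (simp add: LIM_zero_iff)
  qed
  have 1: "(\<lambda>n. LINT x|M. \<phi> x *\<^sub>R G n x) \<longlonglongrightarrow> (LINT x|M. \<phi> x *\<^sub>R H x)"
    by (rule lim) (use test_sqi[OF \<phi>] w s l in \<open>auto simp: wg_def\<close>)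
  have 2: "(\<lambda>n. LINT x|M. u n x *\<^sub>R grad \<phi> x) \<longlonglongrightarrow> (LINT x|M. v x *\<^sub>R grad \<phi> x)"
  proof -
    have i: "integrable M (\<lambda>x. f x *\<^sub>R grad \<phi> x)" if "sqi f" for f
      by (rule grad_scale_integrable[OF open_domain integrable_locally[OF sqi_integrable[OF that]] \<phi>])
    have su: "sqi (u n)" for n using w by (simp add: wg_def)
    \<comment> \<open>The fact \<open>lim\<close> takes a fixed scalar weight and varying vectors,
      while here the fixed factor is the vector. Passing to coordinates restores that form, with
      weight \<open>grad \<phi> x \<bullet> b\<close> and vectors
      \<open>u n x *\<^sub>R b\<close>.\<close>
    have comp: "(LINT x|M. f x *\<^sub>R grad \<phi> x) = (\<Sum>b\<in>Basis. (LINT x|M. (grad \<phi> x \<bullet> b) * f x) *\<^sub>R b)"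
      if "sqi f" for f
    proof -
      have "(LINT x|M. f x *\<^sub>R grad \<phi> x) \<bullet> b = (LINT x|M. (grad \<phi> x \<bullet> b) * f x)" if "b \<in> Basis" for b
        using integral_inner_left[OF i[OF \<open>sqi f\<close>], of b] by (simp add: mult.commute)
      then show ?thesis
        by (subst euclidean_representation[symmetric]) (auto intro!: sum.cong)
    qed
    have b: "(\<lambda>n. LINT x|M. (grad \<phi> x \<bullet> b) * u n x) \<longlonglongrightarrow> (LINT x|M. (grad \<phi> x \<bullet> b) * v x)"
      if b: "b \<in> Basis" for b
    proof -
      have tb: "sqi (\<lambda>x. grad \<phi> x \<bullet> b)" by (rule test_sqi(1)[OF test_grad_component[OF \<phi> b]])
      have "(\<lambda>n. LINT x|M. (grad \<phi> x \<bullet> b) *\<^sub>R (u n x *\<^sub>R b)) \<longlonglongrightarrow> (LINT x|M. (grad \<phi> x \<bullet> b) *\<^sub>R (v x *\<^sub>R b))"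
      proof (rule lim[OF tb])
        have "sqi (\<lambda>x. f x *\<^sub>R b)" if "sqi f" for f
          using that b by (auto simp: square_integrable_def power_mult_distrib intro!: borel_measurable_scaleR)
        then show "sqi (\<lambda>x. u n x *\<^sub>R b)" "sqi (\<lambda>x. v x *\<^sub>R b)" for n using su s by auto
        show "(\<lambda>n. LINT x|M. (norm (u n x *\<^sub>R b - v x *\<^sub>R b))\<^sup>2) \<longlonglongrightarrow> 0"
          using l(1) b by (simp flip: scaleR_diff_left)
      qed
      then have "(\<lambda>n. (LINT x|M. (grad \<phi> x \<bullet> b) *\<^sub>R (u n x *\<^sub>R b)) \<bullet> b) \<longlonglongrightarrow>
          (LINT x|M. (grad \<phi> x \<bullet> b) *\<^sub>R (v x *\<^sub>R b)) \<bullet> b"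
        by (intro tendsto_intros)
      moreover have "(LINT x|M. (grad \<phi> x \<bullet> b) *\<^sub>R (f x *\<^sub>R b)) \<bullet> b = (LINT x|M. (grad \<phi> x \<bullet> b) * f x)"
        if "sqi f" for f
      proof -
        have "integrable M (\<lambda>x. ((grad \<phi> x \<bullet> b) * f x) *\<^sub>R b)"
          using sqi_inner[OF tb that] by (intro integrable_scaleR_left) simp
        from integral_inner_left[OF this, of b] show ?thesis using b by simp
      qed
      ultimately show ?thesis using su s by simp
    qed
    show ?thesis unfolding comp[OF su] comp[OF s(1)] by (intro tendsto_intros b)
  qed
  have "(LINT x|M. u n x *\<^sub>R grad \<phi> x) = - (LINT x|M. \<phi> x *\<^sub>R G n x)" for n
    using w[of n] \<phi> unfolding wg_iff by blast
  then have "(\<lambda>n. LINT x|M. u n x *\<^sub>R grad \<phi> x) \<longlonglongrightarrow> - (LINT x|M. \<phi> x *\<^sub>R H x)"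
    using tendsto_minus[OF 1] by simp
  from LIMSEQ_unique[OF 2 this]
  show "(LINT x|M. v x *\<^sub>R grad \<phi> x) = - (LINT x|M. \<phi> x *\<^sub>R H x)" .
qed

text \<open>Completeness is needed only for sequences of test functions, whose limits lie in the
  closure by construction. The Poincare inequality turns a Cauchy sequence of gradients into one of
  functions, and the almost everywhere convergent subsequence later transfers nonnegativity to the
  limit.\<close>

lemma H01_complete:
  assumes t: "\<And>n. \<phi> n \<in> test_functions \<Omega>"
    and C: "\<And>e. e > 0 \<Longrightarrow> \<exists>N. \<forall>m\<ge>N. \<forall>n\<ge>N. dirichlet \<Omega> (\<lambda>x. \<phi> m x - \<phi> n x) \<le> e"
  obtains u where "u \<in> H01 \<Omega>" "approximates \<phi> u"
    "\<exists>s::nat\<Rightarrow>nat. strict_mono s \<and> (AE x in M. (\<lambda>n. \<phi> (s n) x) \<longlonglongrightarrow> u x)"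
proof -
  obtain P where P: "P > 0" "\<And>u. u \<in> H01 \<Omega> \<Longrightarrow> (LINT x|M. (u x)\<^sup>2) \<le> P * dirichlet \<Omega> u"
    using Poincare by blast
  have td: "(\<lambda>x. \<phi> m x - \<phi> n x) \<in> test_functions \<Omega>" for m n by (intro test_diff t)
  have nn: "(\<integral>\<^sup>+x. ennreal ((norm (\<phi> m x - \<phi> n x))\<^sup>2) \<partial>M) = ennreal (LINT x|M. (\<phi> m x - \<phi> n x)\<^sup>2)" for m n
    using sqiD(2)[OF test_sqi(1)[OF td]] by (subst nn_integral_eq_integral) auto
  have nng: "(\<integral>\<^sup>+x. ennreal ((norm (grad (\<phi> m) x - grad (\<phi> n) x))\<^sup>2) \<partial>M) = ennreal (dirichlet \<Omega> (\<lambda>x. \<phi> m x - \<phi> n x))" for m n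
  proof -
    have w: "wg (\<lambda>x. \<phi> m x - \<phi> n x) (\<lambda>x. grad (\<phi> m) x - grad (\<phi> n) x)" by (intro wg_diff wg_test t)
    show ?thesis unfolding dirichlet_wg[OF w] using sqiD(2)[OF wg_sqi(2)[OF w]]
      by (subst nn_integral_eq_integral) auto
  qed
  obtain G where G: "G \<in> borel_measurable M" "integrable M (\<lambda>x. (norm (G x))\<^sup>2)"
    "(\<lambda>n. \<integral>x. (norm (grad (\<phi> n) x - G x))\<^sup>2 \<partial>M) \<longlonglongrightarrow> 0"
  proof (rule L2_complete[of "\<lambda>n. grad (\<phi> n)" M])
    show "grad (\<phi> n) \<in> borel_measurable M" "integrable M (\<lambda>x. (norm (grad (\<phi> n) x))\<^sup>2)" for n
      using sqiD test_sqi(2)[OF t] by blast+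
    show "\<exists>N. \<forall>m\<ge>N. \<forall>n\<ge>N. (\<integral>\<^sup>+x. ennreal ((norm (grad (\<phi> m) x - grad (\<phi> n) x))\<^sup>2) \<partial>M) \<le> ennreal e"
      if "e > 0" for e
      using C[OF that] unfolding nng by (meson ennreal_leI)
  qed blast
  obtain u where u: "u \<in> borel_measurable M" "integrable M (\<lambda>x. (norm (u x))\<^sup>2)"
    "(\<lambda>n. \<integral>x. (norm (\<phi> n x - u x))\<^sup>2 \<partial>M) \<longlonglongrightarrow> 0"
    "\<exists>s::nat\<Rightarrow>nat. strict_mono s \<and> (AE x in M. (\<lambda>n. \<phi> (s n) x) \<longlonglongrightarrow> u x)"
  proof (rule L2_complete[of \<phi> M])
    show "\<phi> n \<in> borel_measurable M" "integrable M (\<lambda>x. (norm (\<phi> n x))\<^sup>2)" for n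
      using sqiD test_sqi(1)[OF t] by blast+
    show "\<exists>N. \<forall>m\<ge>N. \<forall>n\<ge>N. (\<integral>\<^sup>+x. ennreal ((norm (\<phi> m x - \<phi> n x))\<^sup>2) \<partial>M) \<le> ennreal e"
      if e: "e > 0" for e
    proof -
      obtain N where N: "\<forall>m\<ge>N. \<forall>n\<ge>N. dirichlet \<Omega> (\<lambda>x. \<phi> m x - \<phi> n x) \<le> e / P"
        using C[of "e / P"] e P(1) by auto
      show ?thesis unfolding nn
      proof (intro exI[of _ N] allI impI ennreal_leI)
        fix m n assume "m \<ge> N" "n \<ge> N"
        then have "P * dirichlet \<Omega> (\<lambda>x. \<phi> m x - \<phi> n x) \<le> P * (e / P)"
          using N P(1) by (intro mult_left_mono) auto
        then show "(LINT x|M. (\<phi> m x - \<phi> n x)\<^sup>2) \<le> e"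
          using P(2)[OF test_H01[OF td, of m n]] P(1) by simp
      qed
    qed
  qed blast
  have w: "wg u G"
    by (rule wg_limit[OF wg_test[OF t]]) (use u G in \<open>auto simp: square_integrable_def\<close>)
  have "approximates \<phi> u" unfolding approximates_def
  proof (intro conjI allI t)
    show "(\<lambda>n. LINT x|M. (u x - \<phi> n x)\<^sup>2) \<longlonglongrightarrow> 0" using u(3) by (simp add: power2_commute)
    show "(\<lambda>n. dirichlet \<Omega> (\<lambda>x. u x - \<phi> n x)) \<longlonglongrightarrow> 0"
      using G(3) unfolding dirichlet_wg[OF wg_diff[OF w wg_test[OF t]]] by (simp add: norm_minus_commute)
  qed
  moreover from this w have "u \<in> H01 \<Omega>" unfolding H01_approximates H1_iff by blast
  ultimately show ?thesis using that u(4) by blast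
qed

end

locale bounded_open3 = bounded_open +
  assumes dim3: "DIM('a) = 3"
begin

lemma Sobolev_L4:
  "\<exists>C>0. \<forall>u\<in>H01 \<Omega>. integrable M (\<lambda>x. (u x) ^ 4) \<and> (LINT x|M. (u x) ^ 4) \<le> C * (dirichlet \<Omega> u)\<^sup>2"
proof -
  obtain R where R: "R > 0" "\<And>x. x \<in> \<Omega> \<Longrightarrow> norm x < R" using domain_radius by blast
  obtain C where C: "C > 0"
    "\<And>(u :: 'a \<Rightarrow> real) g d. (\<And>x. GDERIV u x :> g x) \<Longrightarrow> continuous_on UNIV g \<Longrightarrow>
       (\<And>x. u x \<noteq> 0 \<Longrightarrow> norm x < R) \<Longrightarrow> d > 0 \<Longrightarrow> energy g \<le> ennreal (d\<^sup>2) \<Longrightarrow>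
       (\<integral>\<^sup>+x. ennreal ((u x) ^ 4) \<partial>lborel) \<le> ennreal (C * d ^ 4)"
    using Sobolev_L4_smooth[OF R(1) dim3] by blast
  have "integrable M (\<lambda>x. (u x) ^ 4) \<and> (LINT x|M. (u x) ^ 4) \<le> C * (dirichlet \<Omega> u)\<^sup>2"
    if u: "u \<in> H01 \<Omega>" for u
  proof -
    obtain \<phi> where h: "u \<in> H1 \<Omega>" and a: "approximates \<phi> u" using u unfolding H01_approximates by blast
    have t: "\<phi> n \<in> test_functions \<Omega>" for n using a unfolding approximates_def by blast
    have [measurable]: "u \<in> borel_measurable M" "\<phi> n \<in> borel_measurable M" for n
      using sqiD(1)[OF H1_sqi[OF h]] sqiD(1)[OF test_sqi(1)[OF t]] by auto
    have "integrable M (\<lambda>x. (u x - \<phi> n x)\<^sup>2)" for n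
      using sqiD(2)[OF H1_sqi[OF H1_diff[OF h test_H1[OF t]]]] by simp
    then obtain s :: "nat \<Rightarrow> nat" where s: "strict_mono s" "AE x in M. (\<lambda>n. (u x - \<phi> (s n) x)\<^sup>2) \<longlonglongrightarrow> 0"
      using tendsto_L1_AE_subseq[of M "\<lambda>n x. (u x - \<phi> n x)\<^sup>2"] a unfolding approximates_def by auto
    \<comment> \<open>The added inverse makes \<open>d n\<close> positive, as the smooth estimate
      demands, and disappears in the limit.\<close>
    define d where "d n = sqrt (dirichlet \<Omega> (\<phi> n)) + inverse (real (Suc n))" for n
    have d: "d n > 0" for n unfolding d_def by (intro add_nonneg_pos) (auto simp: dirichlet_nonneg)
    have d2: "dirichlet \<Omega> (\<phi> n) \<le> (d n)\<^sup>2" for n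
      unfolding d_def using dirichlet_nonneg by (intro sqrt_le_D) simp
    have dl: "d \<longlonglongrightarrow> sqrt (dirichlet \<Omega> u) + 0"
      unfolding d_def
      by (intro tendsto_intros approximates_convergence[OF h a] LIMSEQ_inverse_real_of_nat)
    have phi4: "(\<integral>\<^sup>+x. ennreal ((\<phi> n x) ^ 4) \<partial>M) \<le> ennreal (C * d n ^ 4)" for n
    proof -
      have "(\<integral>\<^sup>+x. ennreal ((\<phi> n x) ^ 4) \<partial>M) = (\<integral>\<^sup>+x. ennreal ((\<phi> n x) ^ 4) \<partial>lborel)"
      proof (rule M_nn_integral_lborel)
        have [measurable]: "\<phi> n \<in> borel_measurable borel"
          by (rule borel_measurable_continuous_onI[OF test_continuous[OF t]])
        show "(\<lambda>x. ennreal ((\<phi> n x) ^ 4)) \<in> borel_measurable borel" by measurable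
        show "ennreal ((\<phi> n x) ^ 4) = 0" if "x \<notin> \<Omega>" for x
          using test_support_domain[OF t, of n x] that by auto
      qed
      also have "\<dots> \<le> ennreal (C * d n ^ 4)"
      proof (rule C(2)[OF test_GDERIV[OF t] test_grad_continuous[OF t] _ d])
        show "energy (grad (\<phi> n)) \<le> ennreal ((d n)\<^sup>2)"
          unfolding dirichlet_test(1)[OF t] by (rule ennreal_leI[OF d2])
        show "\<phi> n x \<noteq> 0 \<Longrightarrow> norm x < R" for x using test_support_domain[OF t] R(2) by blast
      qed
      finally show ?thesis .
    qed
    have "(\<integral>\<^sup>+x. ennreal ((u x) ^ 4) \<partial>M) = (\<integral>\<^sup>+x. liminf (\<lambda>n. ennreal ((\<phi> (s n) x) ^ 4)) \<partial>M)"
    proof (rule nn_integral_cong_AE, use s(2) in eventually_elim)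
      case (elim x)
      then have "(\<lambda>n. sqrt ((u x - \<phi> (s n) x)\<^sup>2)) \<longlonglongrightarrow> sqrt 0" by (intro tendsto_intros)
      then have "(\<lambda>n. u x - \<phi> (s n) x) \<longlonglongrightarrow> 0" by (simp add: tendsto_rabs_zero_iff)
      then have "(\<lambda>n. u x - (u x - \<phi> (s n) x)) \<longlonglongrightarrow> u x - 0" by (intro tendsto_intros)
      then have "(\<lambda>n. ennreal ((\<phi> (s n) x) ^ 4)) \<longlonglongrightarrow> ennreal ((u x) ^ 4)"
        by (intro tendsto_intros) simp
      then show ?case by (intro lim_imp_Liminf[symmetric]) auto
    qed
    also have "\<dots> \<le> liminf (\<lambda>n. \<integral>\<^sup>+x. ennreal ((\<phi> (s n) x) ^ 4) \<partial>M)"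
      by (rule nn_integral_liminf) measurable
    also have "\<dots> \<le> liminf (\<lambda>n. ennreal (C * d (s n) ^ 4))"
      by (rule Liminf_mono) (use phi4 in simp)
    also have "\<dots> = ennreal (C * (sqrt (dirichlet \<Omega> u) + 0) ^ 4)"
      by (intro lim_imp_Liminf tendsto_intros LIMSEQ_subseq_LIMSEQ[OF dl s(1), unfolded o_def]) auto
    also have "(sqrt (dirichlet \<Omega> u) + 0) ^ 4 = (dirichlet \<Omega> u)\<^sup>2"
      using power_mult[of "sqrt (dirichlet \<Omega> u)" 2 2] by (simp add: dirichlet_nonneg)
    finally have le: "(\<integral>\<^sup>+x. ennreal ((u x) ^ 4) \<partial>M) \<le> ennreal (C * (dirichlet \<Omega> u)\<^sup>2)" .
    have i: "integrable M (\<lambda>x. (u x) ^ 4)"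
      using le by (intro integrableI_bounded) (auto simp: le_less_trans)
    moreover have "(LINT x|M. (u x) ^ 4) \<le> C * (dirichlet \<Omega> u)\<^sup>2"
      using le C(1) by (subst (asm) nn_integral_eq_integral[OF i]) (auto simp: ennreal_le_iff)
    ultimately show ?thesis by simp
  qed
  then show ?thesis using C(1) by blast
qed

end

subsection \<open>The nonlinearity\<close>

text \<open>Subadditivity of the concave power: on the unit interval
  \<open>s \<le> s powr r\<close>, and this is applied to \<open>y/x\<close> and
  \<open>(x - y)/x\<close>, which sum to 1.\<close>

lemma powr_diff_le:
  fixes x y r :: real
  assumes "0 \<le> x" "0 \<le> y" "0 < r" "r \<le> 1"
  shows "\<bar>x powr r - y powr r\<bar> \<le> \<bar>x - y\<bar> powr r"
proof -
  have *: "x powr r \<le> y powr r + (x - y) powr r" if "0 \<le> y" "y \<le> x" for x y :: real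
  proof (cases "x = 0")
    case False
    then have x: "x > 0" using that by simp
    have le: "s \<le> s powr r" if "0 \<le> s" "s \<le> 1" for s :: real
    proof (cases "s = 0")
      case False
      then have "s powr 1 \<le> s powr r" using that assms by (intro powr_mono') auto
      then show ?thesis using that by simp
    qed simp
    have "1 = y / x + (x - y) / x" using x by (simp add: field_simps)
    also have "\<dots> \<le> (y / x) powr r + ((x - y) / x) powr r"
      using that x by (intro add_mono le) auto
    also have "\<dots> = (y powr r + (x - y) powr r) / x powr r"
      using that x by (simp add: powr_divide add_divide_distrib)
    finally show ?thesis using x by (simp add: field_simps)
  qed (use that assms in auto)
  show ?thesis
    using *[of y x] *[of x y] assms powr_mono2[of r x y] powr_mono2[of r y x]
    by (cases "y \<le> x") (auto simp: abs_if)
qed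

lemma DERIV_abs_powr_times:
  fixes t q :: real
  assumes "q > 0"
  shows "((\<lambda>t. \<bar>t\<bar> powr q * t) has_real_derivative (q + 1) * \<bar>t\<bar> powr q) (at t)"
proof -
  consider "t > 0" | "t < 0" | "t = 0" by linarith
  then show ?thesis
  proof cases
    case 1
    have "((\<lambda>t. t powr (q + 1)) has_real_derivative (q + 1) * t powr q) (at t)"
      using 1 has_real_derivative_powr[of t "q + 1"] by simp
    then have "((\<lambda>t. \<bar>t\<bar> powr q * t) has_real_derivative (q + 1) * t powr q) (at t)"
      by (rule has_field_derivative_transform_within_open[where S="{0<..}"])
        (use 1 in \<open>auto simp: powr_add\<close>)
    then show ?thesis using 1 by simp
  next
    case 2
    have "((\<lambda>t. - ((- t) powr (q + 1))) has_real_derivative (q + 1) * (- t) powr q) (at t)"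
      using 2 by (auto intro!: derivative_eq_intros)
    then have "((\<lambda>t. \<bar>t\<bar> powr q * t) has_real_derivative (q + 1) * (- t) powr q) (at t)"
      by (rule has_field_derivative_transform_within_open[where S="{..<0}"])
        (use 2 in \<open>auto simp: powr_add\<close>)
    then show ?thesis using 2 by simp
  next
    case 3
    have "((\<lambda>h::real. \<bar>h\<bar> powr q) \<longlongrightarrow> 0) (at 0)"
      using assms by (auto intro!: tendsto_eq_intros tendsto_powr2 simp: eventually_at_filter)
    then have "((\<lambda>h::real. (\<bar>h\<bar> powr q * h) / h) \<longlongrightarrow> 0) (at 0)"
      by (rule Lim_transform_eventually) (auto simp: eventually_at_filter)
    then show ?thesis using assms by (simp add: 3 DERIV_def)
  qed
qed

lemma DERIV_abs_powr:
  fixes t p :: real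
  assumes "p > 2"
  shows "((\<lambda>t. \<bar>t\<bar> powr p) has_real_derivative p * (\<bar>t\<bar> powr (p - 2) * t)) (at t)"
proof -
  have eq: "\<bar>t\<bar> powr p = (\<bar>t\<bar> powr (p - 2) * t) * t" for t :: real
  proof (cases "t = 0")
    case False
    have "\<bar>t\<bar> powr p = \<bar>t\<bar> powr (p - 2) * \<bar>t\<bar> powr 2"
      by (subst powr_add[symmetric]) simp
    also have "\<bar>t\<bar> powr 2 = t * t"
      using False powr_realpow[of "\<bar>t\<bar>" 2] by (simp add: power2_eq_square)
    finally show ?thesis by simp
  qed simp
  have "((\<lambda>t. (\<bar>t\<bar> powr (p - 2) * t) * t) has_real_derivative
      (p - 2 + 1) * \<bar>t\<bar> powr (p - 2) * t + 1 * (\<bar>t\<bar> powr (p - 2) * t)) (at t)"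
    using assms by (intro DERIV_mult DERIV_abs_powr_times DERIV_ident) auto
  then show ?thesis by (simp add: eq[abs_def] algebra_simps)
qed

text \<open>The intermediate point is located only by its distance from \<open>u\<close>, so that
  the sign of \<open>h\<close> does not matter in later estimates.\<close>

lemma MVT_between:
  fixes f f' :: "real \<Rightarrow> real"
  assumes "\<And>x. (f has_real_derivative f' x) (at x)"
  shows "\<exists>\<xi>. \<bar>\<xi> - u\<bar> \<le> \<bar>h\<bar> \<and> f (u + h) - f u = f' \<xi> * h"
proof -
  consider "h = 0" | "h > 0" | "h < 0" by linarith
  then show ?thesis
  proof cases
    case 2
    then obtain z where "z > u" "z < u + h" "f (u + h) - f u = (u + h - u) * f' z"
      using MVT2[of u "u + h" f f'] assms by auto
    then show ?thesis by (intro exI[of _ z]) (auto simp: mult.commute)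
  next
    case 3
    then obtain z where "z > u + h" "z < u" "f u - f (u + h) = (u - (u + h)) * f' z"
      using MVT2[of "u + h" u f f'] assms by auto
    then show ?thesis by (intro exI[of _ z]) (auto simp: algebra_simps)
  qed (use assms in auto)
qed

text \<open>The mean value theorem is used twice, for the power and for its derivative. Both
  intermediate points stay within \<open>\<bar>h\<bar>\<close> of \<open>u\<close>, so
  \<open>\<bar>u\<bar> + \<bar>h\<bar>\<close> bounds them.\<close>

lemma abs_powr_taylor1:
  fixes u h \<gamma> :: real
  assumes "\<gamma> > 2"
  shows "\<bar>\<bar>u + h\<bar> powr \<gamma> - \<bar>u\<bar> powr \<gamma> - \<gamma> * (\<bar>u\<bar> powr (\<gamma> - 2) * u * h)\<bar>
    \<le> \<gamma> * (\<gamma> - 1) * ((\<bar>u\<bar> + \<bar>h\<bar>) powr (\<gamma> - 2) * h * h)"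
proof -
  let ?g = "\<lambda>t::real. \<bar>t\<bar> powr (\<gamma> - 2) * t"
  obtain \<xi> where \<xi>: "\<bar>\<xi> - u\<bar> \<le> \<bar>h\<bar>" "\<bar>u + h\<bar> powr \<gamma> - \<bar>u\<bar> powr \<gamma> = (\<gamma> * ?g \<xi>) * h"
    using MVT_between[of "\<lambda>t. \<bar>t\<bar> powr \<gamma>" "\<lambda>t. \<gamma> * ?g t" u h] DERIV_abs_powr[OF assms] by auto
  obtain \<zeta> where \<zeta>: "\<bar>\<zeta> - u\<bar> \<le> \<bar>\<xi> - u\<bar>" "?g \<xi> - ?g u = ((\<gamma> - 1) * \<bar>\<zeta>\<bar> powr (\<gamma> - 2)) * (\<xi> - u)"
    using MVT_between[of ?g "\<lambda>t. (\<gamma> - 2 + 1) * \<bar>t\<bar> powr (\<gamma> - 2)" u "\<xi> - u"]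
      DERIV_abs_powr_times[of "\<gamma> - 2"] assms by (auto simp: algebra_simps)
  have "\<bar>\<zeta>\<bar> powr (\<gamma> - 2) \<le> (\<bar>u\<bar> + \<bar>h\<bar>) powr (\<gamma> - 2)"
    using \<zeta>(1) \<xi>(1) assms by (intro powr_mono2) auto
  then have "\<bar>\<zeta>\<bar> powr (\<gamma> - 2) * \<bar>\<xi> - u\<bar> \<le> (\<bar>u\<bar> + \<bar>h\<bar>) powr (\<gamma> - 2) * \<bar>h\<bar>"
    using \<xi>(1) by (intro mult_mono) auto
  then have "(\<gamma> - 1) * (\<bar>\<zeta>\<bar> powr (\<gamma> - 2) * \<bar>\<xi> - u\<bar>) \<le> (\<gamma> - 1) * ((\<bar>u\<bar> + \<bar>h\<bar>) powr (\<gamma> - 2) * \<bar>h\<bar>)"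
    using assms by (intro mult_left_mono) auto
  then have "\<bar>?g \<xi> - ?g u\<bar> \<le> (\<gamma> - 1) * ((\<bar>u\<bar> + \<bar>h\<bar>) powr (\<gamma> - 2) * \<bar>h\<bar>)"
    unfolding \<zeta>(2) using assms by (simp add: abs_mult mult.assoc)
  then have "\<gamma> * (\<bar>?g \<xi> - ?g u\<bar> * \<bar>h\<bar>) \<le> \<gamma> * ((\<gamma> - 1) * ((\<bar>u\<bar> + \<bar>h\<bar>) powr (\<gamma> - 2) * \<bar>h\<bar>) * \<bar>h\<bar>)"
    using assms by (intro mult_left_mono mult_right_mono) auto
  also have "\<gamma> * (\<bar>?g \<xi> - ?g u\<bar> * \<bar>h\<bar>) = \<bar>\<gamma> * (?g \<xi> - ?g u) * h\<bar>"
    using assms by (simp add: abs_mult)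
  also have "\<gamma> * (?g \<xi> - ?g u) * h = \<bar>u + h\<bar> powr \<gamma> - \<bar>u\<bar> powr \<gamma> - \<gamma> * (\<bar>u\<bar> powr (\<gamma> - 2) * u * h)"
    unfolding \<xi>(2) by (simp add: algebra_simps)
  finally show ?thesis by (simp add: mult.assoc)
qed

text \<open>The exponent \<open>\<gamma> - 2\<close> may lie on either side of 1. Writing the power
  as \<open>(t^2) powr ((\<gamma> - 2) / 2)\<close> brings the exponent below 1 throughout, so that
  \<open>powr_diff_le\<close> applies without a case distinction; the price is the product
  \<open>\<bar>h\<bar> * (2 * \<bar>u\<bar> + \<bar>h\<bar>)\<close> from the difference of
  squares.\<close>

lemma abs_powr_taylor2:
  fixes u h \<gamma> :: real
  assumes "\<gamma> > 2" "\<gamma> < 4"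
  shows "\<bar>\<bar>u + h\<bar> powr (\<gamma> - 2) * (u + h) - \<bar>u\<bar> powr (\<gamma> - 2) * u - (\<gamma> - 1) * (\<bar>u\<bar> powr (\<gamma> - 2) * h)\<bar>
    \<le> (\<gamma> - 1) * ((\<bar>h\<bar> * (2 * \<bar>u\<bar> + \<bar>h\<bar>)) powr ((\<gamma> - 2) / 2) * \<bar>h\<bar>)"
proof -
  let ?g = "\<lambda>t::real. \<bar>t\<bar> powr (\<gamma> - 2) * t" and ?r = "(\<gamma> - 2) / 2"
  obtain \<xi> where \<xi>: "\<bar>\<xi> - u\<bar> \<le> \<bar>h\<bar>" "?g (u + h) - ?g u = ((\<gamma> - 1) * \<bar>\<xi>\<bar> powr (\<gamma> - 2)) * h"
    using MVT_between[of ?g "\<lambda>t. (\<gamma> - 2 + 1) * \<bar>t\<bar> powr (\<gamma> - 2)" u h]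
      DERIV_abs_powr_times[of "\<gamma> - 2"] assms by (auto simp: algebra_simps)
  have sq: "\<bar>t\<bar> powr (\<gamma> - 2) = (t\<^sup>2) powr ?r" for t :: real
  proof (cases "t = 0")
    case False
    then have "(t\<^sup>2) powr ?r = (\<bar>t\<bar> powr 2) powr ?r" by (simp add: powr_realpow)
    also have "\<dots> = \<bar>t\<bar> powr (\<gamma> - 2)" unfolding powr_powr by (simp add: diff_divide_distrib)
    finally show ?thesis ..
  qed simp
  have "\<bar>(\<xi>\<^sup>2) powr ?r - (u\<^sup>2) powr ?r\<bar> \<le> \<bar>\<xi>\<^sup>2 - u\<^sup>2\<bar> powr ?r"
    using assms by (intro powr_diff_le) auto
  also have "\<dots> \<le> (\<bar>h\<bar> * (2 * \<bar>u\<bar> + \<bar>h\<bar>)) powr ?r"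
  proof (rule powr_mono2)
    have "\<xi>\<^sup>2 - u\<^sup>2 = (\<xi> - u) * (\<xi> + u)" by (simp add: power2_eq_square algebra_simps)
    then have "\<bar>\<xi>\<^sup>2 - u\<^sup>2\<bar> = \<bar>\<xi> - u\<bar> * \<bar>\<xi> + u\<bar>" by (simp add: abs_mult)
    also have "\<dots> \<le> \<bar>h\<bar> * (2 * \<bar>u\<bar> + \<bar>h\<bar>)"
      using \<xi>(1) by (intro mult_mono) auto
    finally show "\<bar>\<xi>\<^sup>2 - u\<^sup>2\<bar> \<le> \<bar>h\<bar> * (2 * \<bar>u\<bar> + \<bar>h\<bar>)" .
  qed (use assms in auto)
  finally have le: "\<bar>\<bar>\<xi>\<bar> powr (\<gamma> - 2) - \<bar>u\<bar> powr (\<gamma> - 2)\<bar> \<le> (\<bar>h\<bar> * (2 * \<bar>u\<bar> + \<bar>h\<bar>)) powr ?r"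
    by (simp add: sq)
  have "?g (u + h) - ?g u - (\<gamma> - 1) * (\<bar>u\<bar> powr (\<gamma> - 2) * h) =
      (\<gamma> - 1) * ((\<bar>\<xi>\<bar> powr (\<gamma> - 2) - \<bar>u\<bar> powr (\<gamma> - 2)) * h)"
    unfolding \<xi>(2) by (simp add: algebra_simps)
  also have "\<bar>\<dots>\<bar> = (\<gamma> - 1) * (\<bar>\<bar>\<xi>\<bar> powr (\<gamma> - 2) - \<bar>u\<bar> powr (\<gamma> - 2)\<bar> * \<bar>h\<bar>)"
    using assms by (simp add: abs_mult)
  also have "\<dots> \<le> (\<gamma> - 1) * ((\<bar>h\<bar> * (2 * \<bar>u\<bar> + \<bar>h\<bar>)) powr ?r * \<bar>h\<bar>)"
    using assms by (intro mult_left_mono mult_right_mono le) auto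
  finally show ?thesis .
qed

lemma abs_powr_le_fourth:
  fixes t p :: real
  assumes "0 \<le> p" "p \<le> 4"
  shows "\<bar>t\<bar> powr p \<le> 1 + t ^ 4"
proof (cases "\<bar>t\<bar> \<le> 1")
  case True
  have "\<bar>t\<bar> powr p \<le> 1"
    using True assms by (cases "t = 0") (auto intro: powr_le1)
  moreover have "0 \<le> t ^ 4" by simp
  ultimately show ?thesis by linarith
next
  case False
  then have "\<bar>t\<bar> powr p \<le> \<bar>t\<bar> powr 4" using assms by (intro powr_mono) auto
  also have "\<dots> = t ^ 4" using False powr_realpow[of "\<bar>t\<bar>" 4] by simp
  finally show ?thesis by simp
qed

lemma sum_fourth_le: "(x + y) ^ 4 \<le> 8 * (x ^ 4 + y ^ 4)" for x y :: real
  using fourth_power_convex[of 1 1 x y] by simp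

section \<open>Hoelder estimates from the L4 embedding\<close>

context bounded_open3 begin

definition C4 :: real where
  "C4 = (SOME C. C > 0 \<and> (\<forall>u\<in>H01 \<Omega>. integrable M (\<lambda>x. (u x) ^ 4) \<and>
     (LINT x|M. (u x) ^ 4) \<le> C * (dirichlet \<Omega> u)\<^sup>2))"

lemma C4: "C4 > 0" "u \<in> H01 \<Omega> \<Longrightarrow> integrable M (\<lambda>x. (u x) ^ 4)"
  "u \<in> H01 \<Omega> \<Longrightarrow> (LINT x|M. (u x) ^ 4) \<le> C4 * (dirichlet \<Omega> u)\<^sup>2"
  using someI_ex[of "\<lambda>C. C > 0 \<and> (\<forall>u\<in>H01 \<Omega>. integrable M (\<lambda>x. (u x) ^ 4) \<and>
     (LINT x|M. (u x) ^ 4) \<le> C * (dirichlet \<Omega> u)\<^sup>2)"] Sobolev_L4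
  unfolding C4_def[symmetric] by auto

lemma H01_measurable: "u \<in> H01 \<Omega> \<Longrightarrow> u \<in> borel_measurable M"
  using H01_H1 H1_sqi sqiD(1) by blast

lemma sqi_product:
  fixes f g :: "'a \<Rightarrow> real"
  assumes [measurable]: "f \<in> borel_measurable M" "g \<in> borel_measurable M"
    and i: "integrable M (\<lambda>x. (f x) ^ 4)" "integrable M (\<lambda>x. (g x) ^ 4)"
  shows "sqi (\<lambda>x. f x * g x)"
    "(LINT x|M. (f x * g x)\<^sup>2) \<le> sqrt (LINT x|M. (f x) ^ 4) * sqrt (LINT x|M. (g x) ^ 4)"
proof -
  have p4: "(t\<^sup>2)\<^sup>2 = t ^ 4" for t :: real by (simp flip: power_mult)
  have s: "sqi (\<lambda>x. (f x)\<^sup>2)" "sqi (\<lambda>x. (g x)\<^sup>2)"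
    using i by (auto simp: square_integrable_def p4)
  have eq: "(f x * g x)\<^sup>2 = (f x)\<^sup>2 \<bullet> (g x)\<^sup>2" for x by (simp add: power_mult_distrib)
  show "sqi (\<lambda>x. f x * g x)"
    using sqi_inner[OF s] by (simp add: square_integrable_def power_mult_distrib)
  have "(LINT x|M. (f x * g x)\<^sup>2) \<le> \<bar>LINT x|M. (f x)\<^sup>2 \<bullet> (g x)\<^sup>2\<bar>" unfolding eq by (rule abs_ge_self)
  also have "\<dots> \<le> sqrt (LINT x|M. (norm ((f x)\<^sup>2))\<^sup>2) * sqrt (LINT x|M. (norm ((g x)\<^sup>2))\<^sup>2)"
    by (rule Cauchy_Schwarz_integral) (use s in \<open>auto simp: square_integrable_def\<close>)
  finally show "(LINT x|M. (f x * g x)\<^sup>2) \<le> sqrt (LINT x|M. (f x) ^ 4) * sqrt (LINT x|M. (g x) ^ 4)"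
    by (simp add: p4)
qed

text \<open>Hoelder with exponents 2, 4, 4, obtained from two applications of Cauchy-Schwarz. In all
  derivative estimates the weight carries the nonlinearity in L2 and the directions are measured in
  L4.\<close>

lemma trilinear:
  fixes w :: "'a \<Rightarrow> real"
  assumes w: "sqi w" and h: "h \<in> H01 \<Omega>" and k: "k \<in> H01 \<Omega>"
  shows "integrable M (\<lambda>x. w x * h x * k x)"
    "(LINT x|M. \<bar>w x * h x * k x\<bar>) \<le> sqrt (LINT x|M. (w x)\<^sup>2) * sqrt C4 * H01_norm \<Omega> h * H01_norm \<Omega> k"
    "\<bar>LINT x|M. w x * h x * k x\<bar> \<le> sqrt (LINT x|M. (w x)\<^sup>2) * sqrt C4 * H01_norm \<Omega> h * H01_norm \<Omega> k"
proof -
  note p = sqi_product[OF H01_measurable[OF h] H01_measurable[OF k] C4(2)[OF h] C4(2)[OF k]]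
  have s4: "sqrt (LINT x|M. (u x) ^ 4) \<le> sqrt C4 * dirichlet \<Omega> u" if "u \<in> H01 \<Omega>" for u
  proof -
    have "sqrt (LINT x|M. (u x) ^ 4) \<le> sqrt (C4 * (dirichlet \<Omega> u)\<^sup>2)" using C4(3)[OF that] by simp
    then show ?thesis using dirichlet_nonneg by (simp add: real_sqrt_mult)
  qed
  show "integrable M (\<lambda>x. w x * h x * k x)" using sqi_inner[OF w p(1)] by (simp add: mult.assoc)
  have "(LINT x|M. (h x * k x)\<^sup>2) \<le> (sqrt C4 * dirichlet \<Omega> h) * (sqrt C4 * dirichlet \<Omega> k)"
    by (rule order_trans[OF p(2)]) (use C4(1) dirichlet_nonneg in \<open>intro mult_mono s4 h k, auto\<close>)
  also have "\<dots> = C4 * (dirichlet \<Omega> h * dirichlet \<Omega> k)" using C4(1) by simp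
  finally have "sqrt (LINT x|M. (h x * k x)\<^sup>2) \<le> sqrt (C4 * (dirichlet \<Omega> h * dirichlet \<Omega> k))" by simp
  also have "\<dots> = sqrt C4 * (H01_norm \<Omega> h * H01_norm \<Omega> k)" by (simp add: H01_norm_def real_sqrt_mult)
  finally have le: "sqrt (LINT x|M. (h x * k x)\<^sup>2) \<le> sqrt C4 * (H01_norm \<Omega> h * H01_norm \<Omega> k)" .
  have "(LINT x|M. \<bar>w x * h x * k x\<bar>) \<le> \<bar>LINT x|M. \<bar>w x\<bar> \<bullet> \<bar>h x * k x\<bar>\<bar>"
    by (simp add: abs_mult mult.assoc)
  also have "\<dots> \<le> sqrt (LINT x|M. (norm \<bar>w x\<bar>)\<^sup>2) * sqrt (LINT x|M. (norm \<bar>h x * k x\<bar>)\<^sup>2)"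
    by (rule Cauchy_Schwarz_integral) (use sqiD[OF w] sqiD[OF p(1)] in auto)
  also have "\<dots> \<le> sqrt (LINT x|M. (w x)\<^sup>2) * (sqrt C4 * (H01_norm \<Omega> h * H01_norm \<Omega> k))"
    using le by (auto intro: mult_left_mono)
  finally show "(LINT x|M. \<bar>w x * h x * k x\<bar>) \<le> sqrt (LINT x|M. (w x)\<^sup>2) * sqrt C4 * H01_norm \<Omega> h * H01_norm \<Omega> k"
    by (simp add: mult.assoc)
  then show "\<bar>LINT x|M. w x * h x * k x\<bar> \<le> sqrt (LINT x|M. (w x)\<^sup>2) * sqrt C4 * H01_norm \<Omega> h * H01_norm \<Omega> k"
    by (rule order_trans[OF integral_abs_bound])
qed

end

section \<open>The potential term and its expansions to first and second order\<close>

locale superquadratic = bounded_open3 +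
  fixes \<gamma> :: real
  assumes gamma: "2 < \<gamma>" "\<gamma> < 4"
begin

definition pot :: "('a \<Rightarrow> real) \<Rightarrow> real" where
  "pot u = (LINT x|M. \<bar>u x\<bar> powr \<gamma>)"

definition dpot :: "('a \<Rightarrow> real) \<Rightarrow> ('a \<Rightarrow> real) \<Rightarrow> real" where
  "dpot u h = (LINT x|M. \<bar>u x\<bar> powr (\<gamma> - 2) * u x * h x)"

definition d2pot :: "('a \<Rightarrow> real) \<Rightarrow> ('a \<Rightarrow> real) \<Rightarrow> ('a \<Rightarrow> real) \<Rightarrow> real" where
  "d2pot u h k = (\<gamma> - 1) * (LINT x|M. \<bar>u x\<bar> powr (\<gamma> - 2) * h x * k x)"

lemma pot_integrable: "u \<in> H01 \<Omega> \<Longrightarrow> integrable M (\<lambda>x. \<bar>u x\<bar> powr \<gamma>)"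
proof (rule Bochner_Integration.integrable_bound)
  assume u: "u \<in> H01 \<Omega>"
  have [measurable]: "u \<in> borel_measurable M" by (rule H01_measurable[OF u])
  show "integrable M (\<lambda>x. 1 + (u x) ^ 4)" using C4(2)[OF u] by simp
  show "(\<lambda>x. \<bar>u x\<bar> powr \<gamma>) \<in> borel_measurable M" by measurable
  show "AE x in M. norm (\<bar>u x\<bar> powr \<gamma>) \<le> norm (1 + (u x) ^ 4)"
    using gamma abs_powr_le_fourth[of \<gamma>] by (intro AE_I2) simp
qed

text \<open>Since \<open>2 * (\<gamma> - 2) < 4\<close>, the squared weight is dominated by
  \<open>1 + f^4\<close>.\<close>

lemma weight_sqi:
  fixes f :: "'a \<Rightarrow> real"
  assumes [measurable]: "f \<in> borel_measurable M" and i: "integrable M (\<lambda>x. (f x) ^ 4)"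
  shows "sqi (\<lambda>x. \<bar>f x\<bar> powr (\<gamma> - 2))"
    "(LINT x|M. (\<bar>f x\<bar> powr (\<gamma> - 2))\<^sup>2) \<le> measure M \<Omega> + (LINT x|M. (f x) ^ 4)"
proof -
  have eq: "(\<bar>t\<bar> powr (\<gamma> - 2))\<^sup>2 = \<bar>t\<bar> powr (2 * (\<gamma> - 2))" for t :: real
    by (simp add: power2_eq_square flip: powr_add)
  have le: "(\<bar>f x\<bar> powr (\<gamma> - 2))\<^sup>2 \<le> 1 + (f x) ^ 4" for x
    unfolding eq using gamma by (intro abs_powr_le_fourth) auto
  have int: "integrable M (\<lambda>x. (\<bar>f x\<bar> powr (\<gamma> - 2))\<^sup>2)"
  proof (rule Bochner_Integration.integrable_bound)
    show "integrable M (\<lambda>x. 1 + (f x) ^ 4)" using i by simp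
    show "AE x in M. norm ((\<bar>f x\<bar> powr (\<gamma> - 2))\<^sup>2) \<le> norm (1 + (f x) ^ 4)"
      using le by (intro AE_I2) simp
  qed measurable
  then show "sqi (\<lambda>x. \<bar>f x\<bar> powr (\<gamma> - 2))" by (simp add: square_integrable_def)
  have "(LINT x|M. (\<bar>f x\<bar> powr (\<gamma> - 2))\<^sup>2) \<le> (LINT x|M. 1 + (f x) ^ 4)"
    by (rule integral_mono[OF int]) (use i le in auto)
  also have "\<dots> = measure M \<Omega> + (LINT x|M. (f x) ^ 4)" using i by simp
  finally show "(LINT x|M. (\<bar>f x\<bar> powr (\<gamma> - 2))\<^sup>2) \<le> measure M \<Omega> + (LINT x|M. (f x) ^ 4)" .
qed

lemma dpot_integrable:
  assumes "u \<in> H01 \<Omega>" "h \<in> H01 \<Omega>" "k \<in> H01 \<Omega>"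
  shows "integrable M (\<lambda>x. \<bar>u x\<bar> powr (\<gamma> - 2) * h x * k x)"
  by (rule trilinear(1)[OF weight_sqi(1)[OF H01_measurable C4(2)]]) (use assms in auto)

lemma dpot_linear:
  assumes u: "u \<in> H01 \<Omega>" shows "H01_linear \<Omega> (dpot u)"
  unfolding H01_linear_def dpot_def
proof (intro conjI ballI allI)
  fix x y assume "x \<in> H01 \<Omega>" "y \<in> H01 \<Omega>"
  then show "(LINT z|M. \<bar>u z\<bar> powr (\<gamma> - 2) * u z * (x z + y z)) =
    (LINT z|M. \<bar>u z\<bar> powr (\<gamma> - 2) * u z * x z) + (LINT z|M. \<bar>u z\<bar> powr (\<gamma> - 2) * u z * y z)"
    using dpot_integrable[OF u u] by (simp only: distrib_left Bochner_Integration.integral_add)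
next
  fix c x assume "x \<in> H01 \<Omega>"
  have "(\<lambda>z. \<bar>u z\<bar> powr (\<gamma> - 2) * u z * (c * x z)) = (\<lambda>z. c * (\<bar>u z\<bar> powr (\<gamma> - 2) * u z * x z))"
    by (simp add: mult_ac)
  then show "(LINT z|M. \<bar>u z\<bar> powr (\<gamma> - 2) * u z * (c * x z)) =
      c * (LINT z|M. \<bar>u z\<bar> powr (\<gamma> - 2) * u z * x z)" by simp
qed

lemma dpot_bound:
  assumes u: "u \<in> H01 \<Omega>"
  shows "\<exists>K\<ge>0. \<forall>h\<in>H01 \<Omega>. \<bar>dpot u h\<bar> \<le> K * H01_norm \<Omega> h"
proof (intro exI conjI ballI)
  let ?K = "sqrt (LINT x|M. (\<bar>u x\<bar> powr (\<gamma> - 2))\<^sup>2) * sqrt C4 * H01_norm \<Omega> u"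
  show "?K \<ge> 0" using C4(1) by (simp add: H01_norm_nonneg)
  show "\<bar>dpot u h\<bar> \<le> ?K * H01_norm \<Omega> h" if "h \<in> H01 \<Omega>" for h
    unfolding dpot_def by (rule trilinear(3)[OF weight_sqi(1)[OF H01_measurable C4(2)]]) (use u that in auto)
qed

lemma d2pot_bilinear:
  assumes u: "u \<in> H01 \<Omega>"
  shows "H01_bounded_bilinear \<Omega> (d2pot u)"
  unfolding H01_bounded_bilinear_def
proof (intro conjI ballI)
  have c: "d2pot u h k = d2pot u k h" for h k by (simp add: d2pot_def mult_ac)
  have l: "H01_linear \<Omega> (\<lambda>v. d2pot u w v)" if "w \<in> H01 \<Omega>" for w
    unfolding H01_linear_def d2pot_def
  proof (intro conjI ballI allI)
    fix x y assume "x \<in> H01 \<Omega>" "y \<in> H01 \<Omega>"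
    then show "(\<gamma> - 1) * (LINT z|M. \<bar>u z\<bar> powr (\<gamma> - 2) * w z * (x z + y z)) =
      (\<gamma> - 1) * (LINT z|M. \<bar>u z\<bar> powr (\<gamma> - 2) * w z * x z) + (\<gamma> - 1) * (LINT z|M. \<bar>u z\<bar> powr (\<gamma> - 2) * w z * y z)"
      using dpot_integrable[OF u that] by (simp only: distrib_left Bochner_Integration.integral_add)
  next
    fix c x assume "x \<in> H01 \<Omega>"
    have "(\<lambda>z. \<bar>u z\<bar> powr (\<gamma> - 2) * w z * (c * x z)) = (\<lambda>z. c * (\<bar>u z\<bar> powr (\<gamma> - 2) * w z * x z))"
      by (simp add: mult_ac)
    then show "(\<gamma> - 1) * (LINT z|M. \<bar>u z\<bar> powr (\<gamma> - 2) * w z * (c * x z)) =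
        c * ((\<gamma> - 1) * (LINT z|M. \<bar>u z\<bar> powr (\<gamma> - 2) * w z * x z))" by simp
  qed
  then show "\<And>w. w \<in> H01 \<Omega> \<Longrightarrow> H01_linear \<Omega> (d2pot u w)" by blast
  show "\<And>w. w \<in> H01 \<Omega> \<Longrightarrow> H01_linear \<Omega> (\<lambda>v. d2pot u v w)"
  proof -
    fix w assume "w \<in> H01 \<Omega>"
    moreover have "(\<lambda>v. d2pot u v w) = d2pot u w" using c by blast
    ultimately show "H01_linear \<Omega> (\<lambda>v. d2pot u v w)" using l by simp
  qed
  show "\<exists>K. \<forall>h\<in>H01 \<Omega>. \<forall>k\<in>H01 \<Omega>. \<bar>d2pot u h k\<bar> \<le> K * H01_norm \<Omega> h * H01_norm \<Omega> k"
  proof (intro exI ballI)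
    fix h k assume hk: "h \<in> H01 \<Omega>" "k \<in> H01 \<Omega>"
    have "\<bar>d2pot u h k\<bar> = (\<gamma> - 1) * \<bar>LINT x|M. \<bar>u x\<bar> powr (\<gamma> - 2) * h x * k x\<bar>"
      using gamma by (simp add: d2pot_def abs_mult)
    also have "\<dots> \<le> (\<gamma> - 1) * (sqrt (LINT x|M. (\<bar>u x\<bar> powr (\<gamma> - 2))\<^sup>2) * sqrt C4 * H01_norm \<Omega> h * H01_norm \<Omega> k)"
      using gamma u hk by (intro mult_left_mono trilinear(3) weight_sqi(1) H01_measurable C4(2)) auto
    finally show "\<bar>d2pot u h k\<bar> \<le> (\<gamma> - 1) * (sqrt (LINT x|M. (\<bar>u x\<bar> powr (\<gamma> - 2))\<^sup>2) * sqrt C4) * H01_norm \<Omega> h * H01_norm \<Omega> k"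
      by (simp add: mult.assoc)
  qed
qed

lemma abs_sum_fourth_integrable:
  fixes f g :: "'a \<Rightarrow> real"
  assumes [measurable]: "f \<in> borel_measurable M" "g \<in> borel_measurable M"
    and i: "integrable M (\<lambda>x. (f x) ^ 4)" "integrable M (\<lambda>x. (g x) ^ 4)"
  shows "integrable M (\<lambda>x. (\<bar>f x\<bar> + \<bar>g x\<bar>) ^ 4)"
    "(LINT x|M. (\<bar>f x\<bar> + \<bar>g x\<bar>) ^ 4) \<le> 8 * ((LINT x|M. (f x) ^ 4) + (LINT x|M. (g x) ^ 4))"
proof -
  have le: "(\<bar>f x\<bar> + \<bar>g x\<bar>) ^ 4 \<le> 8 * ((f x) ^ 4 + (g x) ^ 4)" for x
    using sum_fourth_le[of "\<bar>f x\<bar>" "\<bar>g x\<bar>"] by simp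
  show int: "integrable M (\<lambda>x. (\<bar>f x\<bar> + \<bar>g x\<bar>) ^ 4)"
  proof (rule Bochner_Integration.integrable_bound)
    show "integrable M (\<lambda>x. 8 * ((f x) ^ 4 + (g x) ^ 4))" using i by simp
    show "AE x in M. norm ((\<bar>f x\<bar> + \<bar>g x\<bar>) ^ 4) \<le> norm (8 * ((f x) ^ 4 + (g x) ^ 4))"
      using le by (intro AE_I2) simp
  qed measurable
  have "(LINT x|M. (\<bar>f x\<bar> + \<bar>g x\<bar>) ^ 4) \<le> (LINT x|M. 8 * ((f x) ^ 4 + (g x) ^ 4))"
    by (rule integral_mono[OF int]) (use i le in auto)
  then show "(LINT x|M. (\<bar>f x\<bar> + \<bar>g x\<bar>) ^ 4) \<le> 8 * ((LINT x|M. (f x) ^ 4) + (LINT x|M. (g x) ^ 4))"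
    using i by simp
qed

text \<open>The pointwise remainder consists of two factors \<open>h\<close> and the weight
  \<open>(\<bar>u\<bar> + \<bar>h\<bar>) powr (\<gamma> - 2)\<close>, to which the trilinear bound
  applies. Restricting to directions of norm at most 1 bounds the weight in terms of
  \<open>u\<close> alone.\<close>

lemma pot_taylor:
  assumes u: "u \<in> H01 \<Omega>"
  shows "\<exists>K\<ge>0. \<forall>h\<in>H01 \<Omega>. H01_norm \<Omega> h \<le> 1 \<longrightarrow>
    \<bar>pot (\<lambda>x. u x + h x) - pot u - \<gamma> * dpot u h\<bar> \<le> K * (H01_norm \<Omega> h)\<^sup>2"
proof (intro exI conjI ballI impI)
  let ?W = "measure M \<Omega> + 8 * (C4 * (dirichlet \<Omega> u)\<^sup>2 + C4)"
  let ?K = "\<gamma> * (\<gamma> - 1) * (sqrt ?W * sqrt C4)"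
  show "?K \<ge> 0" using gamma C4(1) by (intro mult_nonneg_nonneg) auto
  fix h assume h: "h \<in> H01 \<Omega>" "H01_norm \<Omega> h \<le> 1"
  note m[measurable] = H01_measurable[OF u] H01_measurable[OF h(1)]
  define f where "f x = \<bar>u x\<bar> + \<bar>h x\<bar>" for x
  have fabs: "\<bar>f x\<bar> = f x" for x by (simp add: f_def)
  have fm: "f \<in> borel_measurable M" unfolding f_def by measurable
  have f4: "integrable M (\<lambda>x. (f x) ^ 4)"
    "(LINT x|M. (f x) ^ 4) \<le> 8 * ((LINT x|M. (u x) ^ 4) + (LINT x|M. (h x) ^ 4))"
    unfolding f_def by (rule abs_sum_fourth_integrable; use m u h C4(2) in simp)+
  have "dirichlet \<Omega> h \<le> 1"
    using h(2) H01_norm_nonneg[of h] by (simp add: power_le_one flip: H01_norm_sq)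
  then have "(dirichlet \<Omega> h)\<^sup>2 \<le> 1" using dirichlet_nonneg[of h] by (simp add: power_le_one)
  then have "C4 * (dirichlet \<Omega> h)\<^sup>2 \<le> C4" using C4(1) by (simp add: mult_left_le)
  then have h4: "(LINT x|M. (h x) ^ 4) \<le> C4" using C4(3)[OF h(1)] by (rule order_trans[rotated])
  have "(LINT x|M. (f x) ^ 4) \<le> 8 * (C4 * (dirichlet \<Omega> u)\<^sup>2 + C4)"
    by (rule order_trans[OF f4(2)]) (intro mult_left_mono add_mono C4(3)[OF u] h4, simp)
  then have W: "(LINT x|M. (\<bar>f x\<bar> powr (\<gamma> - 2))\<^sup>2) \<le> ?W"
    by (intro order_trans[OF weight_sqi(2)[OF fm f4(1)]] add_left_mono)
  note sq = weight_sqi(1)[OF fm f4(1)]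
  have uh: "(\<lambda>x. u x + h x) \<in> H01 \<Omega>" by (intro H01_add u h)
  have "\<bar>pot (\<lambda>x. u x + h x) - pot u - \<gamma> * dpot u h\<bar> =
    \<bar>LINT x|M. \<bar>u x + h x\<bar> powr \<gamma> - \<bar>u x\<bar> powr \<gamma> - \<gamma> * (\<bar>u x\<bar> powr (\<gamma> - 2) * u x * h x)\<bar>"
    unfolding pot_def dpot_def
    using pot_integrable[OF uh] pot_integrable[OF u] dpot_integrable[OF u u h(1)] by simp
  also have "\<dots> \<le> (LINT x|M. \<bar>\<bar>u x + h x\<bar> powr \<gamma> - \<bar>u x\<bar> powr \<gamma> - \<gamma> * (\<bar>u x\<bar> powr (\<gamma> - 2) * u x * h x)\<bar>)"
    by (rule integral_abs_bound)
  also have "\<dots> \<le> (LINT x|M. \<gamma> * (\<gamma> - 1) * (\<bar>f x\<bar> powr (\<gamma> - 2) * h x * h x))"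
  proof (rule integral_mono)
    show "integrable M (\<lambda>x. \<bar>\<bar>u x + h x\<bar> powr \<gamma> - \<bar>u x\<bar> powr \<gamma> - \<gamma> * (\<bar>u x\<bar> powr (\<gamma> - 2) * u x * h x)\<bar>)"
      using pot_integrable[OF uh] pot_integrable[OF u] dpot_integrable[OF u u h(1)] by simp
    show "integrable M (\<lambda>x. \<gamma> * (\<gamma> - 1) * (\<bar>f x\<bar> powr (\<gamma> - 2) * h x * h x))"
      using trilinear(1)[OF sq h(1) h(1)] by simp
    show "\<bar>\<bar>u x + h x\<bar> powr \<gamma> - \<bar>u x\<bar> powr \<gamma> - \<gamma> * (\<bar>u x\<bar> powr (\<gamma> - 2) * u x * h x)\<bar>
      \<le> \<gamma> * (\<gamma> - 1) * (\<bar>f x\<bar> powr (\<gamma> - 2) * h x * h x)" for x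
      unfolding fabs unfolding f_def by (rule abs_powr_taylor1[OF gamma(1)])
  qed
  also have "\<dots> = \<gamma> * (\<gamma> - 1) * (LINT x|M. \<bar>f x\<bar> powr (\<gamma> - 2) * h x * h x)" by simp
  also have "\<dots> \<le> \<gamma> * (\<gamma> - 1) * (sqrt (LINT x|M. (\<bar>f x\<bar> powr (\<gamma> - 2))\<^sup>2) * sqrt C4 * H01_norm \<Omega> h * H01_norm \<Omega> h)"
    using trilinear(3)[OF sq h(1) h(1)] gamma by (intro mult_left_mono) auto
  also have "\<dots> \<le> \<gamma> * (\<gamma> - 1) * (sqrt ?W * sqrt C4 * H01_norm \<Omega> h * H01_norm \<Omega> h)"
    using W gamma C4(1) H01_norm_nonneg[of h] by (intro mult_left_mono mult_right_mono) auto
  finally show "\<bar>pot (\<lambda>x. u x + h x) - pot u - \<gamma> * dpot u h\<bar> \<le> ?K * (H01_norm \<Omega> h)\<^sup>2"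
    by (simp add: power2_eq_square mult.assoc)
qed

text \<open>Below \<eta> the power is at most its value there, above \<eta> it is controlled by the
  square. The two terms allow \<open>dpot_taylor\<close> to make the weight small using only L2 and
  L4 norms.\<close>

lemma powr_split:
  fixes t \<eta> q :: real
  assumes "t \<ge> 0" "\<eta> > 0" "0 < q" "q < 2"
  shows "t powr q \<le> \<eta> powr q + \<eta> powr (q - 2) * t\<^sup>2"
proof (cases "t \<le> \<eta>")
  case True
  then have "t powr q \<le> \<eta> powr q" using assms by (intro powr_mono2) auto
  moreover have "0 \<le> \<eta> powr (q - 2) * t\<^sup>2" by simp
  ultimately show ?thesis by linarith
next
  case False
  then have t: "t > 0" using assms by simp
  have "t powr q = t powr (q - 2) * t powr 2" by (simp flip: powr_add)
  also have "t powr 2 = t\<^sup>2" using t by (simp add: powr_realpow)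
  also have "t powr (q - 2) * t\<^sup>2 \<le> \<eta> powr (q - 2) * t\<^sup>2"
    using False assms by (intro mult_right_mono powr_mono2') auto
  finally show ?thesis by (simp add: add_increasing)
qed

text \<open>The remainder is a trilinear form whose weight \<open>w\<close> satisfies \<open>w^2 =
  (\<bar>h\<bar> * (2 * \<bar>u\<bar> + \<bar>h\<bar>)) powr (\<gamma> - 2)\<close>. It remains to
  make the L2 norm of \<open>w\<close> small with \<open>h\<close>, uniformly in
  \<open>k\<close>.\<close>

lemma dpot_taylor:
  assumes u: "u \<in> H01 \<Omega>" and e: "e > 0"
  shows "\<exists>d>0. \<forall>h\<in>H01 \<Omega>. H01_norm \<Omega> h < d \<longrightarrow> (\<forall>k\<in>H01 \<Omega>.
    \<bar>dpot (\<lambda>x. u x + h x) k - dpot u k - d2pot u h k\<bar> \<le> e * H01_norm \<Omega> h * H01_norm \<Omega> k)"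
proof -
  define q where "q = \<gamma> - 2"
  have q: "0 < q" "q < 2" using gamma by (auto simp: q_def)
  \<comment> \<open>\<open>e1\<close> is the target for the integral of \<open>w^2\<close>: the
    trilinear bound then has the constant \<open>(\<gamma> - 1) * sqrt e1 * sqrt C4 = e\<close>. One
    half of \<open>e1\<close> is spent on \<open>\<eta> powr q\<close> times the measure, which
    fixes \<eta>, the other on \<open>c * d^2\<close>, which fixes \<open>d\<close>. The summand 1
    in \<mu> and in \<open>c\<close> makes the divisors positive.\<close>
  define e1 where "e1 = (e / ((\<gamma> - 1) * sqrt C4))\<^sup>2"
  have e1: "e1 > 0" "sqrt e1 = e / ((\<gamma> - 1) * sqrt C4)"
    using e gamma C4(1) by (auto simp: e1_def)
  define \<mu> where "\<mu> = measure M \<Omega> + 1"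
  have \<mu>: "\<mu> > 0" "measure M \<Omega> \<le> \<mu>" by (auto simp: \<mu>_def add_nonneg_pos)
  define \<eta> where "\<eta> = (e1 / (2 * \<mu>)) powr (1 / q)"
  have \<eta>: "\<eta> > 0" "\<eta> powr q * \<mu> = e1 / 2"
    using e1 \<mu> q by (auto simp: \<eta>_def powr_powr)
  \<comment> \<open>\<open>W\<close> bounds the square root of the integral of \<open>f^4\<close>
    for \<open>f = 2 \<bar>u\<bar> + \<bar>h\<bar>\<close>; the 16 is the fourth power of 2.\<close>
  define W where "W = sqrt (8 * (16 * (C4 * (dirichlet \<Omega> u)\<^sup>2) + C4))"
  have W: "W \<ge> 0" unfolding W_def using C4(1) by simp
  define c where "c = \<eta> powr (q - 2) * sqrt C4 * W + 1"
  have c: "c > 0" unfolding c_def using \<eta> W C4(1) by (intro add_nonneg_pos mult_nonneg_nonneg) auto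
  define d where "d = min 1 (sqrt (e1 / (2 * c)))"
  have d: "d > 0" "d \<le> 1" "d\<^sup>2 \<le> e1 / (2 * c)"
  proof -
    show "d > 0" "d \<le> 1" using e1 c by (auto simp: d_def)
    then have "d\<^sup>2 \<le> (sqrt (e1 / (2 * c)))\<^sup>2" by (intro power_mono) (auto simp: d_def)
    then show "d\<^sup>2 \<le> e1 / (2 * c)" using e1 c by simp
  qed
  show ?thesis
  proof (intro exI[of _ d] conjI d ballI impI)
    fix h k assume h: "h \<in> H01 \<Omega>" "H01_norm \<Omega> h < d" and k: "k \<in> H01 \<Omega>"
    note m[measurable] = H01_measurable[OF u] H01_measurable[OF h(1)] H01_measurable[OF k]
    define f where "f x = \<bar>2 * u x\<bar> + \<bar>h x\<bar>" for x
    define w where "w x = (\<bar>h x\<bar> * (2 * \<bar>u x\<bar> + \<bar>h x\<bar>)) powr ((\<gamma> - 2) / 2)" for x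
    have fm[measurable]: "f \<in> borel_measurable M" unfolding f_def by measurable
    have [measurable]: "w \<in> borel_measurable M" unfolding w_def by measurable
    have u4: "integrable M (\<lambda>x. (2 * u x) ^ 4)" "(LINT x|M. (2 * u x) ^ 4) = 16 * (LINT x|M. (u x) ^ 4)"
      using C4(2)[OF u] by (simp_all add: power_mult_distrib)
    have f4: "integrable M (\<lambda>x. (f x) ^ 4)"
      "(LINT x|M. (f x) ^ 4) \<le> 8 * ((LINT x|M. (2 * u x) ^ 4) + (LINT x|M. (h x) ^ 4))"
      unfolding f_def by (rule abs_sum_fourth_integrable; use m u4 h C4(2) in simp)+
    have dh: "dirichlet \<Omega> h \<le> d\<^sup>2"
      using h(2) H01_norm_nonneg[of h] by (simp add: power_mono flip: H01_norm_sq)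
    then have "dirichlet \<Omega> h \<le> 1" using d by (meson order_trans power_le_one less_imp_le)
    then have "(dirichlet \<Omega> h)\<^sup>2 \<le> 1" using dirichlet_nonneg[of h] by (simp add: power_le_one)
    then have "C4 * (dirichlet \<Omega> h)\<^sup>2 \<le> C4" using C4(1) by (simp add: mult_left_le)
    then have h4: "(LINT x|M. (h x) ^ 4) \<le> C4" using C4(3)[OF h(1)] by (rule order_trans[rotated])
    have "(LINT x|M. (f x) ^ 4) \<le> 8 * (16 * (C4 * (dirichlet \<Omega> u)\<^sup>2) + C4)"
      by (rule order_trans[OF f4(2)]) (unfold u4(2), intro mult_left_mono add_mono C4(3)[OF u] h4, simp_all)
    then have fW: "sqrt (LINT x|M. (f x) ^ 4) \<le> W" unfolding W_def by simp
    note p = sqi_product[OF H01_measurable[OF h(1)] fm C4(2)[OF h(1)] f4(1)]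
    have "sqrt (LINT x|M. (h x) ^ 4) \<le> sqrt (C4 * (dirichlet \<Omega> h)\<^sup>2)" using C4(3)[OF h(1)] by simp
    also have "\<dots> = sqrt C4 * dirichlet \<Omega> h" using dirichlet_nonneg by (simp add: real_sqrt_mult)
    also have "\<dots> \<le> sqrt C4 * d\<^sup>2" using dh C4(1) by (intro mult_left_mono) auto
    finally have "(LINT x|M. (h x * f x)\<^sup>2) \<le> (sqrt C4 * d\<^sup>2) * W"
      using fW C4(1) by (intro order_trans[OF p(2)] mult_mono) auto
    then have hf: "\<eta> powr (q - 2) * (LINT x|M. (h x * f x)\<^sup>2) \<le> \<eta> powr (q - 2) * ((sqrt C4 * d\<^sup>2) * W)"
      by (intro mult_left_mono) auto
    have w2: "(w x)\<^sup>2 \<le> \<eta> powr q + \<eta> powr (q - 2) * (h x * f x)\<^sup>2" for x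
    proof -
      have "(w x)\<^sup>2 = (\<bar>h x\<bar> * f x) powr q"
        by (simp add: w_def f_def q_def power2_eq_square abs_mult flip: powr_add)
      also have "\<dots> \<le> \<eta> powr q + \<eta> powr (q - 2) * (\<bar>h x\<bar> * f x)\<^sup>2"
        using \<eta> q by (intro powr_split) (auto simp: f_def)
      finally show ?thesis by (simp add: power_mult_distrib)
    qed
    have ib: "integrable M (\<lambda>x. \<eta> powr q + \<eta> powr (q - 2) * (h x * f x)\<^sup>2)"
      using sqiD(2)[OF p(1)] by simp
    have wi: "integrable M (\<lambda>x. (w x)\<^sup>2)"
    proof (rule Bochner_Integration.integrable_bound[OF ib])
      show "AE x in M. norm ((w x)\<^sup>2) \<le> norm (\<eta> powr q + \<eta> powr (q - 2) * (h x * f x)\<^sup>2)"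
        using w2 by (intro AE_I2) simp
    qed measurable
    then have sw: "sqi w" by (simp add: square_integrable_def)
    have "(LINT x|M. (w x)\<^sup>2) \<le> (LINT x|M. \<eta> powr q + \<eta> powr (q - 2) * (h x * f x)\<^sup>2)"
      by (rule integral_mono[OF wi ib w2])
    also have "\<dots> = \<eta> powr q * measure M \<Omega> + \<eta> powr (q - 2) * (LINT x|M. (h x * f x)\<^sup>2)"
      using sqiD(2)[OF p(1)] by simp
    also have "\<dots> \<le> \<eta> powr q * \<mu> + \<eta> powr (q - 2) * ((sqrt C4 * d\<^sup>2) * W)"
      using \<mu> by (intro add_mono hf mult_left_mono) auto
    also have "\<dots> \<le> e1 / 2 + c * d\<^sup>2"
      unfolding \<eta>(2) c_def by (simp add: algebra_simps)
    also have "\<dots> \<le> e1 / 2 + c * (e1 / (2 * c))"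
      using c d(3) by (intro add_left_mono mult_left_mono) auto
    also have "\<dots> = e1" using c by (simp add: field_simps)
    finally have w1: "sqrt (LINT x|M. (w x)\<^sup>2) \<le> e / ((\<gamma> - 1) * sqrt C4)"
      unfolding e1(2)[symmetric] by simp
    have uh: "(\<lambda>x. u x + h x) \<in> H01 \<Omega>" by (intro H01_add u h)
    have triw: "integrable M (\<lambda>x. \<bar>w x * h x * k x\<bar>)" using trilinear(1)[OF sw h(1) k] by simp
    let ?R = "\<lambda>x. \<bar>u x + h x\<bar> powr (\<gamma> - 2) * (u x + h x) * k x - \<bar>u x\<bar> powr (\<gamma> - 2) * u x * k x
        - (\<gamma> - 1) * (\<bar>u x\<bar> powr (\<gamma> - 2) * h x * k x)"
    note ints = dpot_integrable[OF uh uh k] dpot_integrable[OF u u k] dpot_integrable[OF u h(1) k]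
    have "\<bar>dpot (\<lambda>x. u x + h x) k - dpot u k - d2pot u h k\<bar> = \<bar>LINT x|M. ?R x\<bar>"
      unfolding dpot_def d2pot_def using ints by simp
    also have "\<dots> \<le> (LINT x|M. \<bar>?R x\<bar>)" by (rule integral_abs_bound)
    also have "\<dots> \<le> (LINT x|M. (\<gamma> - 1) * \<bar>w x * h x * k x\<bar>)"
    proof (rule integral_mono)
      show "integrable M (\<lambda>x. \<bar>?R x\<bar>)" using ints by simp
      show "integrable M (\<lambda>x. (\<gamma> - 1) * \<bar>w x * h x * k x\<bar>)" using triw by simp
      fix x
      have "?R x = (\<bar>u x + h x\<bar> powr (\<gamma> - 2) * (u x + h x) - \<bar>u x\<bar> powr (\<gamma> - 2) * u x
        - (\<gamma> - 1) * (\<bar>u x\<bar> powr (\<gamma> - 2) * h x)) * k x" by (simp add: algebra_simps)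
      also have "\<bar>\<dots>\<bar> \<le> (\<gamma> - 1) * (w x * \<bar>h x\<bar>) * \<bar>k x\<bar>"
        unfolding abs_mult[of _ "k x"] w_def by (intro mult_right_mono abs_powr_taylor2 gamma) auto
      also have "\<dots> = (\<gamma> - 1) * \<bar>w x * h x * k x\<bar>"
        by (simp add: abs_mult w_def)
      finally show "\<bar>?R x\<bar> \<le> (\<gamma> - 1) * \<bar>w x * h x * k x\<bar>" .
    qed
    also have "\<dots> = (\<gamma> - 1) * (LINT x|M. \<bar>w x * h x * k x\<bar>)" by simp
    also have "\<dots> \<le> (\<gamma> - 1) * (sqrt (LINT x|M. (w x)\<^sup>2) * sqrt C4 * H01_norm \<Omega> h * H01_norm \<Omega> k)"
      using gamma by (intro mult_left_mono trilinear(2)[OF sw h(1) k]) auto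
    also have "\<dots> \<le> (\<gamma> - 1) * (e / ((\<gamma> - 1) * sqrt C4) * sqrt C4 * H01_norm \<Omega> h * H01_norm \<Omega> k)"
      using w1 gamma C4(1) H01_norm_nonneg by (intro mult_left_mono mult_right_mono) auto
    also have "\<dots> = e * H01_norm \<Omega> h * H01_norm \<Omega> k"
      using gamma C4(1) by (simp add: field_simps)
    finally show "\<bar>dpot (\<lambda>x. u x + h x) k - dpot u k - d2pot u h k\<bar> \<le> e * H01_norm \<Omega> h * H01_norm \<Omega> k" .
  qed
qed

end

subsection \<open>Derivatives of the functional\<close>

context superquadratic begin

abbreviation \<Phi> :: "real \<Rightarrow> real \<Rightarrow> ('a \<Rightarrow> real) \<Rightarrow> real" where
  "\<Phi> a l \<equiv> kirchhoff_functional \<Omega> a \<gamma> l"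

lemma \<Phi>_eq: "\<Phi> a l u = a / 2 * dirichlet \<Omega> u + l / 4 * (dirichlet \<Omega> u)\<^sup>2 - 1 / \<gamma> * pot u"
  by (simp add: kirchhoff_functional_def pot_def)

definition d\<Phi> :: "real \<Rightarrow> real \<Rightarrow> ('a \<Rightarrow> real) \<Rightarrow> ('a \<Rightarrow> real) \<Rightarrow> real" where
  "d\<Phi> a l u h = (a + l * dirichlet \<Omega> u) * ip u h - dpot u h"

definition d2\<Phi> :: "real \<Rightarrow> real \<Rightarrow> ('a \<Rightarrow> real) \<Rightarrow> ('a \<Rightarrow> real) \<Rightarrow> ('a \<Rightarrow> real) \<Rightarrow> real" where
  "d2\<Phi> a l u h k = (a + l * dirichlet \<Omega> u) * ip h k + 2 * l * ip u h * ip u k - d2pot u h k"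

lemma ip_add:
  assumes "u \<in> H01 \<Omega>" "v \<in> H01 \<Omega>" "w \<in> H01 \<Omega>"
  shows "ip (\<lambda>x. u x + v x) w = ip u w + ip v w" "ip w (\<lambda>x. u x + v x) = ip w u + ip w v"
  using ip_add_H1[of u v w] assms H01_H1 by (simp_all add: ip_commute[of w])

lemma ip_cmult:
  assumes "u \<in> H01 \<Omega>" "w \<in> H01 \<Omega>"
  shows "ip (\<lambda>x. c * u x) w = c * ip u w" "ip w (\<lambda>x. c * u x) = c * ip w u"
  using ip_cmult_H1[of u w] assms H01_H1 by (simp_all add: ip_commute[of w])

lemma d\<Phi>_bounded_linear:
  assumes u: "u \<in> H01 \<Omega>" shows "H01_bounded_linear \<Omega> (d\<Phi> a l u)"
proof -
  note dl = dpot_linear[OF u, unfolded H01_linear_def]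
  have lin: "H01_linear \<Omega> (d\<Phi> a l u)"
    unfolding H01_linear_def d\<Phi>_def using u dl by (auto simp: ip_add ip_cmult algebra_simps)
  obtain K where K: "K \<ge> 0" "\<And>h. h \<in> H01 \<Omega> \<Longrightarrow> \<bar>dpot u h\<bar> \<le> K * H01_norm \<Omega> h"
    using dpot_bound[OF u] by blast
  have "\<bar>d\<Phi> a l u h\<bar> \<le> (\<bar>a + l * dirichlet \<Omega> u\<bar> * H01_norm \<Omega> u + K) * H01_norm \<Omega> h" if h: "h \<in> H01 \<Omega>" for h
  proof -
    have "\<bar>d\<Phi> a l u h\<bar> \<le> \<bar>a + l * dirichlet \<Omega> u\<bar> * \<bar>ip u h\<bar> + \<bar>dpot u h\<bar>"
      unfolding d\<Phi>_def by (metis abs_mult abs_triangle_ineq4)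
    also have "\<dots> \<le> \<bar>a + l * dirichlet \<Omega> u\<bar> * (H01_norm \<Omega> u * H01_norm \<Omega> h) + K * H01_norm \<Omega> h"
      by (intro add_mono mult_left_mono ip_Cauchy_Schwarz K H01_H1 u h) auto
    finally show ?thesis by (simp add: algebra_simps)
  qed
  with lin show ?thesis unfolding H01_bounded_linear_def by blast
qed

lemma small_times:
  fixes K e :: real
  assumes "K \<ge> 0" "e > 0"
  obtains d where "d > 0" "d \<le> 1" "\<And>t. 0 \<le> t \<Longrightarrow> t < d \<Longrightarrow> K * t \<le> e"
proof
  show "min 1 (e / (K + 1)) > 0" "min 1 (e / (K + 1)) \<le> 1" using assms by auto
  fix t :: real assume t: "0 \<le> t" "t < min 1 (e / (K + 1))"
  then have "t \<le> e / (K + 1)" by simp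
  then have "(K + 1) * t \<le> e" using assms by (simp add: field_simps)
  then show "K * t \<le> e" using t by (simp add: algebra_simps)
qed

lemma \<Phi>_derivative:
  assumes u: "u \<in> H01 \<Omega>" shows "has_H01_derivative \<Omega> (\<Phi> a l) (d\<Phi> a l u) u"
  unfolding has_H01_derivative_def
proof (intro conjI d\<Phi>_bounded_linear u allI impI)
  fix e :: real assume e: "e > 0"
  obtain K where K: "K \<ge> 0" "\<And>h. h \<in> H01 \<Omega> \<Longrightarrow> H01_norm \<Omega> h \<le> 1 \<Longrightarrow>
    \<bar>pot (\<lambda>x. u x + h x) - pot u - \<gamma> * dpot u h\<bar> \<le> K * (H01_norm \<Omega> h)\<^sup>2"
    using pot_taylor[OF u] by blast
  define Du where "Du = dirichlet \<Omega> u"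
  \<comment> \<open>The expansion of the functional is exact, and \<open>A\<close> adds up the
    coefficients of \<open>n^2\<close> in its three remainder terms: the quadratic part of the norm,
    the square of the increment of the Dirichlet integral, and the Taylor remainder of the
    potential.\<close>
  define A where "A = \<bar>a / 2 + l / 2 * Du\<bar> + \<bar>l / 4\<bar> * (2 * H01_norm \<Omega> u + 1)\<^sup>2 + K / \<gamma>"
  have A: "A \<ge> 0" unfolding A_def using K(1) gamma by (intro add_nonneg_nonneg) auto
  obtain d where d: "d > 0" "d \<le> 1" "\<And>t. 0 \<le> t \<Longrightarrow> t < d \<Longrightarrow> A * t \<le> e"
    using small_times[OF A e] by blast
  show "\<exists>d>0. \<forall>h\<in>H01 \<Omega>. H01_norm \<Omega> h < d \<longrightarrow>
        \<bar>\<Phi> a l (\<lambda>x. u x + h x) - \<Phi> a l u - d\<Phi> a l u h\<bar> \<le> e * H01_norm \<Omega> h"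
  proof (intro exI[of _ d] conjI d ballI impI)
    fix h assume h: "h \<in> H01 \<Omega>" "H01_norm \<Omega> h < d"
    define n where "n = H01_norm \<Omega> h"
    define i where "i = ip u h"
    define R where "R = pot (\<lambda>x. u x + h x) - pot u - \<gamma> * dpot u h"
    have n: "0 \<le> n" "n < d" "n \<le> 1" using h d by (auto simp: n_def H01_norm_nonneg)
    have Dh: "dirichlet \<Omega> h = n\<^sup>2" by (simp add: n_def H01_norm_sq)
    have R: "\<bar>R\<bar> \<le> K * n\<^sup>2" unfolding R_def n_def using K(2) h n by (simp add: n_def)
    have i: "\<bar>i\<bar> \<le> H01_norm \<Omega> u * n"
      unfolding i_def n_def by (intro ip_Cauchy_Schwarz H01_H1 u h)
    have pot: "pot (\<lambda>x. u x + h x) = pot u + \<gamma> * dpot u h + R" by (simp add: R_def)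
    have D: "dirichlet \<Omega> (\<lambda>x. u x + h x) = Du + 2 * i + n\<^sup>2"
      using dirichlet_add[OF H01_H1[OF u] H01_H1[OF h(1)]] by (simp add: Du_def i_def Dh)
    have eq: "\<Phi> a l (\<lambda>x. u x + h x) - \<Phi> a l u - d\<Phi> a l u h =
        (a / 2 + l / 2 * Du) * n\<^sup>2 + l / 4 * (2 * i + n\<^sup>2)\<^sup>2 - R / \<gamma>"
      unfolding \<Phi>_eq d\<Phi>_def D pot Du_def[symmetric] i_def[symmetric]
      using gamma by (simp add: field_simps power2_eq_square)
    have "\<bar>2 * i + n\<^sup>2\<bar> \<le> 2 * \<bar>i\<bar> + n * n"
      using abs_triangle_ineq[of "2 * i" "n\<^sup>2"] by (simp add: abs_mult power2_eq_square)
    also have "\<dots> \<le> 2 * (H01_norm \<Omega> u * n) + 1 * n"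
      using i n by (intro add_mono mult_left_mono mult_right_mono) auto
    also have "\<dots> = (2 * H01_norm \<Omega> u + 1) * n" by (simp add: algebra_simps)
    finally have "\<bar>2 * i + n\<^sup>2\<bar>\<^sup>2 \<le> ((2 * H01_norm \<Omega> u + 1) * n)\<^sup>2" by (intro power_mono) auto
    then have sq: "(2 * i + n\<^sup>2)\<^sup>2 \<le> (2 * H01_norm \<Omega> u + 1)\<^sup>2 * n\<^sup>2" by (simp add: power_mult_distrib)
    have "\<bar>(a / 2 + l / 2 * Du) * n\<^sup>2 + l / 4 * (2 * i + n\<^sup>2)\<^sup>2 - R / \<gamma>\<bar> \<le>
      \<bar>(a / 2 + l / 2 * Du) * n\<^sup>2\<bar> + \<bar>l / 4 * (2 * i + n\<^sup>2)\<^sup>2\<bar> + \<bar>R / \<gamma>\<bar>"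
      by linarith
    also have "\<dots> = \<bar>a / 2 + l / 2 * Du\<bar> * n\<^sup>2 + \<bar>l / 4\<bar> * (2 * i + n\<^sup>2)\<^sup>2 + \<bar>R\<bar> / \<gamma>"
      using gamma by (simp add: abs_mult)
    also have "\<dots> \<le> \<bar>a / 2 + l / 2 * Du\<bar> * n\<^sup>2 + \<bar>l / 4\<bar> * ((2 * H01_norm \<Omega> u + 1)\<^sup>2 * n\<^sup>2) + (K * n\<^sup>2) / \<gamma>"
      using gamma R sq by (intro add_mono mult_left_mono divide_right_mono) auto
    also have "\<dots> = (A * n) * n" unfolding A_def by (simp add: algebra_simps power2_eq_square)
    also have "\<dots> \<le> e * n" using d(3)[OF n(1,2)] n by (intro mult_right_mono) auto
    finally show "\<bar>\<Phi> a l (\<lambda>x. u x + h x) - \<Phi> a l u - d\<Phi> a l u h\<bar> \<le> e * H01_norm \<Omega> h"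
      unfolding eq n_def .
  qed
qed

lemma d2\<Phi>_bilinear:
  assumes u: "u \<in> H01 \<Omega>" shows "H01_bounded_bilinear \<Omega> (d2\<Phi> a l u)"
proof -
  note b = d2pot_bilinear[OF u, unfolded H01_bounded_bilinear_def H01_linear_def]
  obtain K where K: "\<And>h k. h \<in> H01 \<Omega> \<Longrightarrow> k \<in> H01 \<Omega> \<Longrightarrow> \<bar>d2pot u h k\<bar> \<le> K * H01_norm \<Omega> h * H01_norm \<Omega> k"
    using b by blast
  have "\<bar>d2\<Phi> a l u h k\<bar> \<le> (\<bar>a + l * dirichlet \<Omega> u\<bar> + 2 * \<bar>l\<bar> * (H01_norm \<Omega> u)\<^sup>2 + K) * H01_norm \<Omega> h * H01_norm \<Omega> k"
    if hk: "h \<in> H01 \<Omega>" "k \<in> H01 \<Omega>" for h k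
  proof -
    have "\<bar>d2\<Phi> a l u h k\<bar> \<le> \<bar>(a + l * dirichlet \<Omega> u) * ip h k\<bar> + \<bar>2 * l * ip u h * ip u k\<bar> + \<bar>d2pot u h k\<bar>"
      unfolding d2\<Phi>_def by linarith
    also have "\<dots> = \<bar>a + l * dirichlet \<Omega> u\<bar> * \<bar>ip h k\<bar> + 2 * \<bar>l\<bar> * (\<bar>ip u h\<bar> * \<bar>ip u k\<bar>) + \<bar>d2pot u h k\<bar>"
      by (simp add: abs_mult)
    also have "\<dots> \<le> \<bar>a + l * dirichlet \<Omega> u\<bar> * (H01_norm \<Omega> h * H01_norm \<Omega> k) +
       2 * \<bar>l\<bar> * ((H01_norm \<Omega> u * H01_norm \<Omega> h) * (H01_norm \<Omega> u * H01_norm \<Omega> k)) + K * H01_norm \<Omega> h * H01_norm \<Omega> k"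
      using u hk by (intro add_mono mult_left_mono mult_mono ip_Cauchy_Schwarz K H01_H1)
        (auto simp: H01_norm_nonneg)
    finally show ?thesis by (simp add: algebra_simps power2_eq_square)
  qed
  moreover have "\<forall>w\<in>H01 \<Omega>. H01_linear \<Omega> (\<lambda>v. d2\<Phi> a l u w v)"
    unfolding H01_linear_def using u b by (auto simp: d2\<Phi>_def ip_add ip_cmult algebra_simps)
  moreover have "\<forall>w\<in>H01 \<Omega>. H01_linear \<Omega> (\<lambda>v. d2\<Phi> a l u v w)"
    unfolding H01_linear_def using u b by (auto simp: d2\<Phi>_def ip_add ip_cmult algebra_simps)
  ultimately show ?thesis unfolding H01_bounded_bilinear_def by blast
qed

lemma \<Phi>_second_derivative:
  assumes u: "u \<in> H01 \<Omega>" shows "has_H01_second_derivative \<Omega> (\<Phi> a l) (d2\<Phi> a l u) u"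
  unfolding has_H01_second_derivative_def
proof (intro conjI d2\<Phi>_bilinear u exI[of _ "d\<Phi> a l"] ballI \<Phi>_derivative allI impI)
  fix e :: real assume e: "e > 0"
  \<comment> \<open>Coefficient of \<open>n * (n * m)\<close> in the part of the remainder that
    stems from the nonlocal term; the potential receives the other half of \<open>e\<close>.\<close>
  define A where "A = \<bar>l\<bar> * (3 * H01_norm \<Omega> u + 1)"
  have A: "A \<ge> 0" unfolding A_def by (simp add: H01_norm_nonneg)
  obtain d1 where d1: "d1 > 0" "d1 \<le> 1" "\<And>t. 0 \<le> t \<Longrightarrow> t < d1 \<Longrightarrow> A * t \<le> e / 2"
    using small_times[OF A half_gt_zero[OF e]] by blast
  obtain d2 where d2: "d2 > 0" "\<And>h k. h \<in> H01 \<Omega> \<Longrightarrow> H01_norm \<Omega> h < d2 \<Longrightarrow> k \<in> H01 \<Omega> \<Longrightarrow>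
    \<bar>dpot (\<lambda>x. u x + h x) k - dpot u k - d2pot u h k\<bar> \<le> e / 2 * H01_norm \<Omega> h * H01_norm \<Omega> k"
    using dpot_taylor[OF u half_gt_zero[OF e]] by blast
  show "\<exists>d>0. \<forall>h\<in>H01 \<Omega>. H01_norm \<Omega> h < d \<longrightarrow> (\<forall>k\<in>H01 \<Omega>.
     \<bar>d\<Phi> a l (\<lambda>x. u x + h x) k - d\<Phi> a l u k - d2\<Phi> a l u h k\<bar> \<le> e * H01_norm \<Omega> h * H01_norm \<Omega> k)"
  proof (intro exI[of _ "min d1 d2"] conjI ballI impI)
    show "min d1 d2 > 0" using d1 d2 by simp
    fix h k assume h: "h \<in> H01 \<Omega>" "H01_norm \<Omega> h < min d1 d2" and k: "k \<in> H01 \<Omega>"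
    define n where "n = H01_norm \<Omega> h"
    define m where "m = H01_norm \<Omega> k"
    define i where "i = ip u h"
    define Du where "Du = dirichlet \<Omega> u"
    define U where "U = H01_norm \<Omega> u"
    define R where "R = dpot (\<lambda>x. u x + h x) k - dpot u k - d2pot u h k"
    have n: "0 \<le> n" "n < d1" "n \<le> 1" "m \<ge> 0" "U \<ge> 0"
      using h d1 by (auto simp: n_def m_def U_def H01_norm_nonneg)
    have Dh: "dirichlet \<Omega> h = n\<^sup>2" by (simp add: n_def H01_norm_sq)
    have R: "\<bar>R\<bar> \<le> e / 2 * n * m" unfolding R_def n_def m_def using d2(2) h k by simp
    have i: "\<bar>i\<bar> \<le> U * n" "\<bar>ip u k\<bar> \<le> U * m" "\<bar>ip h k\<bar> \<le> n * m"
      unfolding i_def n_def m_def U_def by (intro ip_Cauchy_Schwarz H01_H1 u h k)+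
    have D: "dirichlet \<Omega> (\<lambda>x. u x + h x) = Du + 2 * i + n\<^sup>2"
      using dirichlet_add[OF H01_H1[OF u] H01_H1[OF h(1)]] by (simp add: Du_def i_def Dh)
    have eq: "d\<Phi> a l (\<lambda>x. u x + h x) k - d\<Phi> a l u k - d2\<Phi> a l u h k =
        l * (n\<^sup>2 * ip u k + (2 * i + n\<^sup>2) * ip h k) - R"
      unfolding d\<Phi>_def d2\<Phi>_def D R_def Du_def[symmetric] i_def[symmetric] ip_add(1)[OF u h(1) k]
      by (simp add: algebra_simps)
    have n2: "n\<^sup>2 \<le> n" using n by (simp add: power2_eq_square mult_left_le)
    have "\<bar>n\<^sup>2 * ip u k + (2 * i + n\<^sup>2) * ip h k\<bar> \<le> n\<^sup>2 * \<bar>ip u k\<bar> + (2 * \<bar>i\<bar> + n\<^sup>2) * \<bar>ip h k\<bar>"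
    proof -
      have "\<bar>2 * i + n\<^sup>2\<bar> \<le> 2 * \<bar>i\<bar> + n\<^sup>2"
        using abs_triangle_ineq[of "2 * i" "n\<^sup>2"] by (simp add: abs_mult)
      then have "\<bar>2 * i + n\<^sup>2\<bar> * \<bar>ip h k\<bar> \<le> (2 * \<bar>i\<bar> + n\<^sup>2) * \<bar>ip h k\<bar>" by (rule mult_right_mono) simp
      moreover have "\<bar>n\<^sup>2 * ip u k + (2 * i + n\<^sup>2) * ip h k\<bar> \<le> \<bar>n\<^sup>2 * ip u k\<bar> + \<bar>(2 * i + n\<^sup>2) * ip h k\<bar>"
        by (rule abs_triangle_ineq)
      ultimately show ?thesis by (simp add: abs_mult)
    qed
    also have "\<dots> \<le> n\<^sup>2 * (U * m) + (2 * (U * n) + n) * (n * m)"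
      using i n n2 by (intro add_mono mult_mono mult_left_mono) auto
    also have "\<dots> = (3 * U + 1) * n * (n * m)" by (simp add: algebra_simps power2_eq_square)
    finally have "\<bar>l\<bar> * \<bar>n\<^sup>2 * ip u k + (2 * i + n\<^sup>2) * ip h k\<bar> \<le> \<bar>l\<bar> * ((3 * U + 1) * n * (n * m))"
      by (rule mult_left_mono) simp
    also have "\<dots> = (A * n) * (n * m)" by (simp add: A_def U_def algebra_simps)
    also have "\<dots> \<le> e / 2 * (n * m)" using d1(3)[OF n(1,2)] n by (intro mult_right_mono) auto
    finally have "\<bar>l * (n\<^sup>2 * ip u k + (2 * i + n\<^sup>2) * ip h k)\<bar> \<le> e / 2 * (n * m)" by (simp add: abs_mult)
    then have "\<bar>l * (n\<^sup>2 * ip u k + (2 * i + n\<^sup>2) * ip h k) - R\<bar> \<le> e / 2 * (n * m) + e / 2 * n * m"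
      using R abs_triangle_ineq4[of "l * (n\<^sup>2 * ip u k + (2 * i + n\<^sup>2) * ip h k)" R] by linarith
    then show "\<bar>d\<Phi> a l (\<lambda>x. u x + h x) k - d\<Phi> a l u k - d2\<Phi> a l u h k\<bar> \<le> e * H01_norm \<Omega> h * H01_norm \<Omega> k"
      unfolding eq n_def m_def by (simp add: algebra_simps)
  qed
qed

lemma H01_derivative_unique:
  assumes "has_H01_derivative \<Omega> F L u" "has_H01_derivative \<Omega> F L' u" "h \<in> H01 \<Omega>"
  shows "L h = L' h"
proof (rule ccontr)
  assume ne: "L h \<noteq> L' h"
  define N where "N = H01_norm \<Omega> h"
  \<comment> \<open>Two errors \<open>e * s * N\<close> add up to at most half of
    \<open>s * \<bar>L h - L' h\<bar>\<close> with this \<open>e\<close>, a contradiction after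
    division by \<open>s\<close>. The summand 1 admits a direction of norm zero.\<close>
  define e where "e = \<bar>L h - L' h\<bar> / (4 * (N + 1))"
  have N: "N \<ge> 0" by (simp add: N_def H01_norm_nonneg)
  have e: "e > 0" using ne N by (simp add: e_def)
  obtain d where d: "d > 0" "\<And>k. k \<in> H01 \<Omega> \<Longrightarrow> H01_norm \<Omega> k < d \<Longrightarrow> \<bar>F (\<lambda>x. u x + k x) - F u - L k\<bar> \<le> e * H01_norm \<Omega> k"
    using assms(1) e unfolding has_H01_derivative_def by blast
  obtain d' where d': "d' > 0" "\<And>k. k \<in> H01 \<Omega> \<Longrightarrow> H01_norm \<Omega> k < d' \<Longrightarrow> \<bar>F (\<lambda>x. u x + k x) - F u - L' k\<bar> \<le> e * H01_norm \<Omega> k"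
    using assms(2) e unfolding has_H01_derivative_def by blast
  define s where "s = min d d' / (2 * (N + 1))"
  have s: "s > 0" using d d' N by (simp add: s_def)
  have "s * N \<le> s * (N + 1)" using s by simp
  also have "\<dots> = min d d' / 2" using N by (simp add: s_def field_simps)
  also have "\<dots> < min d d'" using d(1) d'(1) by (simp add: min_def)
  finally have sN: "s * N < min d d'" .
  let ?k = "\<lambda>x. s * h x"
  have k: "?k \<in> H01 \<Omega>" by (rule H01_cmult[OF assms(3)])
  have nk: "H01_norm \<Omega> ?k = s * N" using H01_norm_cmult[OF H01_H1[OF assms(3)]] s by (simp add: N_def)
  have "L ?k = s * L h" "L' ?k = s * L' h"
    using assms unfolding has_H01_derivative_def H01_bounded_linear_def H01_linear_def by blast+
  then have "\<bar>F (\<lambda>x. u x + ?k x) - F u - s * L h\<bar> \<le> e * (s * N)"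
      "\<bar>F (\<lambda>x. u x + ?k x) - F u - s * L' h\<bar> \<le> e * (s * N)"
    using d(2)[OF k] d'(2)[OF k] sN unfolding nk by simp_all
  then have "\<bar>s * L h - s * L' h\<bar> \<le> e * (s * N) + e * (s * N)" by linarith
  moreover have "\<bar>s * L h - s * L' h\<bar> = s * \<bar>L h - L' h\<bar>"
    using s by (simp only: right_diff_distrib[symmetric] abs_mult abs_of_pos)
  moreover have "e * (s * N) + e * (s * N) = s * (2 * e * N)" by simp
  ultimately have "s * \<bar>L h - L' h\<bar> \<le> s * (2 * e * N)" by (simp only:)
  then have "\<bar>L h - L' h\<bar> \<le> 2 * e * N" using s by simp
  also have "\<dots> \<le> 2 * e * (N + 1)" using e by simp
  also have "\<dots> = \<bar>L h - L' h\<bar> / 2" using N by (simp add: e_def field_simps)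
  finally show False using ne by simp
qed

text \<open>A derivative is determined only on \<open>H01 \<Omega>\<close>, and its definition
  evaluates it only there; hence the zero functional may replace \<open>d\<Phi> a l u\<close> as
  soon as the latter vanishes on that space.\<close>

lemma critical_point_iff:
  assumes u: "u \<in> H01 \<Omega>"
  shows "critical_point \<Omega> (\<Phi> a l) u \<longleftrightarrow> (\<forall>h\<in>H01 \<Omega>. d\<Phi> a l u h = 0)"
proof
  assume "critical_point \<Omega> (\<Phi> a l) u"
  then show "\<forall>h\<in>H01 \<Omega>. d\<Phi> a l u h = 0"
    using H01_derivative_unique[OF \<Phi>_derivative[OF u]] unfolding critical_point_def by blast
next
  assume 0: "\<forall>h\<in>H01 \<Omega>. d\<Phi> a l u h = 0"
  have "H01_bounded_linear \<Omega> (\<lambda>h. 0)"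
    unfolding H01_bounded_linear_def H01_linear_def by (auto intro: exI[of _ 0])
  with \<Phi>_derivative[OF u, of a l] 0 u show "critical_point \<Omega> (\<Phi> a l) u"
    unfolding critical_point_def has_H01_derivative_def by auto
qed

lemma pot_cmult: "pot (\<lambda>x. c * u x) = \<bar>c\<bar> powr \<gamma> * pot u"
  by (simp add: pot_def abs_mult powr_mult)

lemma dpot_cmult: "t > 0 \<Longrightarrow> dpot (\<lambda>x. t * u x) h = t powr (\<gamma> - 1) * dpot u h"
proof -
  assume t: "t > 0"
  have "\<bar>t * u x\<bar> powr (\<gamma> - 2) * (t * u x) * h x = t powr (\<gamma> - 1) * (\<bar>u x\<bar> powr (\<gamma> - 2) * u x * h x)" for x
  proof -
    have "t powr (\<gamma> - 1) = t powr (\<gamma> - 2 + 1)" by simp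
    also have "\<dots> = t powr (\<gamma> - 2) * t" using t by (subst powr_add) simp
    finally show ?thesis using t by (simp add: abs_mult powr_mult mult_ac)
  qed
  then show ?thesis by (simp only: dpot_def integral_mult_right_zero)
qed

lemma dpot_self: "dpot u u = pot u"
proof -
  have "\<bar>t\<bar> powr (\<gamma> - 2) * t * t = \<bar>t\<bar> powr \<gamma>" for t :: real
  proof (cases "t = 0")
    case False
    have "\<bar>t\<bar> powr \<gamma> = \<bar>t\<bar> powr (\<gamma> - 2) * \<bar>t\<bar> powr 2" by (subst powr_add[symmetric]) simp
    then show ?thesis using False by (simp add: powr_realpow power2_eq_square)
  qed simp
  then show ?thesis by (simp add: dpot_def pot_def)
qed

lemma d2pot_self: "d2pot u u u = (\<gamma> - 1) * pot u"
  using dpot_self[of u] by (simp add: d2pot_def dpot_def)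

lemma pot_nonneg: "pot u \<ge> 0" by (simp add: pot_def)

end

subsection \<open>Extremals of the Sobolev quotient\<close>

context superquadratic begin

text \<open>Continuity of the potential in L4, uniform on the unit ball: convergence supplied by
  Rellich thus controls \<open>pot\<close> before any convergence of gradients is known. The mean
  value theorem bounds the increment by \<open>\<gamma> f^(\<gamma> - 1) \<bar>h\<bar>\<close> with
  \<open>f = \<bar>u\<bar> + \<bar>h\<bar>\<close>; the iterated square root is the L4 norm.\<close>

lemma pot_increment_L4:
  "\<exists>K>0. \<forall>u\<in>H01 \<Omega>. \<forall>h\<in>H01 \<Omega>. dirichlet \<Omega> u \<le> 1 \<longrightarrow> dirichlet \<Omega> h \<le> 1 \<longrightarrow>
    \<bar>pot (\<lambda>x. u x + h x) - pot u\<bar> \<le> K * sqrt (sqrt (LINT x|M. (h x) ^ 4))"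
proof -
  define K where "K = \<gamma> * (sqrt (measure M \<Omega> + 16 * C4) * sqrt (sqrt (16 * C4))) + 1"
  have K: "K > 0" unfolding K_def using gamma C4(1) by (intro add_nonneg_pos mult_nonneg_nonneg) auto
  have "\<bar>pot (\<lambda>x. u x + h x) - pot u\<bar> \<le> K * sqrt (sqrt (LINT x|M. (h x) ^ 4))"
    if u: "u \<in> H01 \<Omega>" "dirichlet \<Omega> u \<le> 1" and h: "h \<in> H01 \<Omega>" "dirichlet \<Omega> h \<le> 1" for u h
  proof -
    note m[measurable] = H01_measurable[OF u(1)] H01_measurable[OF h(1)]
    define f where "f x = \<bar>u x\<bar> + \<bar>h x\<bar>" for x
    have f0: "f x \<ge> 0" for x by (simp add: f_def)
    have fm[measurable]: "f \<in> borel_measurable M" unfolding f_def by measurable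
    have f4: "integrable M (\<lambda>x. (f x) ^ 4)"
      "(LINT x|M. (f x) ^ 4) \<le> 8 * ((LINT x|M. (u x) ^ 4) + (LINT x|M. (h x) ^ 4))"
      unfolding f_def by (rule abs_sum_fourth_integrable; use m u h C4(2) in simp)+
    have four: "(LINT x|M. (v x) ^ 4) \<le> C4" if "v \<in> H01 \<Omega>" "dirichlet \<Omega> v \<le> 1" for v
    proof -
      have "(dirichlet \<Omega> v)\<^sup>2 \<le> 1" using dirichlet_nonneg[of v] that by (simp add: power_le_one)
      then have "C4 * (dirichlet \<Omega> v)\<^sup>2 \<le> C4" using C4(1) by (simp add: mult_left_le)
      then show ?thesis using C4(3)[OF that(1)] by (rule order_trans[rotated])
    qed
    have f16: "(LINT x|M. (f x) ^ 4) \<le> 16 * C4"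
    proof -
      have "(LINT x|M. (f x) ^ 4) \<le> 8 * (C4 + C4)"
        by (rule order_trans[OF f4(2)]) (intro mult_left_mono add_mono four u h, simp)
      then show ?thesis by simp
    qed
    have wf: "sqi (\<lambda>x. \<bar>f x\<bar> powr (\<gamma> - 2))"
        "(LINT x|M. (\<bar>f x\<bar> powr (\<gamma> - 2))\<^sup>2) \<le> measure M \<Omega> + 16 * C4"
      using weight_sqi[OF fm f4(1)] f16 by auto
    note p = sqi_product[OF fm H01_measurable[OF h(1)] f4(1) C4(2)[OF h(1)]]
    have sabs: "sqi (\<lambda>x. \<bar>f x * h x\<bar>)" using p(1) by (auto simp: square_integrable_def)
    have uh: "(\<lambda>x. u x + h x) \<in> H01 \<Omega>" by (intro H01_add u h)
    have "\<bar>pot (\<lambda>x. u x + h x) - pot u\<bar> = \<bar>LINT x|M. \<bar>u x + h x\<bar> powr \<gamma> - \<bar>u x\<bar> powr \<gamma>\<bar>"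
      unfolding pot_def using pot_integrable[OF uh] pot_integrable[OF u(1)] by simp
    also have "\<dots> \<le> (LINT x|M. \<bar>\<bar>u x + h x\<bar> powr \<gamma> - \<bar>u x\<bar> powr \<gamma>\<bar>)" by (rule integral_abs_bound)
    also have "\<dots> \<le> (LINT x|M. \<gamma> * (\<bar>f x\<bar> powr (\<gamma> - 2) \<bullet> \<bar>f x * h x\<bar>))"
    proof (rule integral_mono)
      show "integrable M (\<lambda>x. \<bar>\<bar>u x + h x\<bar> powr \<gamma> - \<bar>u x\<bar> powr \<gamma>\<bar>)"
        using pot_integrable[OF uh] pot_integrable[OF u(1)] by simp
      show "integrable M (\<lambda>x. \<gamma> * (\<bar>f x\<bar> powr (\<gamma> - 2) \<bullet> \<bar>f x * h x\<bar>))"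
        using sqi_inner[OF wf(1) sabs] by simp
      fix x
      obtain \<xi> where \<xi>: "\<bar>\<xi> - u x\<bar> \<le> \<bar>h x\<bar>"
        "\<bar>u x + h x\<bar> powr \<gamma> - \<bar>u x\<bar> powr \<gamma> = (\<gamma> * (\<bar>\<xi>\<bar> powr (\<gamma> - 2) * \<xi>)) * h x"
        using MVT_between[of "\<lambda>t. \<bar>t\<bar> powr \<gamma>" "\<lambda>t. \<gamma> * (\<bar>t\<bar> powr (\<gamma> - 2) * t)" "u x" "h x"]
          DERIV_abs_powr[OF gamma(1)] by auto
      have \<xi>f: "\<bar>\<xi>\<bar> \<le> f x" using \<xi>(1) by (simp add: f_def)
      then have "\<bar>\<xi>\<bar> powr (\<gamma> - 2) * \<bar>\<xi>\<bar> * \<bar>h x\<bar> \<le> \<bar>f x\<bar> powr (\<gamma> - 2) * f x * \<bar>h x\<bar>"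
        using gamma f0 by (intro mult_right_mono mult_mono powr_mono2) auto
      then have "\<gamma> * (\<bar>\<xi>\<bar> powr (\<gamma> - 2) * \<bar>\<xi>\<bar> * \<bar>h x\<bar>) \<le> \<gamma> * (\<bar>f x\<bar> powr (\<gamma> - 2) * f x * \<bar>h x\<bar>)"
        using gamma by (intro mult_left_mono) auto
      then show "\<bar>\<bar>u x + h x\<bar> powr \<gamma> - \<bar>u x\<bar> powr \<gamma>\<bar> \<le> \<gamma> * (\<bar>f x\<bar> powr (\<gamma> - 2) \<bullet> \<bar>f x * h x\<bar>)"
        unfolding \<xi>(2) using gamma f0[of x] by (simp add: abs_mult mult.assoc)
    qed
    also have "\<dots> = \<gamma> * (LINT x|M. \<bar>f x\<bar> powr (\<gamma> - 2) \<bullet> \<bar>f x * h x\<bar>)" by simp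
    also have "\<dots> \<le> \<gamma> * \<bar>LINT x|M. \<bar>f x\<bar> powr (\<gamma> - 2) \<bullet> \<bar>f x * h x\<bar>\<bar>"
      using gamma by (intro mult_left_mono) auto
    also have "\<dots> \<le> \<gamma> * (sqrt (LINT x|M. (norm (\<bar>f x\<bar> powr (\<gamma> - 2)))\<^sup>2) * sqrt (LINT x|M. (norm \<bar>f x * h x\<bar>)\<^sup>2))"
      using gamma sqiD[OF wf(1)] sqiD[OF sabs] by (intro mult_left_mono Cauchy_Schwarz_integral) auto
    also have "\<dots> \<le> \<gamma> * (sqrt (measure M \<Omega> + 16 * C4) * (sqrt (sqrt (16 * C4)) * sqrt (sqrt (LINT x|M. (h x) ^ 4))))"
    proof (intro mult_left_mono mult_mono)
      show "sqrt (LINT x|M. (norm (\<bar>f x\<bar> powr (\<gamma> - 2)))\<^sup>2) \<le> sqrt (measure M \<Omega> + 16 * C4)"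
        using wf(2) by simp
      have "(LINT x|M. (f x * h x)\<^sup>2) \<le> sqrt (16 * C4) * sqrt (LINT x|M. (h x) ^ 4)"
        by (rule order_trans[OF p(2)]) (use f16 in \<open>auto intro: mult_right_mono\<close>)
      then have "sqrt (LINT x|M. (f x * h x)\<^sup>2) \<le> sqrt (sqrt (16 * C4) * sqrt (LINT x|M. (h x) ^ 4))" by simp
      then show "sqrt (LINT x|M. (norm \<bar>f x * h x\<bar>)\<^sup>2) \<le> sqrt (sqrt (16 * C4)) * sqrt (sqrt (LINT x|M. (h x) ^ 4))"
        by (simp add: real_sqrt_mult)
    qed (use gamma C4(1) in auto)
    also have "\<dots> = (K - 1) * sqrt (sqrt (LINT x|M. (h x) ^ 4))" by (simp add: K_def)
    also have "\<dots> \<le> K * sqrt (sqrt (LINT x|M. (h x) ^ 4))" by (intro mult_right_mono) auto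
    finally show ?thesis .
  qed
  with K show ?thesis by blast
qed

definition test_ball :: "('a \<Rightarrow> real) set" where
  "test_ball = {\<phi> \<in> test_functions \<Omega>. dirichlet \<Omega> \<phi> \<le> 1}"

text \<open>The best Sobolev constant. The supremum runs over test functions, for which the smooth
  compactness theorem and \<open>soft_abs\<close> are available; density extends the inequality in
  \<open>Sobolev_S\<close>.\<close>

definition S :: real where "S = (SUP \<phi>\<in>test_ball. pot \<phi>)"

lemma pot_bound: "u \<in> H01 \<Omega> \<Longrightarrow> pot u \<le> measure M \<Omega> + C4 * (dirichlet \<Omega> u)\<^sup>2"
proof -
  assume u: "u \<in> H01 \<Omega>"
  have "pot u \<le> (LINT x|M. 1 + (u x) ^ 4)"
    unfolding pot_def
    by (rule integral_mono[OF pot_integrable[OF u]]) (use C4(2)[OF u] gamma abs_powr_le_fourth[of \<gamma>] in auto)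
  also have "\<dots> = measure M \<Omega> + (LINT x|M. (u x) ^ 4)" using C4(2)[OF u] by simp
  finally show ?thesis using C4(3)[OF u] by simp
qed

lemma test_ball_H01: "\<phi> \<in> test_ball \<Longrightarrow> \<phi> \<in> H01 \<Omega>" by (auto simp: test_ball_def test_H01)

lemma pot_le_S: "\<phi> \<in> test_ball \<Longrightarrow> pot \<phi> \<le> S"
  unfolding S_def
proof (rule cSUP_upper)
  show "bdd_above (pot ` test_ball)"
  proof (rule bdd_aboveI2)
    fix \<phi> assume \<phi>: "\<phi> \<in> test_ball"
    then have "(dirichlet \<Omega> \<phi>)\<^sup>2 \<le> 1"
      using dirichlet_nonneg[of \<phi>] by (simp add: power_le_one test_ball_def)
    then have "C4 * (dirichlet \<Omega> \<phi>)\<^sup>2 \<le> C4" using C4(1) by (simp add: mult_left_le)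
    then show "pot \<phi> \<le> measure M \<Omega> + C4" using pot_bound[OF test_ball_H01[OF \<phi>]] by simp
  qed
qed

lemma dirichlet_zero:
  assumes "u \<in> H01 \<Omega>" "dirichlet \<Omega> u = 0" shows "AE x in M. u x = 0"
proof -
  obtain P where "P > 0" "\<And>u. u \<in> H01 \<Omega> \<Longrightarrow> (LINT x|M. (u x)\<^sup>2) \<le> P * dirichlet \<Omega> u"
    using Poincare by blast
  then have "(LINT x|M. (u x)\<^sup>2) \<le> 0" using assms by fastforce
  moreover have "(LINT x|M. (u x)\<^sup>2) \<ge> 0" by simp
  ultimately have "(LINT x|M. (u x)\<^sup>2) = 0" by linarith
  moreover have "integrable M (\<lambda>x. (u x)\<^sup>2)" using sqiD(2)[OF H1_sqi[OF H01_H1[OF assms(1)]]] by simp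
  ultimately show ?thesis by (subst (asm) integral_nonneg_eq_0_iff_AE) (auto elim!: eventually_mono)
qed

lemma pot_cong_AE:
  assumes "u \<in> borel_measurable M" "v \<in> borel_measurable M" "AE x in M. u x = v x"
  shows "pot u = pot v"
proof -
  note [measurable] = assms(1,2)
  have "(\<lambda>x. \<bar>u x\<bar> powr \<gamma>) \<in> borel_measurable M" "(\<lambda>x. \<bar>v x\<bar> powr \<gamma>) \<in> borel_measurable M"
    by measurable
  moreover have "AE x in M. \<bar>u x\<bar> powr \<gamma> = \<bar>v x\<bar> powr \<gamma>" using assms(3) by eventually_elim simp
  ultimately show ?thesis unfolding pot_def by (rule integral_cong_AE)
qed

text \<open>Homogeneity: dividing by the norm moves the function into \<open>test_ball\<close>. A
  vanishing norm means a null function by Poincare.\<close>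

lemma pot_le_S_test:
  assumes "\<phi> \<in> test_functions \<Omega>" shows "pot \<phi> \<le> S * dirichlet \<Omega> \<phi> powr (\<gamma> / 2)"
proof (cases "dirichlet \<Omega> \<phi> = 0")
  case True
  have "AE x in M. \<phi> x = 0" by (rule dirichlet_zero[OF test_H01[OF assms] True])
  then have "pot \<phi> = pot (\<lambda>x. 0)"
    by (intro pot_cong_AE H01_measurable test_H01 assms H01_zero) auto
  then show ?thesis using True by (simp add: pot_def)
next
  case False
  define t where "t = H01_norm \<Omega> \<phi>"
  have D: "dirichlet \<Omega> \<phi> = t\<^sup>2" by (simp add: t_def H01_norm_sq)
  have t: "t > 0" using False H01_norm_nonneg[of \<phi>] unfolding D t_def by (simp add: less_le)
  have "(\<lambda>x. (1 / t) * \<phi> x) \<in> test_ball"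
    using t test_cmult[OF assms, of "1 / t"] dirichlet_cmult[OF test_H1[OF assms], of "1 / t"]
    by (simp add: test_ball_def D power_divide)
  from pot_le_S[OF this] have "(1 / t) powr \<gamma> * pot \<phi> \<le> S"
    unfolding pot_cmult using t by simp
  then have "pot \<phi> \<le> S * t powr \<gamma>" using t by (simp add: powr_divide field_simps)
  also have "t powr \<gamma> = dirichlet \<Omega> \<phi> powr (\<gamma> / 2)"
  proof -
    have "(t\<^sup>2) powr (\<gamma> / 2) = (t powr 2) powr (\<gamma> / 2)" using t by (simp add: powr_realpow)
    then show ?thesis unfolding D powr_powr by simp
  qed
  finally show ?thesis .
qed

lemma pot_convergence:
  assumes u: "u \<in> H01 \<Omega>" and \<phi>: "\<And>n. \<phi> n \<in> H01 \<Omega>" and l: "(\<lambda>n. dirichlet \<Omega> (\<lambda>x. \<phi> n x - u x)) \<longlonglongrightarrow> 0"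
  shows "(\<lambda>n. pot (\<phi> n)) \<longlonglongrightarrow> pot u"
proof -
  obtain K where K: "K \<ge> 0" "\<And>h. h \<in> H01 \<Omega> \<Longrightarrow> H01_norm \<Omega> h \<le> 1 \<Longrightarrow>
    \<bar>pot (\<lambda>x. u x + h x) - pot u - \<gamma> * dpot u h\<bar> \<le> K * (H01_norm \<Omega> h)\<^sup>2"
    using pot_taylor[OF u] by blast
  obtain L where L: "L \<ge> 0" "\<And>h. h \<in> H01 \<Omega> \<Longrightarrow> \<bar>dpot u h\<bar> \<le> L * H01_norm \<Omega> h"
    using dpot_bound[OF u] by blast
  define n where "n j = H01_norm \<Omega> (\<lambda>x. \<phi> j x - u x)" for j
  have h: "(\<lambda>x. \<phi> j x - u x) \<in> H01 \<Omega>" for j by (intro H01_diff u \<phi>)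
  have n0: "n \<longlonglongrightarrow> 0" unfolding n_def H01_norm_def using tendsto_real_sqrt[OF l] by simp
  have "(\<lambda>j. pot (\<phi> j) - pot u) \<longlonglongrightarrow> 0"
  proof (rule Lim_null_comparison)
    have "\<forall>\<^sub>F j in sequentially. n j < 1" using order_tendstoD(2)[OF n0, of 1] by simp
    then show "\<forall>\<^sub>F j in sequentially. norm (pot (\<phi> j) - pot u) \<le> \<gamma> * (L * n j) + K * (n j)\<^sup>2"
    proof eventually_elim
      case (elim j)
      have "\<bar>pot (\<phi> j) - pot u - \<gamma> * dpot u (\<lambda>x. \<phi> j x - u x)\<bar> \<le> K * (n j)\<^sup>2"
        using K(2)[OF h[of j]] elim by (simp add: n_def)
      moreover have "\<gamma> * \<bar>dpot u (\<lambda>x. \<phi> j x - u x)\<bar> \<le> \<gamma> * (L * n j)"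
        using L(2)[OF h[of j]] gamma by (intro mult_left_mono) (auto simp: n_def)
      moreover have "\<bar>\<gamma> * dpot u (\<lambda>x. \<phi> j x - u x)\<bar> = \<gamma> * \<bar>dpot u (\<lambda>x. \<phi> j x - u x)\<bar>"
        using gamma by (simp add: abs_mult)
      ultimately show ?case unfolding real_norm_def by linarith
    qed
    have "(\<lambda>j. \<gamma> * (L * n j) + K * (n j)\<^sup>2) \<longlonglongrightarrow> \<gamma> * (L * 0) + K * 0\<^sup>2" by (intro tendsto_intros n0)
    then show "(\<lambda>j. \<gamma> * (L * n j) + K * (n j)\<^sup>2) \<longlonglongrightarrow> 0" by simp
  qed
  then show ?thesis by (simp add: LIM_zero_iff)
qed

lemma dirichlet_diff_commute:
  assumes "u \<in> H01 \<Omega>" "v \<in> H01 \<Omega>"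
  shows "dirichlet \<Omega> (\<lambda>x. u x - v x) = dirichlet \<Omega> (\<lambda>x. v x - u x)"
  using dirichlet_cmult[OF H1_diff[OF assms[THEN H01_H1]], of "-1"] by simp

lemma approximates_pot:
  assumes u: "u \<in> H01 \<Omega>" "approximates \<phi> u"
  shows "(\<lambda>n. pot (\<phi> n)) \<longlonglongrightarrow> pot u"
proof (rule pot_convergence[OF u(1)])
  show t: "\<phi> n \<in> H01 \<Omega>" for n using u(2) test_H01 unfolding approximates_def by blast
  show "(\<lambda>n. dirichlet \<Omega> (\<lambda>x. \<phi> n x - u x)) \<longlonglongrightarrow> 0"
    using u(2) unfolding approximates_def dirichlet_diff_commute[OF t u(1)] by blast
qed

lemma Sobolev_S:
  assumes u: "u \<in> H01 \<Omega>" shows "pot u \<le> S * dirichlet \<Omega> u powr (\<gamma> / 2)"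
proof -
  obtain \<phi> where a: "approximates \<phi> u" using u unfolding H01_approximates by blast
  show ?thesis
  proof (rule LIMSEQ_le)
    show "(\<lambda>n. pot (\<phi> n)) \<longlonglongrightarrow> pot u" by (rule approximates_pot[OF u a])
    show "(\<lambda>n. S * dirichlet \<Omega> (\<phi> n) powr (\<gamma> / 2)) \<longlonglongrightarrow> S * dirichlet \<Omega> u powr (\<gamma> / 2)"
      using gamma dirichlet_nonneg
      by (intro tendsto_mult tendsto_const tendsto_powr2 approximates_convergence[OF H01_H1[OF u] a]) auto
  qed (use a pot_le_S_test in \<open>auto simp: approximates_def\<close>)
qed

text \<open>A nearly maximal function is replaced by its \<open>soft_abs\<close>, which does not
  increase the Dirichlet integral; as the parameter tends to 0 the potential converges back by
  dominated convergence.\<close>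

lemma maximizing_sequence:
  assumes "S > 0"
  obtains w where "\<And>n. w n \<in> test_ball" "\<And>n x. w n x \<ge> 0" "(\<lambda>n. pot (w n)) \<longlonglongrightarrow> S"
proof -
  have "(\<lambda>x. 0) \<in> test_ball"
    using dirichlet_cmult[OF test_H1[OF test_zero], of 0] test_zero by (simp add: test_ball_def)
  then have ne: "test_ball \<noteq> {}" by blast
  have "\<exists>w\<in>test_ball. (\<forall>x. w x \<ge> 0) \<and> S - 1 / real (Suc n) < pot w" for n
  proof -
    have "S - 1 / real (Suc n) < S" by simp
    then obtain u where u: "u \<in> test_ball" "S - 1 / real (Suc n) < pot u"
      unfolding S_def[symmetric] using less_cSupE[of "S - 1 / real (Suc n)" "pot ` test_ball"] ne
      unfolding S_def by auto
    have t: "u \<in> test_functions \<Omega>" using u by (simp add: test_ball_def)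
    define d where "d k = 1 / real (Suc k)" for k
    have d: "d k > 0" for k by (simp add: d_def)
    have d0: "d \<longlonglongrightarrow> 0" using LIMSEQ_inverse_real_of_nat by (simp add: d_def[abs_def] inverse_eq_divide)
    let ?w = "\<lambda>k x. soft_abs (d k) (u x)"
    have wt: "?w k \<in> test_functions \<Omega>" for k by (rule test_soft_abs(1)[OF t d])
    have [measurable]: "u \<in> borel_measurable M" "?w k \<in> borel_measurable M" for k
      using H01_measurable test_H01 t wt by blast+
    have wD: "dirichlet \<Omega> (?w k) \<le> dirichlet \<Omega> u" for k
      unfolding dirichlet_wg[OF wg_test[OF wt]] dirichlet_wg[OF wg_test[OF t]]
    proof (rule integral_mono)
      show "integrable M (\<lambda>x. (norm (grad (?w k) x))\<^sup>2)" "integrable M (\<lambda>x. (norm (grad u x))\<^sup>2)"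
        using sqiD(2)[OF test_sqi(2)] wt t by blast+
      show "(norm (grad (?w k) x))\<^sup>2 \<le> (norm (grad u x))\<^sup>2" for x
        by (intro power_mono test_soft_abs(2)[OF t d]) auto
    qed
    have "(\<lambda>k. pot (?w k)) \<longlonglongrightarrow> pot u"
      unfolding pot_def
    proof (rule integral_dominated_convergence[where w = "\<lambda>x. \<bar>u x\<bar> powr \<gamma>"])
      show "integrable M (\<lambda>x. \<bar>u x\<bar> powr \<gamma>)" by (rule pot_integrable[OF test_H01[OF t]])
      show "AE x in M. (\<lambda>k. \<bar>?w k x\<bar> powr \<gamma>) \<longlonglongrightarrow> \<bar>u x\<bar> powr \<gamma>"
      proof (intro AE_I2)
        fix x
        have "(\<lambda>k. ?w k x) \<longlonglongrightarrow> \<bar>u x\<bar>"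
        proof (rule tendsto_sandwich)
          show "(\<lambda>k. \<bar>u x\<bar> - d k) \<longlonglongrightarrow> \<bar>u x\<bar>" using tendsto_diff[OF tendsto_const d0] by simp
        qed (use soft_abs_bounds[OF less_imp_le[OF d]] in auto)
        then have "(\<lambda>k. \<bar>?w k x\<bar>) \<longlonglongrightarrow> \<bar>u x\<bar>" using tendsto_rabs by fastforce
        then show "(\<lambda>k. \<bar>?w k x\<bar> powr \<gamma>) \<longlonglongrightarrow> \<bar>u x\<bar> powr \<gamma>"
          using gamma by (intro tendsto_powr2) auto
      qed
      show "AE x in M. norm (\<bar>?w k x\<bar> powr \<gamma>) \<le> \<bar>u x\<bar> powr \<gamma>" for k
        using gamma soft_abs_nonneg[OF less_imp_le[OF d]] soft_abs_bounds[OF less_imp_le[OF d]]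
        by (intro AE_I2) (auto intro!: powr_mono2)
    qed measurable
    from order_tendstoD(1)[OF this u(2)] obtain k where "S - 1 / real (Suc n) < pot (?w k)"
      unfolding eventually_sequentially by blast
    then show ?thesis using wt[of k] wD[of k] u(1) soft_abs_nonneg[OF less_imp_le[OF d]]
      by (intro bexI[of _ "?w k"]) (auto simp: test_ball_def intro: order_trans)
  qed
  then obtain w where w: "\<And>n. w n \<in> test_ball" "\<And>n x. w n x \<ge> 0" "\<And>n. S - 1 / real (Suc n) < pot (w n)"
    by metis
  have "(\<lambda>n. pot (w n)) \<longlonglongrightarrow> S"
  proof (rule tendsto_sandwich[OF _ _ _ tendsto_const])
    show "(\<lambda>n. S - 1 / real (Suc n)) \<longlonglongrightarrow> S"
      using tendsto_diff[OF tendsto_const LIMSEQ_inverse_real_of_nat, of S] by (simp add: inverse_eq_divide)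
    show "\<forall>\<^sub>F n in sequentially. S - 1 / real (Suc n) \<le> pot (w n)" using w(3) by (simp add: less_imp_le)
    show "\<forall>\<^sub>F n in sequentially. pot (w n) \<le> S" using pot_le_S[OF w(1)] by simp
  qed
  then show ?thesis using that w by blast
qed

lemma extremal_exists:
  assumes S: "S > 0"
  obtains v where "v \<in> H01 \<Omega>" "dirichlet \<Omega> v = 1" "pot v = S" "AE x in M. v x \<ge> 0"
proof -
  obtain w0 where w0: "\<And>n. w0 n \<in> test_ball" "\<And>n x. w0 n x \<ge> 0" "(\<lambda>n. pot (w0 n)) \<longlonglongrightarrow> S"
    using maximizing_sequence[OF S] by blast
  have t0: "w0 n \<in> test_functions \<Omega>" "dirichlet \<Omega> (w0 n) \<le> 1" for n using w0(1) by (auto simp: test_ball_def)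
  obtain R where R: "R > 0" "\<And>x. x \<in> \<Omega> \<Longrightarrow> norm x < R" using domain_radius by blast
  have "\<exists>s :: nat \<Rightarrow> nat. strict_mono s \<and>
    (\<forall>e>0. \<exists>N. \<forall>m\<ge>N. \<forall>n\<ge>N. (\<integral>\<^sup>+x. ennreal ((w0 (s m) x - w0 (s n) x) ^ 4) \<partial>lborel) \<le> ennreal e)"
  proof (rule Rellich_L4_smooth[OF test_GDERIV[OF t0(1)] test_grad_continuous[OF t0(1)] _ R(1) zero_less_one _ dim3])
    show "energy (grad (w0 n)) \<le> ennreal (1\<^sup>2)" for n
      unfolding dirichlet_test(1)[OF t0(1)] using t0(2) by (simp add: ennreal_leI)
    show "w0 n x \<noteq> 0 \<Longrightarrow> norm x < R" for n x using test_support_domain[OF t0(1)] R(2) by blast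
  qed
  then obtain s :: "nat \<Rightarrow> nat" where s: "strict_mono s"
    "\<And>e. e > 0 \<Longrightarrow> \<exists>N. \<forall>m\<ge>N. \<forall>n\<ge>N. (\<integral>\<^sup>+x. ennreal ((w0 (s m) x - w0 (s n) x) ^ 4) \<partial>lborel) \<le> ennreal e"
    by blast
  define w where "w n = w0 (s n)" for n
  have wt: "w n \<in> test_functions \<Omega>" "dirichlet \<Omega> (w n) \<le> 1" "w n x \<ge> 0" for n x
    using t0 w0 by (auto simp: w_def)
  have wS: "(\<lambda>n. pot (w n)) \<longlonglongrightarrow> S"
    unfolding w_def using LIMSEQ_subseq_LIMSEQ[OF w0(3) s(1)] by (simp add: o_def)
  have wH: "w n \<in> H01 \<Omega>" for n using wt test_H01 by blast
  have w4: "\<exists>N. \<forall>m\<ge>N. \<forall>n\<ge>N. (LINT x|M. (w m x - w n x) ^ 4) \<le> e" if e: "e > 0" for e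
  proof -
    obtain N where N: "\<forall>m\<ge>N. \<forall>n\<ge>N. (\<integral>\<^sup>+x. ennreal ((w m x - w n x) ^ 4) \<partial>lborel) \<le> ennreal e"
      using s(2)[OF e] unfolding w_def by blast
    show ?thesis
    proof (intro exI[of _ N] allI impI)
      fix m n assume mn: "m \<ge> N" "n \<ge> N"
      let ?h = "\<lambda>x. w m x - w n x"
      have td: "?h \<in> test_functions \<Omega>" by (intro test_diff wt)
      have [measurable]: "?h \<in> borel_measurable borel"
        by (rule borel_measurable_continuous_onI[OF test_continuous[OF td]])
      have "ennreal (LINT x|M. (?h x) ^ 4) = (\<integral>\<^sup>+x. ennreal ((?h x) ^ 4) \<partial>M)"
        by (rule nn_integral_eq_integral[symmetric]) (use C4(2)[OF test_H01[OF td]] in auto)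
      also have "\<dots> = (\<integral>\<^sup>+x. ennreal ((?h x) ^ 4) \<partial>lborel)"
      proof (rule M_nn_integral_lborel)
        show "ennreal ((?h x) ^ 4) = 0" if "x \<notin> \<Omega>" for x
          using test_support_domain[OF td, of x] that by auto
      qed measurable
      also have "\<dots> \<le> ennreal e" using N mn by blast
      finally show "(LINT x|M. (?h x) ^ 4) \<le> e" using e by (simp add: ennreal_le_iff)
    qed
  qed
  obtain K where K: "K > 0" "\<And>u h. u \<in> H01 \<Omega> \<Longrightarrow> h \<in> H01 \<Omega> \<Longrightarrow> dirichlet \<Omega> u \<le> 1 \<Longrightarrow> dirichlet \<Omega> h \<le> 1 \<Longrightarrow>
    \<bar>pot (\<lambda>x. u x + h x) - pot u\<bar> \<le> K * sqrt (sqrt (LINT x|M. (h x) ^ 4))"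
    using pot_increment_L4 by blast
  text \<open>The midpoint of two nearly extremal functions that are close in \<open>L\<^sup>4\<close> is nearly extremal, so by the
    parallelogram law they are close in \<open>H\<^sub>0\<^sup>1\<close>.\<close>
  have Cauchy: "\<exists>N. \<forall>m\<ge>N. \<forall>n\<ge>N. dirichlet \<Omega> (\<lambda>x. w m x - w n x) \<le> e" if e: "e > 0" for e
  proof -
    \<comment> \<open>Below, \<open>S - 2 * \<delta> < pot p \<le> S * (1 - c / 4)\<close> gives
      \<open>S * c < 8 * \<delta> = S * e\<close>.\<close>
    define \<delta> where "\<delta> = S * e / 8"
    have \<delta>: "\<delta> > 0" using S e by (simp add: \<delta>_def)
    have "\<forall>\<^sub>F n in sequentially. S - \<delta> < pot (w n)" using order_tendstoD(1)[OF wS] \<delta> by simp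
    then obtain N1 where N1: "\<And>n. n \<ge> N1 \<Longrightarrow> S - \<delta> < pot (w n)" by (auto simp: eventually_sequentially)
    obtain N2 where N2: "\<forall>m\<ge>N2. \<forall>n\<ge>N2. (LINT x|M. (w m x - w n x) ^ 4) \<le> (\<delta> / K) ^ 4"
      using w4[of "(\<delta> / K) ^ 4"] \<delta> K(1) by auto
    show ?thesis
    proof (intro exI[of _ "max N1 N2"] allI impI)
      fix m n assume mn: "max N1 N2 \<le> m" "max N1 N2 \<le> n"
      define h where "h x = (1/2) * (w n x - w m x)" for x
      have hH: "h \<in> H01 \<Omega>" unfolding h_def by (intro H01_cmult H01_diff wH)
      define c where "c = dirichlet \<Omega> (\<lambda>x. w m x - w n x)"
      have c0: "c \<ge> 0" by (simp add: c_def dirichlet_nonneg)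
      have Dh: "dirichlet \<Omega> h = c / 4"
        unfolding h_def c_def dirichlet_diff_commute[OF wH[of m] wH[of n]]
        using dirichlet_cmult[OF H01_H1[OF H01_diff[OF wH[of n] wH[of m]]], of "1/2"]
        by (simp add: power2_eq_square)
      have "c \<le> 2 * dirichlet \<Omega> (w m) + 2 * dirichlet \<Omega> (\<lambda>x. -1 * w n x)"
        using dirichlet_add_le[OF H01_H1[OF wH[of m]] H01_H1[OF H01_cmult[OF wH[of n], of "-1"]]] by (simp add: c_def)
      also have "dirichlet \<Omega> (\<lambda>x. -1 * w n x) = dirichlet \<Omega> (w n)"
        by (subst dirichlet_cmult[OF H01_H1[OF wH]]) simp
      finally have c4: "c \<le> 4" using wt(2)[of m] wt(2)[of n] by simp
      have h4: "K * sqrt (sqrt (LINT x|M. (h x) ^ 4)) \<le> \<delta>"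
      proof -
        have "(LINT x|M. (h x) ^ 4) = (1/16) * (LINT x|M. (w n x - w m x) ^ 4)"
          unfolding h_def power_mult_distrib by (simp add: power4_eq_xxxx)
        also have "\<dots> \<le> 1 * (LINT x|M. (w n x - w m x) ^ 4)"
          by (intro mult_right_mono Bochner_Integration.integral_nonneg) auto
        also have "\<dots> \<le> (\<delta> / K) ^ 4" using N2 mn by simp
        finally have "sqrt (sqrt (LINT x|M. (h x) ^ 4)) \<le> sqrt (sqrt ((\<delta> / K) ^ 4))" by simp
        also have "(\<delta> / K) ^ 4 = ((\<delta> / K)\<^sup>2)\<^sup>2" by (simp flip: power_mult)
        also have "sqrt (sqrt (((\<delta> / K)\<^sup>2)\<^sup>2)) = \<delta> / K" using \<delta> K(1) by (simp only: real_sqrt_abs) simp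
        finally show ?thesis using K(1) by (simp add: field_simps)
      qed
      define p where "p x = w m x + h x" for x
      have pH: "p \<in> H01 \<Omega>" unfolding p_def by (intro H01_add wH hH)
      have "\<bar>pot p - pot (w m)\<bar> \<le> K * sqrt (sqrt (LINT x|M. (h x) ^ 4))"
        unfolding p_def using K(2)[OF wH hH wt(2)] c4 by (simp add: Dh)
      then have pp: "pot p > S - 2 * \<delta>" using h4 N1[of m] mn by simp
      \<comment> \<open>The parallelogram law for the midpoint \<open>p\<close> and
        \<open>h\<close>, as \<open>w m = p - h\<close> and \<open>w n = p + h\<close>. The bracket
        at the end is zero.\<close>
      have "dirichlet \<Omega> (\<lambda>x. w m x + h x) + dirichlet \<Omega> (\<lambda>x. w m x + h x) + 2 * dirichlet \<Omega> h
         = dirichlet \<Omega> (w m) + dirichlet \<Omega> (\<lambda>x. w m x + 2 * h x) + (2 * dirichlet \<Omega> h + 2 * dirichlet \<Omega> h - 4 * dirichlet \<Omega> h)"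
        using dirichlet_add[OF H01_H1[OF wH[of m]] H01_H1[OF hH]]
          dirichlet_add[OF H01_H1[OF wH[of m]] H01_H1[OF H01_cmult[OF hH, of 2]]]
          ip_cmult(2)[OF hH wH, of m 2] dirichlet_cmult[OF H01_H1[OF hH], of 2] by simp
      moreover have "(\<lambda>x. w m x + 2 * h x) = w n" by (rule ext) (simp add: h_def field_simps)
      ultimately have Dp: "dirichlet \<Omega> p \<le> 1 - c / 4"
        using wt(2)[of m] wt(2)[of n] Dh unfolding p_def by simp
      then have Dp1: "dirichlet \<Omega> p \<le> 1" using c0 by simp
      \<comment> \<open>As \<open>\<gamma> / 2 > 1\<close> and the base is at most 1, the power may
        be replaced by the Dirichlet integral itself, whose deficit \<open>c / 4\<close> is then
        felt linearly.\<close>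
      have "dirichlet \<Omega> p powr (\<gamma> / 2) \<le> dirichlet \<Omega> p powr 1"
        using Dp1 dirichlet_nonneg[of p] gamma powr_mono'[of 1 "\<gamma> / 2" "dirichlet \<Omega> p"] by simp
      then have "dirichlet \<Omega> p powr (\<gamma> / 2) \<le> 1 - c / 4" using Dp dirichlet_nonneg[of p] by simp
      then have "pot p \<le> S * (1 - c / 4)"
        using Sobolev_S[OF pH] S by (meson mult_left_mono order_trans less_imp_le)
      with pp have "S * c / 4 < 2 * \<delta>" by (simp add: algebra_simps)
      then have "S * c < S * e" by (simp add: \<delta>_def mult.commute)
      then show "dirichlet \<Omega> (\<lambda>x. w m x - w n x) \<le> e" using S by (simp add: c_def)
    qed
  qed
  obtain v where v: "v \<in> H01 \<Omega>" "approximates w v" and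
    sub: "\<exists>r :: nat \<Rightarrow> nat. strict_mono r \<and> (AE x in M. (\<lambda>n. w (r n) x) \<longlonglongrightarrow> v x)"
  proof (rule H01_complete[of w])
    show "w n \<in> test_functions \<Omega>" for n by (rule wt(1))
  qed (use Cauchy in blast)+
  then obtain r where
    r: "strict_mono (r :: nat \<Rightarrow> nat)" "AE x in M. (\<lambda>n. w (r n) x) \<longlonglongrightarrow> v x" by blast
  have Dv: "dirichlet \<Omega> v \<le> 1"
    using approximates_convergence(2)[OF H01_H1[OF v(1)] v(2)] wt(2) by (intro LIMSEQ_le_const2) auto
  have potv: "pot v = S" using LIMSEQ_unique[OF approximates_pot[OF v] wS] .
  have "dirichlet \<Omega> v = 1"
  proof (rule ccontr)
    assume "dirichlet \<Omega> v \<noteq> 1"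
    then have "dirichlet \<Omega> v < 1" using Dv by simp
    then have "dirichlet \<Omega> v powr (\<gamma> / 2) < 1 powr (\<gamma> / 2)"
      using dirichlet_nonneg gamma by (intro powr_less_mono2) auto
    then have "S * dirichlet \<Omega> v powr (\<gamma> / 2) < S" using S by simp
    then show False using Sobolev_S[OF v(1)] potv by simp
  qed
  moreover have "AE x in M. v x \<ge> 0"
    using r(2) by eventually_elim (rule LIMSEQ_le_const, use wt(3) in auto)
  ultimately show ?thesis using that v potv by blast
qed

text \<open>Along \<open>v + s h\<close> the Sobolev upper bound and the Taylor lower bound for the
  potential touch at \<open>s = 0\<close>. Their difference \<open>F\<close> thus has a local
  minimum there, and the vanishing of its derivative is the equation. The normalization of
  \<open>v\<close> makes the multiplier equal to \<open>S\<close>.\<close>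

lemma Euler_Lagrange:
  assumes S: "S > 0" and v: "v \<in> H01 \<Omega>" "dirichlet \<Omega> v = 1" "pot v = S" and h: "h \<in> H01 \<Omega>"
  shows "dpot v h = S * ip v h"
proof -
  obtain K where K: "K \<ge> 0" "\<And>h. h \<in> H01 \<Omega> \<Longrightarrow> H01_norm \<Omega> h \<le> 1 \<Longrightarrow>
    \<bar>pot (\<lambda>x. v x + h x) - pot v - \<gamma> * dpot v h\<bar> \<le> K * (H01_norm \<Omega> h)\<^sup>2"
    using pot_taylor[OF v(1)] by blast
  define i where "i = ip v h"
  define D where "D = dirichlet \<Omega> h"
  define N where "N = H01_norm \<Omega> h"
  have N: "N \<ge> 0" "N\<^sup>2 = D" by (simp_all add: N_def D_def H01_norm_nonneg H01_norm_sq)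
  define F where "F s = S * (1 + 2 * s * i + s\<^sup>2 * D) powr (\<gamma> / 2) - S - \<gamma> * (s * dpot v h) + K * (s\<^sup>2 * D)" for s
  have F0: "F 0 = 0" by (simp add: F_def)
  have "(F has_real_derivative S * (\<gamma> / 2 * (2 * i)) - \<gamma> * dpot v h) (at 0)"
    unfolding F_def by (auto intro!: derivative_eq_intros)
  \<comment> \<open>The radius \<open>1 / (N + 1)\<close> keeps \<open>s h\<close> in the unit ball,
    where the Taylor bound holds.\<close>
  moreover have "F 0 \<le> F s" if s: "\<bar>0 - s\<bar> < 1 / (N + 1)" for s
  proof -
    have "\<bar>s\<bar> * N \<le> \<bar>s\<bar> * (N + 1)" by (intro mult_left_mono) auto
    also have "\<dots> \<le> 1" using s N(1) by (simp add: field_simps)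
    finally have sN: "H01_norm \<Omega> (\<lambda>x. s * h x) \<le> 1"
      using H01_norm_cmult[OF H01_H1[OF h], of s] by (simp add: N_def)
    have sh: "(\<lambda>x. s * h x) \<in> H01 \<Omega>" by (rule H01_cmult[OF h])
    have "dpot v (\<lambda>x. s * h x) = s * dpot v h"
      using dpot_linear[OF v(1)] h unfolding H01_linear_def by blast
    then have 1: "pot (\<lambda>x. v x + s * h x) \<ge> S + \<gamma> * (s * dpot v h) - K * (s\<^sup>2 * D)"
      using K(2)[OF sh sN] H01_norm_cmult[OF H01_H1[OF h], of s] N
      by (simp add: v N_def power_mult_distrib abs_le_iff)
    have "dirichlet \<Omega> (\<lambda>x. v x + s * h x) = 1 + 2 * s * i + s\<^sup>2 * D"
      using dirichlet_add[OF H01_H1[OF v(1)] H01_H1[OF sh]] ip_cmult(2)[OF h v(1), of s]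
        dirichlet_cmult[OF H01_H1[OF h], of s] by (simp add: v i_def D_def)
    then have "pot (\<lambda>x. v x + s * h x) \<le> S * (1 + 2 * s * i + s\<^sup>2 * D) powr (\<gamma> / 2)"
      using Sobolev_S[OF H01_add[OF v(1) sh]] by simp
    with 1 have "F s \<ge> 0" unfolding F_def by linarith
    then show ?thesis by (simp add: F0)
  qed
  ultimately have "S * (\<gamma> / 2 * (2 * i)) - \<gamma> * dpot v h = 0"
    using N(1) by (intro DERIV_local_min[of F _ 0 "1 / (N + 1)"]) auto
  then have "\<gamma> * (S * i - dpot v h) = 0" by (simp add: algebra_simps)
  then show ?thesis using gamma by (simp add: i_def)
qed

lemma S_pos:
  assumes "\<Omega> \<noteq> {}" shows "S > 0"
proof -
  obtain x where "x \<in> \<Omega>" using assms by blast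
  then obtain l u where lu: "x \<in> box l u" "cbox l u \<subseteq> \<Omega>"
    using open_domain by (meson open_contains_cbox)
  define \<phi> where "\<phi> y = (\<Prod>b\<in>Basis. bump 0 (1 * (y \<bullet> b - l \<bullet> b)) * bump 0 (1 * (u \<bullet> b - y \<bullet> b)))" for y
  have t: "\<phi> \<in> test_functions \<Omega>" unfolding \<phi>_def by (rule box_bump_test[OF lu(2)]) simp
  have pos: "\<phi> y > 0" if "y \<in> box l u" for y
    unfolding \<phi>_def using that by (intro prod_pos mult_pos_pos bump_pos) (auto simp: mem_box)
  have notAE: "\<not> (AE x in M. \<phi> x = 0)"
  proof
    assume "AE x in M. \<phi> x = 0"
    then have "AE x in lebesgue. x \<notin> box l u"
    proof (subst (asm) AE_restrict_space_iff)
      show "\<Omega> \<inter> space lebesgue \<in> sets lebesgue" by simp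
      have "y \<in> \<Omega>" "\<phi> y \<noteq> 0" if "y \<in> box l u" for y
        using pos[OF that] that lu(2) box_subset_cbox[of l u] by auto
      then show "AE x in lebesgue. x \<in> \<Omega> \<longrightarrow> \<phi> x = 0 \<Longrightarrow> AE x in lebesgue. x \<notin> box l u"
        by (auto elim!: eventually_mono)
    qed
    then have "box l u \<in> null_sets lebesgue"
      by (subst (asm) AE_iff_null_sets[symmetric]) auto
    then have "negligible (box l u)" by (simp add: negligible_iff_null_sets)
    then show False using lu(1) by (simp add: negligible_interval)
  qed
  have "pot \<phi> \<noteq> 0"
  proof
    assume "pot \<phi> = 0"
    then have "AE x in M. \<bar>\<phi> x\<bar> powr \<gamma> = 0"
      unfolding pot_def using integral_nonneg_eq_0_iff_AE[OF pot_integrable[OF test_H01[OF t]]] by simp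
    then have "AE x in M. \<phi> x = 0" by eventually_elim simp
    then show False using notAE by blast
  qed
  then have p: "pot \<phi> > 0" using pot_nonneg[of \<phi>] by simp
  have "S * dirichlet \<Omega> \<phi> powr (\<gamma> / 2) > 0" using p pot_le_S_test[OF t] by linarith
  then show ?thesis by (simp add: zero_less_mult_iff)
qed

end

subsection \<open>The strong maximum principle\<close>

lemma DERIV_integral_param:
  fixes v :: "'a \<Rightarrow> real" and f f' :: "real \<Rightarrow> 'a \<Rightarrow> real"
  assumes v: "integrable M v" and t0: "a < t0" "t0 < b"
    and D: "\<And>t y. a < t \<Longrightarrow> t < b \<Longrightarrow> ((\<lambda>t. f t y) has_real_derivative f' t y) (at t)"
    and B: "\<And>t y. a < t \<Longrightarrow> t < b \<Longrightarrow> \<bar>f' t y\<bar> \<le> B"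
    and i: "\<And>t. a < t \<Longrightarrow> t < b \<Longrightarrow> integrable M (\<lambda>y. v y * f t y)"
    and m: "(\<lambda>y. v y * f' t0 y) \<in> borel_measurable M"
  shows "((\<lambda>t. \<integral>y. v y * f t y \<partial>M) has_real_derivative (\<integral>y. v y * f' t0 y \<partial>M)) (at t0)"
  unfolding DERIV_def tendsto_at_iff_sequentially
proof (intro allI impI)
  fix X :: "nat \<Rightarrow> real" assume X0: "\<forall>i. X i \<in> UNIV - {0}" and X: "X \<longlonglongrightarrow> 0"
  have "\<forall>\<^sub>F n in sequentially. \<bar>X n\<bar> < min (t0 - a) (b - t0)"
    using order_tendstoD(2)[OF tendsto_rabs_zero[OF X], of "min (t0 - a) (b - t0)"] t0 by simp
  then obtain N where N: "\<And>n. n \<ge> N \<Longrightarrow> \<bar>X n\<bar> < min (t0 - a) (b - t0)"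
    by (auto simp: eventually_sequentially)
  \<comment> \<open>Dropping finitely many terms keeps \<open>t0 + Y n\<close> in the interval where
    the derivative is bounded by \<open>B\<close>.\<close>
  define Y where "Y n = X (n + N)" for n
  have Y0: "Y n \<noteq> 0" for n using X0 by (simp add: Y_def)
  have Y: "Y \<longlonglongrightarrow> 0" unfolding Y_def by (rule LIMSEQ_ignore_initial_segment[OF X])
  have Yin: "a < t0 + Y n" "t0 + Y n < b" for n using N[of "n + N"] by (auto simp: Y_def min_def split: if_splits)
  let ?q = "\<lambda>n y. (f (t0 + Y n) y - f t0 y) / Y n"
  have qB: "\<bar>?q n y\<bar> \<le> B" for n y
  proof -
    have "\<exists>\<xi>. a < \<xi> \<and> \<xi> < b \<and> f (t0 + Y n) y - f t0 y = f' \<xi> y * Y n"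
    proof (cases "Y n > 0")
      case True
      have "\<exists>z>t0. z < t0 + Y n \<and> f (t0 + Y n) y - f t0 y = (t0 + Y n - t0) * f' z y"
        by (rule MVT2) (use True Yin[of n] t0 in \<open>auto intro!: D\<close>)
      then obtain z where "z > t0" "z < t0 + Y n" "f (t0 + Y n) y - f t0 y = (t0 + Y n - t0) * f' z y" by blast
      then show ?thesis using Yin[of n] t0 by (intro exI[of _ z]) (auto simp: mult.commute)
    next
      case False
      have "\<exists>z>t0 + Y n. z < t0 \<and> f t0 y - f (t0 + Y n) y = (t0 - (t0 + Y n)) * f' z y"
        by (rule MVT2) (use False Y0[of n] Yin[of n] t0 in \<open>auto intro!: D\<close>)
      then obtain z where "z > t0 + Y n" "z < t0" "f t0 y - f (t0 + Y n) y = (t0 - (t0 + Y n)) * f' z y" by blast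
      then show ?thesis using Yin[of n] t0 by (intro exI[of _ z]) (auto simp: algebra_simps)
    qed
    then show ?thesis using B Y0[of n] by (auto simp: abs_mult)
  qed
  have "(\<lambda>n. \<integral>y. v y * ?q n y \<partial>M) \<longlonglongrightarrow> (\<integral>y. v y * f' t0 y \<partial>M)"
  proof (rule integral_dominated_convergence[where w = "\<lambda>y. \<bar>v y\<bar> * B"])
    show "integrable M (\<lambda>y. \<bar>v y\<bar> * B)" using v by simp
    show "(\<lambda>y. v y * ?q n y) \<in> borel_measurable M" for n
    proof -
      have "(\<lambda>y. v y * ?q n y) = (\<lambda>y. (v y * f (t0 + Y n) y - v y * f t0 y) / Y n)"
        by (simp add: right_diff_distrib)
      then show ?thesis using i[OF Yin[of n]] i[OF t0] by simp
    qed
    show "AE y in M. norm (v y * ?q n y) \<le> \<bar>v y\<bar> * B" for n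
      using qB[of n] by (intro AE_I2) (simp only: real_norm_def abs_mult mult_left_mono abs_ge_zero)
    show "AE y in M. (\<lambda>n. v y * ?q n y) \<longlonglongrightarrow> v y * f' t0 y"
    proof (intro AE_I2 tendsto_mult tendsto_const)
      fix y
      have "((\<lambda>h. (f (t0 + h) y - f t0 y) / h) \<longlongrightarrow> f' t0 y) (at 0)"
        using D[OF t0, of y] by (simp add: DERIV_def)
      moreover have "filterlim Y (at 0) sequentially"
        unfolding filterlim_at using Y Y0 by simp
      ultimately show "(\<lambda>n. ?q n y) \<longlonglongrightarrow> f' t0 y" by (rule filterlim_compose)
    qed
  qed (rule m)
  also have "(\<lambda>n. \<integral>y. v y * ?q n y \<partial>M) =
      (\<lambda>n. ((\<integral>y. v y * f (t0 + Y n) y \<partial>M) - (\<integral>y. v y * f t0 y \<partial>M)) / Y n)"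
  proof
    fix n
    have "(\<lambda>y. v y * ?q n y) = (\<lambda>y. (v y * f (t0 + Y n) y - v y * f t0 y) / Y n)"
      by (simp add: right_diff_distrib)
    then show "(\<integral>y. v y * ?q n y \<partial>M) = ((\<integral>y. v y * f (t0 + Y n) y \<partial>M) - (\<integral>y. v y * f t0 y \<partial>M)) / Y n"
      using i[OF Yin[of n]] i[OF t0] by simp
  qed
  finally show "((\<lambda>h. ((\<integral>y. v y * f (t0 + h) y \<partial>M) - (\<integral>y. v y * f t0 y \<partial>M)) / h) \<circ> X)
    \<longlonglongrightarrow> (\<integral>y. v y * f' t0 y \<partial>M)"
    unfolding Y_def o_def by (rule LIMSEQ_offset)
qed

text \<open>The mollifiers \<open>\<psi>\<^sub>s\<close> satisfy \<open>d/ds \<psi>\<^sub>s = \<Delta> \<eta>\<^sub>s\<close> with nonnegative \<open>\<eta>\<^sub>s\<close>, so the averages of a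
  supersolution against \<open>\<psi>\<^sub>s\<close> decrease in \<open>s\<close>.\<close>

definition moll :: "real \<Rightarrow> 'a::euclidean_space \<Rightarrow> real" where
  "moll s z = bump 2 (1 - (z \<bullet> z) / s\<^sup>2) / s ^ 3"

definition moll' :: "real \<Rightarrow> 'a::euclidean_space \<Rightarrow> real" where
  "moll' s z = - 3 * bump 2 (1 - (z \<bullet> z) / s\<^sup>2) / s ^ 4 +
     2 * (z \<bullet> z) * (bump 4 (1 - (z \<bullet> z) / s\<^sup>2) - 2 * bump 3 (1 - (z \<bullet> z) / s\<^sup>2)) / s ^ 6"

definition moll_pot :: "real \<Rightarrow> 'a::euclidean_space \<Rightarrow> 'a \<Rightarrow> real" where
  "moll_pot s x y = bump 0 (1 - ((y - x) \<bullet> (y - x)) / s\<^sup>2) / (2 * s\<^sup>2)"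

lemma moll_DERIV:
  assumes "s > 0" shows "((\<lambda>s. moll s z) has_real_derivative moll' s z) (at s)"
proof -
  have b: "(bump 2 has_real_derivative (bump 4 t - 2 * bump 3 t)) (at t)" for t
    using bump_DERIV[of 2 t] by simp
  have "((\<lambda>s. 1 - (z \<bullet> z) / s\<^sup>2) has_real_derivative 2 * (z \<bullet> z) / s ^ 3) (at s)"
    using assms by (auto intro!: derivative_eq_intros simp: field_simps power2_eq_square power3_eq_cube)
  from DERIV_chain2[OF b this]
  have "((\<lambda>s. bump 2 (1 - (z \<bullet> z) / s\<^sup>2) / s ^ 3) has_real_derivative
     ((bump 4 (1 - (z \<bullet> z) / s\<^sup>2) - 2 * bump 3 (1 - (z \<bullet> z) / s\<^sup>2)) * (2 * (z \<bullet> z) / s ^ 3) * s ^ 3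
      - bump 2 (1 - (z \<bullet> z) / s\<^sup>2) * (3 * s\<^sup>2)) / (s ^ 3 * s ^ 3)) (at s)"
    using assms by (intro DERIV_divide) (auto intro!: derivative_eq_intros)
  then show ?thesis unfolding moll_def
  proof (rule DERIV_cong)
    have alg: "(A * (2 * w / s ^ 3) * s ^ 3 - B * (3 * s\<^sup>2)) / (s ^ 3 * s ^ 3) = - 3 * B / s ^ 4 + 2 * w * A / s ^ 6"
      for A B w :: real
      using assms by (simp add: field_simps eval_nat_numeral)
    show "((bump 4 (1 - (z \<bullet> z) / s\<^sup>2) - 2 * bump 3 (1 - (z \<bullet> z) / s\<^sup>2)) * (2 * (z \<bullet> z) / s ^ 3) * s ^ 3
      - bump 2 (1 - (z \<bullet> z) / s\<^sup>2) * (3 * s\<^sup>2)) / (s ^ 3 * s ^ 3) = moll' s z"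
      unfolding moll'_def by (rule alg)
  qed
qed

lemma bump_bound: "bump n t \<le> fact n"
  using bump_le[of n t 0] by simp

lemma moll_nonneg: "s > 0 \<Longrightarrow> moll s z \<ge> 0" by (simp add: moll_def bump_nonneg)

lemma moll_support:
  assumes "s > 0" "norm z \<ge> s" shows "moll s z = 0" "moll' s z = 0"
proof -
  have "s\<^sup>2 \<le> z \<bullet> z" using assms by (simp add: power_mono flip: power2_norm_eq_inner)
  then have "1 - (z \<bullet> z) / s\<^sup>2 \<le> 0" using assms by simp
  then show "moll s z = 0" "moll' s z = 0" by (simp_all add: moll_def moll'_def bump_zero)
qed

lemma moll_le: "s > 0 \<Longrightarrow> moll s z \<le> 2 / s ^ 3"
  unfolding moll_def using bump_bound[of 2] by (intro divide_right_mono) auto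

lemma moll'_bound:
  assumes s: "0 < a" "a < s" "s < b"
  shows "\<bar>moll' s z\<bar> \<le> 6 / a ^ 4 + 72 * b\<^sup>2 / a ^ 6"
proof (cases "norm z \<ge> s")
  case True
  moreover have "s > 0" using s by linarith
  ultimately have "moll' s z = 0" by (intro moll_support(2))
  moreover have "0 \<le> 6 / a ^ 4 + 72 * b\<^sup>2 / a ^ 6" using s by simp
  ultimately show ?thesis by simp
next
  case False
  let ?t = "1 - (z \<bullet> z) / s\<^sup>2"
  have z: "z \<bullet> z \<le> b\<^sup>2"
    using False s unfolding power2_norm_eq_inner[symmetric] by (intro power_mono) auto
  have a: "a ^ 4 \<le> s ^ 4" "a ^ 6 \<le> s ^ 6" using s by (intro power_mono; simp)+
  have "\<bar>- 3 * bump 2 ?t / s ^ 4\<bar> = 3 * bump 2 ?t / s ^ 4"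
    using s by (simp add: abs_mult bump_nonneg)
  also have "\<dots> \<le> (3 * 2) / a ^ 4"
    using a s bump_bound[of 2 ?t] by (intro frac_le) auto
  finally have 1: "\<bar>- 3 * bump 2 ?t / s ^ 4\<bar> \<le> 6 / a ^ 4" by simp
  \<comment> \<open>Here 36 is \<open>4! + 2 * 3!\<close>, from the bound of \<open>bump n\<close>
    by \<open>fact n\<close>.\<close>
  have "\<bar>bump 4 ?t - 2 * bump 3 ?t\<bar> \<le> 36"
    using bump_bound[of 4 ?t] bump_bound[of 3 ?t] bump_nonneg[of 4 ?t] bump_nonneg[of 3 ?t]
    by (simp add: fact_numeral)
  then have "2 * (z \<bullet> z) * \<bar>bump 4 ?t - 2 * bump 3 ?t\<bar> \<le> 2 * b\<^sup>2 * 36"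
    using z by (intro mult_mono) auto
  then have "2 * (z \<bullet> z) * \<bar>bump 4 ?t - 2 * bump 3 ?t\<bar> / s ^ 6 \<le> (2 * b\<^sup>2 * 36) / a ^ 6"
    using a s by (intro frac_le) auto
  then have 2: "\<bar>2 * (z \<bullet> z) * (bump 4 ?t - 2 * bump 3 ?t) / s ^ 6\<bar> \<le> 72 * b\<^sup>2 / a ^ 6"
    using s by (simp add: abs_mult)
  show ?thesis unfolding moll'_def using 1 2 by linarith
qed

lemma Ck_radial: "Ck k (\<lambda>y. bump n (1 - ((y - x) \<bullet> (y - x)) / s\<^sup>2))"
proof (rule Ck_bump)
  show "Ck k (\<lambda>y. 1 - ((y - x) \<bullet> (y - x)) / s\<^sup>2)" for k
    using Ck_diff[OF Ck_const Ck_cmult[OF Ck_norm_sq], of k 1 "1 / s\<^sup>2" x] by simp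
qed

lemma moll_continuous:
  assumes "s > 0"
  shows "continuous_on UNIV (\<lambda>y. moll s (y - x))" "continuous_on UNIV (\<lambda>y. moll' s (y - x))"
proof -
  have c: "continuous_on UNIV (\<lambda>y. bump n (1 - ((y - x) \<bullet> (y - x)) / s\<^sup>2))" for n
    using Ck_radial[of 0 n x s] by simp
  show "continuous_on UNIV (\<lambda>y. moll s (y - x))" "continuous_on UNIV (\<lambda>y. moll' s (y - x))"
    unfolding moll_def moll'_def by (intro continuous_intros c; use assms in simp)+
qed

lemma GDERIV_radial:
  assumes "s > 0"
  shows "GDERIV (\<lambda>y. bump n (1 - ((y - x) \<bullet> (y - x)) / s\<^sup>2)) y :>
    (- 2 / s\<^sup>2 * (bump (n + 2) (1 - ((y - x) \<bullet> (y - x)) / s\<^sup>2) -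
      real n * bump (n + 1) (1 - ((y - x) \<bullet> (y - x)) / s\<^sup>2))) *\<^sub>R (y - x)"
proof -
  have "GDERIV (\<lambda>y. 1 - 1 / s\<^sup>2 * ((y - x) \<bullet> (y - x))) y :>
     0 - ((1 / s\<^sup>2) *\<^sub>R (2 *\<^sub>R (y - x)) + ((y - x) \<bullet> (y - x)) *\<^sub>R 0)"
    by (intro GDERIV_diff GDERIV_mult GDERIV_const GDERIV_norm_sq)
  then have "GDERIV (\<lambda>y. 1 - ((y - x) \<bullet> (y - x)) / s\<^sup>2) y :> (- 2 / s\<^sup>2) *\<^sub>R (y - x)" by simp
  from GDERIV_DERIV_compose[OF this bump_DERIV]
  show ?thesis by (rule GDERIV_subst) simp
qed

lemma moll_pot_test:
  assumes "s > 0" "cball x s \<subseteq> \<Omega>"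
  shows "moll_pot s x \<in> test_functions \<Omega>"
proof (rule test_functionsI[OF _ compact_cball assms(2)])
  show "Ck k (moll_pot s x)" for k
    using Ck_cmult[OF Ck_radial, of k "1 / (2 * s\<^sup>2)" 0 x s] by (simp add: moll_pot_def[abs_def])
  fix y assume nz: "moll_pot s x y \<noteq> 0"
  show "y \<in> cball x s"
  proof (rule ccontr)
    assume "y \<notin> cball x s"
    then have "s \<le> norm (y - x)" by (simp add: dist_norm norm_minus_commute)
    then have "s\<^sup>2 \<le> (y - x) \<bullet> (y - x)"
      using assms(1) by (simp add: power_mono flip: power2_norm_eq_inner)
    then have "1 - ((y - x) \<bullet> (y - x)) / s\<^sup>2 \<le> 0" using assms(1) by simp
    then show False using nz by (simp add: moll_pot_def bump_zero)
  qed
qed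

lemma moll_pot_nonneg: "moll_pot s x y \<ge> 0" by (simp add: moll_pot_def bump_nonneg)

lemma moll_pot_grad:
  assumes "s > 0"
  shows "grad (moll_pot s x) y = (- bump 2 (1 - ((y - x) \<bullet> (y - x)) / s\<^sup>2) / s ^ 4) *\<^sub>R (y - x)"
proof (rule grad_eq)
  have "GDERIV (\<lambda>y. 1 / (2 * s\<^sup>2) * bump 0 (1 - ((y - x) \<bullet> (y - x)) / s\<^sup>2)) y :>
     (1 / (2 * s\<^sup>2)) *\<^sub>R ((- 2 / s\<^sup>2 * (bump (0 + 2) (1 - ((y - x) \<bullet> (y - x)) / s\<^sup>2) -
      real 0 * bump (0 + 1) (1 - ((y - x) \<bullet> (y - x)) / s\<^sup>2))) *\<^sub>R (y - x)) +
     bump 0 (1 - ((y - x) \<bullet> (y - x)) / s\<^sup>2) *\<^sub>R 0"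
    by (intro GDERIV_mult GDERIV_const GDERIV_radial assms)
  then show "GDERIV (moll_pot s x) y :> (- bump 2 (1 - ((y - x) \<bullet> (y - x)) / s\<^sup>2) / s ^ 4) *\<^sub>R (y - x)"
    by (simp add: moll_pot_def[abs_def] power2_eq_square power4_eq_xxxx mult.assoc
        del: add_2_eq_Suc add_2_eq_Suc')
qed

text \<open>The gradient of \<open>moll_pot\<close> is \<open>- bump 2 / s^4\<close> times
  \<open>y - x\<close>. Its divergence takes the factor 3 from the dimension, which matches
  differentiating \<open>1 / s^3\<close> in \<open>moll\<close>; the factor
  \<open>1 / (2 * s^2)\<close> in \<open>moll_pot\<close> is chosen so that the remaining terms
  agree as well.\<close>

lemma moll_pot_laplacian:
  fixes x y :: "'a::euclidean_space"
  assumes s: "s > 0" and d3: "DIM('a) = 3"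
  shows "(\<Sum>b\<in>Basis. grad (\<lambda>y. grad (moll_pot s x) y \<bullet> b) y \<bullet> b) = moll' s (y - x)"
proof -
  let ?t = "1 - ((y - x) \<bullet> (y - x)) / s\<^sup>2"
  have g: "grad (\<lambda>y. grad (moll_pot s x) y \<bullet> b) y \<bullet> b =
     (2 / s ^ 6 * (bump 4 ?t - 2 * bump 3 ?t)) * ((y - x) \<bullet> b)\<^sup>2 - bump 2 ?t / s ^ 4" if b: "b \<in> Basis" for b
  proof -
    have fn: "(\<lambda>y. grad (moll_pot s x) y \<bullet> b) =
      (\<lambda>y. (- 1 / s ^ 4) * (bump 2 (1 - ((y - x) \<bullet> (y - x)) / s\<^sup>2) * (y \<bullet> b - x \<bullet> b)))"
      by (auto simp: moll_pot_grad[OF s] inner_diff_left)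
    have "GDERIV (\<lambda>y. y \<bullet> b - x \<bullet> b) y :> b - 0"
      by (intro GDERIV_diff GDERIV_inner_right GDERIV_const)
    then have gb: "GDERIV (\<lambda>y. y \<bullet> b - x \<bullet> b) y :> b" by simp
    have "GDERIV (\<lambda>y. (- 1 / s ^ 4) * (bump 2 (1 - ((y - x) \<bullet> (y - x)) / s\<^sup>2) * (y \<bullet> b - x \<bullet> b))) y :>
      (- 1 / s ^ 4) *\<^sub>R (bump 2 ?t *\<^sub>R b + (y \<bullet> b - x \<bullet> b) *\<^sub>R
        ((- 2 / s\<^sup>2 * (bump (2 + 2) ?t - real 2 * bump (2 + 1) ?t)) *\<^sub>R (y - x))) +
      (bump 2 ?t * (y \<bullet> b - x \<bullet> b)) *\<^sub>R 0"
      by (intro GDERIV_mult GDERIV_const GDERIV_radial s gb)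
    from grad_eq[OF this]
    have "grad (\<lambda>y. grad (moll_pot s x) y \<bullet> b) y \<bullet> b = (- 1 / s ^ 4) * (bump 2 ?t +
       ((y - x) \<bullet> b) * ((- 2 / s\<^sup>2 * (bump 4 ?t - 2 * bump 3 ?t)) * ((y - x) \<bullet> b)))"
      using b unfolding fn by (simp add: inner_add_left inner_diff_left)
    moreover have "(- 1 / s ^ 4) * (B + w * ((- 2 / s\<^sup>2 * A) * w)) = (2 / s ^ 6 * A) * w\<^sup>2 - B / s ^ 4" for A B w
      using s by (simp add: field_simps eval_nat_numeral)
    ultimately show ?thesis by (simp only:)
  qed
  have "(\<Sum>b\<in>Basis. grad (\<lambda>y. grad (moll_pot s x) y \<bullet> b) y \<bullet> b) =
    (2 / s ^ 6 * (bump 4 ?t - 2 * bump 3 ?t)) * (\<Sum>b\<in>Basis. ((y - x) \<bullet> b)\<^sup>2) - 3 * (bump 2 ?t / s ^ 4)"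
  proof -
    have "(\<Sum>b\<in>Basis. grad (\<lambda>y. grad (moll_pot s x) y \<bullet> b) y \<bullet> b) =
      (\<Sum>b\<in>Basis. (2 / s ^ 6 * (bump 4 ?t - 2 * bump 3 ?t)) * ((y - x) \<bullet> b)\<^sup>2 - bump 2 ?t / s ^ 4)"
      by (rule sum.cong[OF refl g])
    then show ?thesis by (simp only: sum_subtractf sum_distrib_left sum_constant d3 of_nat_numeral)
  qed
  also have "(\<Sum>b\<in>Basis. ((y - x) \<bullet> b)\<^sup>2) = (y - x) \<bullet> (y - x)"
    by (simp only: euclidean_inner[of "y - x" "y - x"] power2_eq_square)
  finally show ?thesis unfolding moll'_def by (simp add: mult_ac)
qed

section \<open>Superharmonic functions: averages and the spreading of zeros\<close>

context bounded_open3 begin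

text \<open>Nonnegative weak supersolutions of the Laplace equation: the inequality
  \<open>- \<Delta> v \<ge> 0\<close> in its weak form against nonnegative test functions.\<close>

definition superharmonic :: "('a \<Rightarrow> real) \<Rightarrow> bool" where
  "superharmonic v \<longleftrightarrow> v \<in> H1 \<Omega> \<and> (AE x in M. v x \<ge> 0) \<and>
     (\<forall>\<eta>\<in>test_functions \<Omega>. (\<forall>x. \<eta> x \<ge> 0) \<longrightarrow> ip v \<eta> \<ge> 0)"

lemma superharmonic_integrable:
  assumes "superharmonic v" shows "integrable M v"
  using assms sqi_integrable H1_sqi unfolding superharmonic_def by blast

lemma times_continuous_bounded_integrable:
  fixes v f :: "'a \<Rightarrow> real"
  assumes "integrable M v" "continuous_on UNIV f" "\<And>x. \<bar>f x\<bar> \<le> B"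
  shows "integrable M (\<lambda>x. v x * f x)"
proof (rule Bochner_Integration.integrable_bound)
  show "integrable M (\<lambda>x. \<bar>v x\<bar> * B)" using assms(1) by simp
  have [measurable]: "v \<in> borel_measurable M" "f \<in> borel_measurable M" using assms M_continuous by auto
  show "(\<lambda>x. v x * f x) \<in> borel_measurable M" by measurable
  have "B \<ge> 0" using assms(3)[of undefined] by linarith
  then show "AE x in M. norm (v x * f x) \<le> norm (\<bar>v x\<bar> * B)"
    using assms(3) by (intro AE_I2) (simp add: abs_mult mult_left_mono)
qed

lemma moll_integrable:
  assumes "integrable M v" "s > 0" shows "integrable M (\<lambda>y. v y * moll s (y - x))"
proof (rule times_continuous_bounded_integrable[OF assms(1) moll_continuous(1)[OF assms(2)]])
  show "\<bar>moll s (y - x)\<bar> \<le> 2 / s ^ 3" for y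
    using moll_nonneg[OF assms(2), of "y - x"] moll_le[OF assms(2), of "y - x"] by simp
qed

text \<open>The weak gradient identity is applied to each partial derivative of the test function
  \<open>moll_pot s x\<close>. Summation produces its Laplacian on one side and minus the inner
  product with \<open>v\<close> on the other.\<close>

lemma superharmonic_moll':
  assumes v: "superharmonic v" and s: "s > 0" "cball x s \<subseteq> \<Omega>"
  shows "(LINT y|M. v y * moll' s (y - x)) \<le> 0"
proof -
  let ?\<eta> = "moll_pot s x"
  have t: "?\<eta> \<in> test_functions \<Omega>" by (rule moll_pot_test[OF s])
  have h: "v \<in> H1 \<Omega>" using v by (simp add: superharmonic_def)
  define G where "G = weak_gradient \<Omega> v"
  have w: "wg v G" unfolding G_def by (rule wg_H1[OF h])
  have sG: "sqi G" "sqi v" using w by (auto simp: wg_def)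
  have b: "integrable M (\<lambda>y. v y * (grad (\<lambda>y. grad ?\<eta> y \<bullet> b) y \<bullet> b))"
    "(LINT y|M. v y * (grad (\<lambda>y. grad ?\<eta> y \<bullet> b) y \<bullet> b)) = - (LINT y|M. (grad ?\<eta> y \<bullet> b) * (G y \<bullet> b))"
    "integrable M (\<lambda>y. (grad ?\<eta> y \<bullet> b) * (G y \<bullet> b))" if b: "b \<in> Basis" for b
  proof -
    have tb: "(\<lambda>y. grad ?\<eta> y \<bullet> b) \<in> test_functions \<Omega>" by (rule test_grad_component[OF t b])
    have i1: "integrable M (\<lambda>y. v y *\<^sub>R grad (\<lambda>y. grad ?\<eta> y \<bullet> b) y)"
      by (rule grad_scale_integrable[OF open_domain integrable_locally[OF sqi_integrable[OF sG(2)]] tb])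
    have i2: "integrable M (\<lambda>y. (grad ?\<eta> y \<bullet> b) *\<^sub>R G y)"
      by (rule test_scale_integrable[OF open_domain integrable_locally[OF sqi_integrable[OF sG(1)]] tb])
    show "integrable M (\<lambda>y. v y * (grad (\<lambda>y. grad ?\<eta> y \<bullet> b) y \<bullet> b))"
      using integrable_inner_left[OF i1, of b] by simp
    show "integrable M (\<lambda>y. (grad ?\<eta> y \<bullet> b) * (G y \<bullet> b))"
      using integrable_inner_left[OF i2, of b] by simp
    have "(LINT y|M. v y *\<^sub>R grad (\<lambda>y. grad ?\<eta> y \<bullet> b) y) = - (LINT y|M. (grad ?\<eta> y \<bullet> b) *\<^sub>R G y)"
      using w tb unfolding wg_iff by blast
    then have "(LINT y|M. v y *\<^sub>R grad (\<lambda>y. grad ?\<eta> y \<bullet> b) y) \<bullet> b = - ((LINT y|M. (grad ?\<eta> y \<bullet> b) *\<^sub>R G y) \<bullet> b)"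
      by simp
    then show "(LINT y|M. v y * (grad (\<lambda>y. grad ?\<eta> y \<bullet> b) y \<bullet> b)) = - (LINT y|M. (grad ?\<eta> y \<bullet> b) * (G y \<bullet> b))"
      using integral_inner_left[OF i1, of b] integral_inner_left[OF i2, of b] by simp
  qed
  have "(LINT y|M. v y * moll' s (y - x)) = (LINT y|M. (\<Sum>b\<in>Basis. v y * (grad (\<lambda>y. grad ?\<eta> y \<bullet> b) y \<bullet> b)))"
    by (simp only: moll_pot_laplacian[OF s(1) dim3, symmetric] sum_distrib_left)
  also have "\<dots> = (\<Sum>b\<in>Basis. - (LINT y|M. (grad ?\<eta> y \<bullet> b) * (G y \<bullet> b)))"
    using b by (subst Bochner_Integration.integral_sum) auto
  also have "\<dots> = - (\<Sum>b\<in>Basis. (LINT y|M. (grad ?\<eta> y \<bullet> b) * (G y \<bullet> b)))" by (simp add: sum_negf)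
  also have "(\<Sum>b\<in>Basis. (LINT y|M. (grad ?\<eta> y \<bullet> b) * (G y \<bullet> b))) =
      (LINT y|M. (\<Sum>b\<in>Basis. (grad ?\<eta> y \<bullet> b) * (G y \<bullet> b)))"
    using b by (subst Bochner_Integration.integral_sum) auto
  also have "\<dots> = (LINT y|M. grad ?\<eta> y \<bullet> G y)"
    by (rule Bochner_Integration.integral_cong[OF refl]) (rule euclidean_inner[symmetric])
  also have "\<dots> = ip v ?\<eta>" by (simp add: ip_wg[OF w wg_test[OF t]] inner_commute)
  finally have "(LINT y|M. v y * moll' s (y - x)) = - ip v ?\<eta>" .
  moreover have "\<forall>y. ?\<eta> y \<ge> 0" by (simp add: moll_pot_nonneg)
  then have "ip v ?\<eta> \<ge> 0" using v t unfolding superharmonic_def by blast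
  ultimately show ?thesis by simp
qed

lemma superharmonic_averages:
  assumes v: "superharmonic v" and s: "0 < s" "s \<le> r" "cball x r \<subseteq> \<Omega>"
  shows "(LINT y|M. v y * moll r (y - x)) \<le> (LINT y|M. v y * moll s (y - x))"
proof -
  \<comment> \<open>Room beyond \<open>r\<close> makes the derivative at the endpoint
    \<open>t = r\<close> two-sided.\<close>
  obtain r' where r': "r' > r" "cball x r' \<subseteq> \<Omega>"
  proof -
    have "\<exists>e>0. \<forall>y\<in>cball x r. ball y e \<subseteq> \<Omega>"
      using compact_subset_open_imp_ball_epsilon_subset[of "cball x r" \<Omega>] open_domain s(3)
      by (metis UN_subset_iff compact_cball)
    then obtain e where e: "e > 0" "\<And>y. y \<in> cball x r \<Longrightarrow> ball y e \<subseteq> \<Omega>" by blast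
    have "cball x (r + e / 2) \<subseteq> \<Omega>"
    proof
      fix z assume z: "z \<in> cball x (r + e / 2)"
      show "z \<in> \<Omega>"
      proof (cases "z \<in> cball x r")
        case False
        then have nz: "norm (z - x) > r" "norm (z - x) \<le> r + e / 2"
          using z by (auto simp: dist_norm norm_minus_commute)
        define y where "y = x + (r / norm (z - x)) *\<^sub>R (z - x)"
        have "norm (z - x) > 0" using nz s by linarith
        then have "norm (y - x) = r" using s by (simp add: y_def)
        then have yc: "y \<in> cball x r" by (simp add: dist_norm norm_minus_commute)
        have "z - y = (1 - r / norm (z - x)) *\<^sub>R (z - x)" by (simp add: y_def scaleR_diff_left)
        then have "norm (z - y) = \<bar>1 - r / norm (z - x)\<bar> * norm (z - x)" by simp
        also have "\<dots> = norm (z - x) - r"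
        proof -
          have "\<bar>1 - r / n\<bar> * n = n - r" if "r < n" for n
            using that s by (simp add: abs_if field_simps)
          then show ?thesis using nz by blast
        qed
        finally have "z \<in> ball y e" using nz e by (simp add: dist_norm norm_minus_commute)
        then show ?thesis using e(2)[OF yc] by blast
      qed (use s in blast)
    qed
    then show ?thesis using that[of "r + e / 2"] e by simp
  qed
  note vi = superharmonic_integrable[OF v]
  have D: "((\<lambda>t. LINT y|M. v y * moll t (y - x)) has_real_derivative (LINT y|M. v y * moll' t (y - x))) (at t)"
    if t: "s \<le> t" "t \<le> r" for t
  proof (rule DERIV_integral_param[OF vi, of "s / 2" t r'])
    show "s / 2 < t" "t < r'" using t s r' by auto
    show "((\<lambda>t. moll t (y - x)) has_real_derivative moll' u (y - x)) (at u)" if "s / 2 < u" for u y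
      using that s by (intro moll_DERIV) auto
    show "\<bar>moll' u (y - x)\<bar> \<le> 6 / (s / 2) ^ 4 + 72 * r'\<^sup>2 / (s / 2) ^ 6" if "s / 2 < u" "u < r'" for u y
      using that s by (intro moll'_bound) auto
    show "integrable M (\<lambda>y. v y * moll u (y - x))" if "s / 2 < u" for u
      using that s by (intro moll_integrable vi) auto
    have "t > 0" using t s by simp
    have [measurable]: "v \<in> borel_measurable M" "(\<lambda>y. moll' t (y - x)) \<in> borel_measurable M"
      using vi M_continuous[OF moll_continuous(2)[OF \<open>t > 0\<close>]] by auto
    show "(\<lambda>y. v y * moll' t (y - x)) \<in> borel_measurable M" by measurable
  qed
  have neg: "(LINT y|M. v y * moll' t (y - x)) \<le> 0" if "s \<le> t" "t \<le> r" for t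
    using that s by (intro superharmonic_moll'[OF v]) auto
  show ?thesis
    by (rule DERIV_nonpos_imp_nonincreasing[OF s(2)]) (use D neg in blast)
qed

text \<open>At a Lebesgue point where \<open>v\<close> vanishes, its mean over a small cube is
  arbitrarily small, and so is its average against a mollifier supported in that cube. Monotonicity
  in the scale carries the smallness over to a mollifier of radius \<open>R/2\<close>, which is
  bounded below on the ball of radius \<open>R/8\<close>; hence \<open>v\<close> has integral zero
  over that ball.\<close>

lemma superharmonic_zero_spreads:
  assumes v: "superharmonic v"
  shows "AE x in M. v x = 0 \<longrightarrow> (\<forall>R>0. cball x R \<subseteq> \<Omega> \<longrightarrow> (AE y in M. y \<in> ball x (R / 8) \<longrightarrow> v y = 0))"
proof -
  note vi = superharmonic_integrable[OF v]
  have vpos: "AE y in M. v y \<ge> 0" using v by (simp add: superharmonic_def)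
  define f where "f = (\<lambda>x. indicator \<Omega> x *\<^sub>R v x)"
  have fi: "integrable lebesgue f" unfolding f_def using vi by (simp add: integrable_restrict_space)
  from Lebesgue_points[OF fi]
  have "AE x in M. \<forall>e>0. \<exists>d>0. \<forall>h. 0 < h \<and> h < d \<longrightarrow>
      norm ((LINT y|lebesgue_on (cbox x (x + h *\<^sub>R One)). f y) /\<^sub>R h ^ DIM('a) - f x) < e"
    by (subst AE_restrict_space_iff) (auto elim!: eventually_mono)
  then show ?thesis
  proof (eventually_elim, intro impI allI)
    fix x R assume leb: "\<forall>e>0. \<exists>d>0. \<forall>h. 0 < h \<and> h < d \<longrightarrow>
      norm ((LINT y|lebesgue_on (cbox x (x + h *\<^sub>R One)). f y) /\<^sub>R h ^ DIM('a) - f x) < e"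
      and vx: "v x = 0" and R: "(0::real) < R" "cball x R \<subseteq> \<Omega>"
    define s where "s = R / 2"
    have s: "s > 0" using R by (simp add: s_def)
    \<comment> \<open>A lower bound for \<open>moll s\<close> around \<open>y0\<close> on
      \<open>?B\<close>: there the argument \<open>t\<close> of \<open>bump 2\<close> lies between
      \<open>3/4\<close> and 1.\<close>
    let ?c = "exp (- 4 / 3) / s ^ 3"
    let ?B = "ball x (R / 8)"
    have Bsets: "?B \<in> sets M" using open_domain
      by (subst sets_restrict_space_iff) (use R in auto)
    have Bi: "integrable M (\<lambda>y. indicator ?B y * v y)"
      using integrable_mult_indicator[OF Bsets vi] by simp
    have key: "?c * (LINT y|M. indicator ?B y * v y) \<le> e" if e: "e > 0" for e
    proof -
      obtain d where d: "d > 0" "\<forall>h. 0 < h \<and> h < d \<longrightarrow>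
         norm ((LINT y|lebesgue_on (cbox x (x + h *\<^sub>R One)). f y) /\<^sub>R h ^ DIM('a) - f x) < e / 16"
        using leb[rule_format, of "e / 16"] e by auto
      \<comment> \<open>With \<open>h \<le> R/24\<close> the centre \<open>y0\<close> is within
        \<open>R/16\<close> of \<open>x\<close>. Then the ball of radius \<open>s\<close> about
        \<open>y0\<close> stays in the ball of radius \<open>R\<close>, and points of
        \<open>?B\<close> are within \<open>R/8 + R/16 = 3/8 * s\<close> of
        \<open>y0\<close>.\<close>
      define h where "h = min (d / 2) (R / 24)"
      have h: "0 < h" "h < d" "h \<le> R / 24" using d R by (auto simp: h_def)
      let ?C = "cbox x (x + h *\<^sub>R One)"
      \<comment> \<open>The Lebesgue cube has \<open>x\<close> as a corner. Around its centre
        \<open>y0\<close> the mollifier of radius \<open>h/2\<close> is supported in the cube, with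
        values at most \<open>16 / h^3\<close>.\<close>
      define y0 where "y0 = x + (h / 2) *\<^sub>R One"
      have ny0: "norm (y0 - x) \<le> 3 * (h / 2)"
      proof -
        have "norm (y0 - x) = h / 2 * norm (One::'a)" using h by (simp add: y0_def)
        also have "norm (One::'a) \<le> 3" using norm_le_l1[of "One::'a"] by (simp add: dim3)
        finally show ?thesis using h by (simp add: mult.commute)
      qed
      have sub: "cball y0 s \<subseteq> \<Omega>"
      proof -
        have "cball y0 s \<subseteq> cball x R"
        proof
          fix z assume "z \<in> cball y0 s"
          then have "norm (z - y0) \<le> s" by (simp add: dist_norm norm_minus_commute)
          then have "norm (z - x) \<le> s + 3 * (h / 2)"
            using ny0 norm_triangle_ineq[of "z - y0" "y0 - x"] by simp
          then show "z \<in> cball x R" using h R by (simp add: s_def dist_norm norm_minus_commute)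
        qed
        then show ?thesis using R by blast
      qed
      have Csets: "?C \<in> sets lebesgue" by simp
      have Cint: "(LINT y|lebesgue_on ?C. f y) = (LINT y|M. indicator ?C y * v y)"
      proof -
        have "(LINT y|lebesgue_on ?C. f y) = (LINT y|lebesgue. indicator ?C y *\<^sub>R f y)"
          by (simp add: integral_restrict_space)
        also have "\<dots> = (LINT y|lebesgue. indicator \<Omega> y *\<^sub>R (indicator ?C y * v y))"
          by (rule Bochner_Integration.integral_cong) (auto simp: f_def)
        also have "\<dots> = (LINT y|M. indicator ?C y * v y)" by (simp add: integral_restrict_space)
        finally show ?thesis .
      qed
      have Ci: "integrable M (\<lambda>y. indicator ?C y * v y)"
      proof -
        have "(\<lambda>y. indicator ?C y *\<^sub>R f y) = (\<lambda>y. indicator \<Omega> y *\<^sub>R (indicator ?C y * v y))"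
          by (auto simp: f_def)
        then show ?thesis
          using integrable_mult_indicator[OF Csets fi] by (simp add: integrable_restrict_space)
      qed
      have small: "(LINT y|M. indicator ?C y * v y) \<le> e / 16 * h ^ 3"
      proof -
        have "norm ((LINT y|M. indicator ?C y * v y) /\<^sub>R h ^ 3) < e / 16"
        proof -
          have "f x = 0" using vx by (simp add: f_def)
          moreover have "norm ((LINT y|lebesgue_on ?C. f y) /\<^sub>R h ^ DIM('a) - f x) < e / 16"
            using d(2) h by blast
          ultimately show ?thesis unfolding Cint dim3 by simp
        qed
        moreover have "t / h ^ 3 \<le> norm (t /\<^sub>R h ^ 3)" for t
          using abs_ge_self[of "t / h ^ 3"] by (simp add: divide_inverse_commute)
        ultimately have "(LINT y|M. indicator ?C y * v y) / h ^ 3 < e / 16"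
          by (rule le_less_trans[rotated])
        then show ?thesis using h by (simp add: pos_divide_less_eq less_imp_le)
      qed
      have "(LINT y|M. v y * moll s (y - y0)) \<le> (LINT y|M. v y * moll (h / 2) (y - y0))"
        using h R by (intro superharmonic_averages[OF v _ _ sub]) (auto simp: s_def)
      also have "\<dots> \<le> (LINT y|M. 16 / h ^ 3 * (indicator ?C y * v y))"
      proof (rule integral_mono_AE)
        show "integrable M (\<lambda>y. v y * moll (h / 2) (y - y0))" using h by (intro moll_integrable vi) auto
        show "integrable M (\<lambda>y. 16 / h ^ 3 * (indicator ?C y * v y))" using Ci by simp
        show "AE y in M. v y * moll (h / 2) (y - y0) \<le> 16 / h ^ 3 * (indicator ?C y * v y)"
          using vpos
        proof eventually_elim
          case (elim y)
          show ?case
          proof (cases "y \<in> ?C")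
            case True
            have "moll (h / 2) (y - y0) \<le> 2 / (h / 2) ^ 3" using h by (intro moll_le) simp
            then have "v y * moll (h / 2) (y - y0) \<le> v y * (16 / h ^ 3)"
              using elim by (intro mult_left_mono) (auto simp: power_divide)
            then show ?thesis using True by (simp add: mult.commute)
          next
            case False
            then obtain b where b: "b \<in> Basis" "y \<bullet> b < x \<bullet> b \<or> x \<bullet> b + h < y \<bullet> b"
              by (auto simp: mem_box inner_simps not_le)
            then have "h / 2 \<le> \<bar>(y - y0) \<bullet> b\<bar>"
              using h by (auto simp: y0_def inner_simps)
            also have "\<dots> \<le> norm (y - y0)" by (rule Basis_le_norm[OF b(1)])
            finally have "moll (h / 2) (y - y0) = 0" using h by (intro moll_support) auto
            then show ?thesis using False by simp
          qed
        qed
      qed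
      also have "\<dots> = 16 / h ^ 3 * (LINT y|M. indicator ?C y * v y)" by simp
      also have "\<dots> \<le> 16 / h ^ 3 * (e / 16 * h ^ 3)" using h by (intro mult_left_mono small) auto
      also have "\<dots> = e" using h by simp
      finally have le: "(LINT y|M. v y * moll s (y - y0)) \<le> e" .
      have "?c * (LINT y|M. indicator ?B y * v y) = (LINT y|M. ?c * (indicator ?B y * v y))" by simp
      also have "\<dots> \<le> (LINT y|M. v y * moll s (y - y0))"
      proof (rule integral_mono_AE)
        show "integrable M (\<lambda>y. ?c * (indicator ?B y * v y))" using Bi by simp
        show "integrable M (\<lambda>y. v y * moll s (y - y0))" by (intro moll_integrable vi s)
        show "AE y in M. ?c * (indicator ?B y * v y) \<le> v y * moll s (y - y0)"
          using vpos
        proof eventually_elim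
          case (elim y)
          show ?case
          proof (cases "y \<in> ?B")
            case True
            then have "norm (y - x) < R / 8" by (simp add: dist_norm norm_minus_commute)
            then have "norm (y - y0) \<le> R / 8 + 3 * (h / 2)"
              using ny0 norm_triangle_ineq4[of "y - x" "y0 - x"] by simp
            then have "norm (y - y0) \<le> 3 / 8 * s" using h by (simp add: s_def)
            then have "(norm (y - y0))\<^sup>2 \<le> (3 / 8 * s)\<^sup>2" by (intro power_mono) auto
            also have "\<dots> \<le> 1 / 4 * s\<^sup>2" by (simp add: power2_eq_square)
            finally have q: "((y - y0) \<bullet> (y - y0)) / s\<^sup>2 \<le> 1 / 4"
              using s by (simp add: power2_norm_eq_inner divide_le_eq)
            define t where "t = 1 - ((y - y0) \<bullet> (y - y0)) / s\<^sup>2"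
            have t: "t \<ge> 3 / 4" "t \<le> 1" using q s by (auto simp: t_def)
            have "exp (- 4 / 3) \<le> exp (- 1 / t)" using t by (simp add: field_simps)
            also have "\<dots> \<le> exp (- 1 / t) / t\<^sup>2"
              using t by (simp add: le_divide_eq power_le_one mult_left_le)
            also have "\<dots> = bump 2 t" using t by (simp add: bump_def)
            finally have "?c \<le> moll s (y - y0)"
              unfolding moll_def t_def[symmetric] using s by (intro divide_right_mono) auto
            then have "?c * v y \<le> v y * moll s (y - y0)"
              using elim by (subst mult.commute) (rule mult_left_mono)
            then show ?thesis using True by simp
          next
            case False
            then show ?thesis using elim moll_nonneg[OF s, of "y - y0"] by simp
          qed
        qed
      qed
      also note le
      finally show ?thesis .
    qed
    have "?c * (LINT y|M. indicator ?B y * v y) \<le> 0"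
      by (rule field_le_epsilon) (use key in simp)
    moreover have "?c > 0" using s by simp
    ultimately have "(LINT y|M. indicator ?B y * v y) \<le> 0" by (simp only: mult_le_0_iff) auto
    moreover have nn: "AE y in M. indicator ?B y * v y \<ge> 0"
      using vpos by eventually_elim (simp add: indicator_def)
    moreover have "(LINT y|M. indicator ?B y * v y) \<ge> 0" by (rule integral_nonneg_AE[OF nn])
    ultimately have "AE y in M. indicator ?B y * v y = 0"
      using integral_nonneg_eq_0_iff_AE[OF Bi] by simp
    then show "AE y in M. y \<in> ?B \<longrightarrow> v y = 0" by eventually_elim (auto simp: indicator_def)
  qed
qed

lemma nonnull_ball:
  assumes "ball z r \<subseteq> \<Omega>" "r > 0" "AE y in M. y \<in> ball z r \<longrightarrow> P y"
  shows "\<exists>y\<in>ball z r. P y"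
proof (rule ccontr)
  assume "\<not> ?thesis"
  then have "AE y in lebesgue. y \<notin> ball z r"
    using assms(1,3) by (subst (asm) AE_restrict_space_iff) (auto elim!: eventually_mono)
  then have "ball z r \<in> null_sets lebesgue"
    by (subst (asm) AE_iff_null_sets[symmetric]) auto
  then have "negligible (ball z r)" by (simp add: negligible_iff_null_sets)
  then show False using assms(2) by (simp add: open_not_negligible)
qed

text \<open>The set \<open>Z\<close> of points near which \<open>v\<close> vanishes almost
  everywhere is open by definition, and its complement in \<Omega> is open because zeros spread to
  balls of a size depending only on the distance to the boundary. Connectedness leaves only
  \<open>Z\<close> equal to \<Omega>, contrary to \<open>nz\<close>.\<close>

theorem strong_maximum_principle:
  assumes conn: "connected \<Omega>" and v: "superharmonic v" and nz: "\<not> (AE x in M. v x = 0)"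
  shows "AE x in M. v x > 0"
proof (rule ccontr)
  assume notpos: "\<not> ?thesis"
  \<comment> \<open>\<open>P\<close> turns the almost everywhere statement on spreading into a
    property of single points, so that a zero with this property can be picked in any set of
    positive measure on which \<open>v\<close> vanishes.\<close>
  define P where "P x \<longleftrightarrow> (v x = 0 \<longrightarrow> (\<forall>R>0. cball x R \<subseteq> \<Omega> \<longrightarrow> (AE y in M. y \<in> ball x (R / 8) \<longrightarrow> v y = 0)))" for x
  have P: "AE x in M. P x" unfolding P_def by (rule superharmonic_zero_spreads[OF v])
  define Z where "Z = {x \<in> \<Omega>. \<exists>r>0. AE y in M. y \<in> ball x r \<longrightarrow> v y = 0}"
  have "\<exists>x\<in>\<Omega>. P x \<and> v x = 0"
  proof (rule ccontr)
    assume no: "\<not> ?thesis"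
    have vpos: "AE x in M. v x \<ge> 0" using v by (simp add: superharmonic_def)
    have "AE x in M. x \<in> \<Omega>" by (rule AE_I2) simp
    with P vpos have "AE x in M. v x > 0" by eventually_elim (use no in force)
    with notpos show False by blast
  qed
  then obtain x where x: "x \<in> \<Omega>" "P x" "v x = 0" by blast
  have PZ: "x \<in> Z" if x: "x \<in> \<Omega>" "P x" "v x = 0" for x
  proof -
    obtain R where "R > 0" "cball x R \<subseteq> \<Omega>" using open_domain x(1) open_contains_cball by blast
    then show ?thesis using x unfolding Z_def P_def by (auto intro!: exI[of _ "R / 8"])
  qed
  have "x \<in> Z" using PZ x by blast
  have oZ: "open Z" unfolding open_contains_ball
  proof
    fix x assume "x \<in> Z"
    then obtain r where x: "x \<in> \<Omega>" "r > 0" "AE y in M. y \<in> ball x r \<longrightarrow> v y = 0" by (auto simp: Z_def)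
    obtain e where e: "e > 0" "ball x e \<subseteq> \<Omega>" using open_domain x(1) open_contains_ball by blast
    show "\<exists>e>0. ball x e \<subseteq> Z"
    proof (intro exI conjI subsetI)
      show "min e (r / 2) > 0" using e x by simp
      fix z assume z: "z \<in> ball x (min e (r / 2))"
      have "ball z (r / 2) \<subseteq> ball x r"
        using z by (auto intro: dist_triangle_half_r simp: dist_commute dist_triangle_half_l)
      then have "AE y in M. y \<in> ball z (r / 2) \<longrightarrow> v y = 0" using x(3) by (auto elim!: eventually_mono)
      then show "z \<in> Z" using z e x(2) by (auto simp: Z_def intro!: exI[of _ "r / 2"])
    qed
  qed
  have oW: "open (\<Omega> - Z)" unfolding open_contains_ball
  proof
    fix x assume x: "x \<in> \<Omega> - Z"
    obtain R where R: "R > 0" "cball x R \<subseteq> \<Omega>" using open_domain x open_contains_cball by blast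
    \<comment> \<open>If some \<open>z\<close> within \<open>R/64\<close> of \<open>x\<close> were
      in \<open>Z\<close>, a spreading zero \<open>y\<close> would exist within \<open>R/32\<close>
      of \<open>x\<close>. The ball of radius \<open>R/2\<close> about \<open>y\<close> lies in
      \<Omega>, so \<open>v\<close> vanishes on the one of radius \<open>R/16\<close>, which
      contains the ball of radius \<open>R/32\<close> about \<open>x\<close>.\<close>
    have "z \<notin> Z" if z: "z \<in> ball x (R / 64)" for z
    proof
      assume "z \<in> Z"
      then obtain r where r: "r > 0" "AE y in M. y \<in> ball z r \<longrightarrow> v y = 0" by (auto simp: Z_def)
      define q where "q = min r (R / 64)"
      have q: "q > 0" "q \<le> r" "q \<le> R / 64" using r R by (auto simp: q_def)
      have sub: "ball z q \<subseteq> ball x (R / 32)"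
      proof
        fix y assume "y \<in> ball z q"
        then have "dist x y < R / 64 + R / 64"
          using z q dist_triangle[of x y z] by simp
        then show "y \<in> ball x (R / 32)" by simp
      qed
      have "AE y in M. y \<in> ball z q \<longrightarrow> v y = 0 \<and> P y"
        using r(2) P by eventually_elim (use q in auto)
      moreover have "ball z q \<subseteq> \<Omega>" using sub R by (force simp: subset_eq)
      ultimately have "\<exists>y\<in>ball z q. v y = 0 \<and> P y" using q(1) by (intro nonnull_ball)
      then obtain y where y: "y \<in> ball z q" "v y = 0" "P y" by blast
      have yx: "dist x y < R / 32" using sub y(1) by auto
      have "cball y (R / 2) \<subseteq> \<Omega>"
      proof
        fix w assume "w \<in> cball y (R / 2)"
        then have "dist x w \<le> R" using yx dist_triangle[of x w y] R(1) by simp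
        then show "w \<in> \<Omega>" using R(2) by auto
      qed
      then have "AE w in M. w \<in> ball y (R / 2 / 8) \<longrightarrow> v w = 0"
        using y(2,3) R(1) unfolding P_def by (meson half_gt_zero)
      moreover have "ball x (R / 32) \<subseteq> ball y (R / 2 / 8)"
      proof
        fix w assume "w \<in> ball x (R / 32)"
        then have "dist y w < R / 32 + R / 32" using yx dist_triangle[of y w x] by (simp add: dist_commute)
        then show "w \<in> ball y (R / 2 / 8)" by simp
      qed
      ultimately have "AE w in M. w \<in> ball x (R / 32) \<longrightarrow> v w = 0" by (auto elim!: eventually_mono)
      then have "x \<in> Z" using x R(1) by (auto simp: Z_def intro!: exI[of _ "R / 32"])
      then show False using x by blast
    qed
    moreover have "ball x (R / 64) \<subseteq> \<Omega>" using R by (force simp: subset_eq)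
    ultimately show "\<exists>e>0. ball x e \<subseteq> \<Omega> - Z" using R(1) by (intro exI[of _ "R / 64"]) auto
  qed
  have "Z \<inter> \<Omega> = {} \<or> (\<Omega> - Z) \<inter> \<Omega> = {}"
    by (rule connectedD[OF conn oZ oW]) auto
  then have Z: "\<Omega> \<subseteq> Z" using \<open>x \<in> Z\<close> x(1) by blast
  have "AE x in M. v x = 0"
  proof -
    \<comment> \<open>Local vanishing almost everywhere becomes global by a countable subcover,
      since only countably many null sets may be united.\<close>
    define \<B> where "\<B> = {ball x r |x r. r > 0 \<and> (AE y in M. y \<in> ball x r \<longrightarrow> v y = 0)}"
    obtain \<C> where C: "\<C> \<subseteq> \<B>" "countable \<C>" "\<Union>\<C> = \<Union>\<B>"
      using Lindelof[of \<B>] by (auto simp: \<B>_def)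
    have ae: "AE y in M. \<forall>B\<in>\<C>. y \<in> B \<longrightarrow> v y = 0"
      by (rule AE_ball_countable[OF C(2), THEN iffD2]) (use C(1) in \<open>auto simp: \<B>_def\<close>)
    have cover: "\<Omega> \<subseteq> \<Union>\<C>"
    proof
      fix x assume "x \<in> \<Omega>"
      then obtain r where "r > 0" "AE y in M. y \<in> ball x r \<longrightarrow> v y = 0" using Z by (auto simp: Z_def)
      then have "ball x r \<in> \<B>" "x \<in> ball x r" by (auto simp: \<B>_def)
      then show "x \<in> \<Union>\<C>" unfolding C(3) by blast
    qed
    have "AE y in M. y \<in> \<Omega>" by (rule AE_I2) simp
    with ae show ?thesis by eventually_elim (use cover in blast)
  qed
  with nz show False by blast
qed

end

subsection \<open>The fibering map\<close>

locale extremal = superquadratic +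
  fixes a :: real and v :: "'a \<Rightarrow> real"
  assumes a: "a > 0" and S: "S > 0"
    and v: "v \<in> H01 \<Omega>" "dirichlet \<Omega> v = 1" "pot v = S" "AE x in M. v x > 0"
begin

definition fib :: "real \<Rightarrow> real \<Rightarrow> real" where
  "fib l t = a / 2 * t\<^sup>2 + l / 4 * t ^ 4 - S / \<gamma> * t powr \<gamma>"

text \<open>The multiple \<open>t v\<close> with \<open>t > 0\<close> is critical for the parameter \<open>slope t\<close> only.\<close>

definition slope :: "real \<Rightarrow> real" where
  "slope t = S * t powr (\<gamma> - 4) - a * t powr (- 2)"

lemma powr_shift:
  fixes t :: real
  assumes "t > 0"
  shows "t powr (\<gamma> - 1) = t powr (\<gamma> - 2) * t" "t powr \<gamma> = t powr (\<gamma> - 2) * t\<^sup>2"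
    "t powr (\<gamma> - 2) = t powr (\<gamma> - 4) * t\<^sup>2"
proof -
  have 2: "t powr 2 = t\<^sup>2" using assms by (simp add: powr_realpow)
  have "t powr (\<gamma> - 2 + 1) = t powr (\<gamma> - 2) * t powr 1" "t powr (\<gamma> - 2 + 2) = t powr (\<gamma> - 2) * t powr 2"
    "t powr (\<gamma> - 4 + 2) = t powr (\<gamma> - 4) * t powr 2" by (rule powr_add)+
  then show "t powr (\<gamma> - 1) = t powr (\<gamma> - 2) * t" "t powr \<gamma> = t powr (\<gamma> - 2) * t\<^sup>2"
    "t powr (\<gamma> - 2) = t powr (\<gamma> - 4) * t\<^sup>2" using assms by (simp_all add: 2)
qed

lemma slope_eq:
  assumes "t > 0" shows "slope t * t\<^sup>2 = S * t powr (\<gamma> - 2) - a"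
proof -
  have "t powr (- 2) * t\<^sup>2 = 1"
    using assms by (simp add: powr_minus powr_realpow field_simps)
  then show ?thesis unfolding slope_def powr_shift(3)[OF assms] by (simp add: algebra_simps)
qed

text \<open>With \<open>t^3\<close> factored out, the monotonicity of \<open>fib l\<close> is read
  off from comparing \<open>slope\<close> with the level \<open>l\<close>; a single graph serves all
  parameters.\<close>

lemma fib_DERIV:
  assumes "t > 0" shows "(fib l has_real_derivative t ^ 3 * (l - slope t)) (at t)"
proof -
  have "(fib l has_real_derivative a / 2 * (2 * t) + l / 4 * (4 * t ^ 3) - S / \<gamma> * (\<gamma> * t powr (\<gamma> - 1))) (at t)"
    unfolding fib_def using assms by (auto intro!: derivative_eq_intros)
  moreover have "a / 2 * (2 * t) + l / 4 * (4 * t ^ 3) - S / \<gamma> * (\<gamma> * t powr (\<gamma> - 1)) = t ^ 3 * (l - slope t)"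
  proof -
    have "t ^ 3 * slope t = t * (slope t * t\<^sup>2)" by (simp add: power3_eq_cube power2_eq_square)
    also have "\<dots> = t * (S * t powr (\<gamma> - 2) - a)" by (simp only: slope_eq[OF assms])
    finally show ?thesis unfolding powr_shift(1)[OF assms] using gamma by (simp add: algebra_simps)
  qed
  ultimately show ?thesis by simp
qed

lemma fib_continuous: "continuous_on {0..} (fib l)"
  unfolding fib_def using gamma by (intro continuous_intros continuous_on_powr') auto

lemma fib_increasing:
  assumes "0 \<le> s" "s < t" "\<And>r. s < r \<Longrightarrow> r < t \<Longrightarrow> slope r < l"
  shows "fib l s < fib l t"
proof (rule DERIV_pos_imp_increasing_open[OF assms(2)])
  show "\<exists>y. (fib l has_real_derivative y) (at x) \<and> 0 < y" if "s < x" "x < t" for x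
    using fib_DERIV[of x l] assms(1) assms(3)[OF that] that by (intro exI[of _ "x ^ 3 * (l - slope x)"]) auto
  show "continuous_on {s..t} (fib l)"
    by (rule continuous_on_subset[OF fib_continuous]) (use assms in auto)
qed

lemma fib_decreasing:
  assumes "0 \<le> s" "s < t" "\<And>r. s < r \<Longrightarrow> r < t \<Longrightarrow> slope r > l"
  shows "fib l s > fib l t"
proof (rule DERIV_neg_imp_decreasing_open[OF assms(2)])
  show "\<exists>y. (fib l has_real_derivative y) (at x) \<and> y < 0" if "s < x" "x < t" for x
    using fib_DERIV[of x l] assms(1) assms(3)[OF that] that
    by (intro exI[of _ "x ^ 3 * (l - slope x)"]) (auto simp: mult_pos_neg)
  show "continuous_on {s..t} (fib l)"
    by (rule continuous_on_subset[OF fib_continuous]) (use assms in auto)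
qed

text \<open>\<open>t\<^sub>*\<close> maximizes the slope, and \<open>fib l\<close> vanishes at its critical point \<open>t\<^sub>0\<close> for \<open>l = slope t\<^sub>0\<close>.\<close>

definition tstar :: real where "tstar = (2 * a / ((4 - \<gamma>) * S)) powr (1 / (\<gamma> - 2))"
definition tzero :: real where "tzero = (\<gamma> * a / ((4 - \<gamma>) * S)) powr (1 / (\<gamma> - 2))"

lemma tstar: "tstar > 0" "(4 - \<gamma>) * (S * tstar powr (\<gamma> - 2)) = 2 * a"
  using a S gamma by (auto simp: tstar_def powr_powr)

lemma tzero: "tzero > tstar" "(4 - \<gamma>) * (S * tzero powr (\<gamma> - 2)) = \<gamma> * a"
proof -
  show "(4 - \<gamma>) * (S * tzero powr (\<gamma> - 2)) = \<gamma> * a"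
    using a S gamma by (auto simp: tzero_def powr_powr)
  show "tzero > tstar" unfolding tstar_def tzero_def
    using a S gamma by (intro powr_less_mono2 divide_strict_right_mono) auto
qed

definition lstar :: real where "lstar = slope tstar"
definition lzero :: real where "lzero = slope tzero"

lemma slope_DERIV:
  assumes "t > 0"
  shows "(slope has_real_derivative t powr (- 3) * (2 * a - (4 - \<gamma>) * (S * t powr (\<gamma> - 2)))) (at t)"
proof -
  have "(slope has_real_derivative S * ((\<gamma> - 4) * t powr (\<gamma> - 5)) - a * (- 2 * t powr (- 3))) (at t)"
    unfolding slope_def using assms by (auto intro!: derivative_eq_intros)
  moreover have "t powr (\<gamma> - 5) = t powr (- 3) * t powr (\<gamma> - 2)" by (simp flip: powr_add)
  ultimately show ?thesis by (simp add: algebra_simps)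
qed

lemma powr_compare:
  assumes "0 < s" "s < t"
  shows "(4 - \<gamma>) * (S * s powr (\<gamma> - 2)) < (4 - \<gamma>) * (S * t powr (\<gamma> - 2))"
proof -
  have "s powr (\<gamma> - 2) < t powr (\<gamma> - 2)" using assms gamma by (intro powr_less_mono2) auto
  then show ?thesis using S gamma by simp
qed

lemma slope_continuous: "0 < s \<Longrightarrow> continuous_on {s..t} slope"
  by (rule DERIV_continuous_on[OF has_field_derivative_at_within[OF slope_DERIV]]) auto

lemma slope_increasing:
  assumes "0 < s" "s < t" "t \<le> tstar" shows "slope s < slope t"
proof (rule DERIV_pos_imp_increasing_open[OF assms(2)])
  fix x assume x: "s < x" "x < t"
  have "(4 - \<gamma>) * (S * x powr (\<gamma> - 2)) < 2 * a"
    using powr_compare[of x tstar] tstar x assms by simp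
  then show "\<exists>y. (slope has_real_derivative y) (at x) \<and> 0 < y"
    using slope_DERIV[of x] x assms
    by (intro exI[of _ "x powr (- 3) * (2 * a - (4 - \<gamma>) * (S * x powr (\<gamma> - 2)))"] conjI) auto
qed (rule slope_continuous[OF assms(1)])

lemma slope_decreasing:
  assumes "tstar \<le> s" "s < t" shows "slope s > slope t"
proof (rule DERIV_neg_imp_decreasing_open[OF assms(2)])
  have s: "s > 0" using assms tstar by simp
  show "continuous_on {s..t} slope" by (rule slope_continuous[OF s])
  fix x assume x: "s < x" "x < t"
  have "2 * a < (4 - \<gamma>) * (S * x powr (\<gamma> - 2))"
    using powr_compare[of tstar x] tstar x assms by simp
  then show "\<exists>y. (slope has_real_derivative y) (at x) \<and> y < 0"
    using slope_DERIV[of x] x s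
    by (intro exI[of _ "x powr (- 3) * (2 * a - (4 - \<gamma>) * (S * x powr (\<gamma> - 2)))"] conjI) (auto simp: mult_pos_neg)
qed

lemma slope_le: "t > 0 \<Longrightarrow> slope t \<le> lstar"
  unfolding lstar_def using slope_increasing[of t tstar] slope_decreasing[of tstar t]
  by (cases t tstar rule: linorder_cases) auto

lemma lzero_bounds: "0 < lzero" "lzero < lstar"
proof -
  show "lzero < lstar" unfolding lzero_def lstar_def by (rule slope_decreasing) (use tzero in auto)
  have t: "tzero > 0" using tzero tstar by simp
  have "(4 - \<gamma>) * a < (4 - \<gamma>) * (S * tzero powr (\<gamma> - 2))"
    unfolding tzero(2) using a gamma by (intro mult_strict_right_mono) auto
  then have "S * tzero powr (\<gamma> - 2) - a > 0" using gamma by simp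
  then have "lzero * tzero\<^sup>2 > 0" unfolding lzero_def slope_eq[OF t] .
  then show "0 < lzero" using t by (simp add: zero_less_mult_iff)
qed

text \<open>Intermediate values on the increasing and on the decreasing part of
  \<open>slope\<close>; the two roots coincide with \<open>tstar\<close> when
  \<open>l = lstar\<close>.\<close>

lemma branches:
  assumes l: "0 < l" "l \<le> lstar"
  shows "\<exists>p q. 0 < p \<and> p \<le> tstar \<and> tstar \<le> q \<and> slope p = l \<and> slope q = l \<and>
    (l < lstar \<longrightarrow> p < tstar \<and> tstar < q) \<and> (\<forall>t. 0 < t \<and> t < p \<longrightarrow> slope t < l) \<and>
    (\<forall>t. p < t \<and> t < q \<longrightarrow> slope t > l) \<and> (\<forall>t. q < t \<longrightarrow> slope t < l)"
proof -
  \<comment> \<open>At this point \<open>S * t powr (\<gamma> - 2) \<le> a\<close>, so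
    \<open>slope\<close> is nonpositive and hence below \<open>l\<close>.\<close>
  define t1 where "t1 = min tstar ((a / S) powr (1 / (\<gamma> - 2)))"
  have t1: "t1 > 0" "t1 \<le> tstar" using tstar a S by (auto simp: t1_def)
  have "t1 powr (\<gamma> - 2) \<le> ((a / S) powr (1 / (\<gamma> - 2))) powr (\<gamma> - 2)"
    using t1 gamma by (intro powr_mono2) (auto simp: t1_def)
  also have "\<dots> = a / S" using a S gamma by (simp add: powr_powr)
  finally have "S * t1 powr (\<gamma> - 2) - a \<le> 0" using S by (simp add: field_simps)
  then have "slope t1 \<le> 0" unfolding slope_eq[OF t1(1), symmetric] using t1 by (simp add: mult_le_0_iff)
  then obtain p where p: "t1 \<le> p" "p \<le> tstar" "slope p = l"
    using IVT'[of slope t1 l tstar] t1 l slope_continuous[OF t1(1)] unfolding lstar_def by auto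
  \<comment> \<open>Here the first term of \<open>slope\<close> alone is at most \<open>l\<close>;
    the exponent \<open>\<gamma> - 4\<close> is negative, so a large argument makes it
    small.\<close>
  define t2 where "t2 = max tstar ((l / S) powr (1 / (\<gamma> - 4)))"
  have t2: "t2 > 0" "t2 \<ge> tstar" using tstar by (auto simp: t2_def)
  have "t2 powr (\<gamma> - 4) \<le> ((l / S) powr (1 / (\<gamma> - 4))) powr (\<gamma> - 4)"
    using l S gamma by (intro powr_mono2') (auto simp: t2_def)
  also have "\<dots> = l / S" using l S gamma by (simp add: powr_powr)
  finally have "S * t2 powr (\<gamma> - 4) \<le> l" using S by (simp add: field_simps)
  moreover have "a * t2 powr (- 2) > 0" using a t2 by simp
  ultimately have "slope t2 \<le> l" unfolding slope_def by linarith
  then obtain q where q: "tstar \<le> q" "q \<le> t2" "slope q = l"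
    using IVT2'[of slope t2 l tstar] t2 l slope_continuous[OF tstar(1)] unfolding lstar_def by auto
  have p0: "p > 0" using p t1 by simp
  show ?thesis
  proof (rule exI[of _ p], rule exI[of _ q], intro conjI allI impI)
    show "p < tstar" "tstar < q" if "l < lstar"
      using that p q unfolding lstar_def by (auto simp: less_le)
    show "slope t < l" if "0 < t \<and> t < p" for t using slope_increasing[of t p] p that by auto
    show "slope t < l" if "q < t" for t using slope_decreasing[of q t] q that by auto
    show "slope t > l" if "p < t \<and> t < q" for t
      using slope_increasing[of p t] slope_decreasing[of t q] p q p0 that by (cases "t \<le> tstar") auto
  qed (use p q p0 in auto)
qed

text \<open>The radius at which \<open>fib l\<close> has its barrier, that is, the norm of the
  mountain pass solution \<open>tw l * v\<close>. The other root, the norm of the minimizer, is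
  chosen afterwards because its description refers to \<open>tw l\<close>.\<close>

definition tw :: "real \<Rightarrow> real" where
  "tw l = (SOME p. \<exists>q. 0 < p \<and> p \<le> tstar \<and> tstar \<le> q \<and> slope p = l \<and> slope q = l \<and>
    (l < lstar \<longrightarrow> p < tstar \<and> tstar < q) \<and> (\<forall>t. 0 < t \<and> t < p \<longrightarrow> slope t < l) \<and>
    (\<forall>t. p < t \<and> t < q \<longrightarrow> slope t > l) \<and> (\<forall>t. q < t \<longrightarrow> slope t < l))"

definition tu :: "real \<Rightarrow> real" where
  "tu l = (SOME q. tstar \<le> q \<and> slope q = l \<and> (l < lstar \<longrightarrow> tstar < q) \<and>
    (\<forall>t. tw l < t \<and> t < q \<longrightarrow> slope t > l) \<and> (\<forall>t. q < t \<longrightarrow> slope t < l))"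

lemma tw_tu:
  assumes "0 < l" "l \<le> lstar"
  shows "0 < tw l" "tw l \<le> tstar" "tstar \<le> tu l" "slope (tw l) = l" "slope (tu l) = l"
    "l < lstar \<Longrightarrow> tw l < tstar" "l < lstar \<Longrightarrow> tstar < tu l"
    "\<And>t. 0 < t \<Longrightarrow> t < tw l \<Longrightarrow> slope t < l" "\<And>t. tw l < t \<Longrightarrow> t < tu l \<Longrightarrow> slope t > l"
    "\<And>t. tu l < t \<Longrightarrow> slope t < l"
proof -
  note w = someI_ex[OF branches[OF assms], folded tw_def]
  then have "\<exists>q. tstar \<le> q \<and> slope q = l \<and> (l < lstar \<longrightarrow> tstar < q) \<and>
    (\<forall>t. tw l < t \<and> t < q \<longrightarrow> slope t > l) \<and> (\<forall>t. q < t \<longrightarrow> slope t < l)" by blast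
  note u = someI_ex[OF this, folded tu_def]
  show "0 < tw l" "tw l \<le> tstar" "tstar \<le> tu l" "slope (tw l) = l" "slope (tu l) = l"
    "l < lstar \<Longrightarrow> tw l < tstar" "l < lstar \<Longrightarrow> tstar < tu l"
    "\<And>t. 0 < t \<Longrightarrow> t < tw l \<Longrightarrow> slope t < l" "\<And>t. tw l < t \<Longrightarrow> t < tu l \<Longrightarrow> slope t > l"
    "\<And>t. tu l < t \<Longrightarrow> slope t < l"
    using w u by blast+
qed

lemma tu_lzero: "tu lzero = tzero"
proof -
  note t = tw_tu[of lzero]
  have l: "0 < lzero" "lzero \<le> lstar" using lzero_bounds by auto
  show ?thesis
    using slope_decreasing[of "tu lzero" tzero] slope_decreasing[of tzero "tu lzero"] t(3,5)[OF l] tzero(1)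
    unfolding lzero_def[symmetric] by (cases "tu lzero" tzero rule: linorder_cases) auto
qed

lemma fib_zero: "fib l 0 = 0" using gamma by (simp add: fib_def)

lemma fib_shape:
  assumes l: "0 < l" "l \<le> lstar"
  shows "0 \<le> s \<Longrightarrow> s < t \<Longrightarrow> t \<le> tw l \<Longrightarrow> fib l s < fib l t"
    "tw l \<le> s \<Longrightarrow> s < t \<Longrightarrow> t \<le> tu l \<Longrightarrow> fib l s > fib l t"
    "tu l \<le> s \<Longrightarrow> s < t \<Longrightarrow> fib l s < fib l t"
proof -
  note T = tw_tu[OF l]
  show "0 \<le> s \<Longrightarrow> s < t \<Longrightarrow> t \<le> tw l \<Longrightarrow> fib l s < fib l t" using T by (intro fib_increasing) auto
  show "tw l \<le> s \<Longrightarrow> s < t \<Longrightarrow> t \<le> tu l \<Longrightarrow> fib l s > fib l t" using T by (intro fib_decreasing) auto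
  show "tu l \<le> s \<Longrightarrow> s < t \<Longrightarrow> fib l s < fib l t" using T tstar by (intro fib_increasing) auto
qed

lemma fib_max:
  assumes l: "0 < l" "l \<le> lstar" and t: "0 \<le> t" "t \<le> tu l"
  shows "fib l t \<le> fib l (tw l)"
  using fib_shape(1)[OF l, of t "tw l"] fib_shape(2)[OF l, of "tw l" t] t
  by (cases t "tw l" rule: linorder_cases) auto

lemma fib_min:
  assumes l: "0 < l" "l \<le> lstar" and t: "tw l \<le> t"
  shows "fib l (tu l) \<le> fib l t"
  using fib_shape(2)[OF l, of t "tu l"] fib_shape(3)[OF l, of "tu l" t] t
  by (cases t "tu l" rule: linorder_cases) auto

lemma fib_nonneg:
  assumes l: "0 < l" "l \<le> lstar" and t: "0 \<le> t" "t \<le> tw l"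
  shows "fib l t \<ge> 0"
  using fib_shape(1)[OF l, of 0 t] t by (cases "t = 0") (auto simp: fib_zero)

lemma fib_tw_pos: "0 < l \<Longrightarrow> l \<le> lstar \<Longrightarrow> fib l (tw l) > 0"
  using fib_shape(1)[of l 0 "tw l"] tw_tu(1)[of l] by (simp add: fib_zero)

text \<open>Eliminating \<open>lzero\<close> by the critical equation leaves a multiple of
  \<open>\<gamma> * a - (4 - \<gamma>) * (S * tzero powr (\<gamma> - 2))\<close>; this is the origin
  of the constant in \<open>tzero\<close>.\<close>

lemma fib_lzero_tzero: "fib lzero tzero = 0"
proof -
  have t: "tzero > 0" using tzero tstar by simp
  have "fib lzero tzero = a / 2 * tzero\<^sup>2 + (lzero * tzero\<^sup>2) / 4 * tzero\<^sup>2 - S / \<gamma> * (tzero powr (\<gamma> - 2) * tzero\<^sup>2)"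
    unfolding fib_def powr_shift(2)[OF t] by (simp add: power4_eq_xxxx power2_eq_square)
  also have "\<dots> = tzero\<^sup>2 / (4 * \<gamma>) * (\<gamma> * a - (4 - \<gamma>) * (S * tzero powr (\<gamma> - 2)))"
    unfolding lzero_def slope_eq[OF t] using gamma by (simp add: field_simps)
  finally show ?thesis unfolding tzero(2) by simp
qed

text \<open>The fibering map is affine in the parameter, so the sign information at
  \<open>lzero\<close> transfers to all other parameters.\<close>

lemma fib_shift: "fib l t = fib m t + (l - m) / 4 * t ^ 4"
  by (simp add: fib_def field_simps)

lemma fib_lzero_nonneg: "t \<ge> 0 \<Longrightarrow> fib lzero t \<ge> 0"
  using fib_nonneg[of lzero t] fib_min[of lzero t] lzero_bounds
  by (cases "t \<le> tw lzero") (auto simp: tu_lzero fib_lzero_tzero)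

lemma fib_tu_sign:
  shows "0 < l \<Longrightarrow> l < lzero \<Longrightarrow> fib l (tu l) < 0"
    and "lzero < l \<Longrightarrow> t > 0 \<Longrightarrow> fib l t > 0"
proof -
  assume l: "0 < l" "l < lzero"
  then have l': "l \<le> lstar" using lzero_bounds by simp
  have t: "tzero > 0" "tw l \<le> tzero" using tzero tstar tw_tu(2)[OF l(1) l'] by auto
  have "fib l (tu l) \<le> fib l tzero" by (rule fib_min[OF l(1) l' t(2)])
  also have "\<dots> = (l - lzero) / 4 * tzero ^ 4"
    unfolding fib_shift[of l tzero lzero] fib_lzero_tzero by simp
  also have "\<dots> < 0" using l t by (intro mult_neg_pos) auto
  finally show "fib l (tu l) < 0" .
next
  assume l: "lzero < l" and t: "t > 0"
  have "(l - lzero) / 4 * t ^ 4 > 0" using l t by simp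
  then show "fib l t > 0"
    unfolding fib_shift[of l t lzero] using fib_lzero_nonneg[of t] t by simp
qed

text \<open>Up to \<open>tw l\<close> the map is nonnegative while its value at \<open>tu l\<close>
  is not positive; beyond \<open>tw l\<close> the point \<open>tu l\<close> is the minimum by
  shape.\<close>

lemma fib_global_min:
  assumes l: "0 < l" "l \<le> lzero" and t: "t \<ge> 0"
  shows "fib l (tu l) \<le> fib l t"
proof -
  have l': "l \<le> lstar" using l lzero_bounds by simp
  have "fib l (tu l) \<le> 0"
    using fib_tu_sign(1)[of l] l tu_lzero fib_lzero_tzero by (cases "l = lzero") auto
  then show ?thesis
    using fib_nonneg[OF l(1) l' t] fib_min[OF l(1) l', of t] by (cases "t \<le> tw l") auto
qed

subsection \<open>From the fibering map to the functional\<close>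

lemma ray_H01: "(\<lambda>x. t * v x) \<in> H01 \<Omega>" by (rule H01_cmult[OF v(1)])

lemma ray_dirichlet: "dirichlet \<Omega> (\<lambda>x. t * v x) = t\<^sup>2"
  by (simp add: dirichlet_cmult[OF H01_H1[OF v(1)]] v)

lemma ray_norm: "H01_norm \<Omega> (\<lambda>x. t * v x) = \<bar>t\<bar>"
  by (simp add: H01_norm_def ray_dirichlet)

lemma ray_\<Phi>: "t \<ge> 0 \<Longrightarrow> \<Phi> a l (\<lambda>x. t * v x) = fib l t"
  by (simp add: \<Phi>_eq ray_dirichlet pot_cmult v fib_def flip: power_mult)

lemma pot_le_norm:
  assumes "u \<in> H01 \<Omega>" shows "pot u \<le> S * H01_norm \<Omega> u powr \<gamma>"
proof -
  have "(H01_norm \<Omega> u)\<^sup>2 powr (\<gamma> / 2) = H01_norm \<Omega> u powr \<gamma>"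
  proof (cases "H01_norm \<Omega> u = 0")
    case False
    then have p: "H01_norm \<Omega> u > 0" using H01_norm_nonneg[of u] by simp
    have "(H01_norm \<Omega> u)\<^sup>2 powr (\<gamma> / 2) = (H01_norm \<Omega> u powr 2) powr (\<gamma> / 2)"
      using p by (simp add: powr_realpow)
    then show ?thesis unfolding powr_powr by simp
  qed (use gamma in simp)
  then show ?thesis using Sobolev_S[OF assms] by (simp add: H01_norm_sq)
qed

lemma \<Phi>_ge_fib: "u \<in> H01 \<Omega> \<Longrightarrow> fib l (H01_norm \<Omega> u) \<le> \<Phi> a l u"
proof -
  assume u: "u \<in> H01 \<Omega>"
  have "1 / \<gamma> * pot u \<le> 1 / \<gamma> * (S * H01_norm \<Omega> u powr \<gamma>)"
    using pot_le_norm[OF u] gamma by (intro mult_left_mono) auto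
  moreover have "(dirichlet \<Omega> u)\<^sup>2 = H01_norm \<Omega> u ^ 4" unfolding H01_norm_sq[symmetric] by (simp flip: power_mult)
  ultimately show ?thesis unfolding \<Phi>_eq fib_def by (simp add: H01_norm_sq)
qed

text \<open>By the Euler-Lagrange equation both parts of the derivative at \<open>t v\<close> are
  multiples of \<open>ip v h\<close>; the common scalar factor vanishes exactly when
  \<open>slope t = l\<close>.\<close>

lemma ray_critical:
  assumes t: "t > 0" "slope t = l"
  shows "positive_kirchhoff_solution \<Omega> a \<gamma> l (\<lambda>x. t * v x)"
proof -
  have "d\<Phi> a l (\<lambda>x. t * v x) h = 0" if h: "h \<in> H01 \<Omega>" for h
  proof -
    have "d\<Phi> a l (\<lambda>x. t * v x) h = (a + l * t\<^sup>2) * (t * ip v h) - t powr (\<gamma> - 1) * (S * ip v h)"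
      unfolding d\<Phi>_def ray_dirichlet dpot_cmult[OF t(1)] ip_cmult(1)[OF v(1) h]
        Euler_Lagrange[OF S v(1-3) h] ..
    also have "\<dots> = t * ip v h * (a + l * t\<^sup>2 - S * t powr (\<gamma> - 2))"
      unfolding powr_shift(1)[OF t(1)] by (simp add: algebra_simps)
    also have "a + l * t\<^sup>2 - S * t powr (\<gamma> - 2) = 0" using slope_eq[OF t(1)] t(2) by simp
    finally show ?thesis by simp
  qed
  moreover have "AE x in M. t * v x > 0" using v(4) by eventually_elim (use t in simp)
  ultimately show ?thesis
    unfolding positive_kirchhoff_solution_def kirchhoff_solution_def critical_point_iff[OF ray_H01] by blast
qed

text \<open>The value is \<open>- t^5\<close> times the derivative of \<open>slope\<close> at
  \<open>t\<close>: positive on the decreasing branch of \<open>slope\<close> and zero at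
  \<open>tstar\<close>.\<close>

lemma ray_second_derivative:
  assumes t: "t > 0" "slope t = l"
  shows "d2\<Phi> a l (\<lambda>x. t * v x) (\<lambda>x. t * v x) (\<lambda>x. t * v x) = t\<^sup>2 * ((4 - \<gamma>) * (S * t powr (\<gamma> - 2)) - 2 * a)"
proof -
  have l: "l * t\<^sup>2 = S * t powr (\<gamma> - 2) - a" using slope_eq[OF t(1)] t(2) by simp
  have "d2\<Phi> a l (\<lambda>x. t * v x) (\<lambda>x. t * v x) (\<lambda>x. t * v x) =
     (a + l * t\<^sup>2) * t\<^sup>2 + 2 * l * t\<^sup>2 * t\<^sup>2 - (\<gamma> - 1) * (t powr \<gamma> * S)"
    using t unfolding d2\<Phi>_def d2pot_self pot_cmult dirichlet_ip[symmetric] ray_dirichlet v(3) by simp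
  also have "\<dots> = t\<^sup>2 * (a + 3 * (l * t\<^sup>2) - (\<gamma> - 1) * (S * t powr (\<gamma> - 2)))"
    unfolding powr_shift(2)[OF t(1)] by (simp add: algebra_simps)
  finally show ?thesis unfolding l by (simp add: algebra_simps)
qed

lemma path_norm_continuous:
  assumes "\<phi> \<in> H01_paths \<Omega> w"
  shows "continuous_on {0..1} (\<lambda>t. H01_norm \<Omega> (\<phi> t))"
  unfolding continuous_on_def
proof
  fix t :: real assume t: "t \<in> {0..1}"
  note p = assms[unfolded H01_paths_def]
  have "((\<lambda>s. H01_norm \<Omega> (\<phi> s) - H01_norm \<Omega> (\<phi> t)) \<longlongrightarrow> 0) (at t within {0..1})"
  proof (rule Lim_null_comparison)
    show "((\<lambda>s. H01_norm \<Omega> (\<lambda>x. \<phi> s x - \<phi> t x)) \<longlongrightarrow> 0) (at t within {0..1})" using p t by blast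
    show "\<forall>\<^sub>F s in at t within {0..1}. norm (H01_norm \<Omega> (\<phi> s) - H01_norm \<Omega> (\<phi> t)) \<le> H01_norm \<Omega> (\<lambda>x. \<phi> s x - \<phi> t x)"
      unfolding eventually_at_filter real_norm_def using p t
      by (intro always_eventually allI impI H01_norm_diff_triangle H01_H1) auto
  qed
  then show "((\<lambda>s. H01_norm \<Omega> (\<phi> s)) \<longlongrightarrow> H01_norm \<Omega> (\<phi> t)) (at t within {0..1})"
    by (simp add: LIM_zero_iff)
qed

text \<open>Each path crosses the sphere of radius \<open>tw l\<close>, where the functional is at
  least \<open>fib l (tw l)\<close>, and the segment along \<open>v\<close> does not exceed this
  value. The radius \<tau> of the endpoint matters only through lying between \<open>tw l\<close>
  and \<open>tu l\<close>, which covers both choices of endpoint.\<close>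

lemma mountain_pass:
  assumes l: "0 < l" "l \<le> lstar" and \<tau>: "tw l \<le> \<tau>" "\<tau> \<le> tu l"
  shows "mountain_pass_level \<Omega> (\<Phi> a l) (\<lambda>x. \<tau> * v x) = fib l (tw l)"
proof -
  let ?P = "H01_paths \<Omega> (\<lambda>x. \<tau> * v x)"
  have \<tau>0: "\<tau> > 0" using \<tau> tw_tu(1)[OF l] by simp
  have lower: "fib l (tw l) \<le> (SUP t\<in>{0..1}. \<Phi> a l (\<phi> t))" if \<phi>: "\<phi> \<in> ?P" for \<phi>
  proof -
    note p = \<phi>[unfolded H01_paths_def]
    have H: "\<phi> t \<in> H01 \<Omega>" if "t \<in> {0..1}" for t using p that by blast
    have c: "continuous_on {0..1} (\<lambda>t. H01_norm \<Omega> (\<phi> t))" by (rule path_norm_continuous[OF \<phi>])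
    \<comment> \<open>Paths meet their endpoints only almost everywhere, so the norms there are
      transferred by \<open>dirichlet_cong\<close>.\<close>
    have "dirichlet \<Omega> (\<phi> 0) = dirichlet \<Omega> (\<lambda>x. 0 * v x)"
      by (rule dirichlet_cong) (use p H[of 0] H01_H1 ray_H01[of 0] in auto)
    then have n0: "H01_norm \<Omega> (\<phi> 0) = 0" using ray_dirichlet[of 0] by (simp add: H01_norm_def)
    have "dirichlet \<Omega> (\<phi> 1) = dirichlet \<Omega> (\<lambda>x. \<tau> * v x)"
      by (rule dirichlet_cong) (use p H[of 1] H01_H1 ray_H01 in auto)
    then have n1: "H01_norm \<Omega> (\<phi> 1) = \<tau>" using ray_dirichlet[of \<tau>] \<tau>0 by (simp add: H01_norm_def)
    obtain s where s: "0 \<le> s" "s \<le> 1" "H01_norm \<Omega> (\<phi> s) = tw l"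
      using IVT'[of "\<lambda>t. H01_norm \<Omega> (\<phi> t)" 0 "tw l" 1] c n0 n1 \<tau> tw_tu(1)[OF l] by auto
    have "compact ((\<lambda>t. H01_norm \<Omega> (\<phi> t)) ` {0..1})" by (rule compact_continuous_image[OF c]) simp
    then obtain B where B: "\<And>t. t \<in> {0..1} \<Longrightarrow> H01_norm \<Omega> (\<phi> t) \<le> B"
      using compact_imp_bounded bounded_imp_bdd_above unfolding bdd_above_def by (metis image_eqI)
    \<comment> \<open>The supremum of reals is an upper bound only for a bounded family; norms are
      bounded along the path, and the potential enters with a favourable sign.\<close>
    have "bdd_above ((\<lambda>t. \<Phi> a l (\<phi> t)) ` {0..1})"
    proof (rule bdd_aboveI2)
      fix t :: real assume t: "t \<in> {0..1}"
      have "dirichlet \<Omega> (\<phi> t) \<le> B\<^sup>2"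
        unfolding H01_norm_sq[symmetric] using B[OF t] H01_norm_nonneg by (intro power_mono)
      moreover from this have "(dirichlet \<Omega> (\<phi> t))\<^sup>2 \<le> (B\<^sup>2)\<^sup>2"
        by (intro power_mono dirichlet_nonneg)
      ultimately have "a / 2 * dirichlet \<Omega> (\<phi> t) \<le> a / 2 * B\<^sup>2" "l / 4 * (dirichlet \<Omega> (\<phi> t))\<^sup>2 \<le> l / 4 * (B\<^sup>2)\<^sup>2"
        using a l by (intro mult_left_mono; simp)+
      moreover have "1 / \<gamma> * pot (\<phi> t) \<ge> 0" using gamma pot_nonneg by simp
      ultimately show "\<Phi> a l (\<phi> t) \<le> a / 2 * B\<^sup>2 + l / 4 * (B\<^sup>2)\<^sup>2" unfolding \<Phi>_eq by linarith
    qed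
    then have "\<Phi> a l (\<phi> s) \<le> (SUP t\<in>{0..1}. \<Phi> a l (\<phi> t))" using s by (intro cSUP_upper) auto
    moreover have "fib l (tw l) \<le> \<Phi> a l (\<phi> s)" using \<Phi>_ge_fib[OF H[of s]] s by simp
    ultimately show ?thesis by linarith
  qed
  define \<psi> where "\<psi> t x = t * (\<tau> * v x)" for t x
  have \<psi>eq: "\<psi> t = (\<lambda>x. (t * \<tau>) * v x)" for t by (auto simp: \<psi>_def)
  have \<psi>: "\<psi> \<in> ?P"
    unfolding H01_paths_def
  proof (intro CollectI conjI ballI)
    show "\<psi> t \<in> H01 \<Omega>" for t unfolding \<psi>eq by (rule ray_H01)
    fix t :: real assume "t \<in> {0..1}"
    have "H01_norm \<Omega> (\<lambda>x. \<psi> s x - \<psi> t x) = \<bar>s * \<tau> - t * \<tau>\<bar>" for s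
      unfolding \<psi>eq left_diff_distrib[symmetric] ray_norm ..
    moreover have "((\<lambda>s. \<bar>s * \<tau> - t * \<tau>\<bar>) \<longlongrightarrow> \<bar>t * \<tau> - t * \<tau>\<bar>) (at t within {0..1})"
      by (intro tendsto_intros)
    ultimately show "((\<lambda>s. H01_norm \<Omega> (\<lambda>x. \<psi> s x - \<psi> t x)) \<longlongrightarrow> 0) (at t within {0..1})" by simp
  qed (auto simp: \<psi>_def)
  have upper: "(SUP t\<in>{0..1}. \<Phi> a l (\<psi> t)) \<le> fib l (tw l)"
  proof (rule cSUP_least)
    fix t :: real assume t: "t \<in> {0..1}"
    have "t * \<tau> \<le> \<tau>" "t * \<tau> \<ge> 0" using t \<tau>0 by (auto simp: mult_left_le_one_le)
    then show "\<Phi> a l (\<psi> t) \<le> fib l (tw l)"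
      unfolding \<psi>eq using \<tau> by (subst ray_\<Phi>) (auto intro!: fib_max l)
  qed simp
  have bdd: "bdd_below ((\<lambda>\<phi>. SUP t\<in>{0..1}. \<Phi> a l (\<phi> t)) ` ?P)" by (rule bdd_belowI2) (rule lower)
  have "mountain_pass_level \<Omega> (\<Phi> a l) (\<lambda>x. \<tau> * v x) \<le> fib l (tw l)"
    unfolding mountain_pass_level_def by (rule order_trans[OF cINF_lower[OF bdd \<psi>] upper])
  moreover have "fib l (tw l) \<le> mountain_pass_level \<Omega> (\<Phi> a l) (\<lambda>x. \<tau> * v x)"
    unfolding mountain_pass_level_def using \<psi> by (intro cINF_greatest lower) auto
  ultimately show ?thesis by simp
qed

text \<open>Within distance \<open>tu l - tw l\<close> of the minimizer all norms exceed
  \<open>tw l\<close>, and there \<open>fib l\<close> is smallest at \<open>tu l\<close>.\<close>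

lemma ray_local_minimizer:
  assumes l: "0 < l" "l < lstar"
  shows "local_minimizer \<Omega> (\<Phi> a l) (\<lambda>x. tu l * v x)"
  unfolding local_minimizer_def
proof (intro conjI ray_H01 exI[of _ "tu l - tw l"] ballI impI)
  note T = tw_tu[OF l(1) less_imp_le[OF l(2)]]
  have t: "tu l > 0" "tw l < tu l" using T l tstar by auto
  then show "tu l - tw l > 0" by simp
  fix z assume z: "z \<in> H01 \<Omega>" "H01_norm \<Omega> (\<lambda>x. z x - tu l * v x) < tu l - tw l"
  have "\<bar>H01_norm \<Omega> z - tu l\<bar> < tu l - tw l"
    using H01_norm_diff_triangle[OF H01_H1[OF z(1)] H01_H1[OF ray_H01], of "tu l"] z(2) t by (simp add: ray_norm)
  then have "fib l (tu l) \<le> fib l (H01_norm \<Omega> z)" using l by (intro fib_min) auto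
  also have "\<dots> \<le> \<Phi> a l z" by (rule \<Phi>_ge_fib[OF z(1)])
  finally show "\<Phi> a l (\<lambda>x. tu l * v x) \<le> \<Phi> a l z" using t by (simp add: ray_\<Phi>)
qed

lemma ray_global_minimizer:
  assumes l: "0 < l" "l \<le> lzero"
  shows "global_minimizer \<Omega> (\<Phi> a l) (\<lambda>x. tu l * v x)"
  unfolding global_minimizer_def
proof (intro conjI ray_H01 ballI)
  fix z assume z: "z \<in> H01 \<Omega>"
  have t: "tu l > 0" using tw_tu(3)[of l] tstar l lzero_bounds by auto
  have "fib l (tu l) \<le> fib l (H01_norm \<Omega> z)" using l H01_norm_nonneg by (intro fib_global_min) auto
  also have "\<dots> \<le> \<Phi> a l z" by (rule \<Phi>_ge_fib[OF z])
  finally show "\<Phi> a l (\<lambda>x. tu l * v x) \<le> \<Phi> a l z" using t by (simp add: ray_\<Phi>)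
qed

text \<open>A solution tested with itself satisfies \<open>l \<le> slope t\<close> for its norm
  \<open>t\<close> if this is positive, whereas \<open>slope\<close> never exceeds
  \<open>lstar\<close>.\<close>

lemma no_solution:
  assumes l: "l > lstar" and z: "z \<in> H01 \<Omega>"
  shows "kirchhoff_solution \<Omega> a \<gamma> l z \<longleftrightarrow> (AE x in M. z x = 0)"
proof
  assume "kirchhoff_solution \<Omega> a \<gamma> l z"
  then have "d\<Phi> a l z z = 0" using z unfolding kirchhoff_solution_def critical_point_iff[OF z] by blast
  then have eq: "(a + l * dirichlet \<Omega> z) * dirichlet \<Omega> z = pot z"
    by (simp add: d\<Phi>_def dpot_self flip: dirichlet_ip)
  define t where "t = H01_norm \<Omega> z"
  have D: "dirichlet \<Omega> z = t\<^sup>2" by (simp add: t_def H01_norm_sq)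
  have "t = 0"
  proof (rule ccontr)
    assume "t \<noteq> 0"
    then have t: "t > 0" using H01_norm_nonneg[of z] by (simp add: t_def)
    have "(a + l * t\<^sup>2) * t\<^sup>2 \<le> (S * t powr (\<gamma> - 2)) * t\<^sup>2"
      using eq pot_le_norm[OF z] unfolding D t_def[symmetric] powr_shift(2)[OF t] by (simp add: mult.assoc)
    then have "l * t\<^sup>2 \<le> slope t * t\<^sup>2" unfolding slope_eq[OF t] using t by simp
    then have "l \<le> slope t" using t by simp
    then show False using slope_le[OF t] l by simp
  qed
  then show "AE x in M. z x = 0" by (intro dirichlet_zero[OF z]) (simp add: D)
next
  assume 0: "AE x in M. z x = 0"
  have "dirichlet \<Omega> z = dirichlet \<Omega> (\<lambda>x. 0 * v x)"
    by (rule dirichlet_cong[OF H01_H1[OF z] H01_H1[OF ray_H01]]) (use 0 in auto)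
  then have "H01_norm \<Omega> z = 0" using ray_dirichlet[of 0] by (simp add: H01_norm_def)
  then have "ip z h = 0" if "h \<in> H01 \<Omega>" for h
    using ip_Cauchy_Schwarz[OF H01_H1[OF z] H01_H1[OF that]] by simp
  moreover have "dpot z h = 0" for h
    unfolding dpot_def by (rule integral_eq_zero_AE) (use 0 in \<open>auto elim!: eventually_mono\<close>)
  ultimately show "kirchhoff_solution \<Omega> a \<gamma> l z"
    unfolding kirchhoff_solution_def critical_point_iff[OF z] d\<Phi>_def by simp
qed

end

text \<open>The Euler-Lagrange equation of a nonnegative extremal makes it superharmonic, because
  its potential term is nonnegative against nonnegative test functions; the strong maximum principle
  then applies.\<close>

lemma (in superquadratic) positive_extremal:
  assumes "\<Omega> \<noteq> {}" "connected \<Omega>"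
  obtains v where "v \<in> H01 \<Omega>" "dirichlet \<Omega> v = 1" "pot v = S" "AE x in M. v x > 0"
proof -
  have S: "S > 0" by (rule S_pos[OF assms(1)])
  obtain v where v: "v \<in> H01 \<Omega>" "dirichlet \<Omega> v = 1" "pot v = S" "AE x in M. v x \<ge> 0"
    using extremal_exists[OF S] by blast
  have "superharmonic v" unfolding superharmonic_def
  proof (intro conjI ballI impI H01_H1 v)
    fix \<eta> assume \<eta>: "\<eta> \<in> test_functions \<Omega>" "\<forall>x. \<eta> x \<ge> 0"
    have "dpot v \<eta> \<ge> 0" unfolding dpot_def
      by (rule integral_nonneg_AE) (use v(4) \<eta>(2) in \<open>auto elim!: eventually_mono\<close>)
    then show "ip v \<eta> \<ge> 0"
      using Euler_Lagrange[OF S v(1-3) test_H01[OF \<eta>(1)]] S by (simp add: zero_le_mult_iff)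
  qed
  moreover have "\<not> (AE x in M. v x = 0)"
  proof
    assume "AE x in M. v x = 0"
    then have "pot v = pot (\<lambda>x. 0)" by (intro pot_cong_AE H01_measurable v H01_zero)
    then show False using v(3) S by (simp add: pot_def)
  qed
  ultimately have "AE x in M. v x > 0" by (rule strong_maximum_principle[OF assms(2)])
  then show ?thesis using that v by blast
qed

section \<open>Assembly of the two branches of multiples of the extremal\<close>

theorem theorem1p1:
  fixes \<Omega> :: "(real ^ 3) set" and a \<gamma> :: real
  assumes "bounded_regular_domain \<Omega>" and "a > 0" and "2 < \<gamma>" and "\<gamma> < 4"
  defines "\<Phi> \<equiv> kirchhoff_functional \<Omega> a \<gamma>"
  shows "\<exists>(l\<^sub>0::real) (l\<^sub>1::real) (\<epsilon>::real) (u :: real \<Rightarrow> real ^ 3 \<Rightarrow> real) (w :: real \<Rightarrow> real ^ 3 \<Rightarrow> real).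
      0 < l\<^sub>0 \<and> l\<^sub>0 < l\<^sub>1 \<and> \<epsilon> > 0 \<and> l\<^sub>0 + \<epsilon> \<le> l\<^sub>1 \<and>
      \<comment> \<open>(1)\<close>
      (\<forall>l\<in>{0<..l\<^sub>1}. positive_kirchhoff_solution \<Omega> a \<gamma> l (u l)) \<and>
      (\<forall>l\<in>{0<..l\<^sub>0}. global_minimizer \<Omega> (\<Phi> l) (u l)) \<and>
      (\<forall>l\<in>{l\<^sub>0<..<l\<^sub>1}. local_minimizer \<Omega> (\<Phi> l) (u l)) \<and>
      (\<forall>l\<in>{0<..<l\<^sub>1}. \<exists>B. has_H01_second_derivative \<Omega> (\<Phi> l) B (u l) \<and> B (u l) (u l) > 0) \<and>
      (\<exists>B. has_H01_second_derivative \<Omega> (\<Phi> l\<^sub>1) B (u l\<^sub>1) \<and> B (u l\<^sub>1) (u l\<^sub>1) = 0) \<and>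
      \<comment> \<open>(2)\<close>
      (\<forall>l\<in>{0<..<l\<^sub>0 + \<epsilon>}. positive_kirchhoff_solution \<Omega> a \<gamma> l (w l) \<and>
         mountain_pass_critical_point \<Omega> (\<Phi> l) (if l \<le> l\<^sub>0 then u l\<^sub>0 else u l) (w l)) \<and>
      \<comment> \<open>(3)\<close>
      (\<forall>l\<in>{0<..<l\<^sub>0}. \<Phi> l (u l) < 0) \<and> \<Phi> l\<^sub>0 (u l\<^sub>0) = 0 \<and> (\<forall>l\<in>{l\<^sub>0<..l\<^sub>1}. \<Phi> l (u l) > 0) \<and>
      \<comment> \<open>(4)\<close>
      (\<forall>l\<in>{0<..<l\<^sub>0 + \<epsilon>}. \<Phi> l (w l) > 0 \<and> \<Phi> l (w l) > \<Phi> l (u l)) \<and>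
      \<comment> \<open>(5)\<close>
      (\<forall>l>l\<^sub>1. \<forall>v\<in>H01 \<Omega>. kirchhoff_solution \<Omega> a \<gamma> l v \<longleftrightarrow> (AE x in lebesgue_on \<Omega>. v x = 0))"
proof -
  have dom: "open \<Omega>" "connected \<Omega>" "\<Omega> \<noteq> {}" "bounded \<Omega>"
    using assms(1) by (auto simp: bounded_regular_domain_def)
  interpret superquadratic \<Omega> \<gamma> by standard (use dom assms in auto)
  obtain v where v: "v \<in> H01 \<Omega>" "dirichlet \<Omega> v = 1" "pot v = S" "AE x in M. v x > 0"
    using positive_extremal[OF dom(3,2)] by blast
  interpret extremal \<Omega> \<gamma> a v by standard (use assms v S_pos[OF dom(3)] in auto)
  define u where "u l x = tu l * v x" for l x
  define w where "w l x = tw l * v x" for l x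
  have u: "u l = (\<lambda>x. tu l * v x)" and w: "w l = (\<lambda>x. tw l * v x)" for l by (auto simp: u_def w_def)
  have tu: "tu l > 0" "slope (tu l) = l" "tw l > 0" "slope (tw l) = l" if "0 < l" "l \<le> lstar" for l
    using tw_tu[OF that] tstar by auto
  have \<Phi>u: "\<Phi> l (u l) = fib l (tu l)" and \<Phi>w: "\<Phi> l (w l) = fib l (tw l)" if "0 < l" "l \<le> lstar" for l
    using tu[OF that] unfolding assms(5) u w by (auto intro!: ray_\<Phi>)
  have second: "has_H01_second_derivative \<Omega> (\<Phi> l) (d2\<Phi> a l (u l)) (u l)" for l
    unfolding assms(5) u by (rule \<Phi>_second_derivative[OF ray_H01])
  have 1: "\<forall>l\<in>{0<..lstar}. positive_kirchhoff_solution \<Omega> a \<gamma> l (u l)"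
    unfolding u using tu by (auto intro!: ray_critical)
  have 2: "\<forall>l\<in>{0<..lzero}. global_minimizer \<Omega> (\<Phi> l) (u l)"
    unfolding u assms(5) by (auto intro!: ray_global_minimizer)
  have 3: "\<forall>l\<in>{lzero<..<lstar}. local_minimizer \<Omega> (\<Phi> l) (u l)"
    unfolding u assms(5) using lzero_bounds by (auto intro!: ray_local_minimizer)
  have 4: "d2\<Phi> a l (u l) (u l) (u l) > 0" if l: "0 < l" "l < lstar" for l
  proof -
    have "tstar < tu l" using tw_tu(7)[of l] l by auto
    then have "2 * a < (4 - \<gamma>) * (S * tu l powr (\<gamma> - 2))"
      using powr_compare[OF tstar(1)] tstar(2) by metis
    then show ?thesis unfolding u using tu[of l] l by (subst ray_second_derivative) auto
  qed
  have ls: "0 < lstar" using lzero_bounds by simp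
  \<comment> \<open>At \<open>lstar\<close> the upper branch reaches the maximum point of
    \<open>slope\<close>, where the second derivative along the ray degenerates.\<close>
  have "tu lstar = tstar"
    using slope_decreasing[of tstar "tu lstar"] tw_tu(3,5)[OF ls order_refl] unfolding lstar_def[symmetric]
    by (cases "tstar = tu lstar") auto
  then have 5: "d2\<Phi> a lstar (u lstar) (u lstar) (u lstar) = 0"
    unfolding u using tu[OF ls order_refl] tstar(2) by (subst ray_second_derivative) auto
  have 6: "positive_kirchhoff_solution \<Omega> a \<gamma> l (w l) \<and>
      mountain_pass_critical_point \<Omega> (\<Phi> l) (if l \<le> lzero then u lzero else u l) (w l)"
    if l: "0 < l" "l < lstar" for l
  proof -
    have l': "l \<le> lstar" using l by simp
    have pos: "positive_kirchhoff_solution \<Omega> a \<gamma> l (w l)"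
      unfolding w using tu[OF l(1) l'] by (auto intro!: ray_critical)
    define \<tau> where "\<tau> = (if l \<le> lzero then tu lzero else tu l)"
    have "tw l \<le> \<tau>" using tw_tu(2,3)[OF l(1) l'] tw_tu(3)[of lzero] lzero_bounds by (auto simp: \<tau>_def)
    \<comment> \<open>To the right of \<open>tstar\<close> the slope decreases, so the smaller
      parameter \<open>l\<close> has the larger root and the endpoint for \<open>lzero\<close> lies
      below \<open>tu l\<close>.\<close>
    moreover have "\<tau> \<le> tu l"
    proof (cases "l \<le> lzero")
      case True
      have "\<not> tu l < tu lzero"
        using slope_decreasing[of "tu l" "tu lzero"] tw_tu(3,5)[OF l(1) l'] tw_tu(5)[of lzero] True lzero_bounds
        by auto
      then show ?thesis by (simp add: \<tau>_def True)
    qed (simp add: \<tau>_def)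
    ultimately have "mountain_pass_level \<Omega> (\<Phi> l) (\<lambda>x. \<tau> * v x) = \<Phi> l (w l)"
      unfolding \<Phi>w[OF l(1) l'] unfolding assms(5) by (intro mountain_pass l l')
    moreover have "(if l \<le> lzero then u lzero else u l) = (\<lambda>x. \<tau> * v x)" by (simp add: u \<tau>_def)
    ultimately show ?thesis
      using pos unfolding mountain_pass_critical_point_def positive_kirchhoff_solution_def
        kirchhoff_solution_def assms(5) by simp
  qed
  have 7: "\<forall>l\<in>{0<..<lzero}. \<Phi> l (u l) < 0" "\<Phi> lzero (u lzero) = 0" "\<forall>l\<in>{lzero<..lstar}. \<Phi> l (u l) > 0"
    using \<Phi>u fib_tu_sign lzero_bounds tu tu_lzero fib_lzero_tzero by auto
  have 8: "\<Phi> l (w l) > 0 \<and> \<Phi> l (w l) > \<Phi> l (u l)" if l: "0 < l" "l < lstar" for l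
    using fib_tw_pos[of l] fib_shape(2)[of l "tw l" "tu l"] tw_tu(6,7)[of l] l \<Phi>u[of l] \<Phi>w[of l] by auto
  have 9: "\<forall>l>lstar. \<forall>z\<in>H01 \<Omega>. kirchhoff_solution \<Omega> a \<gamma> l z \<longleftrightarrow> (AE x in lebesgue_on \<Omega>. z x = 0)"
    using no_solution by blast
  show ?thesis
  \<comment> \<open>The mountain pass geometry along the ray persists for all parameters below
    \<open>lstar\<close>, so \<epsilon> may be the whole gap \<open>lstar - lzero\<close>.\<close>
  proof (rule exI[of _ lzero], rule exI[of _ lstar], rule exI[of _ "lstar - lzero"], rule exI[of _ u],
      rule exI[of _ w], intro conjI)
    show "\<forall>l\<in>{0<..<lstar}. \<exists>B. has_H01_second_derivative \<Omega> (\<Phi> l) B (u l) \<and> 0 < B (u l) (u l)"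
      using second 4 by (auto intro!: exI)
    show "\<exists>B. has_H01_second_derivative \<Omega> (\<Phi> lstar) B (u lstar) \<and> B (u lstar) (u lstar) = 0"
      using second 5 by blast
    show "\<forall>l\<in>{0<..<lzero + (lstar - lzero)}. positive_kirchhoff_solution \<Omega> a \<gamma> l (w l) \<and>
         mountain_pass_critical_point \<Omega> (\<Phi> l) (if l \<le> lzero then u lzero else u l) (w l)"
      using 6 by auto
    show "\<forall>l\<in>{0<..<lzero + (lstar - lzero)}. \<Phi> l (w l) > 0 \<and> \<Phi> l (w l) > \<Phi> l (u l)"
      using 8 by auto
  qed (use lzero_bounds 1 2 3 7 9 in auto)
qed

end
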